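(* Let $K$ be a number field with a fixed embedding $K\hookrightarrow\mathbf{C}$, let $X$ be a projective variety over $K$ of dimension $n\ge 2$, let $L$ be an ample line bundle on $X$, and let $h_L$ be a fixed (logarithmic) height function associated to $L$. Let $M$ be a non-compact Riemann surface, $U\subset M$ a relatively compact open subset, and $\varphi:M\to X(\mathbf{C})$ a holomorphic map with Zariski dense image. For $T>0$ let $A_U(T)$ be the cardinality of $\{z\in U:\ \varphi(z)\in X(K)\ \text{and}\ h_L(\varphi(z))\le T\}$. Let $A>1$, $\gamma>\frac{n}{n-1}$ and $\epsilon>0$ be real numbers. Then there are infinitely many intervals of the form $[t,At]$ with $t>1$, with the set of such $t$ unbounded, such that $$A_U(T)\le \epsilon\, T^{\gamma}\qquad\text{for every } T\in[t,At].$$ In particular the set $\{T : A_U(T)\le\epsilon T^\gamma\}$ is unbounded.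
   Context: Riemann surfaces are connected. $h_L$ denotes the absolute logarithmic Weil height attached to the ample line bundle $L$, normalised by dividing by $[K:\mathbf{Q}]$ (any choice in its class modulo bounded functions). *)

theory Defs
  imports
    "HOL-Complex_Analysis.Complex_Analysis"
    "HOL-Library.Poly_Mapping"
    "HOL-Algebra.QuotRing"
    "HOL-Algebra.Ideal_Product"
begin

section \<open>Number fields\<close>

definition rat_scale :: "rat \<Rightarrow> 'k::field_char_0 \<Rightarrow> 'k" where
  "rat_scale q x = of_rat q * x"

definition number_field :: "'k::field_char_0 itself \<Rightarrow> bool" where
  "number_field _ \<longleftrightarrow> (\<exists>B::'k set. finite B \<and> module.span rat_scale B = UNIV)"

definition degree_over_Q :: "'k::field_char_0 itself \<Rightarrow> nat" where
  "degree_over_Q _ = vector_space.dim rat_scale (UNIV :: 'k set)"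

definition field_embedding :: "('k::field_char_0 \<Rightarrow> complex) \<Rightarrow> bool" where
  "field_embedding \<sigma> \<longleftrightarrow>
     \<sigma> 1 = 1 \<and> (\<forall>x y. \<sigma> (x + y) = \<sigma> x + \<sigma> y) \<and> (\<forall>x y. \<sigma> (x * y) = \<sigma> x * \<sigma> y)"

definition integer_ring :: "'k::field_char_0 ring" where
  "integer_ring = \<lparr>carrier = {x. algebraic_int x}, monoid.mult = (*), one = 1,
                   ring.zero = 0, add = (+)\<rparr>"

definition finite_places :: "'k::field_char_0 set set" where
  "finite_places = {P. primeideal P integer_ring \<and> P \<noteq> {0}}"

definition ideal_norm :: "'k::field_char_0 set \<Rightarrow> nat" where
  "ideal_norm P = card (carrier (integer_ring Quot P))"

text \<open>The exponent of \<open>P\<close> in a nonzero algebraic integer, then in a nonzero element of the field.\<close>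

definition int_valuation :: "'k::field_char_0 set \<Rightarrow> 'k \<Rightarrow> nat" where
  "int_valuation P a = (GREATEST e::nat. a \<in> P [^]\<^bsub>ideals_set integer_ring\<^esub> e)"

definition valuation :: "'k::field_char_0 set \<Rightarrow> 'k \<Rightarrow> int" where
  "valuation P x = (THE e. \<exists>a b. algebraic_int a \<and> algebraic_int b \<and> a \<noteq> 0 \<and> b \<noteq> 0 \<and>
      x = a / b \<and> e = int (int_valuation P a) - int (int_valuation P b))"

text \<open>This is the absolute value extending the usual one of \<open>\<rat>\<close>, raised to the local degree.\<close>

definition finite_abs :: "'k::field_char_0 set \<Rightarrow> 'k \<Rightarrow> real" where
  "finite_abs P x = (if x = 0 then 0 else real (ideal_norm P) powi (- valuation P x))"

text \<open>
  The absolute logarithmic height of \<open>[a 0 : \<dots> : a r]\<close>.  Summing over all embeddings, a pair of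
  conjugate embeddings counts twice, which is the local degree of a complex place.
  The sum over the finite places has finite support.
\<close>

definition log_height :: "nat \<Rightarrow> (nat \<Rightarrow> 'k::field_char_0) \<Rightarrow> real" where
  "log_height r a =
     ((\<Sum>\<sigma> | field_embedding \<sigma>. ln (Max ((\<lambda>i. cmod (\<sigma> (a i))) ` {..r})))
      + (\<Sum>\<^sub>\<infinity>P\<in>finite_places. ln (Max ((\<lambda>i. finite_abs P (a i)) ` {..r}))))
     / real (degree_over_Q TYPE('k))"

section \<open>Projective varieties\<close>

text \<open>
  Varieties over a subfield \<open>F\<close> of \<open>\<complex>\<close> are represented by their complex points, together with
  the Zariski topology, functions and morphisms defined over \<open>F\<close>.  A point of projective space
  is the set of its homogeneous coordinate vectors; a vector for \<open>\<P>\<^sup>N\<close> is a function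
  vanishing at all indices above \<open>N\<close>.
\<close>

type_synonym ppoint = "(nat \<Rightarrow> complex) set"
type_synonym cpoly = "(nat \<Rightarrow>\<^sub>0 nat) \<Rightarrow>\<^sub>0 complex"

definition proj_class :: "(nat \<Rightarrow> complex) \<Rightarrow> ppoint" where
  "proj_class v = {\<lambda>i. c * v i | c. c \<noteq> 0}"

definition proj_space :: "nat \<Rightarrow> ppoint set" where
  "proj_space N = {proj_class v | v. (\<exists>i. v i \<noteq> 0) \<and> (\<forall>i>N. v i = 0)}"

definition poly_eval :: "cpoly \<Rightarrow> (nat \<Rightarrow> complex) \<Rightarrow> complex" where
  "poly_eval p v = (\<Sum>m\<in>Poly_Mapping.keys p. Poly_Mapping.lookup p m *
      (\<Prod>i\<in>Poly_Mapping.keys m. v i ^ Poly_Mapping.lookup m i))"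

definition homogeneous :: "complex set \<Rightarrow> nat \<Rightarrow> nat \<Rightarrow> cpoly \<Rightarrow> bool" where
  "homogeneous F N d p \<longleftrightarrow>
     (\<forall>m\<in>Poly_Mapping.keys p. Poly_Mapping.lookup p m \<in> F \<and> Poly_Mapping.keys m \<subseteq> {..N} \<and>
        (\<Sum>i\<in>Poly_Mapping.keys m. Poly_Mapping.lookup m i) = d)"

definition zariski_closed :: "complex set \<Rightarrow> nat \<Rightarrow> ppoint set \<Rightarrow> bool" where
  "zariski_closed F N Z \<longleftrightarrow>
     (\<exists>S. (\<forall>p\<in>S. \<exists>d. homogeneous F N d p) \<and>
          Z = {x \<in> proj_space N. \<forall>p\<in>S. \<forall>v\<in>x. poly_eval p v = 0})"

definition zariski_open_in :: "complex set \<Rightarrow> nat \<Rightarrow> ppoint set \<Rightarrow> ppoint set \<Rightarrow> bool" where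
  "zariski_open_in F N X V \<longleftrightarrow> (\<exists>Z. zariski_closed F N Z \<and> V = X - Z)"

text \<open>Irreducibility is over \<open>F\<close>, i.e. \<open>X\<close> is an integral scheme over \<open>F\<close>.\<close>

definition projective_variety :: "complex set \<Rightarrow> nat \<Rightarrow> ppoint set \<Rightarrow> bool" where
  "projective_variety F N X \<longleftrightarrow> zariski_closed F N X \<and> X \<noteq> {} \<and>
     (\<forall>Z1 Z2. zariski_closed F N Z1 \<and> zariski_closed F N Z2 \<and> X \<subseteq> Z1 \<union> Z2
        \<longrightarrow> X \<subseteq> Z1 \<or> X \<subseteq> Z2)"

definition variety_dim :: "complex set \<Rightarrow> nat \<Rightarrow> ppoint set \<Rightarrow> enat" where
  "variety_dim F N X = Sup {enat d | d. \<exists>Z.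
     (\<forall>i\<le>d. projective_variety F N (Z i) \<and> Z i \<subseteq> X) \<and> (\<forall>i<d. Z i \<subset> Z (Suc i))}"

definition rational_points :: "complex set \<Rightarrow> ppoint set \<Rightarrow> ppoint set" where
  "rational_points F X = {x \<in> X. \<exists>v\<in>x. \<forall>i. v i \<in> F}"

definition zariski_dense_in :: "nat \<Rightarrow> ppoint set \<Rightarrow> ppoint set \<Rightarrow> bool" where
  "zariski_dense_in N X S \<longleftrightarrow> S \<subseteq> X \<and> (\<forall>Z. zariski_closed UNIV N Z \<and> S \<subseteq> Z \<longrightarrow> X \<subseteq> Z)"

definition regular_on ::
    "complex set \<Rightarrow> nat \<Rightarrow> ppoint set \<Rightarrow> ppoint set \<Rightarrow> (ppoint \<Rightarrow> complex) \<Rightarrow> bool" where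
  "regular_on F N X V f \<longleftrightarrow>
     (\<forall>x\<in>V. \<exists>W p q d. zariski_open_in F N X W \<and> x \<in> W \<and> W \<subseteq> V \<and>
        homogeneous F N d p \<and> homogeneous F N d q \<and>
        (\<forall>y\<in>W. \<forall>v\<in>y. poly_eval q v \<noteq> 0 \<and> f y = poly_eval p v / poly_eval q v))"

definition proj_morphism ::
    "complex set \<Rightarrow> nat \<Rightarrow> ppoint set \<Rightarrow> nat \<Rightarrow> (ppoint \<Rightarrow> ppoint) \<Rightarrow> bool" where
  "proj_morphism F N X r f \<longleftrightarrow>
     (\<forall>x\<in>X. \<exists>W P d. zariski_open_in F N X W \<and> x \<in> W \<and> (\<forall>j\<le>r. homogeneous F N d (P j)) \<and>
        (\<forall>y\<in>W. \<forall>v\<in>y. (\<exists>j\<le>r. poly_eval (P j) v \<noteq> 0) \<and>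
           f y = proj_class (\<lambda>j. if j \<le> r then poly_eval (P j) v else 0)))"

text \<open>An isomorphism onto a closed subvariety of \<open>\<P>\<^sup>r\<close>.\<close>

definition closed_immersion ::
    "complex set \<Rightarrow> nat \<Rightarrow> ppoint set \<Rightarrow> nat \<Rightarrow> (ppoint \<Rightarrow> ppoint) \<Rightarrow> bool" where
  "closed_immersion F N X r f \<longleftrightarrow>
     proj_morphism F N X r f \<and> inj_on f X \<and> zariski_closed F r (f ` X) \<and>
     proj_morphism F r (f ` X) N (inv_into X f)"

section \<open>Line bundles, ampleness and heights\<close>

text \<open>
  A line bundle is given by transition functions on a finite Zariski open cover; a section is a
  family \<open>s\<close> of functions with \<open>s i = trans i j * s j\<close> on overlaps.
\<close>

record line_bundle_data =
  idx :: "nat set"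
  dom :: "nat \<Rightarrow> ppoint set"
  trans :: "nat \<Rightarrow> nat \<Rightarrow> ppoint \<Rightarrow> complex"

definition line_bundle :: "complex set \<Rightarrow> nat \<Rightarrow> ppoint set \<Rightarrow> line_bundle_data \<Rightarrow> bool" where
  "line_bundle F N X L \<longleftrightarrow>
     finite (idx L) \<and> (\<forall>i\<in>idx L. zariski_open_in F N X (dom L i)) \<and>
     (\<Union>i\<in>idx L. dom L i) = X \<and>
     (\<forall>i\<in>idx L. \<forall>j\<in>idx L. regular_on F N X (dom L i \<inter> dom L j) (trans L i j)) \<and>
     (\<forall>i\<in>idx L. \<forall>x\<in>dom L i. trans L i i x = 1) \<and>
     (\<forall>i\<in>idx L. \<forall>j\<in>idx L. \<forall>k\<in>idx L. \<forall>x\<in>dom L i \<inter> dom L j \<inter> dom L k.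
        trans L i j x * trans L j k x = trans L i k x)"

definition tensor_power :: "line_bundle_data \<Rightarrow> nat \<Rightarrow> line_bundle_data" where
  "tensor_power L m = L\<lparr>trans := \<lambda>i j x. trans L i j x ^ m\<rparr>"

definition global_section :: "complex set \<Rightarrow> nat \<Rightarrow> ppoint set \<Rightarrow> line_bundle_data \<Rightarrow>
    (nat \<Rightarrow> ppoint \<Rightarrow> complex) \<Rightarrow> bool" where
  "global_section F N X L s \<longleftrightarrow>
     (\<forall>i\<in>idx L. regular_on F N X (dom L i) (s i)) \<and>
     (\<forall>i\<in>idx L. \<forall>j\<in>idx L. \<forall>x\<in>dom L i \<inter> dom L j. s i x = trans L i j x * s j x)"

text \<open>
  The map \<open>x \<mapsto> [s 0 x : \<dots> : s r x]\<close>, computed in any trivialisation at \<open>x\<close>.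
\<close>

definition section_map ::
    "line_bundle_data \<Rightarrow> nat \<Rightarrow> (nat \<Rightarrow> nat \<Rightarrow> ppoint \<Rightarrow> complex) \<Rightarrow> ppoint \<Rightarrow> ppoint" where
  "section_map L r s x =
     (let i = (SOME i. i \<in> idx L \<and> x \<in> dom L i)
      in proj_class (\<lambda>a. if a \<le> r then s a i x else 0))"

definition embedding_sections :: "complex set \<Rightarrow> nat \<Rightarrow> ppoint set \<Rightarrow> line_bundle_data \<Rightarrow>
    nat \<Rightarrow> (nat \<Rightarrow> nat \<Rightarrow> ppoint \<Rightarrow> complex) \<Rightarrow> bool" where
  "embedding_sections F N X L r s \<longleftrightarrow>
     (\<forall>a\<le>r. global_section F N X L (s a)) \<and>
     (\<forall>i\<in>idx L. \<forall>x\<in>dom L i. \<exists>a\<le>r. s a i x \<noteq> 0) \<and>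
     closed_immersion F N X r (section_map L r s)"

definition very_ample :: "complex set \<Rightarrow> nat \<Rightarrow> ppoint set \<Rightarrow> line_bundle_data \<Rightarrow> bool" where
  "very_ample F N X L \<longleftrightarrow> (\<exists>r s. embedding_sections F N X L r s)"

definition ample :: "complex set \<Rightarrow> nat \<Rightarrow> ppoint set \<Rightarrow> line_bundle_data \<Rightarrow> bool" where
  "ample F N X L \<longleftrightarrow> line_bundle F N X L \<and> (\<exists>m>0. very_ample F N X (tensor_power L m))"

text \<open>
  Below \<open>\<iota>\<close> embeds the number field in \<open>\<complex>\<close>.  The height of a rational point does not depend on
  the chosen coordinates, by the product formula.
\<close>

definition weil_height :: "('k::field_char_0 \<Rightarrow> complex) \<Rightarrow> nat \<Rightarrow> ppoint \<Rightarrow> real" where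
  "weil_height \<iota> r x =
     log_height r (SOME a. x = proj_class (\<lambda>i. \<iota> (a i)) \<and> (\<exists>i. a i \<noteq> 0) \<and> (\<forall>i>r. a i = 0))"

text \<open>
  For ample \<open>L\<close>: \<open>m * h\<close> is, up to a bounded function, the Weil height in a projective embedding
  of \<open>X\<close> by sections of \<open>L\<^sup>m\<close>.
\<close>

definition height_function :: "('k::field_char_0 \<Rightarrow> complex) \<Rightarrow> nat \<Rightarrow> ppoint set \<Rightarrow>
    line_bundle_data \<Rightarrow> (ppoint \<Rightarrow> real) \<Rightarrow> bool" where
  "height_function \<iota> N X L h \<longleftrightarrow>
     (\<exists>m>0. \<exists>r s. embedding_sections (range \<iota>) N X (tensor_power L m) r s \<and>
        (\<exists>C. \<forall>x\<in>rational_points (range \<iota>) X.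
           \<bar>h x - weil_height \<iota> r (section_map (tensor_power L m) r s x) / real m\<bar> \<le> C))"

section \<open>Riemann surfaces\<close>

text \<open>
  The surface is a whole type; an atlas is a set of pairs of a domain and a coordinate.
  Second countability is not required, being automatic by a theorem of Rado.
\<close>

definition riemann_surface :: "('m::t2_space set \<times> ('m \<Rightarrow> complex)) set \<Rightarrow> bool" where
  "riemann_surface \<A> \<longleftrightarrow>
     connected (UNIV :: 'm set) \<and> (\<Union>(W, \<psi>)\<in>\<A>. W) = UNIV \<and>
     (\<forall>(W, \<psi>)\<in>\<A>. open W \<and> open (\<psi> ` W) \<and>
        homeomorphism W (\<psi> ` W) \<psi> (inv_into W \<psi>)) \<and>
     (\<forall>(W, \<psi>)\<in>\<A>. \<forall>(W', \<psi>')\<in>\<A>. (\<psi>' \<circ> inv_into W \<psi>) holomorphic_on \<psi> ` (W \<inter> W'))"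

definition surface_holomorphic_on ::
    "('m::t2_space set \<times> ('m \<Rightarrow> complex)) set \<Rightarrow> 'm set \<Rightarrow> ('m \<Rightarrow> complex) \<Rightarrow> bool" where
  "surface_holomorphic_on \<A> S g \<longleftrightarrow>
     (\<forall>(W, \<psi>)\<in>\<A>. (g \<circ> inv_into W \<psi>) holomorphic_on \<psi> ` (W \<inter> S))"

definition standard_chart :: "nat \<Rightarrow> nat \<Rightarrow> ppoint set" where
  "standard_chart N i = {x \<in> proj_space N. \<forall>v\<in>x. v i \<noteq> 0}"

definition affine_coord :: "nat \<Rightarrow> nat \<Rightarrow> ppoint \<Rightarrow> complex" where
  "affine_coord i j x = (let v = (SOME v. v \<in> x) in v j / v i)"

text \<open>Holomorphic maps to \<open>\<P>\<^sup>N\<close>; those to \<open>X(\<complex>)\<close> are the ones with values in \<open>X\<close>.\<close>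

definition holomorphic_to_proj ::
    "('m::t2_space set \<times> ('m \<Rightarrow> complex)) set \<Rightarrow> nat \<Rightarrow> ('m \<Rightarrow> ppoint) \<Rightarrow> bool" where
  "holomorphic_to_proj \<A> N \<phi> \<longleftrightarrow> range \<phi> \<subseteq> proj_space N \<and>
     (\<forall>i\<le>N. open (\<phi> -` standard_chart N i) \<and>
        (\<forall>j\<le>N. surface_holomorphic_on \<A> (\<phi> -` standard_chart N i) (affine_coord i j \<circ> \<phi>)))"

text \<open>Counting measure is used so that an infinite set has cardinality \<open>\<infinity>\<close>, not \<open>0\<close>.\<close>

definition point_count :: "('k::field_char_0 \<Rightarrow> complex) \<Rightarrow> ppoint set \<Rightarrow> (ppoint \<Rightarrow> real) \<Rightarrow>
    ('m \<Rightarrow> ppoint) \<Rightarrow> 'm set \<Rightarrow> real \<Rightarrow> ennreal" where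
  "point_count \<iota> X h \<phi> U T =
     emeasure (count_space UNIV) {z \<in> U. \<phi> z \<in> rational_points (range \<iota>) X \<and> h (\<phi> z) \<le> T}"

end

theory Submission
  imports
    Defs
    "Jordan_Normal_Form.Char_Poly"
    "HOL-Computational_Algebra.Field_as_Ring"
begin

text \<open>
  Suppose that the points are abundant at some height in every interval \<open>[t, At]\<close> with large \<open>t\<close>.
  A maximal chain of subvarieties of \<open>X\<close> gives \<open>n + 1\<close> forms of equal degree that are
  algebraically independent on \<open>X\<close>. By Siegel's lemma there is a nonzero integral polynomial \<open>G\<close> in them, of
  degree \<open>D\<close> about \<open>T\<^sub>0 powr (1/(n-1))\<close>, vanishing at about \<open>D\<^sup>n\<close> of the points of height at most
  \<open>T\<^sub>0\<close>. By the Schwarz lemma and chains of discs, \<open>k\<close> zeros of \<open>G \<circ> \<phi>\<close> in \<open>U\<close> make \<open>G \<circ> \<phi>\<close> smaller than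
  \<open>exp (C D - c k)\<close> on compact sets, whereas Liouville's inequality bounds a nonzero value at a point
  of height \<open>T\<close> below by \<open>exp (- C D T)\<close>. So \<open>G\<close> vanishes at all points of height at most \<open>T\<^sub>0\<close>, and then, as
  \<open>\<gamma> > n/(n-1)\<close>, successively at those of height at most \<open>T\<^sub>1 < T\<^sub>2 < \<dots>\<close> with \<open>T\<^sub>i\<^sub>+\<^sub>1 \<le> 2A T\<^sub>i\<close>. With infinitely
  many zeros \<open>G \<circ> \<phi>\<close> is zero, which contradicts the Zariski density of the image.
\<close>

section \<open>Orders and heights in a number field\<close>

text \<open>The exponent n/(n-1) balances two demands. Siegel's lemma yields about D^n zeros at the
  price of coefficients of logarithmic size D T0. The gain exp (- c D^n) has to beat the loss exp (C
  D T0) in Liouville's inequality, so D^(n-1) must be a large multiple of T0. Later the degree stays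
  fixed, and a step from T to T' needs more than a constant times D T' zeros; abundance in every
  interval [t, At] bounds T'/T, and T powr \<gamma> supplies these zeros.

  Heights are defined through residue rings of prime ideals, so Liouville's inequality rests on the
  product formula, hence on the factorisation of principal ideals and on the equality of index and
  norm. Both come from pigeonhole arguments with \<int>[\<theta>], in which all embeddings into
  \<complex> are treated alike.

  Forms on the curve are sections rather than functions. They are measured by a scale invariant
  modulus, which on a small disc is comparable to the modulus of a holomorphic function up to exp (C
  D); a loss linear in the degree is harmless in every estimate.\<close>

definition zscale :: "int \<Rightarrow> 'a::comm_ring_1 \<Rightarrow> 'a" where
  "zscale n x = of_int n * x"

interpretation zmod: Modules.module zscale
  by unfold_locales (simp_all add: zscale_def algebra_simps)

text \<open>The determinant trick: multiplication by \<open>x\<close> acts on the list of generators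
  by an integer matrix, and the list itself is an eigenvector for the eigenvalue \<open>x\<close>.
  So \<open>x\<close> is a root of the characteristic polynomial, which is monic and integral. The
  nonzero generator keeps the eigenvector from being zero.\<close>

lemma algebraic_int_finite_span:
  fixes x :: "'k::field_char_0"
  assumes fin: "finite G" and nz: "\<exists>g\<in>G. g \<noteq> 0" and st: "\<And>g. g \<in> G \<Longrightarrow> x * g \<in> zmod.span G"
  shows "algebraic_int x"
proof -
  obtain gs where gs: "distinct gs" "set gs = G" using finite_distinct_list[OF fin] by blast
  define n where "n = length gs"
  have "\<exists>c. x * g = (\<Sum>h\<in>G. of_int (c h) * h)" if "g \<in> G" for g
    using st[OF that] unfolding zmod.span_finite[OF fin] by (auto simp: zscale_def)
  then obtain c where c: "\<And>g. g \<in> G \<Longrightarrow> x * g = (\<Sum>h\<in>G. of_int (c g h) * h)" by metis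
  define A :: "int mat" where "A = mat n n (\<lambda>(i,j). c (gs ! i) (gs ! j))"
  have A: "A \<in> carrier_mat n n" by (simp add: A_def)
  let ?A = "map_mat (of_int :: int \<Rightarrow> 'k) A"
  define v where "v = vec n (\<lambda>i. gs ! i)"
  have sumG: "(\<Sum>h\<in>G. f h) = (\<Sum>j<n. f (gs ! j))" for f :: "'k \<Rightarrow> 'k"
    unfolding gs(2)[symmetric] n_def
    by (subst sum.distinct_set_conv_list[OF gs(1)]) (simp add: sum_list_sum_nth atLeast0LessThan)
  have "eigenvector ?A v x"
    unfolding eigenvector_def
  proof (intro conjI)
    show "v \<in> carrier_vec (dim_row ?A)" using A by (simp add: v_def)
    obtain g where "g \<in> G" "g \<noteq> 0" using nz by blast
    then obtain i where "i < n" "gs ! i \<noteq> 0" using gs n_def by (metis in_set_conv_nth)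
    then show "v \<noteq> 0\<^sub>v (dim_row ?A)" using A unfolding v_def
      by (metis carrier_matD(1) index_map_mat(2) index_vec index_zero_vec(1))
    show "?A *\<^sub>v v = x \<cdot>\<^sub>v v"
    proof (rule eq_vecI)
      fix i assume "i < dim_vec (x \<cdot>\<^sub>v v)"
      then have i: "i < n" by (simp add: v_def)
      have "(?A *\<^sub>v v) $ i = (\<Sum>j<n. of_int (c (gs ! i) (gs ! j)) * gs ! j)"
        using i A by (simp add: scalar_prod_def v_def A_def atLeast0LessThan)
      also have "\<dots> = x * gs ! i"
        using c[of "gs ! i"] i gs n_def unfolding sumG by (metis nth_mem)
      finally show "(?A *\<^sub>v v) $ i = (x \<cdot>\<^sub>v v) $ i" using i by (simp add: v_def)
    qed (simp_all add: v_def A_def)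
  qed
  then have "poly (char_poly ?A) x = 0"
    using eigenvalue_root_char_poly[of ?A n x] A unfolding eigenvalue_def by auto
  moreover have "char_poly ?A = map_poly of_int (char_poly A)"
    by (rule of_int_hom.char_poly_hom[OF A])
  moreover have "lead_coeff (char_poly A) = 1"
    using degree_monic_char_poly[OF A] by simp
  ultimately show ?thesis unfolding algebraic_int_altdef_ipoly by metis
qed

lemma zspan_mult:
  fixes a b :: "'a::comm_ring_1"
  assumes "a \<in> zmod.span A" "b \<in> zmod.span B"
  shows "a * b \<in> zmod.span {x * y | x y. x \<in> A \<and> y \<in> B}" (is "_ \<in> zmod.span ?S")
proof -
  have *: "x * b \<in> zmod.span ?S" if "x \<in> A" for x
    using assms(2)
  proof (induction rule: zmod.span_induct_alt)
    case base then show ?case by (simp add: zmod.span_zero)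
  next
    case (step c y z)
    have "zscale c (x * y) + x * z \<in> zmod.span ?S"
      using step that by (intro zmod.span_add zmod.span_scale) (auto intro!: zmod.span_base)
    moreover have "x * (zscale c y + z) = zscale c (x * y) + x * z" by (simp add: zscale_def algebra_simps)
    ultimately show ?case by simp
  qed
  show ?thesis using assms(1)
  proof (induction rule: zmod.span_induct_alt)
    case base then show ?case by (simp add: zmod.span_zero)
  next
    case (step c y z)
    have "zscale c (y * b) + z * b \<in> zmod.span ?S"
      using step * by (intro zmod.span_add zmod.span_scale) auto
    moreover have "(zscale c y + z) * b = zscale c (y * b) + z * b" by (simp add: zscale_def algebra_simps)
    ultimately show ?case by simp
  qed
qed

text \<open>The monic equation rewrites x^n through lower powers. Positivity of n puts 1 among the
  generators, which starts the induction.\<close>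

lemma algebraic_int_powers_span:
  fixes x :: "'k::field_char_0"
  assumes "algebraic_int x"
  obtains n where "n > 0" "\<And>i. x ^ i \<in> zmod.span ((\<lambda>i. x ^ i) ` {..<n})"
proof -
  obtain p where p: "poly (map_poly of_int p) x = 0" "lead_coeff p = 1"
    using assms unfolding algebraic_int_altdef_ipoly by blast
  define n where "n = degree p"
  have n0: "n > 0"
  proof (rule ccontr)
    assume "\<not> n > 0"
    then obtain c where "p = [:c:]" unfolding n_def by (meson degree_eq_zeroE not_gr_zero)
    then show False using p by simp
  qed
  let ?S = "zmod.span ((\<lambda>i. x ^ i) ` {..<n})"
  have "(\<Sum>i\<le>n. of_int (coeff p i) * x ^ i) = 0"
    using p(1) unfolding poly_altdef n_def by (simp add: degree_map_poly coeff_map_poly)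
  then have xn: "x ^ n = - (\<Sum>i<n. zscale (coeff p i) (x ^ i))"
    using p(2) unfolding n_def by (simp add: lessThan_Suc_atMost[symmetric] zscale_def eq_neg_iff_add_eq_0 add.commute)
  have xnS: "x ^ n \<in> ?S" unfolding xn
    by (intro zmod.span_neg zmod.span_sum zmod.span_scale zmod.span_base) auto
  have "x ^ i \<in> ?S" for i
  proof (induction i)
    case 0 then show ?case using n0 by (intro zmod.span_base image_eqI[of _ _ 0]) auto
  next
    case (Suc i)
    have "x * y \<in> ?S" if "y \<in> ?S" for y
      using that
    proof (induction rule: zmod.span_induct_alt)
      case base then show ?case by (simp add: zmod.span_zero)
    next
      case (step c y z)
      then obtain j where j: "j < n" "y = x ^ j" by auto
      have "x * y \<in> ?S"
      proof (cases "Suc j < n")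
        case True then show ?thesis using j by (intro zmod.span_base) (auto intro!: image_eqI[of _ _ "Suc j"])
      next
        case False then have "Suc j = n" using j by simp
        then show ?thesis using xnS j by (metis power_Suc)
      qed
      then have "zscale c (x * y) + x * z \<in> ?S" using step by (intro zmod.span_add zmod.span_scale)
      moreover have "x * (zscale c y + z) = zscale c (x * y) + x * z" by (simp add: zscale_def algebra_simps)
      ultimately show ?case by simp
    qed
    then show ?case using Suc by simp
  qed
  with n0 show ?thesis using that by blast
qed

text \<open>Both operations stabilise the finitely generated module spanned by the products of
  powers of \<open>x\<close> and of \<open>y\<close>.\<close>

lemma
  fixes x y :: "'k::field_char_0"
  assumes "algebraic_int x" "algebraic_int y"
  shows algebraic_int_plus: "algebraic_int (x + y)"
    and algebraic_int_times: "algebraic_int (x * y)"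
proof -
  obtain m where m: "m > 0" "\<And>i. x ^ i \<in> zmod.span ((\<lambda>i. x ^ i) ` {..<m})"
    using algebraic_int_powers_span[OF assms(1)] by blast
  obtain n where n: "n > 0" "\<And>i. y ^ i \<in> zmod.span ((\<lambda>i. y ^ i) ` {..<n})"
    using algebraic_int_powers_span[OF assms(2)] by blast
  define G where "G = {u * v | u v. u \<in> (\<lambda>i. x ^ i) ` {..<m} \<and> v \<in> (\<lambda>i. y ^ i) ` {..<n}}"
  have fin: "finite G"
    by (rule finite_subset[of _ "(\<lambda>(u,v). u * v) ` ((\<lambda>i. x ^ i) ` {..<m} \<times> (\<lambda>i. y ^ i) ` {..<n})"])
       (auto simp: G_def)
  have "x ^ 0 * y ^ 0 \<in> G" unfolding G_def using m(1) n(1) by blast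
  then have nz: "\<exists>g\<in>G. g \<noteq> 0" by (intro bexI[of _ "x ^ 0 * y ^ 0"]) simp_all
  have sp: "x ^ i * y ^ j \<in> zmod.span G" for i j
    unfolding G_def by (intro zspan_mult m n)
  have G: "\<exists>i j. g = x ^ i * y ^ j" if "g \<in> G" for g using that by (auto simp: G_def)
  show "algebraic_int (x + y)"
  proof (rule algebraic_int_finite_span[OF fin nz])
    fix g assume "g \<in> G"
    then obtain i j where g: "g = x ^ i * y ^ j" using G by blast
    have "x ^ Suc i * y ^ j + x ^ i * y ^ Suc j \<in> zmod.span G" by (intro zmod.span_add sp)
    then show "(x + y) * g \<in> zmod.span G" by (simp add: g algebra_simps)
  qed
  show "algebraic_int (x * y)"
  proof (rule algebraic_int_finite_span[OF fin nz])
    fix g assume "g \<in> G"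
    then obtain i j where g: "g = x ^ i * y ^ j" using G by blast
    show "x * y * g \<in> zmod.span G" using sp[of "Suc i" "Suc j"] by (simp add: g algebra_simps)
  qed
qed

lemma algebraic_int_diff:
  fixes x y :: "'k::field_char_0"
  assumes "algebraic_int x" "algebraic_int y"
  shows "algebraic_int (x - y)"
  using algebraic_int_plus[OF assms(1), of "- y"] assms(2) by simp

lemma algebraic_int_of_int [simp]: "algebraic_int (of_int n)"
  by (rule int_imp_algebraic_int) simp

lemma algebraic_int_1 [simp]: "algebraic_int 1"
  by (rule int_imp_algebraic_int) simp

lemma algebraic_int_power:
  fixes x :: "'k::field_char_0"
  shows "algebraic_int x \<Longrightarrow> algebraic_int (x ^ n)"
  by (induction n) (auto intro: algebraic_int_times)

lemma algebraic_int_sum: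
  fixes f :: "'a \<Rightarrow> 'k::field_char_0"
  shows "(\<And>i. i \<in> A \<Longrightarrow> algebraic_int (f i)) \<Longrightarrow> algebraic_int (sum f A)"
  by (induction A rule: infinite_finite_induct) (auto intro: algebraic_int_plus)

lemma algebraic_int_prod:
  fixes f :: "'a \<Rightarrow> 'k::field_char_0"
  shows "(\<And>i. i \<in> A \<Longrightarrow> algebraic_int (f i)) \<Longrightarrow> algebraic_int (prod f A)"
  by (induction A rule: infinite_finite_induct) (auto intro: algebraic_int_times)

section \<open>Number fields as simple extensions of \<rat>\<close>

abbreviation rpoly :: "rat poly \<Rightarrow> 'k::field_char_0 \<Rightarrow> 'k" where
  "rpoly p x \<equiv> poly (map_poly of_rat p) x"

lemma rat_scale_vector_space: "vector_space (rat_scale :: rat \<Rightarrow> 'k \<Rightarrow> 'k::field_char_0)"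
  by unfold_locales (simp_all add: rat_scale_def algebra_simps of_rat_add of_rat_mult)

interpretation rvs: vector_space "rat_scale :: rat \<Rightarrow> 'k::field_char_0 \<Rightarrow> 'k"
  by (rule rat_scale_vector_space)

lemma field_embedding_hom: "field_embedding \<sigma> \<Longrightarrow> field_hom \<sigma>"
proof -
  assume s: "field_embedding \<sigma>"
  have "\<sigma> 0 + \<sigma> 0 = \<sigma> 0" using s unfolding field_embedding_def by (metis add_0)
  then have "\<sigma> 0 = 0" by simp
  then show ?thesis using s unfolding field_embedding_def by unfold_locales auto
qed

lemma field_embedding_of_rat:
  assumes "field_embedding \<sigma>" shows "\<sigma> (of_rat q) = of_rat q"
proof -
  interpret field_hom \<sigma> by (rule field_embedding_hom[OF assms])
  obtain a b where q: "q = of_int a / of_int b" "b \<noteq> 0"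
    by (cases q) (auto simp: Fract_of_int_quotient)
  show ?thesis by (simp add: q(1) divide_inverse of_rat_mult of_rat_inverse hom_mult hom_inverse hom_of_int)
qed

interpretation of_rat_poly_hom: map_poly_comm_ring_hom "of_rat :: rat \<Rightarrow> 'k::field_char_0" ..

lemma field_embedding_poly:
  assumes "field_embedding \<sigma>" shows "poly (map_poly \<sigma> p) (\<sigma> x) = \<sigma> (poly p x)"
proof -
  interpret field_hom \<sigma> by (rule field_embedding_hom[OF assms])
  show ?thesis by (induction p) (simp_all add: map_poly_pCons hom_distribs)
qed

lemma field_embedding_rpoly:
  assumes "field_embedding \<sigma>" shows "\<sigma> (rpoly p x) = rpoly p (\<sigma> x)"
proof -
  interpret field_hom \<sigma> by (rule field_embedding_hom[OF assms])
  have "map_poly \<sigma> (map_poly of_rat p) = map_poly of_rat p"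
    by (simp add: map_poly_map_poly o_def field_embedding_of_rat[OF assms])
  then show ?thesis using field_embedding_poly[OF assms, of "map_poly of_rat p" x] by simp
qed

lemma rpoly_add [simp]: "rpoly (p + q) x = rpoly p x + rpoly q x"
  by (simp only: of_rat_poly_hom.hom_add poly_add)
lemma rpoly_mult [simp]: "rpoly (p * q) x = rpoly p x * rpoly q x"
  by (simp only: of_rat_poly_hom.hom_mult poly_mult)
lemma rpoly_diff [simp]: "rpoly (p - q) x = rpoly p x - rpoly q x"
  by (simp only: of_rat_poly_hom.hom_minus poly_diff)
lemma rpoly_smult [simp]: "rpoly (Polynomial.smult c p) x = of_rat c * rpoly p x"
  by (simp only: of_rat_hom.map_poly_hom_smult poly_smult)
lemma rpoly_const [simp]: "rpoly [:c:] x = of_rat c"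
  by (simp add: of_rat_hom.map_poly_pCons_hom)
lemma rpoly_pcompose [simp]: "rpoly (pcompose p q) x = rpoly p (rpoly q x)"
  by (simp only: of_rat_hom.map_poly_pcompose poly_pcompose)
lemma rpoly_sum [simp]: "rpoly (sum f A) x = (\<Sum>i\<in>A. rpoly (f i) x)"
  by (induction A rule: infinite_finite_induct) auto

lemma of_rat_poly_eq_0_iff [simp]: "(map_poly of_rat p :: 'k::field_char_0 poly) = 0 \<longleftrightarrow> p = 0"
  by (simp add: poly_eq_iff coeff_map_poly)

text \<open>Linear dependence is a property of the set of powers, hence the case distinction: two
  equal powers give a relation at once, and infinitely many distinct ones exceed a finite spanning
  set.\<close>

lemma number_field_algebraic:
  fixes x :: "'k::field_char_0"
  assumes "number_field TYPE('k)"
  obtains p where "p \<noteq> 0" "rpoly p x = 0"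
proof (cases "inj (\<lambda>i::nat. x ^ i)")
  case False
  then obtain i j :: nat where ij: "i < j" "x ^ i = x ^ j"
    unfolding inj_def by (metis linorder_neqE_nat)
  define p where "p = monom (1::rat) i - monom 1 j"
  have "coeff p i = 1" using ij by (simp add: p_def)
  then have "p \<noteq> 0" by auto
  moreover have "rpoly p x = 0" using ij(2) by (simp add: p_def hom_distribs poly_monom)
  ultimately show ?thesis using that by blast
next
  case True
  obtain B :: "'k set" where B: "finite B" "rvs.span B = UNIV"
    using assms unfolding number_field_def by blast
  have "\<not> rvs.independent (range (\<lambda>i::nat. x ^ i))"
    using rvs.independent_span_bound[OF B(1)] B(2) range_inj_infinite[OF True] by blast
  then obtain S u v where S: "finite S" "S \<subseteq> range (\<lambda>i::nat. x ^ i)" "(\<Sum>v\<in>S. rat_scale (u v) v) = 0" "v \<in> S" "u v \<noteq> 0"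
    unfolding rvs.dependent_explicit by blast
  obtain I where I: "finite I" "S = (\<lambda>i. x ^ i) ` I"
    using S(1,2) by (meson finite_subset_image)
  define p where "p = (\<Sum>i\<in>I. monom (u (x ^ i)) i)"
  obtain i where i: "i \<in> I" "v = x ^ i" using S(4) I(2) by blast
  have "coeff p i = u v" using I(1) i by (simp add: p_def coeff_sum)
  then have "p \<noteq> 0" using S(5) by auto
  moreover have "rpoly p x = (\<Sum>i\<in>I. rat_scale (u (x ^ i)) (x ^ i))"
    unfolding p_def by (simp add: hom_distribs poly_sum poly_monom rat_scale_def)
  moreover have "\<dots> = 0"
    using S(3) unfolding I(2) by (subst (asm) sum.reindex) (use True in \<open>auto simp: inj_on_def inj_def\<close>)
  ultimately show ?thesis using that by simp
qed

text \<open>The minimal polynomial. In characteristic 0 its derivative is nonzero and of smaller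
  degree, hence does not vanish at \<open>x\<close>; this is the separability behind the primitive
  element theorem.\<close>

lemma min_rpoly:
  fixes x :: "'k::field_char_0"
  assumes "number_field TYPE('k)"
  obtains p where "p \<noteq> 0" "rpoly p x = 0" "\<And>q. rpoly q x = 0 \<Longrightarrow> p dvd q" "rpoly (pderiv p) x \<noteq> 0"
    "lead_coeff p = 1" "degree p > 0"
proof -
  let ?P = "\<lambda>p. p \<noteq> 0 \<and> rpoly p x = 0"
  obtain p0 where "?P p0" using number_field_algebraic[OF assms] by blast
  then obtain p1 where p1: "?P p1" "\<And>q. ?P q \<Longrightarrow> degree p1 \<le> degree q"
    using exists_least_iff[of "\<lambda>n. \<exists>p. ?P p \<and> degree p = n"] by (metis linorder_not_less)
  define p where "p = Polynomial.smult (inverse (lead_coeff p1)) p1"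
  have p: "?P p" "degree p = degree p1" "lead_coeff p = 1" using p1(1) by (auto simp: p_def)
  have min: "q = 0" if "rpoly q x = 0" "degree q < degree p" for q
    using p1(2)[of q] that p(2) by force
  have dv: "p dvd q" if "rpoly q x = 0" for q
  proof -
    have "q = p * (q div p) + q mod p" by simp
    then have "rpoly (q mod p) x = 0" using that p(1) by (metis rpoly_add rpoly_mult add_0 mult_zero_left)
    then have "q mod p = 0" using min p(1) degree_mod_less'[of p q] by blast
    then show ?thesis by auto
  qed
  have d: "degree p > 0"
  proof (rule ccontr)
    assume "\<not> degree p > 0"
    then have "p = 1" using p(3) by (simp add: monic_degree_0)
    then show False using p(1) by simp
  qed
  have "rpoly (pderiv p) x \<noteq> 0"
  proof
    assume "rpoly (pderiv p) x = 0"
    then have "pderiv p = 0" using min d by (simp add: degree_pderiv)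
    then show False using d by (simp add: pderiv_eq_0_iff)
  qed
  then show ?thesis using that p dv d by blast
qed

definition adjoin :: "'k::field_char_0 \<Rightarrow> 'k set" where
  "adjoin x = range (\<lambda>p. rpoly p x)"

lemma adjoin_closed:
  shows "u \<in> adjoin x \<Longrightarrow> v \<in> adjoin x \<Longrightarrow> u + v \<in> adjoin x"
    and "u \<in> adjoin x \<Longrightarrow> v \<in> adjoin x \<Longrightarrow> u - v \<in> adjoin x"
    and "u \<in> adjoin x \<Longrightarrow> v \<in> adjoin x \<Longrightarrow> u * v \<in> adjoin x"
    and "of_rat c \<in> adjoin x" and "x \<in> adjoin x" and "u \<in> adjoin x \<Longrightarrow> rpoly p u \<in> adjoin x"
proof -
  show "u \<in> adjoin x \<Longrightarrow> v \<in> adjoin x \<Longrightarrow> u + v \<in> adjoin x"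
    unfolding adjoin_def by (auto simp flip: rpoly_add)
  show "u \<in> adjoin x \<Longrightarrow> v \<in> adjoin x \<Longrightarrow> u - v \<in> adjoin x"
    unfolding adjoin_def by (auto simp flip: rpoly_diff)
  show "u \<in> adjoin x \<Longrightarrow> v \<in> adjoin x \<Longrightarrow> u * v \<in> adjoin x"
    unfolding adjoin_def by (auto simp flip: rpoly_mult)
  show "of_rat c \<in> adjoin x" unfolding adjoin_def by (rule range_eqI[of _ _ "[:c:]"]) simp
  show "x \<in> adjoin x" unfolding adjoin_def by (rule range_eqI[of _ _ "[:0,1:]"]) simp
  show "u \<in> adjoin x \<Longrightarrow> rpoly p u \<in> adjoin x"
    unfolding adjoin_def by (auto simp flip: rpoly_pcompose)
qed

lemma adjoin_0: "0 \<in> adjoin x" and adjoin_1: "1 \<in> adjoin x"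
  using adjoin_closed(4)[of 0 x] adjoin_closed(4)[of 1 x] by simp_all

text \<open>\<rat>[u] is a field: the minimal polynomial of \<open>u\<close> has a nonzero constant
  term \<open>c\<close>, for otherwise dividing it by the variable would lower its degree; then u
  q(u) = - c gives the inverse.\<close>

lemma adjoin_inverse:
  fixes x :: "'k::field_char_0"
  assumes "number_field TYPE('k)" "u \<in> adjoin x"
  shows "inverse u \<in> adjoin x"
proof (cases "u = 0")
  case True then show ?thesis by (simp add: adjoin_0)
next
  case False
  obtain p where p: "p \<noteq> 0" "rpoly p u = 0" "\<And>q. rpoly q u = 0 \<Longrightarrow> p dvd q" "degree p > 0"
    using min_rpoly[OF assms(1)] by metis
  obtain c q where cq: "p = pCons c q" by (cases p) auto
  have e: "of_rat c + u * rpoly q u = 0" using p(2) by (simp add: cq hom_distribs)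
  have "q \<noteq> 0" using p(4) cq by auto
  have "c \<noteq> 0"
  proof
    assume "c = 0"
    then have "rpoly q u = 0" using e False by simp
    then have "p dvd q" using p(3) by blast
    then show False using cq \<open>q \<noteq> 0\<close> dvd_imp_degree_le[of p q] by simp
  qed
  have "of_rat c = - (u * rpoly q u)" using e by (simp add: eq_neg_iff_add_eq_0)
  then have "u * (- of_rat (inverse c) * rpoly q u) = inverse (of_rat c) * of_rat c"
    by (simp add: of_rat_inverse algebra_simps)
  then have "u * (- of_rat (inverse c) * rpoly q u) = 1" using \<open>c \<noteq> 0\<close> by simp
  then have "inverse u = of_rat (- inverse c) * rpoly q u"
    by (metis inverse_unique of_rat_minus)
  then show ?thesis using adjoin_closed assms(2) by metis
qed

text \<open>Division by a monic polynomial stays within a subring of coefficients. Applied to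
  \<open>adjoin \<gamma>\<close>, it replaces polynomial arithmetic over a subfield that has no type
  of its own.\<close>

lemma poly_division_subring:
  fixes g f :: "'a::field poly"
  assumes R: "\<And>u v. u \<in> R \<Longrightarrow> v \<in> R \<Longrightarrow> u - v \<in> R" "\<And>u v. u \<in> R \<Longrightarrow> v \<in> R \<Longrightarrow> u * v \<in> R"  "0 \<in> R"
    and g: "lead_coeff g = 1" "\<And>i. coeff g i \<in> R" and f: "\<And>i. coeff f i \<in> R"
  shows "\<exists>q r. f = q * g + r \<and> (r = 0 \<or> degree r < degree g) \<and> (\<forall>i. coeff r i \<in> R)"
  using f
proof (induction "degree f" arbitrary: f rule: less_induct)
  case less
  show ?case
  proof (cases "f = 0 \<or> degree f < degree g")
    case True then show ?thesis using less.prems by (intro exI[of _ 0] exI[of _ f]) auto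
  next
    case False
    then have fg: "degree g \<le> degree f" "f \<noteq> 0" by auto
    define m where "m = monom (lead_coeff f) (degree f - degree g)"
    define f1 where "f1 = f - m * g"
    have c: "coeff f1 i \<in> R" for i
      unfolding f1_def m_def coeff_diff coeff_monom_mult
      using less.prems g(2) R by auto
    have dmg: "degree (m * g) \<le> degree f" unfolding m_def using fg
      by (metis degree_monom_le degree_mult_le le_add_diff_inverse2 add_le_mono1 order_trans)
    have cz: "coeff f1 (degree f) = 0" unfolding f1_def m_def coeff_diff coeff_monom_mult
      using fg g(1) by simp
    have df1: "degree f1 \<le> degree f" unfolding f1_def using dmg by (simp add: degree_diff_le)
    have "\<exists>q r. f1 = q * g + r \<and> (r = 0 \<or> degree r < degree g) \<and> (\<forall>i. coeff r i \<in> R)"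
    proof (cases "degree f1 < degree f")
      case True then show ?thesis using less.hyps c by blast
    next
      case False
      then have "degree f1 = degree f" using df1 by simp
      then have "f1 = 0" using cz by (metis leading_coeff_0_iff)
      then show ?thesis using R(3) by (intro exI[of _ 0] exI[of _ 0]) auto
    qed
    then obtain q r where "f1 = q * g + r" "r = 0 \<or> degree r < degree g" "\<forall>i. coeff r i \<in> R" by blast
    moreover from this(1) have "f = (m + q) * g + r" unfolding f1_def by (simp add: algebra_simps)
    ultimately show ?thesis by blast
  qed
qed


text \<open>The classical choice \<alpha> + c \<beta>. The monic polynomial \<open>g\<close> of
  least degree over \<rat>(\<gamma>) with root \<beta> divides both q and p(\<gamma> - c X). These
  have only \<beta> as a common root in \<complex>, and it is a simple root of q, so g = X - \<beta>
  and \<beta> lies in \<rat>(\<gamma>).\<close>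

lemma two_generators_one:
  fixes \<iota> :: "'k::field_char_0 \<Rightarrow> complex" and \<alpha> \<beta> :: 'k
  assumes nf: "number_field TYPE('k)" and emb: "field_embedding \<iota>"
  shows "\<exists>\<gamma>. \<alpha> \<in> adjoin \<gamma> \<and> \<beta> \<in> adjoin \<gamma>"
proof -
  interpret field_hom \<iota> by (rule field_embedding_hom[OF emb])
  have inj: "\<iota> u = \<iota> v \<longleftrightarrow> u = v" for u v by (metis eq_iff hom_minus hom_0_iff right_minus_eq)
  have iota_rat: "\<iota> (of_rat r) = of_rat r" for r by (rule field_embedding_of_rat[OF emb])
  obtain p where p: "p \<noteq> 0" "rpoly p \<alpha> = 0" using number_field_algebraic[OF nf, of \<alpha>] by blast
  obtain q where q: "q \<noteq> 0" "rpoly q \<beta> = 0" "rpoly (pderiv q) \<beta> \<noteq> 0"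
    using min_rpoly[OF nf, of \<beta>] by metis
  have fin: "finite {z::complex. rpoly r z = 0}" if "r \<noteq> 0" for r
    using that by (intro poly_roots_finite) (simp only: of_rat_poly_eq_0_iff not_False_eq_True)
  \<comment> \<open>The multipliers c for which another pair of conjugates satisfies \<xi> + c
    \<eta> = \<iota> \<alpha> + c \<iota> \<beta>. Pairs with \<eta> = \<iota> \<beta> divide by
    zero and contribute only the value 0.\<close>
  define Bad where "Bad = (\<lambda>(\<xi>,\<eta>). (\<xi> - \<iota> \<alpha>) / (\<iota> \<beta> - \<eta>)) ` ({z. rpoly p z = 0} \<times> {z. rpoly q z = 0})"
  have "finite Bad" unfolding Bad_def using fin p(1) q(1) by blast
  moreover have "infinite (range (of_nat :: nat \<Rightarrow> complex))" by (rule range_inj_infinite) simp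
  ultimately obtain c :: nat where c: "of_nat c \<notin> Bad" by (meson finite_subset image_subsetI)
  define \<gamma> where "\<gamma> = \<alpha> + of_nat c * \<beta>"
  have avoid: "\<eta> = \<iota> \<beta>" if "rpoly q \<eta> = 0" "rpoly p (\<iota> \<gamma> - of_nat c * \<eta>) = 0" for \<eta>
  proof (rule ccontr)
    assume n: "\<eta> \<noteq> \<iota> \<beta>"
    have "(\<iota> \<gamma> - of_nat c * \<eta> - \<iota> \<alpha>) / (\<iota> \<beta> - \<eta>) \<in> Bad"
      unfolding Bad_def using that by force
    moreover have "\<iota> \<gamma> - of_nat c * \<eta> - \<iota> \<alpha> = of_nat c * (\<iota> \<beta> - \<eta>)"
      unfolding \<gamma>_def by (simp add: hom_add hom_mult hom_of_nat algebra_simps)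
    ultimately show False using c n by simp
  qed
  let ?R = "adjoin \<gamma>"
  have R: "of_nat c \<in> ?R" "of_rat r \<in> ?R" for r using adjoin_closed(4)[of "of_nat c"] adjoin_closed(4) by auto
  define P where "P g \<longleftrightarrow> lead_coeff g = 1 \<and> (\<forall>i. coeff g i \<in> ?R) \<and> poly g \<beta> = 0" for g
  define q' where "q' = map_poly (of_rat :: rat \<Rightarrow> 'k) q"
  define h where "h = pcompose (map_poly of_rat p) [:\<gamma>, - of_nat c:]"
  have normalise: "P (Polynomial.smult (inverse (lead_coeff g)) g)"
    if "g \<noteq> 0" "\<forall>i. coeff g i \<in> ?R" "poly g \<beta> = 0" for g
    unfolding P_def using that adjoin_closed(3)[OF adjoin_inverse[OF nf]] by simp
  have q'R: "\<forall>i. coeff q' i \<in> ?R" unfolding q'_def by (simp add: R)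
  have q'0: "q' \<noteq> 0" "poly q' \<beta> = 0" using q unfolding q'_def by (simp_all only: of_rat_poly_eq_0_iff not_False_eq_True)
  have "P (Polynomial.smult (inverse (lead_coeff q')) q')" using normalise q'0 q'R by blast
  then obtain g where g: "P g" "\<And>g'. P g' \<Longrightarrow> degree g \<le> degree g'"
    using exists_least_iff[of "\<lambda>n. \<exists>g. P g \<and> degree g = n"] by (metis linorder_not_less)
  \<comment> \<open>The remainder, made monic, would contradict the minimal degree of
    \<open>g\<close>.\<close>
  have dv: "g dvd f" if f: "\<forall>i. coeff f i \<in> ?R" "poly f \<beta> = 0" for f
  proof -
    have "\<exists>a r. f = a * g + r \<and> (r = 0 \<or> degree r < degree g) \<and> (\<forall>i. coeff r i \<in> ?R)"
      by (rule poly_division_subring) (use adjoin_closed(2,3) adjoin_0 g(1) f(1) in \<open>auto simp: P_def\<close>)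
    then obtain a r where ar: "f = a * g + r" "r = 0 \<or> degree r < degree g" "\<forall>i. coeff r i \<in> ?R"
      by blast
    have "poly r \<beta> = 0" using ar(1) f(2) g(1) unfolding P_def by simp
    have "r = 0"
    proof (rule ccontr)
      assume "r \<noteq> 0"
      then have "degree g \<le> degree r" using g(2)[OF normalise[OF _ ar(3)]] \<open>poly r \<beta> = 0\<close> by simp
      then show False using ar(2) \<open>r \<noteq> 0\<close> by simp
    qed
    then show ?thesis using ar(1) by simp
  qed
  have pcR: "\<forall>i. coeff (pcompose f [:\<gamma>, - of_nat c:]) i \<in> ?R" if "\<forall>i. coeff f i \<in> ?R" for f
    using that
  proof (induction f)
    case 0 then show ?case by (simp add: adjoin_0)
  next
    case (pCons a f)
    have fR: "\<forall>i. coeff f i \<in> ?R" using pCons.prems by (metis coeff_pCons_Suc)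
    have aR: "a \<in> ?R" using pCons.prems by (metis coeff_pCons_0)
    have m: "- of_nat c \<in> ?R" using adjoin_closed(2)[OF adjoin_0 R(1)] by simp
    define k where "k = pcompose f [:\<gamma>, - of_nat c:]"
    have k: "coeff k i \<in> ?R" for i using pCons.IH[OF fR] by (simp add: k_def)
    have e: "coeff ([:a:] + [:\<gamma>, - of_nat c:] * k) i
        = coeff [:a:] i + (\<gamma> * coeff k i + (case i of 0 \<Rightarrow> 0 | Suc j \<Rightarrow> - of_nat c * coeff k j))" for i
      by (cases i) simp_all
    have a: "coeff [:a:] i \<in> ?R" for i using aR adjoin_0 by (cases i) auto
    have s: "(case i of 0 \<Rightarrow> 0 | Suc j \<Rightarrow> - of_nat c * coeff k j) \<in> ?R" for i
      using adjoin_closed(3)[OF m k] adjoin_0 by (cases i) (simp_all only: nat.case)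
    show ?case unfolding pcompose_pCons k_def[symmetric] e
      by (intro allI adjoin_closed(1) a s adjoin_closed(3)[OF adjoin_closed(5) k])
  qed
  have "\<forall>i. coeff h i \<in> ?R" unfolding h_def by (rule pcR) (simp add: R)
  moreover have "poly h \<beta> = 0" unfolding h_def using p(2) by (simp add: poly_pcompose \<gamma>_def algebra_simps)
  ultimately have gh: "g dvd h" by (rule dv)
  have gq: "g dvd q'" by (rule dv[OF q'R q'0(2)])
  obtain g1 where g1: "g = [:- \<beta>, 1:] * g1"
    using g(1) unfolding P_def poly_eq_0_iff_dvd by auto
  have g0: "g \<noteq> 0" "g1 \<noteq> 0" using g(1) g1 unfolding P_def by auto
  have dg: "degree g = Suc (degree g1)" unfolding g1 using g0 by (subst degree_mult_eq) auto
  \<comment> \<open>A further root of \<open>g\<close> would be a common root of q and h, hence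
    equal to \<iota> \<beta> by \<open>avoid\<close>; then \<beta> would be a double root of
    \<open>q'\<close>, contrary to separability.\<close>
  have "degree g1 = 0"
  proof (rule ccontr)
    assume d: "degree g1 \<noteq> 0"
    have di: "degree (map_poly \<iota> f) = degree f" for f
      by (rule degree_map_poly) simp
    obtain \<eta> where eta: "poly (map_poly \<iota> g1) \<eta> = 0"
      using fundamental_theorem_of_algebra[of "map_poly \<iota> g1"] constant_degree di d by metis
    have mm: "map_poly \<iota> (u * v) = map_poly \<iota> u * map_poly \<iota> v" for u v
    proof -
      interpret mp: map_poly_comm_ring_hom \<iota> ..
      show ?thesis by (rule mp.hom_mult)
    qed
    have root: "poly (map_poly \<iota> f) \<eta> = 0" if fd: "g dvd f" for f
    proof -
      obtain k where "f = [:- \<beta>, 1:] * g1 * k" using fd unfolding g1 dvd_def by blast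
      then show ?thesis by (simp only: mm poly_mult eta mult_zero_left mult_zero_right)
    qed
    have iq: "map_poly \<iota> q' = map_poly of_rat q" unfolding q'_def
      by (simp add: map_poly_map_poly o_def iota_rat)
    have "poly (map_poly \<iota> h) \<eta> = rpoly p (\<iota> \<gamma> - of_nat c * \<eta>)"
    proof -
      have "map_poly \<iota> h = pcompose (map_poly \<iota> (map_poly of_rat p)) (map_poly \<iota> [:\<gamma>, - of_nat c:])"
        unfolding h_def by (rule map_poly_pcompose)
      also have "map_poly \<iota> (map_poly of_rat p) = map_poly of_rat p"
        by (simp add: map_poly_map_poly o_def iota_rat)
      also have "map_poly \<iota> [:\<gamma>, - of_nat c:] = [:\<iota> \<gamma>, - of_nat c:]"
        by (simp add: map_poly_pCons_hom hom_uminus hom_of_nat)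
      finally show ?thesis by (simp add: poly_pcompose algebra_simps)
    qed
    then have "\<eta> = \<iota> \<beta>" using avoid root[OF gh] root[OF gq] iq by simp
    then have "poly g1 \<beta> = 0" using eta field_embedding_poly[OF emb, of g1 \<beta>] by simp
    then obtain g2 where g2: "g1 = [:- \<beta>, 1:] * g2" unfolding poly_eq_0_iff_dvd dvd_def by blast
    obtain r' where r': "q' = g * r'" using gq unfolding dvd_def by blast
    define r where "r = g2 * r'"
    have "q' = [:- \<beta>, 1:] * ([:- \<beta>, 1:] * r)"
      unfolding r' g1 g2 r_def by (simp only: mult.assoc)
    moreover have "poly [:- \<beta>, 1:] \<beta> = 0" by simp
    ultimately have "poly (pderiv q') \<beta> = 0"
      by (simp only: pderiv_mult poly_add poly_mult mult_zero_left mult_zero_right add_0)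
    moreover have "pderiv q' = map_poly of_rat (pderiv q)" unfolding q'_def
      by (simp add: of_rat_hom.map_poly_pderiv)
    ultimately show False using q(3) by simp
  qed
  then obtain a where a: "g1 = [:a:]" by (meson degree_eq_zeroE)
  have "a = 1" using g(1) unfolding P_def g1 a by (cases "a = 0") auto
  then have "coeff g 0 = - \<beta>" by (simp add: g1 a)
  then have "- \<beta> \<in> ?R" using g(1) unfolding P_def by metis
  then have b: "\<beta> \<in> ?R" using adjoin_closed(2)[OF adjoin_0] by fastforce
  then have "\<gamma> - of_nat c * \<beta> \<in> ?R"
    by (intro adjoin_closed(2)[OF adjoin_closed(5)] adjoin_closed(3) R(1) b)
  then have "\<alpha> \<in> ?R" by (simp add: \<gamma>_def)
  with b show ?thesis by blast
qed

lemma adjoin_mono: "x \<in> adjoin y \<Longrightarrow> adjoin x \<subseteq> adjoin y"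
  using adjoin_closed(6) unfolding adjoin_def[of x] by blast

theorem primitive_element:
  fixes \<iota> :: "'k::field_char_0 \<Rightarrow> complex"
  assumes nf: "number_field TYPE('k)" and emb: "field_embedding \<iota>"
  shows "\<exists>\<theta>::'k. adjoin \<theta> = UNIV"
proof -
  obtain B :: "'k set" where B: "finite B" "rvs.span B = UNIV"
    using nf unfolding number_field_def by blast
  have "\<exists>\<theta>. B \<subseteq> adjoin \<theta>" using B(1)
  proof induction
    case (insert b B)
    then obtain \<theta> where t: "B \<subseteq> adjoin \<theta>" by blast
    obtain \<gamma> where "b \<in> adjoin \<gamma>" "\<theta> \<in> adjoin \<gamma>" using two_generators_one[OF nf emb] by blast
    then show ?case using t adjoin_mono by blast
  qed auto
  then obtain \<theta> where t: "B \<subseteq> adjoin \<theta>" by blast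
  have "rvs.subspace (adjoin \<theta>)"
    unfolding rvs.subspace_def rat_scale_def
    by (intro conjI ballI allI adjoin_0 adjoin_closed(1) adjoin_closed(3)[OF adjoin_closed(4)])
  then have "rvs.span B \<subseteq> adjoin \<theta>" using t by (rule rvs.span_minimal[rotated])
  then show ?thesis using B(2) by blast
qed

lemma algebraic_int_embedding:
  assumes "field_embedding \<sigma>"
  shows "algebraic_int (\<sigma> x) \<longleftrightarrow> algebraic_int x"
proof -
  interpret field_hom \<sigma> by (rule field_embedding_hom[OF assms])
  have "poly (map_poly of_int p) (\<sigma> x) = \<sigma> (poly (map_poly of_int p) x)" for p
  proof -
    have "map_poly \<sigma> (map_poly of_int p) = map_poly of_int p"
      by (simp add: map_poly_map_poly o_def hom_of_int)
    then show ?thesis using field_embedding_poly[OF assms, of "map_poly of_int p" x] by simp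
  qed
  then show ?thesis unfolding algebraic_int_altdef_ipoly by simp
qed

lemma field_embedding_zero: "field_embedding \<sigma> \<Longrightarrow> \<sigma> 0 = 0"
proof -
  assume "field_embedding \<sigma>"
  then interpret field_hom \<sigma> by (rule field_embedding_hom)
  show ?thesis by simp
qed

lemma clear_denominators:
  fixes p :: "rat poly"
  shows "\<exists>M>0. \<forall>i. of_nat M * coeff p i \<in> \<int>"
proof (induction p)
  case 0 then show ?case by (intro exI[of _ 1]) auto
next
  case (pCons a p)
  then obtain M where M: "M > 0" "\<And>i. of_nat M * coeff p i \<in> \<int>" by blast
  obtain n d :: int where nd: "a = of_int n / of_int d" "d > 0"
    by (cases a) (auto simp: Fract_of_int_quotient)
  define N where "N = nat d * M"
  have "of_nat N * a = of_int (n * int M)" using nd by (simp add: N_def)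
  then have a: "of_nat N * a \<in> \<int>" by (simp only: Ints_of_int)
  have "of_nat N * coeff p i = of_int d * (of_nat M * coeff p i)" for i
    using nd by (simp add: N_def)
  then have b: "of_nat N * coeff p i \<in> \<int>" for i using Ints_mult[OF Ints_of_int M(2)] by metis
  have "\<forall>i. of_nat N * coeff (pCons a p) i \<in> \<int>"
  proof
    fix i show "of_nat N * coeff (pCons a p) i \<in> \<int>" by (cases i) (simp_all only: coeff_pCons_0 coeff_pCons_Suc a b)
  qed
  moreover have "N > 0" using nd M by (simp add: N_def)
  ultimately show ?case by blast
qed

text \<open>If \<open>M\<close> clears the denominators of the monic minimal polynomial of degree n,
  then weighting its i-th coefficient by M^(n-i) gives a monic integral polynomial with root M
  x.\<close>

lemma algebraic_int_multiple:
  fixes x :: "'k::field_char_0"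
  assumes "number_field TYPE('k)"
  shows "\<exists>d>0. algebraic_int (of_nat d * x)"
proof -
  obtain p where p: "rpoly p x = 0" "lead_coeff p = 1"
    using min_rpoly[OF assms, of x] by metis
  obtain M where M: "M > 0" "\<And>i. of_nat M * coeff p i \<in> \<int>" using clear_denominators[of p] by blast
  define n where "n = degree p"
  define q where "q = (\<Sum>i\<le>n. monom (of_rat (of_nat M ^ (n - i) * coeff p i)) i :: 'k poly)"
  have cq: "coeff q i = (if i \<le> n then of_rat (of_nat M ^ (n - i) * coeff p i) else 0)" for i
    unfolding q_def coeff_sum coeff_monom by (simp add: sum.delta)
  have qn: "coeff q n = 1" using p(2) by (simp add: cq n_def)
  have dq: "degree q = n"
    by (rule antisym) (use qn in \<open>auto intro!: degree_le le_degree simp: cq\<close>)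
  have "coeff q i \<in> \<int>" for i
  proof (cases "i < n")
    case True
    then obtain k where "n - i = Suc k" by (metis Suc_diff_Suc)
    then have "of_nat M ^ (n - i) * coeff p i = of_nat M ^ k * (of_nat M * coeff p i)"
      by (simp only: power_Suc2 mult.assoc)
    also have "\<dots> \<in> \<int>" by (rule Ints_mult[OF Ints_power[OF Ints_of_nat] M(2)])
    finally obtain z where "of_nat M ^ (n - i) * coeff p i = of_int z" by (auto elim: Ints_cases)
    then show ?thesis using True by (simp add: cq)
  next
    case False
    then show ?thesis using qn cq[of i] by (cases "i = n") auto
  qed
  moreover have "poly q (of_nat M * x) = 0"
  proof -
    have "poly q (of_nat M * x) = (\<Sum>i\<le>n. of_nat M ^ n * (of_rat (coeff p i) * x ^ i))"
      unfolding q_def poly_sum poly_monom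
    proof (intro sum.cong refl)
      fix i assume "i \<in> {..n}"
      then have "(of_nat M :: 'k) ^ n = of_nat M ^ (n - i) * of_nat M ^ i" by (simp flip: power_add)
      then show "of_rat (of_nat M ^ (n - i) * coeff p i) * (of_nat M * x) ^ i = of_nat M ^ n * (of_rat (coeff p i) * x ^ i)"
        by (simp add: of_rat_mult of_rat_power power_mult_distrib)
    qed
    also have "\<dots> = of_nat M ^ n * rpoly p x"
      unfolding poly_altdef by (simp add: n_def sum_distrib_left degree_map_poly coeff_map_poly)
    finally show ?thesis using p(1) by simp
  qed
  ultimately have "algebraic_int (of_nat M * x)"
    using qn dq by (intro algebraic_int.intros[of q]) auto
  then show ?thesis using M(1) by blast
qed

section \<open>Embeddings into \<complex> and the norm\<close>

locale nfield =
  fixes \<iota> :: "'k::field_char_0 \<Rightarrow> complex"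
  assumes nf: "number_field TYPE('k)" and emb: "field_embedding \<iota>"
begin

lemma primitive_algebraic_int: "\<exists>\<theta>::'k. adjoin \<theta> = UNIV \<and> algebraic_int \<theta>"
proof -
  obtain t :: 'k where t: "adjoin t = UNIV" using primitive_element[OF nf emb] by blast
  obtain d where d: "d > 0" "algebraic_int (of_nat d * t)" using algebraic_int_multiple[OF nf] by blast
  have "t = of_rat (inverse (of_nat d)) * (of_nat d * t)" using d(1) by (simp add: of_rat_inverse)
  then have "t \<in> adjoin (of_nat d * t)" using adjoin_closed(3)[OF adjoin_closed(4) adjoin_closed(5)] by metis
  then have "adjoin (of_nat d * t) = UNIV" using adjoin_mono t by blast
  then show ?thesis using d(2) by blast
qed

text \<open>An integral primitive element: \<int>[\<theta>] is then a lattice inside the ring of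
  integers, and its coordinates turn counting in \<O> into counting integer vectors.\<close>

definition \<theta> :: 'k where "\<theta> = (SOME t. adjoin t = UNIV \<and> algebraic_int t)"

lemma theta: "adjoin \<theta> = UNIV" "algebraic_int \<theta>"
  using someI_ex[OF primitive_algebraic_int] unfolding \<theta>_def by auto

definition \<mu> :: "rat poly" where
  "\<mu> = (SOME p. p \<noteq> 0 \<and> rpoly p \<theta> = 0 \<and> (\<forall>q. rpoly q \<theta> = 0 \<longrightarrow> p dvd q) \<and> rpoly (pderiv p) \<theta> \<noteq> 0 \<and>
    lead_coeff p = 1 \<and> degree p > 0)"

lemma mu: "\<mu> \<noteq> 0" "rpoly \<mu> \<theta> = 0" "\<And>q. rpoly q \<theta> = 0 \<Longrightarrow> \<mu> dvd q" "rpoly (pderiv \<mu>) \<theta> \<noteq> 0"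
    "lead_coeff \<mu> = 1" "degree \<mu> > 0"
proof -
  have "\<exists>p. p \<noteq> 0 \<and> rpoly p \<theta> = 0 \<and> (\<forall>q. rpoly q \<theta> = 0 \<longrightarrow> p dvd q) \<and> rpoly (pderiv p) \<theta> \<noteq> 0 \<and>
    lead_coeff p = 1 \<and> degree p > 0"
    using min_rpoly[OF nf, of \<theta>] by metis
  from someI_ex[OF this] show "\<mu> \<noteq> 0" "rpoly \<mu> \<theta> = 0" "\<And>q. rpoly q \<theta> = 0 \<Longrightarrow> \<mu> dvd q" "rpoly (pderiv \<mu>) \<theta> \<noteq> 0"
    "lead_coeff \<mu> = 1" "degree \<mu> > 0"
    unfolding \<mu>_def[symmetric] by auto
qed

definition m :: nat where "m = degree \<mu>"

definition E :: "('k \<Rightarrow> complex) set" where "E = {\<sigma>. field_embedding \<sigma>}"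

definition rts :: "complex set" where "rts = {z. rpoly \<mu> z = 0}"

lemma m_pos: "m > 0" using mu by (simp add: m_def)

text \<open>Write \<mu> = g e with g the gcd. One factor vanishes at \<theta> and is therefore
  divisible by \<mu>; it cannot be g, which divides the derivative of smaller degree.\<close>

lemma mu_coprime: "\<exists>a b. a * \<mu> + b * pderiv \<mu> = 1"
proof -
  define g where "g = gcd \<mu> (pderiv \<mu>)"
  have g0: "g \<noteq> 0" unfolding g_def using mu(1) by simp
  have pd: "pderiv \<mu> \<noteq> 0" using mu(4) by auto
  obtain e where e: "\<mu> = g * e" unfolding g_def by (meson dvdE gcd_dvd1)
  have e0: "e \<noteq> 0" using e mu(1) by auto
  have dm: "degree \<mu> = degree g + degree e" unfolding e using g0 e0 by (rule degree_mult_eq)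
  have "degree g = 0"
  proof -
    have "rpoly g \<theta> * rpoly e \<theta> = 0" using mu(2) e rpoly_mult by metis
    then consider "rpoly g \<theta> = 0" | "rpoly e \<theta> = 0" by auto
    then show ?thesis
    proof cases
      case 1
      then have "\<mu> dvd g" by (rule mu(3))
      then have "\<mu> dvd pderiv \<mu>" unfolding g_def by (meson dvd_trans gcd_dvd2)
      then have "degree \<mu> \<le> degree (pderiv \<mu>)" using pd by (rule dvd_imp_degree_le)
      then show ?thesis using mu(6) by (simp add: degree_pderiv)
    next
      case 2
      then have "\<mu> dvd e" by (rule mu(3))
      then have "degree \<mu> \<le> degree e" using e0 by (rule dvd_imp_degree_le)
      then show ?thesis using dm by simp
    qed
  qed
  then have "g = 1" unfolding g_def using g0 g_def
    by (metis is_unit_gcd is_unit_iff_degree mu(1) gcd_eq_0_iff coprime_iff_gcd_eq_1)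
  then show ?thesis using bezout_coefficients[of \<mu> "pderiv \<mu>"] unfolding g_def
    by (metis surj_pair)
qed

text \<open>Since \<mu> is coprime to its derivative, all its complex roots are simple, and the
  degree counts them.\<close>

lemma card_rts: "finite rts" "card rts = m"
proof -
  let ?M = "map_poly of_rat \<mu> :: complex poly"
  have M0: "?M \<noteq> 0" using mu(1) by (simp only: of_rat_poly_eq_0_iff not_False_eq_True)
  show fin: "finite rts" unfolding rts_def using poly_roots_finite[OF M0] .
  have sf: "rsquarefree ?M" unfolding rsquarefree_roots
  proof (intro allI notI)
    fix a assume a: "poly ?M a = 0 \<and> poly (pderiv ?M) a = 0"
    obtain u v where uv: "u * \<mu> + v * pderiv \<mu> = 1" using mu_coprime by blast
    have "pderiv ?M = map_poly of_rat (pderiv \<mu>)" by (simp add: of_rat_hom.map_poly_pderiv)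
    then have "rpoly (u * \<mu> + v * pderiv \<mu>) a = 0" using a by simp
    then show False using uv by simp
  qed
  have "m = size (proots ?M)" by (simp add: size_proots_complex m_def)
  also have "\<dots> = (\<Sum>a\<in>set_mset (proots ?M). count (proots ?M) a)" by (rule size_multiset_overloaded_eq)
  also have "\<dots> = (\<Sum>a\<in>rts. Polynomial.order a ?M)" using M0 by (simp add: rts_def)
  also have "\<dots> = (\<Sum>a\<in>rts. 1)"
    using rsquarefree_root_order[OF sf _ M0] by (intro sum.cong) (auto simp: rts_def)
  finally show "card rts = m" by simp
qed

lemma rep_theta: "\<exists>g. degree g < m \<and> x = rpoly g \<theta>"
proof -
  have "x \<in> adjoin \<theta>" using theta(1) by simp
  then obtain g where g: "x = rpoly g \<theta>" unfolding adjoin_def by blast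
  have "g = \<mu> * (g div \<mu>) + g mod \<mu>" by simp
  then have "rpoly g \<theta> = rpoly (g mod \<mu>) \<theta>" using mu(2) rpoly_add rpoly_mult by (metis add_0 mult_zero_left)
  moreover have "degree (g mod \<mu>) < m"
    using degree_mod_less[OF mu(1), of g] mu(6) by (auto simp: m_def)
  ultimately show ?thesis using g by auto
qed

text \<open>Sending \<theta> to \<xi> is well defined on polynomial expressions, as two polynomials
  with the same value at \<theta> differ by a multiple of \<mu>.\<close>

lemma embedding_of_root:
  assumes "\<xi> \<in> rts" shows "\<exists>\<sigma>\<in>E. \<sigma> \<theta> = \<xi>"
proof -
  have wd: "rpoly g \<xi> = rpoly h \<xi>" if "rpoly g \<theta> = rpoly h \<theta>" for g h
  proof -
    have "\<mu> dvd g - h" using that by (intro mu(3)) simp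
    then obtain k where "g - h = \<mu> * k" by (rule dvdE)
    then have "rpoly (g - h) \<xi> = 0" using assms by (simp add: rts_def)
    then show ?thesis by simp
  qed
  define \<sigma> where "\<sigma> x = rpoly (SOME g. x = rpoly g \<theta>) \<xi>" for x
  have \<sigma>: "\<sigma> (rpoly g \<theta>) = rpoly g \<xi>" for g
    unfolding \<sigma>_def by (rule wd) (metis (mono_tags, lifting) someI)
  have "field_embedding \<sigma>" unfolding field_embedding_def
  proof (intro conjI allI)
    show "\<sigma> 1 = 1" using \<sigma>[of 1] by simp
    fix x y
    obtain g h where gh: "x = rpoly g \<theta>" "y = rpoly h \<theta>" using rep_theta by metis
    show "\<sigma> (x + y) = \<sigma> x + \<sigma> y" using \<sigma>[of "g + h"] \<sigma>[of g] \<sigma>[of h] by (simp add: gh)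
    show "\<sigma> (x * y) = \<sigma> x * \<sigma> y" using \<sigma>[of "g * h"] \<sigma>[of g] \<sigma>[of h] by (simp add: gh)
  qed
  moreover have "\<sigma> \<theta> = \<xi>" using \<sigma>[of "[:0, 1:]"] by simp
  ultimately show ?thesis unfolding E_def by blast
qed

lemma bij_embeddings: "bij_betw (\<lambda>\<sigma>. \<sigma> \<theta>) E rts"
  unfolding bij_betw_def
proof (intro conjI)
  show "inj_on (\<lambda>\<sigma>. \<sigma> \<theta>) E"
  proof (rule inj_onI)
    fix \<sigma> \<sigma>' assume a: "\<sigma> \<in> E" "\<sigma>' \<in> E" "\<sigma> \<theta> = \<sigma>' \<theta>"
    show "\<sigma> = \<sigma>'"
    proof
      fix x obtain g where "x = rpoly g \<theta>" using rep_theta by blast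
      then show "\<sigma> x = \<sigma>' x" using a field_embedding_rpoly unfolding E_def by (metis mem_Collect_eq)
    qed
  qed
  have "\<sigma> \<theta> \<in> rts" if "\<sigma> \<in> E" for \<sigma>
    using field_embedding_rpoly[of \<sigma> \<mu> \<theta>] that mu(2) field_embedding_zero[of \<sigma>]
    by (simp add: E_def rts_def)
  then show "(\<lambda>\<sigma>. \<sigma> \<theta>) ` E = rts" using embedding_of_root by blast
qed

lemma E_hom: "\<sigma> \<in> E \<Longrightarrow> field_hom \<sigma>" unfolding E_def using field_embedding_hom by blast

lemma emb_simps [simp]:
  assumes "\<sigma> \<in> E"
  shows "\<sigma> 0 = 0" "\<sigma> 1 = 1" "\<sigma> (x + y) = \<sigma> x + \<sigma> y" "\<sigma> (x * y) = \<sigma> x * \<sigma> y" "\<sigma> (x - y) = \<sigma> x - \<sigma> y"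
    "\<sigma> (- x) = - \<sigma> x" "\<sigma> (of_int n) = of_int n" "\<sigma> (of_nat k) = of_nat k" "\<sigma> (of_rat r) = of_rat r"
    "\<sigma> (x ^ k) = \<sigma> x ^ k" "\<sigma> x = 0 \<longleftrightarrow> x = 0" "\<sigma> (x / y) = \<sigma> x / \<sigma> y" "\<sigma> (sum f A) = (\<Sum>i\<in>A. \<sigma> (f i))"
proof -
  interpret field_hom \<sigma> by (rule E_hom[OF assms])
  show "\<sigma> 0 = 0" "\<sigma> 1 = 1" "\<sigma> (x + y) = \<sigma> x + \<sigma> y" "\<sigma> (x * y) = \<sigma> x * \<sigma> y" "\<sigma> (x - y) = \<sigma> x - \<sigma> y"
    "\<sigma> (- x) = - \<sigma> x" "\<sigma> (of_int n) = of_int n" "\<sigma> (of_nat k) = of_nat k" 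
    "\<sigma> (x ^ k) = \<sigma> x ^ k" "\<sigma> x = 0 \<longleftrightarrow> x = 0" "\<sigma> (sum f A) = (\<Sum>i\<in>A. \<sigma> (f i))"
    by (simp_all add: hom_add hom_mult hom_minus hom_uminus hom_of_int hom_of_nat hom_power hom_sum)
  show "\<sigma> (of_rat r) = of_rat r" using field_embedding_of_rat assms by (auto simp: E_def)
  show "\<sigma> (x / y) = \<sigma> x / \<sigma> y" by (simp add: divide_inverse hom_mult hom_inverse)
qed

lemma E_card: "finite E" "card E = m" "\<iota> \<in> E"
proof -
  show "finite E" using bij_betw_finite[OF bij_embeddings] card_rts(1) by blast
  show "card E = m" using bij_betw_same_card[OF bij_embeddings] card_rts(2) by simp
  show "\<iota> \<in> E" using emb by (simp add: E_def)
qed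

lemma E_cnj: "\<sigma> \<in> E \<Longrightarrow> (\<lambda>x. cnj (\<sigma> x)) \<in> E"
  unfolding E_def field_embedding_def by auto

text \<open>The norm is the determinant of multiplication by \<open>x\<close>, a rational matrix
  \<open>M\<close> in the basis of powers of \<theta>. The Vandermonde matrix \<open>W\<close> of
  the conjugates of \<theta> diagonalises it: W M = Dg W, with the conjugates of \<open>x\<close> on
  the diagonal of \<open>Dg\<close>.\<close>

lemma norm_rational: "(\<Prod>\<sigma>\<in>E. \<sigma> x) \<in> \<rat>"
proof -
  obtain zs where zs: "distinct zs" "set zs = rts" using finite_distinct_list[OF card_rts(1)] by blast
  have lz: "length zs = m" using card_rts(2) distinct_card[OF zs(1)] zs(2) by simp
  have "\<forall>j. \<exists>g. degree g < m \<and> x * \<theta> ^ j = rpoly g \<theta>" using rep_theta by blast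
  from choice[OF this] obtain g where g': "\<forall>j. degree (g j) < m \<and> x * \<theta> ^ j = rpoly (g j) \<theta>" by blast
  have g: "degree (g j) < m" "x * \<theta> ^ j = rpoly (g j) \<theta>" for j using g' by auto
  define sg where "sg z = (THE \<sigma>. \<sigma> \<in> E \<and> \<sigma> \<theta> = z)" for z
  have sg: "sg z \<in> E" "sg z \<theta> = z" if zr: "z \<in> rts" for z
  proof -
    obtain s where "s \<in> E" "s \<theta> = z" using embedding_of_root[OF zr] by blast
    then have "\<exists>!\<sigma>. \<sigma> \<in> E \<and> \<sigma> \<theta> = z" using bij_betw_imp_inj_on[OF bij_embeddings] by (auto dest: inj_onD)
    from theI'[OF this] show "sg z \<in> E" "sg z \<theta> = z" unfolding sg_def by auto
  qed
  define M :: "rat mat" where "M = mat m m (\<lambda>(i, j). coeff (g j) i)"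
  define W :: "complex mat" where "W = mat m m (\<lambda>(k, i). (zs ! k) ^ i)"
  define Dg :: "complex mat" where "Dg = mat m m (\<lambda>(k, i). if k = i then sg (zs ! k) x else 0)"
  let ?M = "map_mat of_rat M :: complex mat"
  have car: "M \<in> carrier_mat m m" "W \<in> carrier_mat m m" "Dg \<in> carrier_mat m m" "?M \<in> carrier_mat m m"
    by (auto simp: M_def W_def Dg_def)
  have "W * ?M = Dg * W"
  proof (rule eq_matI)
    fix k j assume kj: "k < dim_row (Dg * W)" "j < dim_col (Dg * W)"
    then have kj': "k < m" "j < m" by (auto simp: Dg_def W_def)
    let ?z = "zs ! k"
    have z: "?z \<in> rts" using kj' lz zs(2) by (metis nth_mem)
    have "(W * ?M) $$ (k, j) = (\<Sum>i<m. ?z ^ i * of_rat (coeff (g j) i))"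
      using kj' by (simp add: W_def M_def scalar_prod_def atLeast0LessThan)
    also have "\<dots> = rpoly (g j) ?z"
    proof -
      have "rpoly (g j) ?z = (\<Sum>i\<le>degree (g j). of_rat (coeff (g j) i) * ?z ^ i)"
        unfolding poly_altdef by (simp add: degree_map_poly coeff_map_poly)
      also have "\<dots> = (\<Sum>i<m. of_rat (coeff (g j) i) * ?z ^ i)"
        using g(1)[of j] by (intro sum.mono_neutral_left) (auto simp: coeff_eq_0)
      finally show ?thesis by (simp add: mult.commute)
    qed
    also have "\<dots> = sg ?z (rpoly (g j) \<theta>)" using field_embedding_rpoly[of "sg ?z"] sg[OF z] by (simp add: E_def)
    also have "\<dots> = sg ?z x * ?z ^ j" using sg[OF z] by (simp flip: g(2))
    also have "\<dots> = (Dg * W) $$ (k, j)"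
      using kj' by (simp add: W_def Dg_def scalar_prod_def if_distrib[of "\<lambda>u. u * _"] sum.delta cong: if_cong)
    finally show "(W * ?M) $$ (k, j) = (Dg * W) $$ (k, j)" .
  qed (auto simp: W_def Dg_def M_def)
  then have "det W * det ?M = det Dg * det W"
    by (simp only: det_mult[OF car(2,4), symmetric] det_mult[OF car(3,2), symmetric])
  \<comment> \<open>A kernel vector would consist of the coefficients of a polynomial of degree
    below m that vanishes at the m roots of \<mu>.\<close>
  moreover have "det W \<noteq> 0"
  proof
    assume "det W = 0"
    then obtain v where v: "v \<in> carrier_vec m" "v \<noteq> 0\<^sub>v m" "W *\<^sub>v v = 0\<^sub>v m"
      using det_0_iff_vec_prod_zero_field[OF car(2)] by blast
    define p where "p = (\<Sum>i<m. monom (v $ i) i)"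
    have cp: "coeff p i = (if i < m then v $ i else 0)" for i
      unfolding p_def coeff_sum coeff_monom by (simp add: sum.delta)
    have "p = 0"
    proof (rule ccontr)
      assume p0: "p \<noteq> 0"
      have "rts \<subseteq> {z. poly p z = 0}"
      proof
        fix z assume "z \<in> rts"
        then obtain k where k: "k < m" "z = zs ! k" using zs(2) lz by (metis in_set_conv_nth)
        have "(W *\<^sub>v v) $ k = 0" using v(3) k by simp
        then have "(\<Sum>i<m. z ^ i * v $ i) = 0" using k v(1) by (simp add: W_def scalar_prod_def atLeast0LessThan)
        then show "z \<in> {z. poly p z = 0}" by (simp add: p_def poly_sum poly_monom mult.commute)
      qed
      then have "m \<le> card {z. poly p z = 0}" using card_mono[OF poly_roots_finite[OF p0]] card_rts by metis
      also have "\<dots> \<le> degree p" by (rule card_poly_roots_bound[OF p0])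
      also have "degree p < m"
        using m_pos p0 cp by (metis leading_coeff_0_iff)
      finally show False by simp
    qed
    then have "v $ i = 0" if "i < m" for i using cp[of i] that by simp
    then show False using v(1,2) by (metis eq_vecI carrier_vecD index_zero_vec)
  qed
  ultimately have "det ?M = det Dg" by simp
  moreover have "det ?M = of_rat (det M)" by (rule of_rat_hom.hom_det)
  moreover have "det Dg = (\<Prod>\<sigma>\<in>E. \<sigma> x)"
  proof -
    have "upper_triangular Dg" by (auto simp: Dg_def)
    then have "det Dg = prod_list (diag_mat Dg)" using det_upper_triangular car(3) by blast
    also have "\<dots> = (\<Prod>k<m. sg (zs ! k) x)"
      by (simp add: prod.list_conv_set_nth diag_mat_def Dg_def atLeast0LessThan)
    also have "\<dots> = (\<Prod>z\<in>rts. sg z x)"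
      by (rule prod.reindex_bij_betw) (use bij_betw_nth[OF zs(1), of "{..<m}"] lz zs(2) in auto)
    also have "\<dots> = (\<Prod>\<sigma>\<in>E. sg (\<sigma> \<theta>) x)" by (rule prod.reindex_bij_betw[OF bij_embeddings, symmetric])
    also have "\<dots> = (\<Prod>\<sigma>\<in>E. \<sigma> x)"
    proof (rule prod.cong)
      fix \<sigma> assume s: "\<sigma> \<in> E"
      then have "\<sigma> \<theta> \<in> rts" using bij_embeddings unfolding bij_betw_def by blast
      then have "sg (\<sigma> \<theta>) = \<sigma>" using sg s bij_betw_imp_inj_on[OF bij_embeddings] by (auto dest: inj_onD)
      then show "sg (\<sigma> \<theta>) x = \<sigma> x" by simp
    qed simp
    finally show ?thesis .
  qed
  ultimately show ?thesis by (metis Rats_of_rat)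
qed

definition Nm :: "'k \<Rightarrow> real" where "Nm x = (\<Prod>\<sigma>\<in>E. cmod (\<sigma> x))"

lemma Nm_mult: "Nm (x * y) = Nm x * Nm y"
  unfolding Nm_def by (simp add: norm_mult prod.distrib)

lemma Nm_pos: "x \<noteq> 0 \<Longrightarrow> Nm x > 0"
  unfolding Nm_def by (intro prod_pos) auto

lemma norm_int:
  assumes "algebraic_int x" obtains n where "(\<Prod>\<sigma>\<in>E. \<sigma> x) = of_int n"
proof -
  have "algebraic_int (\<Prod>\<sigma>\<in>E. \<sigma> x)"
    using assms algebraic_int_embedding by (intro algebraic_int_prod) (auto simp: E_def)
  then have "(\<Prod>\<sigma>\<in>E. \<sigma> x) \<in> \<int>" using norm_rational by (rule rational_algebraic_int_is_int)
  then show ?thesis using that by (auto elim: Ints_cases)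
qed

lemma Nm_ge_1:
  assumes "algebraic_int x" "x \<noteq> 0" shows "Nm x \<ge> 1"
proof -
  obtain n where n: "(\<Prod>\<sigma>\<in>E. \<sigma> x) = of_int n" using norm_int[OF assms(1)] .
  have "Nm x = cmod (of_int n)" unfolding Nm_def n[symmetric] by (simp add: prod_norm)
  then have N: "Nm x = \<bar>of_int n\<bar>" by simp
  then have "n \<noteq> 0" using Nm_pos[OF assms(2)] by auto
  then show ?thesis using N by linarith
qed

text \<open>The cofactor is, up to sign, the product of the remaining conjugates, which is integral.
  It belongs to the field because it equals the norm divided by \<open>x\<close>.\<close>

lemma norm_cofactor:
  assumes "algebraic_int x" "x \<noteq> 0"
  obtains y n where "algebraic_int y" "x * y = of_nat n" "n > 0" "real n = Nm x"
proof -
  obtain n where n: "(\<Prod>\<sigma>\<in>E. \<sigma> x) = of_int n" using norm_int[OF assms(1)] .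
  have "Nm x = cmod (of_int n)" unfolding Nm_def n[symmetric] by (simp add: prod_norm)
  then have N: "Nm x = \<bar>of_int n\<bar>" by simp
  then have n0: "n \<noteq> 0" using Nm_pos[OF assms(2)] by auto
  define y where "y = of_int n / x"
  have "\<iota> x * (\<Prod>\<sigma>\<in>E - {\<iota>}. \<sigma> x) = of_int n"
    using n E_card by (simp add: prod.remove[of E \<iota>])
  then have "\<iota> y = (\<Prod>\<sigma>\<in>E - {\<iota>}. \<sigma> x)" using E_card(3) assms(2) by (simp add: y_def field_simps)
  moreover have "algebraic_int (\<Prod>\<sigma>\<in>E - {\<iota>}. \<sigma> x)"
    using assms algebraic_int_embedding by (intro algebraic_int_prod) (auto simp: E_def)
  ultimately have y: "algebraic_int y" using algebraic_int_embedding[OF emb] by metis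
  have xy: "x * y = of_int n" using assms(2) by (simp add: y_def)
  have "x * (of_int (sgn n) * y) = of_int (sgn n) * of_int n" using xy by (simp add: mult.left_commute)
  also have "\<dots> = of_nat (nat \<bar>n\<bar>)"
    by (simp flip: of_int_mult add: sgn_if)
  finally show ?thesis
    using n0 N y by (intro that[of "of_int (sgn n) * y" "nat \<bar>n\<bar>"]) (auto intro: algebraic_int_times)
qed

end

text \<open>Each coordinate disc is cut into at most (4R/s + 2)^2 squares of side s/2; two points in
  one square differ by less than s/2 in real and in imaginary part, hence by less than s. The labels
  impose a congruence condition at the same time. The lemma serves the finiteness of bounded
  integers, Minkowski's bound and Siegel's lemma.\<close>

lemma box_pigeonhole:
  fixes F :: "'x \<Rightarrow> 'i \<Rightarrow> complex" and R s :: "'i \<Rightarrow> real"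
  assumes I: "finite I" "\<And>i. i \<in> I \<Longrightarrow> s i > 0" "\<And>i. i \<in> I \<Longrightarrow> R i \<ge> 0"
    and X: "finite X" "\<And>x i. x \<in> X \<Longrightarrow> i \<in> I \<Longrightarrow> cmod (F x i) \<le> R i"
    and lab: "finite L" "lab ` X \<subseteq> L"
    and big: "real (card X) > real (card L) * (\<Prod>i\<in>I. (4 * R i / s i + 2)\<^sup>2)"
  shows "\<exists>x\<in>X. \<exists>y\<in>X. x \<noteq> y \<and> lab x = lab y \<and> (\<forall>i\<in>I. cmod (F x i - F y i) < s i)"
proof -
  define cell where "cell i z = (\<lfloor>2 * Re z / s i\<rfloor>, \<lfloor>2 * Im z / s i\<rfloor>)" for i z
  define B where "B i = {- \<lceil>2 * R i / s i\<rceil>..\<lfloor>2 * R i / s i\<rfloor>}" for i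
  define f where "f x = (lab x, \<lambda>i\<in>I. cell i (F x i))" for x
  define Y where "Y = L \<times> (\<Pi>\<^sub>E i\<in>I. B i \<times> B i)"
  have finY: "finite Y" unfolding Y_def using lab I by (auto intro!: finite_PiE simp: B_def)
  have fY: "f ` X \<subseteq> Y"
  proof
    fix w assume "w \<in> f ` X"
    then obtain x where x: "x \<in> X" "w = f x" by blast
    have "cell i (F x i) \<in> B i \<times> B i" if "i \<in> I" for i
    proof -
      have m: "\<lfloor>2 * t / s i\<rfloor> \<in> B i" if "\<bar>t\<bar> \<le> R i" for t
      proof -
        have "2 * t / s i \<le> 2 * R i / s i" "- (2 * R i / s i) \<le> 2 * t / s i"
          using that I(2)[OF \<open>i \<in> I\<close>] by (auto simp: field_simps)
        then have "\<lfloor>2 * t / s i\<rfloor> \<le> \<lfloor>2 * R i / s i\<rfloor>" "\<lfloor>- (2 * R i / s i)\<rfloor> \<le> \<lfloor>2 * t / s i\<rfloor>"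
          by (auto intro: floor_mono)
        then show ?thesis by (simp add: B_def floor_minus)
      qed
      have "cmod (F x i) \<le> R i" using X(2)[OF x(1) that] .
      then show ?thesis unfolding cell_def
        using m abs_Re_le_cmod[of "F x i"] abs_Im_le_cmod[of "F x i"] by auto
    qed
    then show "w \<in> Y" using x lab by (auto simp: f_def Y_def)
  qed
  have "real (card Y) = real (card L) * (\<Prod>i\<in>I. (real (card (B i)))\<^sup>2)"
    unfolding Y_def using I by (simp add: card_cartesian_product card_PiE power2_eq_square)
  also have "\<dots> \<le> real (card L) * (\<Prod>i\<in>I. (4 * R i / s i + 2)\<^sup>2)"
  proof (intro mult_left_mono prod_mono)
    fix i assume i: "i \<in> I"
    have q: "2 * R i / s i \<ge> 0" using I(2,3)[OF i] by simp
    have "real (card (B i)) = of_int (\<lfloor>2 * R i / s i\<rfloor> + \<lceil>2 * R i / s i\<rceil> + 1)"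
      unfolding B_def using q by (simp add: ceiling_mono nat_add_distrib)
    also have "\<dots> \<le> 4 * R i / s i + 2"
      using of_int_floor_le[of "2 * R i / s i"] of_int_ceiling_le_add_one[of "2 * R i / s i"] by (simp only: of_int_add of_int_1)
    finally show "0 \<le> (real (card (B i)))\<^sup>2 \<and> (real (card (B i)))\<^sup>2 \<le> (4 * R i / s i + 2)\<^sup>2"
      by (auto intro: power_mono)
  qed auto
  finally have "card Y < card X" using big by linarith
  then have "\<not> inj_on f X" using card_inj_on_le[OF _ fY finY] by fastforce
  then obtain x y where xy: "x \<in> X" "y \<in> X" "x \<noteq> y" "f x = f y" unfolding inj_on_def by blast
  have "cmod (F x i - F y i) < s i" if i: "i \<in> I" for i
  proof -
    have si: "s i > 0" using I(2)[OF i] .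
    have "cell i (F x i) = cell i (F y i)" using xy(4) i unfolding f_def by (auto dest: fun_cong[of _ _ i])
    moreover have fl: "\<bar>a - b\<bar> < 1" if "\<lfloor>a\<rfloor> = \<lfloor>b\<rfloor>" for a b :: real
      using that floor_correct[of a] floor_correct[of b] by linarith
    ultimately have 1: "\<bar>2 * Re (F x i) / s i - 2 * Re (F y i) / s i\<bar> < 1" "\<bar>2 * Im (F x i) / s i - 2 * Im (F y i) / s i\<bar> < 1"
      unfolding cell_def by auto
    have sc: "\<bar>a - b\<bar> < s i / 2" if "\<bar>2 * a / s i - 2 * b / s i\<bar> < 1" for a b
    proof -
      have "2 * a / s i - 2 * b / s i = (a - b) / (s i / 2)" by (simp add: diff_divide_distrib mult.commute)
      then have "\<bar>(a - b) / (s i / 2)\<bar> < 1" using that by (simp only:)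
      then have "\<bar>a - b\<bar> / (s i / 2) < 1" using si by (simp only: abs_divide)
      then show ?thesis using si by (simp add: divide_less_eq)
    qed
    have "cmod (F x i - F y i) \<le> \<bar>Re (F x i - F y i)\<bar> + \<bar>Im (F x i - F y i)\<bar>" by (rule cmod_le)
    also have "\<dots> < s i" using sc[OF 1(1)] sc[OF 1(2)] by simp
    finally show ?thesis .
  qed
  moreover have "lab x = lab y" using xy(4) by (simp add: f_def)
  ultimately show ?thesis using xy by blast
qed

section \<open>The order \<int>[\<theta>] and indices of ideals\<close>

context nfield
begin

lemma small_algebraic_int_zero:
  assumes "algebraic_int x" "\<And>\<sigma>. \<sigma> \<in> E \<Longrightarrow> cmod (\<sigma> x) < 1"
  shows "x = 0"
proof (rule ccontr)
  assume "x \<noteq> 0"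
  then have "1 \<le> Nm x" using Nm_ge_1 assms(1) by blast
  moreover have "Nm x < 1" unfolding Nm_def
  proof -
    have "(\<Prod>\<sigma>\<in>E. cmod (\<sigma> x)) < (\<Prod>\<sigma>\<in>E. 1)"
      using assms(2) E_card \<open>x \<noteq> 0\<close> by (intro prod_mono_strict) (auto simp: less_imp_le)
    then show "(\<Prod>\<sigma>\<in>E. cmod (\<sigma> x)) < 1" by simp
  qed
  ultimately show False by simp
qed

text \<open>Among too many such integers two would differ by less than 1 at every embedding; their
  difference then has norm below 1, so it is zero.\<close>

lemma finite_bounded_algebraic_int:
  assumes "R \<ge> 0"
  shows "finite {x::'k. algebraic_int x \<and> (\<forall>\<sigma>\<in>E. cmod (\<sigma> x) \<le> R)}" (is "finite ?S")
proof (rule ccontr)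
  assume inf: "infinite ?S"
  obtain N :: nat where N: "real N > real (card {()}) * (\<Prod>\<sigma>\<in>E. (4 * R / 1 + 2)\<^sup>2)"
    using reals_Archimedean2 by blast
  obtain X where X: "finite X" "card X = N" "X \<subseteq> ?S" using infinite_arbitrarily_large[OF inf] by blast
  have "\<exists>x\<in>X. \<exists>y\<in>X. x \<noteq> y \<and> (\<lambda>_. ()) x = (\<lambda>_. ()) y \<and> (\<forall>\<sigma>\<in>E. cmod (\<sigma> x - \<sigma> y) < 1)"
    by (rule box_pigeonhole[where L = "{()}" and R = "\<lambda>_. R"]) (use E_card assms X N in auto)
  then obtain x y where xy: "x \<in> X" "y \<in> X" "x \<noteq> y" "\<forall>\<sigma>\<in>E. cmod (\<sigma> x - \<sigma> y) < 1" by blast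
  have "x - y = 0"
    by (rule small_algebraic_int_zero) (use xy X(3) in \<open>auto intro: algebraic_int_diff\<close>)
  then show False using xy by simp
qed

lemma theta_independent:
  fixes c d :: "nat \<Rightarrow> rat"
  assumes "(\<Sum>i<m. of_rat (c i) * \<theta> ^ i) = (\<Sum>i<m. of_rat (d i) * \<theta> ^ i)" "i < m"
  shows "c i = d i"
proof -
  define p where "p = (\<Sum>i<m. monom (c i - d i) i)"
  have cp: "coeff p j = (if j < m then c j - d j else 0)" for j
    unfolding p_def coeff_sum coeff_monom by (simp add: sum.delta)
  have "rpoly p \<theta> = (\<Sum>i<m. of_rat (c i - d i) * \<theta> ^ i)"
    unfolding p_def by (simp add: of_rat_hom.map_poly_hom_monom poly_monom)
  also have "\<dots> = 0" using assms(1) by (simp add: of_rat_diff left_diff_distrib sum_subtractf)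
  finally have dv: "\<mu> dvd p" by (rule mu(3))
  have "p = 0"
  proof (rule ccontr)
    assume p0: "p \<noteq> 0"
    have "degree p < m" using m_pos p0 cp by (metis leading_coeff_0_iff)
    then show False using dvd_imp_degree_le[OF dv p0] by (simp add: m_def)
  qed
  then show ?thesis using cp[of i] assms(2) by simp
qed

lemma theta_coordinates: "\<exists>c. x = (\<Sum>i<m. of_rat (c i) * \<theta> ^ i)"
proof -
  obtain g where g: "degree g < m" "x = rpoly g \<theta>" using rep_theta by blast
  have "rpoly g \<theta> = (\<Sum>i\<le>degree g. of_rat (coeff g i) * \<theta> ^ i)"
    unfolding poly_altdef by (simp add: degree_map_poly coeff_map_poly)
  also have "\<dots> = (\<Sum>i<m. of_rat (coeff g i) * \<theta> ^ i)"
    using g(1) by (intro sum.mono_neutral_left) (auto simp: coeff_eq_0)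
  finally show ?thesis using g(2) by blast
qed

definition lat :: "(nat \<Rightarrow> int) \<Rightarrow> 'k" where "lat c = (\<Sum>i<m. of_int (c i) * \<theta> ^ i)"

lemma lat_int: "algebraic_int (lat c)"
  unfolding lat_def using theta(2) by (intro algebraic_int_sum algebraic_int_times algebraic_int_power) auto

lemma lat_inj: "lat c = lat d \<Longrightarrow> i < m \<Longrightarrow> c i = d i"
  using theta_independent[of "\<lambda>i. of_int (c i)" "\<lambda>i. of_int (d i)" i] by (simp add: lat_def)

text \<open>Converts a bound on coordinates with respect to powers of \<theta> into a bound on
  conjugates; the sum over \<open>E\<close> makes it the same for all embeddings.\<close>

definition \<Theta> :: real where "\<Theta> = 1 + (\<Sum>\<sigma>\<in>E. \<Sum>i<m. cmod (\<sigma> \<theta>) ^ i)"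

lemma Theta: "\<Theta> \<ge> 1" "\<sigma> \<in> E \<Longrightarrow> (\<Sum>i<m. cmod (\<sigma> \<theta>) ^ i) \<le> \<Theta>"
proof -
  show "\<Theta> \<ge> 1" unfolding \<Theta>_def by (simp add: sum_nonneg)
  assume "\<sigma> \<in> E"
  then have "(\<Sum>i<m. cmod (\<sigma> \<theta>) ^ i) \<le> (\<Sum>\<sigma>\<in>E. \<Sum>i<m. cmod (\<sigma> \<theta>) ^ i)"
    using E_card(1) by (intro member_le_sum[of \<sigma> E "\<lambda>\<sigma>. \<Sum>i<m. cmod (\<sigma> \<theta>) ^ i"]) (auto intro: sum_nonneg)
  then show "(\<Sum>i<m. cmod (\<sigma> \<theta>) ^ i) \<le> \<Theta>" by (simp add: \<Theta>_def)
qed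

lemma coordinates_bound:
  assumes "\<sigma> \<in> E" "\<And>i. i < m \<Longrightarrow> \<bar>c i\<bar> \<le> B"
  shows "cmod (\<sigma> (\<Sum>i<m. of_rat (c i) * \<theta> ^ i)) \<le> of_rat B * \<Theta>"
proof -
  have B0: "B \<ge> 0" using assms(2)[of 0] m_pos by (meson abs_ge_zero order_trans)
  have "cmod (\<sigma> (\<Sum>i<m. of_rat (c i) * \<theta> ^ i)) \<le> (\<Sum>i<m. cmod (of_rat (c i) * \<sigma> \<theta> ^ i))"
    using assms(1) by (simp add: sum_norm_le)
  also have "\<dots> \<le> (\<Sum>i<m. of_rat B * cmod (\<sigma> \<theta>) ^ i)"
  proof (rule sum_mono)
    fix i assume "i \<in> {..<m}"
    then have "(of_rat \<bar>c i\<bar> :: real) \<le> of_rat B" using assms(2) by (simp add: of_rat_less_eq)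
    moreover have "cmod (of_rat (c i)) = of_rat \<bar>c i\<bar>"
    proof -
      have "(of_rat (c i) :: complex) = of_real (of_rat (c i))" 
        by (cases "c i") (simp add: Fract_of_int_quotient of_rat_divide)
      then have "cmod (of_rat (c i)) = \<bar>of_rat (c i)\<bar>" by (simp only: norm_of_real)
      then show ?thesis by (simp add: abs_if of_rat_minus)
    qed
    ultimately show "cmod (of_rat (c i) * \<sigma> \<theta> ^ i) \<le> of_rat B * cmod (\<sigma> \<theta>) ^ i"
      by (simp add: norm_mult norm_power mult_right_mono)
  qed
  also have "\<dots> \<le> of_rat B * \<Theta>"
    using Theta(2)[OF assms(1)] B0 by (simp flip: sum_distrib_left add: mult_left_mono)
  finally show ?thesis .
qed

text \<open>The classes of \<open>\<O>\<close> modulo \<open>\<int>[\<theta>]\<close> have representatives with coordinates in \<open>[0,1)\<close>, and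
  there are only finitely many such algebraic integers.\<close>

lemma finite_reps_lattice:
  obtains T where "finite T" "\<And>t. t \<in> T \<Longrightarrow> algebraic_int t"
    "\<And>x. algebraic_int x \<Longrightarrow> \<exists>t\<in>T. \<exists>c. x = t + lat c"
proof -
  define T where "T = {x::'k. algebraic_int x \<and> (\<forall>\<sigma>\<in>E. cmod (\<sigma> x) \<le> \<Theta>)}"
  have "\<exists>t\<in>T. \<exists>c. x = t + lat c" if x: "algebraic_int x" for x
  proof -
    obtain c where c: "x = (\<Sum>i<m. of_rat (c i) * \<theta> ^ i)" using theta_coordinates by blast
    define t where "t = (\<Sum>i<m. of_rat (frac (c i)) * \<theta> ^ i)"
    have "x = t + lat (\<lambda>i. \<lfloor>c i\<rfloor>)"
      unfolding c t_def lat_def sum.distrib[symmetric]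
    proof (rule sum.cong[OF refl])
      fix i
      have "c i = frac (c i) + of_int \<lfloor>c i\<rfloor>" by (simp add: frac_def)
      then have "(of_rat (c i) :: 'k) = of_rat (frac (c i)) + of_int \<lfloor>c i\<rfloor>" by (metis of_rat_add of_rat_of_int_eq)
      then show "of_rat (c i) * \<theta> ^ i = of_rat (frac (c i)) * \<theta> ^ i + of_int \<lfloor>c i\<rfloor> * \<theta> ^ i"
        by (simp add: distrib_right)
    qed
    moreover from this have "t = x - lat (\<lambda>i. \<lfloor>c i\<rfloor>)" by simp
    then have "algebraic_int t" using x lat_int algebraic_int_diff by metis
    moreover have "cmod (\<sigma> t) \<le> \<Theta>" if "\<sigma> \<in> E" for \<sigma>
      unfolding t_def using coordinates_bound[OF that, of "\<lambda>i. frac (c i)" 1]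
      by (simp add: frac_lt_1 less_imp_le)
    ultimately show ?thesis unfolding T_def by blast
  qed
  moreover have "finite T" unfolding T_def using finite_bounded_algebraic_int[of \<Theta>] Theta(1) by simp
  ultimately show ?thesis using that[of T] unfolding T_def by blast
qed

definition cosets :: "'k set \<Rightarrow> 'k set set" where
  "cosets I = (\<lambda>x. {y. algebraic_int y \<and> y - x \<in> I}) ` {x. algebraic_int x}"

definition pideal :: "'k \<Rightarrow> 'k set" where "pideal x = {x * y | y. algebraic_int y}"

text \<open>Ideals of \<O> as subsets of \<open>'k\<close>; negatives are covered by multiplication
  with -1. \<open>places_ideal\<close> and \<open>places_intro\<close> translate from and to the
  prime ideals of \<open>integer_ring\<close>.\<close>

definition isideal :: "'k set \<Rightarrow> bool" where
  "isideal I \<longleftrightarrow> 0 \<in> I \<and> (\<forall>x\<in>I. algebraic_int x) \<and> (\<forall>x\<in>I. \<forall>y\<in>I. x + y \<in> I) \<and>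
     (\<forall>x\<in>I. \<forall>a. algebraic_int a \<longrightarrow> a * x \<in> I)"

lemma isidealD:
  assumes "isideal I"
  shows "0 \<in> I" "x \<in> I \<Longrightarrow> algebraic_int x" "x \<in> I \<Longrightarrow> y \<in> I \<Longrightarrow> x + y \<in> I" "x \<in> I \<Longrightarrow> y \<in> I \<Longrightarrow> x - y \<in> I"
    "x \<in> I \<Longrightarrow> algebraic_int a \<Longrightarrow> a * x \<in> I" "x \<in> I \<Longrightarrow> algebraic_int a \<Longrightarrow> x * a \<in> I"
proof -
  show "0 \<in> I" "x \<in> I \<Longrightarrow> algebraic_int x" "x \<in> I \<Longrightarrow> y \<in> I \<Longrightarrow> x + y \<in> I" and
   m: "\<And>x a. x \<in> I \<Longrightarrow> algebraic_int a \<Longrightarrow> a * x \<in> I" using assms by (auto simp: isideal_def)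
  show "x \<in> I \<Longrightarrow> algebraic_int a \<Longrightarrow> x * a \<in> I" using m[of x a] by (simp only: mult.commute[of x a])
  show "x \<in> I \<Longrightarrow> y \<in> I \<Longrightarrow> x - y \<in> I" 
    using m[of y "-1"] assms by (auto simp: isideal_def)
qed

lemma pideal_ideal: "algebraic_int x \<Longrightarrow> isideal (pideal x)"
  unfolding isideal_def pideal_def
proof (intro conjI ballI allI impI)
  assume x: "algebraic_int x"
  show "0 \<in> {x * y |y. algebraic_int y}" by (intro CollectI exI[of _ 0]) auto
  fix u assume "u \<in> {x * y |y. algebraic_int y}"
  then obtain y where y: "u = x * y" "algebraic_int y" by blast
  show "algebraic_int u" using x y by (simp add: algebraic_int_times)
  show "a * u \<in> {x * y |y. algebraic_int y}" if "algebraic_int a" for a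
    using y that by (intro CollectI exI[of _ "a * y"]) (auto intro: algebraic_int_times)
  fix v assume "v \<in> {x * y |y. algebraic_int y}"
  then obtain z where z: "v = x * z" "algebraic_int z" by blast
  show "u + v \<in> {x * y |y. algebraic_int y}"
    using y z by (intro CollectI exI[of _ "y + z"]) (auto intro: algebraic_int_plus simp: distrib_left)
qed

lemma coset_eq_iff:
  assumes "isideal I" "algebraic_int x" "algebraic_int x'"
  shows "{y. algebraic_int y \<and> y - x \<in> I} = {y. algebraic_int y \<and> y - x' \<in> I} \<longleftrightarrow> x - x' \<in> I"
proof
  assume "{y. algebraic_int y \<and> y - x \<in> I} = {y. algebraic_int y \<and> y - x' \<in> I}"
  moreover have "x \<in> {y. algebraic_int y \<and> y - x \<in> I}" using assms isidealD(1) by simp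
  ultimately show "x - x' \<in> I" by blast
next
  assume a: "x - x' \<in> I"
  have "y - x \<in> I \<longleftrightarrow> y - x' \<in> I" for y
    using isidealD(3)[OF assms(1) _ a, of "y - x"] isidealD(4)[OF assms(1) _ a, of "y - x'"] by auto
  then show "{y. algebraic_int y \<and> y - x \<in> I} = {y. algebraic_int y \<and> y - x' \<in> I}" by blast
qed

text \<open>A nonzero ideal contains a positive integer \<open>n\<close>, hence \<open>n\<int>[\<theta>]\<close>, which has finite index.\<close>

lemma ideal_contains_nat:
  assumes "isideal I" "x \<in> I" "x \<noteq> 0"
  obtains n :: nat where "n > 0" "of_nat n \<in> I" "real n = Nm x"
proof -
  obtain y n where "algebraic_int y" "x * y = of_nat n" "n > 0" "real n = Nm x"
    using norm_cofactor[OF isidealD(2)[OF assms(1,2)] assms(3)] by metis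
  then show ?thesis using that isidealD(6)[OF assms(1,2)] by metis
qed

text \<open>Representatives modulo n\<int>[\<theta>], which lies inside n\<O>. The point is that
  \<open>q\<close> does not depend on n: a constant factor is removed later by passing to
  powers.\<close>

lemma finite_reps_nat: "\<exists>q. \<forall>n>0. \<exists>T. finite T \<and> card T \<le> q * n ^ m \<and> (\<forall>t\<in>T. algebraic_int t) \<and>
    (\<forall>x. algebraic_int x \<longrightarrow> (\<exists>t\<in>T. \<exists>c. x = t + of_nat n * lat c))"
proof -
  obtain T where T: "finite T" "\<And>t. t \<in> T \<Longrightarrow> algebraic_int t"
    "\<And>x. algebraic_int x \<Longrightarrow> \<exists>t\<in>T. \<exists>c. x = t + lat c" using finite_reps_lattice by metis
  have "\<exists>S. finite S \<and> card S \<le> card T * n ^ m \<and> (\<forall>t\<in>S. algebraic_int t) \<and>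
    (\<forall>x. algebraic_int x \<longrightarrow> (\<exists>t\<in>S. \<exists>c. x = t + of_nat n * lat c))" if n: "n > 0" for n :: nat
  proof -
    define P where "P = (\<Pi>\<^sub>E i\<in>{..<m}. {0..<int n})"
    have cP: "card P = n ^ m" "finite P" unfolding P_def by (simp_all add: card_PiE finite_PiE)
    define S where "S = (\<lambda>(t, c). t + lat c) ` (T \<times> P)"
    have "card S \<le> card T * n ^ m" unfolding S_def using card_image_le[of "T \<times> P" "\<lambda>(t, c). t + lat c"] T(1) cP
      by (simp add: card_cartesian_product)
    moreover have "finite S" unfolding S_def using T(1) cP by auto
    moreover have "\<forall>t\<in>S. algebraic_int t" unfolding S_def using T(2) lat_int by (auto intro: algebraic_int_plus)
    moreover have "\<exists>t\<in>S. \<exists>c. x = t + of_nat n * lat c" if x: "algebraic_int x" for x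
    proof -
      obtain t c where tc: "t \<in> T" "x = t + lat c" using T(3)[OF x] by blast
      define c1 where "c1 = (\<lambda>i\<in>{..<m}. c i mod int n)"
      have "c1 \<in> P" unfolding P_def c1_def using n by auto
      then have "t + lat c1 \<in> S" unfolding S_def using tc(1) by force
      moreover have "lat c = lat c1 + of_nat n * lat (\<lambda>i. c i div int n)"
        unfolding lat_def sum_distrib_left sum.distrib[symmetric]
      proof (rule sum.cong[OF refl])
        fix i assume "i \<in> {..<m}"
        then have "c i = c1 i + int n * (c i div int n)" by (simp add: c1_def)
        then have "(of_int (c i) :: 'k) = of_int (c1 i + int n * (c i div int n))" by (rule arg_cong)
        then have "(of_int (c i) :: 'k) = of_int (c1 i) + of_nat n * of_int (c i div int n)"
          by (simp only: of_int_add of_int_mult of_int_of_nat_eq)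
        then show "of_int (c i) * \<theta> ^ i = of_int (c1 i) * \<theta> ^ i + of_nat n * (of_int (c i div int n) * \<theta> ^ i)"
          by (simp add: algebra_simps)
      qed
      ultimately show ?thesis using tc(2) by (metis add.assoc)
    qed
    ultimately show ?thesis by blast
  qed
  then show ?thesis by blast
qed

lemma finite_index:
  assumes "isideal I" "x \<in> I" "x \<noteq> 0"
  obtains T where "finite T" "\<And>t. t \<in> T \<Longrightarrow> algebraic_int t" "\<And>x. algebraic_int x \<Longrightarrow> \<exists>t\<in>T. x - t \<in> I"
proof -
  obtain n :: nat where n: "n > 0" "of_nat n \<in> I" using ideal_contains_nat[OF assms] by metis
  obtain q where q: "\<forall>n>0. \<exists>T. finite T \<and> card T \<le> q * n ^ m \<and> (\<forall>t\<in>T. algebraic_int t) \<and>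
    (\<forall>x. algebraic_int x \<longrightarrow> (\<exists>t\<in>T. \<exists>c. x = t + of_nat n * lat c))"
    using finite_reps_nat ..
  obtain T where T: "finite T" "card T \<le> q * n ^ m" "\<forall>t\<in>T. algebraic_int t"
    "\<forall>x. algebraic_int x \<longrightarrow> (\<exists>t\<in>T. \<exists>c. x = t + of_nat n * lat c)"
    using q[rule_format, OF n(1)] by (elim exE conjE)
  have nl: "of_nat n * lat c \<in> I" for c using isidealD(6)[OF assms(1) n(2) lat_int] .
  have "\<exists>t\<in>T. x - t \<in> I" if x: "algebraic_int x" for x
  proof -
    obtain t c where "t \<in> T" "x = t + of_nat n * lat c" using T(4) x by blast
    then show ?thesis using nl[of c] by (intro bexI[of _ t]) auto
  qed
  then show ?thesis using that[of T] T by blast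
qed

lemma cosets_finite_reps:
  assumes "isideal I" "finite T" "\<And>x. algebraic_int x \<Longrightarrow> \<exists>t\<in>T. x - t \<in> I" "\<And>t. t \<in> T \<Longrightarrow> algebraic_int t"
  shows "finite (cosets I)" "card (cosets I) \<le> card T"
proof -
  have "cosets I \<subseteq> (\<lambda>x. {y. algebraic_int y \<and> y - x \<in> I}) ` T"
    unfolding cosets_def
  proof clarify
    fix x :: 'k assume x: "algebraic_int x"
    obtain t where t: "t \<in> T" "x - t \<in> I" using assms(3)[OF x] by blast
    then have "{y. algebraic_int y \<and> y - x \<in> I} = {y. algebraic_int y \<and> y - t \<in> I}"
      using coset_eq_iff[OF assms(1) x assms(4)[OF t(1)]] by simp
    then show "{y. algebraic_int y \<and> y - x \<in> I} \<in> (\<lambda>x. {y. algebraic_int y \<and> y - x \<in> I}) ` T" using t(1) by blast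
  qed
  then show "finite (cosets I)" "card (cosets I) \<le> card T"
    using assms(2) by (auto intro: finite_subset surj_card_le)
qed

lemma finite_cosets:
  assumes "isideal I" "x \<in> I" "x \<noteq> 0" shows "finite (cosets I)"
  using finite_index[OF assms] cosets_finite_reps(1)[OF assms(1)] by metis

definition idx :: "'k set \<Rightarrow> nat" where "idx I = card (cosets I)"

lemma idx_nat_bound: "\<exists>q>0. \<forall>n>0. idx (pideal (of_nat n)) \<le> q * n ^ m"
proof -
  obtain q where q: "\<forall>n>0. \<exists>T. finite T \<and> card T \<le> q * n ^ m \<and> (\<forall>t\<in>T. algebraic_int t) \<and>
    (\<forall>x. algebraic_int x \<longrightarrow> (\<exists>t\<in>T. \<exists>c. x = t + of_nat n * lat c))"
    using finite_reps_nat ..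
  have "idx (pideal (of_nat n)) \<le> Suc q * n ^ m" if n: "n > 0" for n
  proof -
    obtain T where T: "finite T" "card T \<le> q * n ^ m" "\<forall>t\<in>T. algebraic_int t"
      "\<forall>x. algebraic_int x \<longrightarrow> (\<exists>t\<in>T. \<exists>c. x = t + of_nat n * lat c)" using q[rule_format, OF n] by (elim exE conjE)
    have "idx (pideal (of_nat n)) \<le> card T"
      unfolding idx_def
    proof (rule cosets_finite_reps(2)[OF pideal_ideal T(1)])
      fix x :: 'k assume "algebraic_int x"
      then obtain t c where tc: "t \<in> T" "x = t + of_nat n * lat c" using T(4) by blast
      have "of_nat n * lat c \<in> pideal (of_nat n)" unfolding pideal_def using lat_int by blast
      then show "\<exists>t\<in>T. x - t \<in> pideal (of_nat n)" using tc by (intro bexI[of _ t]) auto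
    qed (use T(3) algebraic_int_of_int[of "int n"] in auto)
    then show ?thesis using T(2) by simp
  qed
  then show ?thesis by blast
qed

text \<open>Minkowski's argument for \<open>\<O> \<oplus> i\<O>\<close>: passing to pairs makes all embeddings complex, so that
  no distinction of real and complex places is needed.\<close>

lemma idx_pideal_lower: "\<exists>c>0. \<forall>x. algebraic_int x \<longrightarrow> x \<noteq> 0 \<longrightarrow> c * Nm x \<le> real (idx (pideal x))"
proof -
  \<comment> \<open>Each factor of the box count below is at most (16 \<Theta> H / |\<sigma> x|)^2,
    against H^(2m) pairs of lattice vectors; this leaves the constant 1 / (16 \<Theta>)^m.\<close>
  define c where "c = 1 / (16 * \<Theta>) ^ m"
  have c: "c > 0" unfolding c_def using Theta(1) by simp
  have "c * Nm x \<le> real (idx (pideal x))" if x: "algebraic_int x" "x \<noteq> 0" for x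
  proof (rule ccontr)
    assume "\<not> ?thesis"
    then have lt: "real (idx (pideal x)) < c * Nm x" by simp
    have idl: "isideal (pideal x)" by (rule pideal_ideal[OF x(1)])
    have xin: "x \<in> pideal x" unfolding pideal_def by (intro CollectI exI[of _ 1]) auto
    have fin: "finite (cosets (pideal x))" by (rule finite_cosets[OF idl xin x(2)])
    have spos: "cmod (\<sigma> x) > 0" if "\<sigma> \<in> E" for \<sigma> using x(2) that by simp
    \<comment> \<open>\<open>H\<close> dominates all |\<sigma> x|, so that the summand 2 in the box
      count is absorbed by the main term.\<close>
    obtain H :: nat where H: "H > 0" "\<And>\<sigma>. \<sigma> \<in> E \<Longrightarrow> cmod (\<sigma> x) \<le> real H"
    proof -
      obtain H :: nat where "1 + (\<Sum>\<sigma>\<in>E. cmod (\<sigma> x)) \<le> real H" using real_arch_simple by blast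
      moreover have "cmod (\<sigma> x) \<le> (\<Sum>\<sigma>\<in>E. cmod (\<sigma> x))" if "\<sigma> \<in> E" for \<sigma>
        using that E_card(1) by (intro member_le_sum) auto
      moreover have "(\<Sum>\<sigma>\<in>E. cmod (\<sigma> x)) \<ge> 0" by (simp add: sum_nonneg)
      ultimately have "real H > 0" "\<And>\<sigma>. \<sigma> \<in> E \<Longrightarrow> cmod (\<sigma> x) \<le> real H" by fastforce+
      then show ?thesis using that[of H] by simp
    qed
    define P where "P = (\<Pi>\<^sub>E i\<in>{..<m}. {0..<int H})"
    have cP: "card P = H ^ m" "finite P" unfolding P_def by (simp_all add: card_PiE finite_PiE)
    define lab where "lab cd = ({y. algebraic_int y \<and> y - lat (fst cd) \<in> pideal x}, {y. algebraic_int y \<and> y - lat (snd cd) \<in> pideal x})" for cd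
    define F where "F cd \<sigma> = \<sigma> (lat (fst cd)) + \<i> * \<sigma> (lat (snd cd))" for cd and \<sigma> :: "'k \<Rightarrow> complex"
    have lb: "cmod (\<sigma> (lat c)) \<le> real H * \<Theta>" if "c \<in> P" "\<sigma> \<in> E" for c \<sigma>
    proof -
      have "\<bar>rat_of_int (c i)\<bar> \<le> of_nat H" if i: "i < m" for i
      proof -
        have "0 \<le> c i" "c i < int H" using \<open>c \<in> P\<close> i unfolding P_def by (auto simp: PiE_def Pi_def)
        then have "\<bar>c i\<bar> \<le> int H" by simp
        then have "rat_of_int \<bar>c i\<bar> \<le> rat_of_int (int H)" by (simp only: of_int_le_iff)
        then show ?thesis by simp
      qed
      then show ?thesis using coordinates_bound[OF that(2), of "\<lambda>i. of_int (c i)" "of_nat H"] by (simp add: lat_def)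
    qed
    have "\<exists>cd\<in>P \<times> P. \<exists>cd'\<in>P \<times> P. cd \<noteq> cd' \<and> lab cd = lab cd' \<and> (\<forall>\<sigma>\<in>E. cmod (F cd \<sigma> - F cd' \<sigma>) < cmod (\<sigma> x))"
    proof (rule box_pigeonhole[where R = "\<lambda>_. 2 * (real H * \<Theta>)" and L = "cosets (pideal x) \<times> cosets (pideal x)"])
      show "lab ` (P \<times> P) \<subseteq> cosets (pideal x) \<times> cosets (pideal x)"
        unfolding lab_def cosets_def using lat_int by auto
      show "cmod (F cd \<sigma>) \<le> 2 * (real H * \<Theta>)" if "cd \<in> P \<times> P" "\<sigma> \<in> E" for cd \<sigma>
        using norm_triangle_ineq[of "\<sigma> (lat (fst cd))" "\<i> * \<sigma> (lat (snd cd))"] lb[of "fst cd" \<sigma>] lb[of "snd cd" \<sigma>] that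
        by (auto simp: F_def norm_mult)
      have "(\<Prod>\<sigma>\<in>E. (4 * (2 * (real H * \<Theta>)) / cmod (\<sigma> x) + 2)\<^sup>2) \<le> (\<Prod>\<sigma>\<in>E. (16 * \<Theta> * real H / cmod (\<sigma> x))\<^sup>2)"
      proof (intro prod_mono conjI power_mono)
        fix \<sigma> assume s: "\<sigma> \<in> E"
        have "real H * 1 \<le> real H * \<Theta>" using Theta(1) by (intro mult_left_mono) auto
        then have "2 * cmod (\<sigma> x) \<le> 8 * (real H * \<Theta>)" using H(2)[OF s] spos[OF s] by linarith
        then have "2 \<le> 8 * (real H * \<Theta>) / cmod (\<sigma> x)" using spos[OF s] by (simp add: le_divide_eq)
        moreover have "4 * (2 * (real H * \<Theta>)) / cmod (\<sigma> x) = 8 * (real H * \<Theta>) / cmod (\<sigma> x)"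
          "16 * \<Theta> * real H / cmod (\<sigma> x) = 2 * (8 * (real H * \<Theta>) / cmod (\<sigma> x))" by simp_all
        ultimately show "4 * (2 * (real H * \<Theta>)) / cmod (\<sigma> x) + 2 \<le> 16 * \<Theta> * real H / cmod (\<sigma> x)"
          by linarith
        show "0 \<le> 4 * (2 * (real H * \<Theta>)) / cmod (\<sigma> x) + 2" using Theta(1) by simp
      qed auto
      also have "\<dots> = ((16 * \<Theta> * real H) ^ m / Nm x)\<^sup>2"
        unfolding Nm_def by (simp add: prod_power_distrib[symmetric] prod_dividef E_card)
      finally have "real (idx (pideal x) ^ 2) * (\<Prod>\<sigma>\<in>E. (4 * (2 * (real H * \<Theta>)) / cmod (\<sigma> x) + 2)\<^sup>2)
          \<le> real (idx (pideal x) ^ 2) * ((16 * \<Theta> * real H) ^ m / Nm x)\<^sup>2" by (intro mult_left_mono) auto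
      also have "\<dots> = (real (idx (pideal x)) * ((16 * \<Theta> * real H) ^ m / Nm x))\<^sup>2" by (simp only: power_mult_distrib of_nat_power)
      also have "\<dots> < (c * Nm x * ((16 * \<Theta> * real H) ^ m / Nm x))\<^sup>2"
        using lt H(1) Theta(1) Nm_pos[OF x(2)] by (intro power_strict_mono mult_strict_right_mono) auto
      also have "\<dots> = (real H ^ m)\<^sup>2"
        using Nm_pos[OF x(2)] Theta(1) by (simp add: c_def power_mult_distrib)
      also have "\<dots> = real (card (P \<times> P))" using cP by (simp add: card_cartesian_product power2_eq_square)
      finally show "real (card (cosets (pideal x) \<times> cosets (pideal x))) * (\<Prod>\<sigma>\<in>E. (4 * (2 * (real H * \<Theta>)) / cmod (\<sigma> x) + 2)\<^sup>2)
        < real (card (P \<times> P))" by (simp add: idx_def card_cartesian_product power2_eq_square)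
    qed (use E_card cP fin spos Theta(1) in auto)
    then obtain cd cd' where cd: "cd \<in> P \<times> P" "cd' \<in> P \<times> P" "cd \<noteq> cd'" "lab cd = lab cd'"
      "\<And>\<sigma>. \<sigma> \<in> E \<Longrightarrow> cmod (F cd \<sigma> - F cd' \<sigma>) < cmod (\<sigma> x)" by blast
    have "lat (fst cd) - lat (fst cd') \<in> pideal x" "lat (snd cd) - lat (snd cd') \<in> pideal x"
      using cd(4) coset_eq_iff[OF idl lat_int lat_int] unfolding lab_def by auto
    then obtain u v where uv: "lat (fst cd) - lat (fst cd') = x * u" "algebraic_int u"
      "lat (snd cd) - lat (snd cd') = x * v" "algebraic_int v" unfolding pideal_def by blast
    have sm: "cmod (\<sigma> u + \<i> * \<sigma> v) < 1" if s: "\<sigma> \<in> E" for \<sigma>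
    proof -
      have "F cd \<sigma> - F cd' \<sigma> = \<sigma> (lat (fst cd) - lat (fst cd')) + \<i> * \<sigma> (lat (snd cd) - lat (snd cd'))"
        using s by (simp add: F_def algebra_simps)
      also have "\<dots> = \<sigma> x * (\<sigma> u + \<i> * \<sigma> v)" using s by (simp add: uv algebra_simps)
      finally have "cmod (\<sigma> x) * cmod (\<sigma> u + \<i> * \<sigma> v) < cmod (\<sigma> x) * 1" using cd(5)[OF s] by (simp add: norm_mult)
      then show ?thesis using spos[OF s] by (simp only: mult_less_cancel_left_pos)
    qed
    \<comment> \<open>\<open>E\<close> is closed under complex conjugation, so the bound for
      \<sigma> u + \<i> \<sigma> v also holds with a minus sign; sum and difference then bound u and
      v separately.\<close>
    have sm': "cmod (\<sigma> u - \<i> * \<sigma> v) < 1" if s: "\<sigma> \<in> E" for \<sigma>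
    proof -
      have "cmod (cnj (\<sigma> u) + \<i> * cnj (\<sigma> v)) < 1" using sm[OF E_cnj[OF s]] .
      moreover have "cnj (\<sigma> u) + \<i> * cnj (\<sigma> v) = cnj (\<sigma> u - \<i> * \<sigma> v)" by simp
      ultimately show ?thesis by (simp only: complex_mod_cnj)
    qed
    have "cmod (\<sigma> u) < 1 \<and> cmod (\<sigma> v) < 1" if s: "\<sigma> \<in> E" for \<sigma>
    proof -
      have "2 * cmod (\<sigma> u) = cmod ((\<sigma> u + \<i> * \<sigma> v) + (\<sigma> u - \<i> * \<sigma> v))" by (simp flip: mult_2 add: norm_mult)
      also have "\<dots> < 2" using norm_triangle_ineq[of "\<sigma> u + \<i> * \<sigma> v" "\<sigma> u - \<i> * \<sigma> v"] sm[OF s] sm'[OF s] by linarith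
      finally have 1: "cmod (\<sigma> u) < 1" by simp
      have "2 * cmod (\<sigma> v) = cmod ((\<sigma> u + \<i> * \<sigma> v) - (\<sigma> u - \<i> * \<sigma> v))" by (simp flip: mult_2 add: norm_mult)
      also have "\<dots> < 2" using norm_triangle_ineq4[of "\<sigma> u + \<i> * \<sigma> v" "\<sigma> u - \<i> * \<sigma> v"] sm[OF s] sm'[OF s] by linarith
      finally show ?thesis using 1 by simp
    qed
    then have "u = 0" "v = 0" using small_algebraic_int_zero uv(2,4) by blast+
    then have e: "lat (fst cd) = lat (fst cd')" "lat (snd cd) = lat (snd cd')" using uv by auto
    have P: "fst cd \<in> P" "fst cd' \<in> P" "snd cd \<in> P" "snd cd' \<in> P" using cd(1,2) by auto
    have "fst cd = fst cd'"
      by (rule PiE_ext[OF P(1,2)[unfolded P_def]]) (use lat_inj[OF e(1)] in auto)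
    moreover have "snd cd = snd cd'"
      by (rule PiE_ext[OF P(3,4)[unfolded P_def]]) (use lat_inj[OF e(2)] in auto)
    ultimately show False using cd(3) by (simp add: prod_eq_iff)
  qed
  then show ?thesis using c by blast
qed

end

section \<open>Places, powers of prime ideals and uniformizers\<close>

lemma integer_ring_simps [simp]:
  "carrier integer_ring = {x. algebraic_int x}" "x \<otimes>\<^bsub>integer_ring\<^esub> y = x * y" "\<one>\<^bsub>integer_ring\<^esub> = 1"
  "\<zero>\<^bsub>integer_ring\<^esub> = 0" "x \<oplus>\<^bsub>integer_ring\<^esub> y = x + y"
  by (simp_all add: integer_ring_def)

lemma integer_ring_cring: "cring (integer_ring :: 'k::field_char_0 ring)"
proof (rule cringI)
  show "abelian_group (integer_ring :: 'k ring)"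
  proof (rule abelian_groupI)
    fix x :: 'k assume "x \<in> carrier integer_ring"
    then show "\<exists>y\<in>carrier integer_ring. y \<oplus>\<^bsub>integer_ring\<^esub> x = \<zero>\<^bsub>integer_ring\<^esub>"
      by (intro bexI[of _ "- x"]) auto
  qed (auto intro: algebraic_int_plus simp: add.assoc add.commute)
  show "comm_monoid (integer_ring :: 'k ring)"
    by (rule comm_monoidI) (auto intro: algebraic_int_times simp: mult.assoc mult.commute)
qed (auto simp: distrib_right)

context nfield
begin

lemma places_ideal:
  assumes "P \<in> (finite_places :: 'k set set)"
  shows "isideal P" "1 \<notin> P" "\<exists>x\<in>P. x \<noteq> 0"
    "algebraic_int a \<Longrightarrow> algebraic_int b \<Longrightarrow> a * b \<in> P \<Longrightarrow> a \<in> P \<or> b \<in> P"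
proof -
  have pr: "primeideal P integer_ring" using assms by (simp add: finite_places_def)
  then interpret primeideal P integer_ring .
  note as = ideal.axioms(1)[OF primeideal.axioms(1)[OF pr]]
  have sub: "x \<in> P \<Longrightarrow> algebraic_int x" for x using a_subset by auto
  show idl: "isideal P" unfolding isideal_def
    using sub additive_subgroup.zero_closed[OF as] additive_subgroup.a_closed[OF as] I_l_closed by auto
  show "1 \<notin> P"
  proof
    assume "1 \<in> P"
    then have "carrier integer_ring = P" using isidealD(6)[OF idl \<open>1 \<in> P\<close>] sub by auto
    then show False using I_notcarr by blast
  qed
  show "\<exists>x\<in>P. x \<noteq> 0" using assms isidealD(1)[OF idl] by (auto simp: finite_places_def)
  show "algebraic_int a \<Longrightarrow> algebraic_int b \<Longrightarrow> a * b \<in> P \<Longrightarrow> a \<in> P \<or> b \<in> P"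
    using I_prime[of a b] by simp
qed

lemma places_intro:
  assumes "isideal P" "1 \<notin> P" "x \<in> P" "x \<noteq> 0"
    "\<And>a b. algebraic_int a \<Longrightarrow> algebraic_int b \<Longrightarrow> a * b \<in> P \<Longrightarrow> a \<in> P \<or> b \<in> P"
  shows "P \<in> (finite_places :: 'k set set)"
proof -
  interpret cring "integer_ring :: 'k ring" by (rule integer_ring_cring)
  have "ideal P integer_ring"
  proof (rule idealI[OF ring_axioms])
    have inv: "inv\<^bsub>add_monoid integer_ring\<^esub> x = - x" if "algebraic_int x" for x :: 'k
      using that add.inv_equality[of "- x" x] by (simp add: a_inv_def)
    have invP: "inv\<^bsub>add_monoid integer_ring\<^esub> a \<in> P" if "a \<in> P" for a
      using isidealD(4)[OF assms(1) isidealD(1)[OF assms(1)] that] inv isidealD(2)[OF assms(1) that] by simp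
    show "subgroup P (add_monoid integer_ring)"
      by (rule add.subgroupI) (use isidealD(2,3)[OF assms(1)] assms(3) invP[folded a_inv_def] in auto)
  qed (use isidealD(5,6)[OF assms(1)] in auto)
  then have "primeideal P integer_ring"
    by (rule primeidealI[OF _ integer_ring_cring]) (use assms in auto)
  then show ?thesis unfolding finite_places_def using assms(3,4) by auto
qed

lemma ideal_norm_idx:
  assumes "P \<in> (finite_places :: 'k set set)" shows "ideal_norm P = idx P"
proof -
  have idl: "isideal P" by (rule places_ideal(1)[OF assms])
  have "P +>\<^bsub>integer_ring\<^esub> a = {y. algebraic_int y \<and> y - a \<in> P}" if a: "algebraic_int a" for a
  proof -
    have "P +>\<^bsub>integer_ring\<^esub> a = {h + a | h. h \<in> P}"
      by (auto simp: a_r_coset_def r_coset_def)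
    also have "\<dots> = {y. algebraic_int y \<and> y - a \<in> P}"
    proof safe
      fix h assume "h \<in> P" then show "algebraic_int (h + a)" using a isidealD(2)[OF idl] algebraic_int_plus by blast
    next
      fix y assume "y - a \<in> P" then show "\<exists>h. y = h + a \<and> h \<in> P" by (intro exI[of _ "y - a"]) auto
    qed auto
    finally show ?thesis .
  qed
  then have "carrier (integer_ring Quot P) = cosets P"
    unfolding FactRing_def cosets_def A_RCOSETS_def RCOSETS_def a_r_coset_def by (auto simp: image_def)
  then show ?thesis by (simp add: ideal_norm_def idx_def)
qed

text \<open>Powers of \<open>P\<close> with the recursion of the monoid power, the new factor on the
  right, so that \<open>Pw_eq\<close> holds by unfolding. The zeroth power is \<O>, the unit for
  multiplication of ideals.\<close>

fun Pw :: "'k set \<Rightarrow> nat \<Rightarrow> 'k set" where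
  "Pw P 0 = {x. algebraic_int x}"
| "Pw P (Suc e) = ideal_prod integer_ring (Pw P e) P"

lemma Pw_eq: "P [^]\<^bsub>ideals_set integer_ring\<^esub> e = Pw P e"
  by (induction e) (simp_all add: nat_pow_def ideals_set_def)

declare Pw.simps(2) [simp del]

lemma Pw_props:
  assumes "isideal P"
  shows Pw_ideal: "isideal (Pw P e)" and Pw_Suc_subset: "Pw P (Suc e) \<subseteq> Pw P e"
proof -
  have "isideal (Pw P e) \<and> isideal (Pw P (Suc e)) \<and> Pw P (Suc e) \<subseteq> Pw P e" for e
  proof (induction e)
    have step: "isideal (ideal_prod integer_ring I P)" "ideal_prod integer_ring I P \<subseteq> I" if I: "isideal I" for I
    proof -
      have sub: "x \<in> I" if "x \<in> ideal_prod integer_ring I P" for x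
        using that by (induction rule: ideal_prod.induct)
          (use isidealD(2)[OF assms] isidealD(3,6)[OF I] in auto)
      then show "ideal_prod integer_ring I P \<subseteq> I" by blast
      have "a * x \<in> ideal_prod integer_ring I P" if "x \<in> ideal_prod integer_ring I P" "algebraic_int a" for x a
        using that(1)
      proof (induction rule: ideal_prod.induct)
        case (prod i j)
        then have "(a * i) \<otimes>\<^bsub>integer_ring\<^esub> j \<in> ideal_prod integer_ring I P"
          using isidealD(5)[OF I prod(1) that(2)] by (intro ideal_prod.prod)
        then show ?case by (simp add: mult.assoc)
      next
        case (sum s1 s2)
        then have "(a * s1) \<oplus>\<^bsub>integer_ring\<^esub> (a * s2) \<in> ideal_prod integer_ring I P"
          by (intro ideal_prod.sum) auto
        then show ?case by (simp add: distrib_left)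
      qed
      moreover have "0 \<in> ideal_prod integer_ring I P"
        using ideal_prod.prod[OF isidealD(1)[OF I] isidealD(1)[OF assms], of integer_ring] by simp
      moreover have "x + y \<in> ideal_prod integer_ring I P"
        if "x \<in> ideal_prod integer_ring I P" "y \<in> ideal_prod integer_ring I P" for x y
        using ideal_prod.sum[OF that] by simp
      ultimately show "isideal (ideal_prod integer_ring I P)"
        using sub isidealD(2)[OF I] unfolding isideal_def by blast
    qed
    case 0
    have "isideal (Pw P 0)" unfolding isideal_def by (auto intro: algebraic_int_plus algebraic_int_times)
    then show ?case using step[of "Pw P 0"] by (auto simp: Pw.simps(2)[of _ 0])
    case (Suc e)
    then show ?case using step[of "Pw P (Suc e)"] by (auto simp: Pw.simps(2)[of _ "Suc e"])
  qed
  then show "isideal (Pw P e)" "Pw P (Suc e) \<subseteq> Pw P e" by auto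
qed

lemma Pw_antimono: "isideal P \<Longrightarrow> e \<le> f \<Longrightarrow> Pw P f \<subseteq> Pw P e"
  using Pw_Suc_subset lift_Suc_antimono_le[of "Pw P"] by blast

lemma Pw_1: assumes "isideal P" shows "Pw P 1 = P"
proof
  show "Pw P 1 \<subseteq> P"
  proof
    fix x assume "x \<in> Pw P 1"
    then have "x \<in> ideal_prod integer_ring {x. algebraic_int x} P" by (simp add: Pw.simps(2))
    then show "x \<in> P" by (induction rule: ideal_prod.induct) (use isidealD(3,5)[OF assms] in auto)
  qed
  show "P \<subseteq> Pw P 1"
  proof
    fix x assume "x \<in> P"
    then show "x \<in> Pw P 1" using ideal_prod.prod[of 1 "{x. algebraic_int x}" x P integer_ring] by (simp add: Pw.simps(2))
  qed
qed

lemma Pw_mult: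
  assumes "isideal P" "a \<in> Pw P e" "b \<in> Pw P f"
  shows "a * b \<in> Pw P (e + f)"
  using assms(3)
proof (induction f arbitrary: b)
  case 0 then show ?case using isidealD(6)[OF Pw_ideal[OF assms(1)] assms(2)] by simp
next
  case (Suc f)
  have "b \<in> ideal_prod integer_ring (Pw P f) P" using Suc.prems by (simp add: Pw.simps(2))
  then show ?case
  proof (induction rule: ideal_prod.induct)
    case (prod i j)
    then have "(a * i) \<otimes>\<^bsub>integer_ring\<^esub> j \<in> ideal_prod integer_ring (Pw P (e + f)) P"
      using Suc.IH by (intro ideal_prod.prod) auto
    then show ?case by (simp add: mult.assoc Pw.simps(2))
  next
    case (sum s1 s2)
    then show ?case using isidealD(3)[OF Pw_ideal[OF assms(1), of "e + Suc f"]] by (simp add: distrib_left)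
  qed
qed

lemma Pw_power: "isideal P \<Longrightarrow> a \<in> P \<Longrightarrow> a ^ e \<in> Pw P e"
proof (induction e)
  case (Suc e)
  then have "a ^ e * a \<in> Pw P (e + 1)" using Pw_mult[of P "a ^ e" e a 1] Pw_1[of P] by auto
  then show ?case by (simp add: mult.commute)
qed simp

text \<open>Powers of \<open>s\<close> repeat modulo an ideal of finite index. This stands in for
  the structure theory of finite rings: it provides inverses modulo primes and a cancellation
  argument in \<open>places_annihilator\<close>.\<close>

lemma pigeonhole_powers:
  assumes "isideal I" "x \<in> I" "x \<noteq> 0" "algebraic_int s"
  obtains i d where "d > 0" "s ^ i * (1 - s ^ d) \<in> I"
proof -
  have fin: "finite (cosets I)" by (rule finite_cosets[OF assms(1-3)])
  define q where "q i = {y. algebraic_int y \<and> y - s ^ i \<in> I}" for i :: nat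
  have ai: "algebraic_int (s ^ i)" for i using assms(4) by (rule algebraic_int_power)
  have "range q \<subseteq> cosets I" unfolding q_def cosets_def using ai by blast
  then have "\<not> inj q" using fin finite_subset range_inj_infinite by metis
  then obtain i j where ij: "i < j" "q i = q j" unfolding inj_def by (metis linorder_neqE_nat)
  then have "s ^ i - s ^ j \<in> I" using coset_eq_iff[OF assms(1) ai ai] unfolding q_def by blast
  moreover have "s ^ i - s ^ j = s ^ i * (1 - s ^ (j - i))" using ij(1) by (simp add: right_diff_distrib flip: power_add)
  ultimately show ?thesis using that[of "j - i" i] ij(1) by simp
qed

lemma places_power:
  assumes "P \<in> (finite_places :: 'k set set)" "algebraic_int a" "a ^ k \<in> P" shows "a \<in> P"
  using assms(3)
proof (induction k)
  case 0 then show ?case using places_ideal(2)[OF assms(1)] by simp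
next
  case (Suc k) then show ?case using places_ideal(4)[OF assms(1,2) algebraic_int_power[OF assms(2)]] by auto
qed

text \<open>A finite domain is a field; the inverse is s^(d-1), where s^d is congruent to 1.\<close>

lemma places_inverse:
  assumes P: "P \<in> (finite_places :: 'k set set)" and s: "algebraic_int s" "s \<notin> P"
  obtains u where "algebraic_int u" "1 - u * s \<in> P"
proof -
  obtain x where x: "x \<in> P" "x \<noteq> 0" using places_ideal(3)[OF P] by blast
  obtain i d where id: "d > 0" "s ^ i * (1 - s ^ d) \<in> P"
    using pigeonhole_powers[OF places_ideal(1)[OF P] x s(1)] by metis
  have "s ^ i \<notin> P" using places_power[OF P s(1)] s(2) by blast
  then have "1 - s ^ d \<in> P"
    using places_ideal(4)[OF P algebraic_int_power[OF s(1)] _ id(2)] s(1) by (auto intro: algebraic_int_diff algebraic_int_power)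
  then show ?thesis using that[of "s ^ (d - 1)"] id(1) s(1)
    by (auto simp: algebraic_int_power simp flip: power_Suc2)
qed

text \<open>\<open>P\<close> is an associated prime of \<O>/(\<alpha>). Among the \<beta> whose
  annihilator modulo (\<alpha>) lies in \<open>P\<close>, one with the largest annihilator is taken;
  maximality forces all of \<open>P\<close> to annihilate it. The quotient \<beta>/\<alpha> then
  carries \<open>P\<close> into \<O> without being integral.\<close>

lemma places_annihilator:
  assumes P: "P \<in> (finite_places :: 'k set set)" and \<alpha>: "\<alpha> \<in> P" "\<alpha> \<noteq> 0"
  obtains \<beta> where "algebraic_int \<beta>" "\<beta> \<notin> pideal \<alpha>" "\<And>p. p \<in> P \<Longrightarrow> p * \<beta> \<in> pideal \<alpha>"
proof -
  note idl = places_ideal(1)[OF P]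
  have a: "algebraic_int \<alpha>" using isidealD(2)[OF idl \<alpha>(1)] .
  note pid = pideal_ideal[OF a]
  have apid: "\<alpha> \<in> pideal \<alpha>" unfolding pideal_def by (intro CollectI exI[of _ 1]) auto
  obtain T where T: "finite T" "\<And>t. t \<in> T \<Longrightarrow> algebraic_int t" "\<And>x. algebraic_int x \<Longrightarrow> \<exists>t\<in>T. x - t \<in> pideal \<alpha>"
    using finite_index[OF pid apid \<alpha>(2)] by metis
  define ann where "ann \<beta> = {y. algebraic_int y \<and> y * \<beta> \<in> pideal \<alpha>}" for \<beta>
  \<comment> \<open>Annihilators contain (\<alpha>), so they can be compared through the finitely
    many representatives in \<open>T\<close>.\<close>
  define A where "A \<beta> = {t\<in>T. t * \<beta> \<in> pideal \<alpha>}" for \<beta>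
  have finA: "finite (A \<beta>)" "card (A \<beta>) \<le> card T" for \<beta> unfolding A_def using T(1) by (auto intro: card_mono)
  define good where "good \<beta> \<longleftrightarrow> algebraic_int \<beta> \<and> ann \<beta> \<subseteq> P" for \<beta>
  have ann_rep: "t * \<beta> \<in> pideal \<alpha> \<longleftrightarrow> y * \<beta> \<in> pideal \<alpha>" if "y - t \<in> pideal \<alpha>" "algebraic_int \<beta>" for y t \<beta>
  proof -
    have "(y - t) * \<beta> \<in> pideal \<alpha>" using isidealD(6)[OF pid that] .
    then show ?thesis
      using isidealD(3)[OF pid, of "t * \<beta>" "(y - t) * \<beta>"] isidealD(4)[OF pid, of "y * \<beta>" "(y - t) * \<beta>"] by (auto simp: algebra_simps)
  qed
  have "good 1" unfolding good_def ann_def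
  proof (intro conjI subsetI)
    fix y assume "y \<in> {y. algebraic_int y \<and> y * 1 \<in> pideal \<alpha>}"
    then obtain z where "y = \<alpha> * z" "algebraic_int z" unfolding pideal_def by auto
    then show "y \<in> P" using isidealD(6)[OF idl \<alpha>(1)] by simp
  qed simp
  then have "\<exists>\<beta>. good \<beta> \<and> (\<forall>\<beta>'. good \<beta>' \<longrightarrow> card (A \<beta>') \<le> card (A \<beta>))"
    using ex_has_greatest_nat[of good 1 "\<lambda>\<beta>. card (A \<beta>)" "Suc (card T)"] finA(2) by (simp add: less_Suc_eq_le)
  then obtain \<beta> where b: "good \<beta>" "\<And>\<beta>'. good \<beta>' \<Longrightarrow> card (A \<beta>') \<le> card (A \<beta>)" by blast
  have bi: "algebraic_int \<beta>" and bP: "ann \<beta> \<subseteq> P" using b(1) by (auto simp: good_def)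
  have AA: "A \<beta> \<subseteq> A (s * \<beta>)" if "algebraic_int s" for s
    unfolding A_def using isidealD(5)[OF pid _ that] by (auto simp: mult.left_commute[of _ s])
  have "p * \<beta> \<in> pideal \<alpha>" if p: "p \<in> P" for p
  proof (rule ccontr)
    assume np: "p * \<beta> \<notin> pideal \<alpha>"
    have pi: "algebraic_int p" using isidealD(2)[OF idl p] .
    show False
    proof (cases "\<exists>s. algebraic_int s \<and> s \<notin> P \<and> s * (p * \<beta>) \<in> pideal \<alpha>")
      case True
      then obtain s where s: "algebraic_int s" "s \<notin> P" "s * (p * \<beta>) \<in> pideal \<alpha>" by blast
      have "good (s * \<beta>)" unfolding good_def
      proof (intro conjI subsetI)
        show "algebraic_int (s * \<beta>)" using s bi by (simp add: algebraic_int_times)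
        fix y assume "y \<in> ann (s * \<beta>)"
        then have y: "algebraic_int y" "(y * s) * \<beta> \<in> pideal \<alpha>" unfolding ann_def by (auto simp: mult.assoc)
        then have "y * s \<in> P" using bP s(1) unfolding ann_def by (auto intro: algebraic_int_times)
        then show "y \<in> P" using places_ideal(4)[OF P y(1) s(1)] s(2) by blast
      qed
      then have "card (A (s * \<beta>)) \<le> card (A \<beta>)" by (rule b(2))
      then have eq: "A \<beta> = A (s * \<beta>)" using AA[OF s(1)] finA(1) card_seteq by blast
      \<comment> \<open>That s p \<beta> lies in (\<alpha>) says that p annihilates s \<beta>; as
        the two annihilators agree, p annihilates \<beta> as well.\<close>
      obtain t where t: "t \<in> T" "p - t \<in> pideal \<alpha>" using T(3)[OF pi] by blast
      have "t * (s * \<beta>) \<in> pideal \<alpha>"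
        using ann_rep[OF t(2), of "s * \<beta>"] s bi by (auto simp: algebraic_int_times mult.left_commute)
      then have "t \<in> A \<beta>" using t(1) eq by (simp add: A_def)
      then have "p * \<beta> \<in> pideal \<alpha>" using ann_rep[OF t(2) bi] by (simp add: A_def)
      then show False using np by blast
    next
      case False
      then have "good (p * \<beta>)" unfolding good_def ann_def using pi bi by (auto intro: algebraic_int_times)
      then have "card (A (p * \<beta>)) \<le> card (A \<beta>)" by (rule b(2))
      then have eq: "A \<beta> = A (p * \<beta>)" using AA[OF pi] finA(1) card_seteq by blast
      \<comment> \<open>Equal annihilators of p \<beta> and \<beta> allow p to be cancelled.
        Cancelling it i times from p^i (1 - p^d) \<beta> puts 1 - p^d, hence 1, into
        \<open>P\<close>.\<close>
      have canc: "y * \<beta> \<in> pideal \<alpha>" if y: "algebraic_int y" "y * p * \<beta> \<in> pideal \<alpha>" for y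
      proof -
        obtain t where t: "t \<in> T" "y - t \<in> pideal \<alpha>" using T(3)[OF y(1)] by blast
        have "t * (p * \<beta>) \<in> pideal \<alpha>"
          using ann_rep[OF t(2), of "p * \<beta>"] y(2) pi bi by (auto simp: algebraic_int_times mult.assoc)
        then have "t \<in> A \<beta>" using t(1) eq by (simp add: A_def)
        then show ?thesis using ann_rep[OF t(2) bi] by (simp add: A_def)
      qed
      obtain i d where id: "d > 0" "p ^ i * (1 - p ^ d) \<in> pideal \<alpha>"
        using pigeonhole_powers[OF pid apid \<alpha>(2) pi] by metis
      have di: "algebraic_int (1 - p ^ d)" using pi by (simp add: algebraic_int_diff algebraic_int_power)
      have "(1 - p ^ d) * p ^ i * \<beta> \<in> pideal \<alpha>" using isidealD(6)[OF pid id(2) bi] by (simp add: mult.commute)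
      then have "(1 - p ^ d) * \<beta> \<in> pideal \<alpha>"
      proof (induction i)
        case (Suc i)
        have "algebraic_int ((1 - p ^ d) * p ^ i)" using di pi by (simp add: algebraic_int_times algebraic_int_power)
        moreover have "(1 - p ^ d) * p ^ i * p * \<beta> \<in> pideal \<alpha>" using Suc.prems by (simp only: power_Suc2 mult.assoc)
        ultimately have "(1 - p ^ d) * p ^ i * \<beta> \<in> pideal \<alpha>" by (rule canc)
        then show ?case by (rule Suc.IH)
      qed simp
      then have "1 - p ^ d \<in> P" using bP di unfolding ann_def by auto
      moreover have "p ^ d \<in> P" using id(1) isidealD(6)[OF idl p algebraic_int_power[OF pi, of "d - 1"]] by (simp flip: power_Suc)
      ultimately have "1 - p ^ d + p ^ d \<in> P" by (rule isidealD(3)[OF idl])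
      then show False using places_ideal(2)[OF P] by simp
    qed
  qed
  moreover have "\<beta> \<notin> pideal \<alpha>"
    using bP places_ideal(2)[OF P] unfolding ann_def by auto
  ultimately show ?thesis using that bi by blast
qed

text \<open>A nonzero ideal is a finitely generated \<int>-module: it is spanned by the n
  \<theta>^i, for a positive integer n in it, and by those representatives modulo n\<int>[\<theta>]
  that lie in it. Stability under \<open>x\<close> then makes \<open>x\<close> integral.\<close>

lemma ideal_stable_integral:
  assumes P: "isideal P" "x0 \<in> P" "x0 \<noteq> 0" and st: "\<And>p. p \<in> P \<Longrightarrow> x * p \<in> P"
  shows "algebraic_int x"
proof -
  obtain n :: nat where n: "n > 0" "of_nat n \<in> P" using ideal_contains_nat[OF P] by metis
  obtain q where q: "\<forall>n>0. \<exists>T. finite T \<and> card T \<le> q * n ^ m \<and> (\<forall>t\<in>T. algebraic_int t) \<and>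
    (\<forall>x. algebraic_int x \<longrightarrow> (\<exists>t\<in>T. \<exists>c. x = t + of_nat n * lat c))"
    using finite_reps_nat ..
  obtain T where T: "finite T" "card T \<le> q * n ^ m" "\<forall>t\<in>T. algebraic_int t"
    "\<forall>x. algebraic_int x \<longrightarrow> (\<exists>t\<in>T. \<exists>c. x = t + of_nat n * lat c)"
    using q[rule_format, OF n(1)] by (elim exE conjE)
  define G where "G = (\<lambda>i. of_nat n * \<theta> ^ i) ` {..<m} \<union> (T \<inter> P)"
  have nl: "of_nat n * lat c \<in> P" for c using isidealD(6)[OF P(1) n(2) lat_int] .
  have sp: "p \<in> zmod.span G" if p: "p \<in> P" for p
  proof -
    obtain t c where tc: "t \<in> T" "p = t + of_nat n * lat c" using T(4) isidealD(2)[OF P(1) p] by blast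
    have "t = p - of_nat n * lat c" using tc by simp
    then have "t \<in> P" using isidealD(4)[OF P(1) p nl] by simp
    then have "t \<in> zmod.span G" using tc(1) by (intro zmod.span_base) (auto simp: G_def)
    moreover have "of_nat n * lat c = (\<Sum>i<m. zscale (c i) (of_nat n * \<theta> ^ i))"
      unfolding lat_def sum_distrib_left zscale_def by (intro sum.cong) auto
    moreover have "(\<Sum>i<m. zscale (c i) (of_nat n * \<theta> ^ i)) \<in> zmod.span G"
      by (intro zmod.span_sum zmod.span_scale zmod.span_base) (auto simp: G_def)
    ultimately show ?thesis using tc(2) zmod.span_add by metis
  qed
  show ?thesis
  proof (rule algebraic_int_finite_span[of G])
    show "finite G" unfolding G_def using T(1) by auto
    have "of_nat n * \<theta> ^ 0 \<in> G" unfolding G_def using m_pos by blast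
    then show "\<exists>g\<in>G. g \<noteq> 0" using n(1) by (intro bexI[of _ "of_nat n * \<theta> ^ 0"]) auto
    fix g assume "g \<in> G"
    then have "g \<in> P"
    proof -
      have "of_nat n * \<theta> ^ i \<in> P" for i using isidealD(6)[OF P(1) n(2) algebraic_int_power[OF theta(2)]] .
      then show ?thesis using \<open>g \<in> G\<close> by (auto simp: G_def)
    qed
    then show "x * g \<in> zmod.span G" using sp st by blast
  qed
qed

text \<open>The localisation of \<open>\<O>\<close> at \<open>P\<close> has a principal maximal ideal.\<close>

lemma uniformizer:
  assumes P: "P \<in> (finite_places :: 'k set set)"
  obtains \<pi> w where "\<pi> \<in> P" "\<pi> \<noteq> 0" "algebraic_int w" "w \<notin> P" "\<And>p. p \<in> P \<Longrightarrow> \<exists>z. algebraic_int z \<and> w * p = \<pi> * z"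
proof -
  note idl = places_ideal(1)[OF P]
  obtain \<alpha> where \<alpha>: "\<alpha> \<in> P" "\<alpha> \<noteq> 0" using places_ideal(3)[OF P] by blast
  obtain \<beta> where \<beta>: "algebraic_int \<beta>" "\<beta> \<notin> pideal \<alpha>" "\<And>p. p \<in> P \<Longrightarrow> p * \<beta> \<in> pideal \<alpha>"
    using places_annihilator[OF P \<alpha>] by metis
  define x where "x = \<beta> / \<alpha>"
  have xp: "algebraic_int (x * p)" if pP: "p \<in> P" for p
  proof -
    obtain z where "p * \<beta> = \<alpha> * z" "algebraic_int z" using \<beta>(3)[OF pP] unfolding pideal_def by blast
    then show ?thesis using \<alpha>(2) by (simp add: x_def field_simps)
  qed
  \<comment> \<open>Otherwise \<open>x\<close> would stabilise \<open>P\<close> and be integral, and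
    \<beta> would lie in (\<alpha>). The required w is x \<pi>, with w p = \<pi> (x p) and x p
    integral.\<close>
  have "\<exists>\<pi>\<in>P. x * \<pi> \<notin> P"
  proof (rule ccontr)
    assume "\<not> ?thesis"
    then have "algebraic_int x" using ideal_stable_integral[OF idl \<alpha>] by blast
    moreover have "\<beta> = \<alpha> * x" using \<alpha>(2) by (simp add: x_def)
    ultimately show False using \<beta>(2) unfolding pideal_def by blast
  qed
  then obtain \<pi> where \<pi>: "\<pi> \<in> P" "x * \<pi> \<notin> P" by blast
  have "\<pi> \<noteq> 0" using \<pi>(2) isidealD(1)[OF idl] by auto
  moreover have "\<exists>z. algebraic_int z \<and> (x * \<pi>) * p = \<pi> * z" if "p \<in> P" for p
    using xp[OF that] by (intro exI[of _ "x * p"]) (auto simp: ac_simps)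
  ultimately show ?thesis using that \<pi> xp by blast
qed

text \<open>Localisation without fractions: instead of dividing by an element outside
  \<open>P\<close>, the equation is multiplied by a power of it.\<close>

lemma Pw_local:
  assumes "isideal P" "algebraic_int w" "\<And>p. p \<in> P \<Longrightarrow> \<exists>z. algebraic_int z \<and> w * p = \<pi> * z" "a \<in> Pw P e"
  shows "\<exists>z. algebraic_int z \<and> w ^ e * a = \<pi> ^ e * z"
  using assms(4)
proof (induction e arbitrary: a)
  case 0 then show ?case by auto
next
  case (Suc e)
  have "a \<in> ideal_prod integer_ring (Pw P e) P" using Suc.prems by (simp add: Pw.simps(2))
  then show ?case
  proof (induction rule: ideal_prod.induct)
    case (prod i j)
    obtain z where z: "algebraic_int z" "w ^ e * i = \<pi> ^ e * z" using Suc.IH[OF prod(1)] by blast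
    obtain y where y: "algebraic_int y" "w * j = \<pi> * y" using assms(3)[OF prod(2)] by blast
    have "w ^ Suc e * (i * j) = (w ^ e * i) * (w * j)" by (simp add: ac_simps)
    also have "\<dots> = \<pi> ^ Suc e * (z * y)" unfolding z(2) y(2) by (simp add: ac_simps)
    finally show ?case using z(1) y(1) by (auto intro: algebraic_int_times)
  next
    case (sum s1 s2)
    then obtain z1 z2 where "algebraic_int z1" "w ^ Suc e * s1 = \<pi> ^ Suc e * z1"
      "algebraic_int z2" "w ^ Suc e * s2 = \<pi> ^ Suc e * z2" by blast
    then have "algebraic_int (z1 + z2) \<and> w ^ Suc e * (s1 \<oplus>\<^bsub>integer_ring\<^esub> s2) = \<pi> ^ Suc e * (z1 + z2)"
      by (simp only: integer_ring_simps distrib_left algebraic_int_plus simp_thms)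
    then show ?case by blast
  qed
qed

text \<open>Elements outside \<open>P\<close> are invertible modulo every power of it: with 1 - u s
  in P, the power (1 - u s)^k lies in P^k and has the form 1 - y s.\<close>

lemma Pw_cancel:
  assumes P: "P \<in> (finite_places :: 'k set set)" and s: "algebraic_int s" "s \<notin> P" and a: "algebraic_int a" "s * a \<in> Pw P k"
  shows "a \<in> Pw P k"
proof -
  note idl = places_ideal(1)[OF P]
  note idk = Pw_ideal[OF idl, of k]
  obtain u where u: "algebraic_int u" "1 - u * s \<in> P" using places_inverse[OF P s] by metis
  have "\<exists>y. algebraic_int y \<and> (1 - u * s) ^ j = 1 - y * s" for j
  proof (induction j)
    case 0 then show ?case by (intro exI[of _ 0]) auto
  next
    case (Suc j)
    then obtain y where y: "algebraic_int y" "(1 - u * s) ^ j = 1 - y * s" by blast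
    have "(1 - u * s) ^ Suc j = 1 - (u + y - u * s * y) * s" by (simp only: power_Suc2 y(2)) (simp add: algebra_simps)
    moreover have "algebraic_int (u + y - u * s * y)"
      using u(1) y(1) s(1) by (intro algebraic_int_diff algebraic_int_plus algebraic_int_times)
    ultimately show ?case by blast
  qed
  then obtain y where y: "algebraic_int y" "(1 - u * s) ^ k = 1 - y * s" by blast
  have "(1 - u * s) ^ k \<in> Pw P k" by (rule Pw_power[OF idl u(2)])
  then have "(1 - y * s) * a \<in> Pw P k" using isidealD(6)[OF idk _ a(1)] y(2) by simp
  moreover have "y * (s * a) \<in> Pw P k" using isidealD(5)[OF idk a(2) y(1)] .
  ultimately have "(1 - y * s) * a + y * (s * a) \<in> Pw P k" by (rule isidealD(3)[OF idk])
  then show ?thesis by (simp add: algebra_simps)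
qed

text \<open>Reads off the exponent of \<open>a\<close> from a local equation s a = \<pi>^e z with s
  outside \<open>P\<close>: it is exactly e if z is outside \<open>P\<close>. The multiplicativity
  of valuations and the index of P^e rest on this.\<close>

lemma Pw_Suc_iff:
  assumes P: "P \<in> (finite_places :: 'k set set)"
    and \<pi>: "\<pi> \<in> P" "\<pi> \<noteq> 0" and w: "algebraic_int w" "w \<notin> P" "\<And>p. p \<in> P \<Longrightarrow> \<exists>z. algebraic_int z \<and> w * p = \<pi> * z"
    and a: "algebraic_int a" and s: "algebraic_int s" "s \<notin> P" "algebraic_int z" "s * a = \<pi> ^ e * z"
  shows "a \<in> Pw P e" "a \<in> Pw P (Suc e) \<longleftrightarrow> z \<in> P"
proof -
  note idl = places_ideal(1)[OF P]
  have "\<pi> ^ e * z \<in> Pw P e" by (rule isidealD(6)[OF Pw_ideal[OF idl] Pw_power[OF idl \<pi>(1)] s(3)])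
  then show "a \<in> Pw P e" using Pw_cancel[OF P s(1,2) a] s(4) by simp
  show "a \<in> Pw P (Suc e) \<longleftrightarrow> z \<in> P"
  proof
    assume "z \<in> P"
    then have "\<pi> ^ e * z \<in> Pw P (e + 1)" by (intro Pw_mult[OF idl Pw_power[OF idl \<pi>(1)]]) (simp only: Pw_1[OF idl])
    then show "a \<in> Pw P (Suc e)" using Pw_cancel[OF P s(1,2) a, of "Suc e"] s(4) by simp
  next
    assume "a \<in> Pw P (Suc e)"
    then obtain y where y: "algebraic_int y" "w ^ Suc e * a = \<pi> ^ Suc e * y" using Pw_local[OF idl w(1,3)] by blast
    have "\<pi> ^ e * (w ^ Suc e * z) = w ^ Suc e * (s * a)" unfolding s(4) by (rule mult.left_commute)
    also have "\<dots> = s * (w ^ Suc e * a)" by (rule mult.left_commute)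
    also have "\<dots> = \<pi> ^ e * (\<pi> * (s * y))" unfolding y(2) by (simp add: ac_simps)
    finally have "w ^ Suc e * z = \<pi> * (s * y)" using \<pi>(2) by simp
    also have "\<dots> \<in> P" using isidealD(6)[OF idl \<pi>(1)] s(1) y(1) by (auto intro: algebraic_int_times)
    finally have "w ^ Suc e \<in> P \<or> z \<in> P" using places_ideal(4)[OF P algebraic_int_power[OF w(1)] s(3)] by blast
    then show "z \<in> P" using places_power[OF P w(1)] w(2) by blast
  qed
qed

end

text \<open>Counts classes through any map with the same fibres, in place of isomorphism theorems
  for quotients.\<close>

lemma card_image_kernel:
  assumes "\<And>x y. x \<in> S \<Longrightarrow> y \<in> S \<Longrightarrow> f x = f y \<longleftrightarrow> g x = g y"
  shows "card (f ` S) = card (g ` S)"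
proof (rule bij_betw_same_card)
  show "bij_betw (\<lambda>v. g (inv_into S f v)) (f ` S) (g ` S)"
  proof (rule bij_betw_imageI)
    show "inj_on (\<lambda>v. g (inv_into S f v)) (f ` S)"
    proof (rule inj_onI)
      fix u v assume uv: "u \<in> f ` S" "v \<in> f ` S" "g (inv_into S f u) = g (inv_into S f v)"
      then have "f (inv_into S f u) = f (inv_into S f v)" using assms inv_into_into by metis
      then show "u = v" using uv by (simp add: f_inv_into_f)
    qed
    show "(\<lambda>v. g (inv_into S f v)) ` f ` S = g ` S"
    proof -
      have "g (inv_into S f (f x)) = g x" if "x \<in> S" for x
        using assms[of "inv_into S f (f x)" x] that f_inv_into_f[of "f x" f S] inv_into_into[of "f x" f S] by blast
      then show ?thesis by (force simp: image_image)
    qed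
  qed
qed

section \<open>Indices of prime powers, valuations and absolute values\<close>

context nfield
begin

definition coset :: "'k set \<Rightarrow> 'k \<Rightarrow> 'k set" where "coset I x = {y. algebraic_int y \<and> y - x \<in> I}"

lemma cosets_coset: "cosets I = coset I ` {x. algebraic_int x}"
  by (simp add: cosets_def coset_def)

lemma coset_eq: "isideal I \<Longrightarrow> algebraic_int x \<Longrightarrow> algebraic_int x' \<Longrightarrow> coset I x = coset I x' \<longleftrightarrow> x - x' \<in> I"
  unfolding coset_def by (rule coset_eq_iff)

lemma idx_card: "idx I = card (coset I ` {x. algebraic_int x})"
  by (simp add: idx_def cosets_coset)

text \<open>Classes modulo \<open>I\<close> map onto classes modulo \<open>J\<close>; an element of
  \<open>J\<close> outside \<open>I\<close> shares its class modulo \<open>J\<close> with 0, so the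
  map is then not injective.\<close>

lemma idx_mono:
  assumes "isideal I" "isideal J" "I \<subseteq> J" "x \<in> I" "x \<noteq> 0"
  shows "idx J \<le> idx I" "I \<noteq> J \<Longrightarrow> idx J < idx I"
proof -
  have fin: "finite (coset I ` {x. algebraic_int x})" using finite_cosets[OF assms(1,4,5)] by (simp add: cosets_coset)
  define f where "f C = coset J (SOME x. algebraic_int x \<and> C = coset I x)" for C
  have f: "f (coset I x) = coset J x" if x: "algebraic_int x" for x
  proof -
    define y where "y = (SOME y. algebraic_int y \<and> coset I x = coset I y)"
    have "algebraic_int y \<and> coset I x = coset I y" unfolding y_def by (rule someI[of _ x]) (use x in simp)
    then have "x - y \<in> J" using coset_eq[OF assms(1) x, of y] assms(3) by blast
    then show ?thesis unfolding f_def y_def[symmetric]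
      using coset_eq[OF assms(2) x, of y] \<open>algebraic_int y \<and> _\<close> by simp
  qed
  have im: "coset J ` {x. algebraic_int x} = f ` coset I ` {x. algebraic_int x}"
    unfolding image_image by (rule image_cong) (simp_all add: f)
  then show "idx J \<le> idx I" unfolding idx_card using card_image_le[OF fin] by simp
  assume "I \<noteq> J"
  then obtain y where y: "y \<in> J" "y \<notin> I" using assms(3) by blast
  have yi: "algebraic_int y" using isidealD(2)[OF assms(2) y(1)] .
  have "coset I y \<noteq> coset I 0" using coset_eq[OF assms(1) yi, of 0] y by simp
  moreover have "f (coset I y) = f (coset I 0)" using f[OF yi] f[of 0] coset_eq[OF assms(2) yi, of 0] y by simp
  ultimately have "\<not> inj_on f (coset I ` {x. algebraic_int x})" using yi by (auto simp: inj_on_def)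
  then have "card (f ` coset I ` {x. algebraic_int x}) \<noteq> card (coset I ` {x. algebraic_int x})"
    using eq_card_imp_inj_on[OF fin] by blast
  then show "idx J < idx I" unfolding idx_card im using card_image_le[OF fin, of f] by simp
qed

text \<open>The Chinese remainder theorem, with c and 1 - c in the role of idempotents: c x + (1 -
  c) y is congruent to x modulo \<open>I\<close> and to y modulo \<open>J\<close>.\<close>

lemma idx_inter:
  assumes I: "isideal I" and J: "isideal J" and c: "c \<in> J" "1 - c \<in> I"
  shows "idx (I \<inter> J) = idx I * idx J"
proof -
  have IJ: "isideal (I \<inter> J)" using I J unfolding isideal_def by blast
  let ?O = "{x::'k. algebraic_int x}"
  have ci: "algebraic_int c" "algebraic_int (1 - c)" using isidealD(2) I J c by blast+
  have "idx (I \<inter> J) = card ((\<lambda>x. (coset I x, coset J x)) ` ?O)"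
    unfolding idx_card by (rule card_image_kernel) (auto simp: coset_eq I J IJ)
  also have "(\<lambda>x. (coset I x, coset J x)) ` ?O = coset I ` ?O \<times> coset J ` ?O"
  proof
    show "coset I ` ?O \<times> coset J ` ?O \<subseteq> (\<lambda>x. (coset I x, coset J x)) ` ?O"
    proof clarify
      fix x y :: 'k assume xy: "algebraic_int x" "algebraic_int y"
      define z where "z = c * x + (1 - c) * y"
      have z: "algebraic_int z" unfolding z_def using xy ci by (intro algebraic_int_plus algebraic_int_times)
      have "x - z = (1 - c) * (x - y)" by (simp add: z_def algebra_simps)
      then have "x - z \<in> I" using isidealD(6)[OF I c(2) algebraic_int_diff[OF xy]] by simp
      moreover have "y - z = - (c * (x - y))" by (simp add: z_def algebra_simps)
      then have "y - z \<in> J" using isidealD(4)[OF J isidealD(1)[OF J] isidealD(6)[OF J c(1) algebraic_int_diff[OF xy]]] by simp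
      ultimately have "coset I x = coset I z" "coset J y = coset J z" using coset_eq I J xy z by auto
      then show "(coset I x, coset J y) \<in> (\<lambda>x. (coset I x, coset J x)) ` ?O" using z by auto
    qed
  qed auto
  finally show ?thesis by (simp add: idx_card card_cartesian_product)
qed

text \<open>Multiplication by \<pi>^e identifies \<O>/P with P^e/P^(e+1). So a class modulo P^(e+1)
  amounts to a class modulo P^e together with a further digit \<open>d\<close> modulo
  \<open>P\<close>, measured against the representative \<open>r\<close> of the former.\<close>

lemma idx_Pw:
  assumes P: "P \<in> (finite_places :: 'k set set)"
  shows "idx (Pw P e) = idx P ^ e"
proof (induction e)
  case 0
  have "coset (Pw P 0) x = {x. algebraic_int x}" if "algebraic_int x" for x
    using that by (auto simp: coset_def intro: algebraic_int_diff)
  then have "coset (Pw P 0) ` {x. algebraic_int x} = {{x. algebraic_int x}}" using algebraic_int_0 by (auto simp: image_def)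
  then show ?case by (simp add: idx_card)
next
  case (Suc e)
  note idl = places_ideal(1)[OF P]
  let ?O = "{x::'k. algebraic_int x}"
  let ?I = "Pw P (Suc e)" and ?J = "Pw P e"
  have I: "isideal ?I" and J: "isideal ?J" using Pw_ideal[OF idl] by auto
  have IJ: "?I \<subseteq> ?J" by (rule Pw_Suc_subset[OF idl])
  obtain \<pi> w where pw: "\<pi> \<in> P" "\<pi> \<noteq> 0" "algebraic_int w" "w \<notin> P" "\<And>p. p \<in> P \<Longrightarrow> \<exists>z. algebraic_int z \<and> w * p = \<pi> * z"
    using uniformizer[OF P] by metis
  have pe: "\<pi> ^ e \<in> ?J" using Pw_power[OF idl pw(1)] .
  have pii: "algebraic_int \<pi>" using isidealD(2)[OF idl pw(1)] .
  have kern: "\<pi> ^ e * d \<in> ?I \<longleftrightarrow> d \<in> P" if d: "algebraic_int d" for d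
    using Pw_Suc_iff(2)[OF P pw(1-4) pw(5), of "\<pi> ^ e * d" 1 d e] d pii places_ideal(2)[OF P]
    by (auto intro: algebraic_int_times algebraic_int_power)
  \<comment> \<open>Up to the factor w^e, the element a is \<pi>^e z; with u an inverse of w^e
    modulo \<open>P\<close>, the error a (1 - u w^e) is a product of an element of P^e with one of
    P.\<close>
  have ex: "\<exists>d. algebraic_int d \<and> a - \<pi> ^ e * d \<in> ?I" if a: "a \<in> ?J" for a
  proof -
    obtain z where z: "algebraic_int z" "w ^ e * a = \<pi> ^ e * z" using Pw_local[OF idl pw(3,5) a] by blast
    have we: "algebraic_int (w ^ e)" "w ^ e \<notin> P" using pw(3,4) places_power[OF P pw(3)] algebraic_int_power by blast+
    obtain u where u: "algebraic_int u" "1 - u * w ^ e \<in> P" using places_inverse[OF P we] by metis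
    have "a - \<pi> ^ e * (u * z) = a * (1 - u * w ^ e)"
    proof -
      have "\<pi> ^ e * (u * z) = u * (w ^ e * a)" unfolding z(2) by (rule mult.left_commute)
      then show ?thesis by (simp only:) (simp add: algebra_simps)
    qed
    also have "\<dots> \<in> Pw P (e + 1)" by (rule Pw_mult[OF idl a]) (use u(2) Pw_1[OF idl] in simp)
    finally show ?thesis using u(1) z(1) by (intro exI[of _ "u * z"]) (auto intro: algebraic_int_times)
  qed
  define r where "r C = (SOME x. algebraic_int x \<and> C = coset ?J x)" for C
  have r: "algebraic_int (r (coset ?J y))" "coset ?J (r (coset ?J y)) = coset ?J y" "y - r (coset ?J y) \<in> ?J" if y: "algebraic_int y" for y
  proof -
    have "algebraic_int (r (coset ?J y)) \<and> coset ?J y = coset ?J (r (coset ?J y))"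
      unfolding r_def by (rule someI[of _ y]) (use y in simp)
    then show "algebraic_int (r (coset ?J y))" "coset ?J (r (coset ?J y)) = coset ?J y" "y - r (coset ?J y) \<in> ?J"
      using coset_eq[OF J y] by auto
  qed
  define d where "d y = (SOME d. algebraic_int d \<and> y - r (coset ?J y) - \<pi> ^ e * d \<in> ?I)" for y
  have d: "algebraic_int (d y)" "y - r (coset ?J y) - \<pi> ^ e * d y \<in> ?I" if y: "algebraic_int y" for y
    using someI_ex[OF ex[OF r(3)[OF y]]] unfolding d_def[symmetric] by auto
  have "idx ?I = card ((\<lambda>y. (coset ?J y, coset P (d y))) ` ?O)"
    unfolding idx_card
  proof (rule card_image_kernel)
    fix x y :: 'k assume "x \<in> ?O" "y \<in> ?O"
    then have x: "algebraic_int x" and y: "algebraic_int y" by auto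
    show "coset ?I x = coset ?I y \<longleftrightarrow> (coset ?J x, coset P (d x)) = (coset ?J y, coset P (d y))"
    proof (cases "coset ?J x = coset ?J y")
      case True
      define ex where "ex = x - r (coset ?J y) - \<pi> ^ e * d x"
      define ey where "ey = y - r (coset ?J y) - \<pi> ^ e * d y"
      have e: "ex \<in> ?I" "ey \<in> ?I" using d(2)[OF x] d(2)[OF y] True by (auto simp: ex_def ey_def)
      have dd: "algebraic_int (d x - d y)" using d x y algebraic_int_diff by blast
      have 1: "x - y = (ex - ey) + \<pi> ^ e * (d x - d y)" by (simp add: ex_def ey_def algebra_simps)
      have "x - y \<in> ?I \<longleftrightarrow> \<pi> ^ e * (d x - d y) \<in> ?I"
        using isidealD(4)[OF I e] isidealD(3)[OF I isidealD(4)[OF I e], of "\<pi> ^ e * (d x - d y)"]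
          isidealD(4)[OF I _ isidealD(4)[OF I e], of "x - y"] unfolding 1 by auto
      then show ?thesis using True coset_eq[OF I x y] coset_eq[OF idl d(1)[OF x] d(1)[OF y]] kern[OF dd] by simp
    next
      case False
      then show ?thesis using coset_eq[OF I x y] coset_eq[OF J x y] IJ by auto
    qed
  qed
  also have "(\<lambda>y. (coset ?J y, coset P (d y))) ` ?O = coset ?J ` ?O \<times> coset P ` ?O"
  proof
    show "coset ?J ` ?O \<times> coset P ` ?O \<subseteq> (\<lambda>y. (coset ?J y, coset P (d y))) ` ?O"
    proof clarify
      fix x b :: 'k assume xb: "algebraic_int x" "algebraic_int b"
      define y where "y = r (coset ?J x) + \<pi> ^ e * b"
      have y: "algebraic_int y" unfolding y_def using r(1)[OF xb(1)] pii xb(2)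
        by (intro algebraic_int_plus algebraic_int_times algebraic_int_power)
      have "y - r (coset ?J x) \<in> ?J" using isidealD(6)[OF J pe xb(2)] by (simp add: y_def)
      then have cJ: "coset ?J y = coset ?J x" using coset_eq[OF J y r(1)[OF xb(1)]] r(2)[OF xb(1)] by simp
      have "\<pi> ^ e * (b - d y) \<in> ?I" using d(2)[OF y] by (simp add: cJ) (simp add: y_def algebra_simps)
      then have "coset P b = coset P (d y)"
        using kern[OF algebraic_int_diff[OF xb(2) d(1)[OF y]]] coset_eq[OF idl xb(2) d(1)[OF y]] by simp
      then show "(coset ?J x, coset P b) \<in> (\<lambda>y. (coset ?J y, coset P (d y))) ` ?O" using y cJ by auto
    qed
  qed (use d in auto)
  finally show ?case using Suc.IH by (simp add: idx_card card_cartesian_product)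
qed

lemma idx_place_ge_2:
  assumes P: "P \<in> (finite_places :: 'k set set)" shows "idx P \<ge> 2"
proof -
  note idl = places_ideal(1)[OF P]
  obtain x where x: "x \<in> P" "x \<noteq> 0" using places_ideal(3)[OF P] by blast
  have "coset P 0 \<noteq> coset P 1" using coset_eq[OF idl, of 1 0] places_ideal(2)[OF P] by auto
  then have "2 = card {coset P 0, coset P 1}" by simp
  also have "\<dots> \<le> card (coset P ` {x. algebraic_int x})"
    using finite_cosets[OF idl x] by (intro card_mono) (auto simp: cosets_coset)
  finally show ?thesis by (simp add: idx_card)
qed

text \<open>The exponents \<open>e\<close> with \<open>a \<in> P\<^sup>e\<close> are bounded, because \<open>P\<^sup>e\<close> has index at least \<open>2\<^sup>e\<close>.\<close>

lemma int_valuation_props: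
  assumes P: "P \<in> (finite_places :: 'k set set)" and a: "algebraic_int a" "a \<noteq> 0"
  shows "a \<in> Pw P (int_valuation P a)" "a \<notin> Pw P (Suc (int_valuation P a))"
proof -
  note idl = places_ideal(1)[OF P]
  have bd: "e \<le> idx (pideal a)" if e: "a \<in> Pw P e" for e
  proof -
    have sub: "pideal a \<subseteq> Pw P e" unfolding pideal_def using isidealD(6)[OF Pw_ideal[OF idl] e] by blast
    have "e < 2 ^ e" by simp
    also have "(2::nat) ^ e \<le> idx P ^ e" using idx_place_ge_2[OF P] by (intro power_mono) auto
    also have "\<dots> = idx (Pw P e)" using idx_Pw[OF P] by simp
    also have "\<dots> \<le> idx (pideal a)"
      by (rule idx_mono(1)[OF pideal_ideal[OF a(1)] Pw_ideal[OF idl] sub _ a(2)])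
        (auto simp: pideal_def intro!: exI[of _ 1])
    finally show ?thesis by simp
  qed
  have iv: "int_valuation P a = (GREATEST e. a \<in> Pw P e)" by (simp add: int_valuation_def Pw_eq)
  show "a \<in> Pw P (int_valuation P a)" unfolding iv
    by (rule GreatestI_nat[of _ 0 "idx (pideal a)"]) (use a bd in auto)
  show "a \<notin> Pw P (Suc (int_valuation P a))"
  proof
    assume *: "a \<in> Pw P (Suc (int_valuation P a))"
    have "Suc (int_valuation P a) \<le> (GREATEST e. a \<in> Pw P e)"
      by (rule Greatest_le_nat[of "\<lambda>e. a \<in> Pw P e" _ "idx (pideal a)"]) (use * bd in auto)
    then show False using iv by simp
  qed
qed

lemma int_valuation_eqI:
  assumes P: "P \<in> (finite_places :: 'k set set)" and a: "a \<noteq> 0" "a \<in> Pw P e" "a \<notin> Pw P (Suc e)"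
  shows "int_valuation P a = e"
proof -
  note idl = places_ideal(1)[OF P]
  have ai: "algebraic_int a" using isidealD(2)[OF Pw_ideal[OF idl] a(2)] .
  note iv = int_valuation_props[OF P ai a(1)]
  have "\<not> Suc e \<le> int_valuation P a" using a(3) iv(1) Pw_antimono[OF idl, of "Suc e" "int_valuation P a"] by blast
  moreover have "\<not> Suc (int_valuation P a) \<le> e" using a(2) iv(2) Pw_antimono[OF idl, of "Suc (int_valuation P a)" e] by blast
  ultimately show ?thesis by simp
qed

lemma int_valuation_ge: 
  assumes P: "P \<in> (finite_places :: 'k set set)" and a: "a \<noteq> 0" "a \<in> Pw P e"
  shows "e \<le> int_valuation P a"
proof -
  note idl = places_ideal(1)[OF P]
  have ai: "algebraic_int a" using isidealD(2)[OF Pw_ideal[OF idl] a(2)] .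
  note iv = int_valuation_props[OF P ai a(1)]
  have "\<not> Suc (int_valuation P a) \<le> e" using a(2) iv(2) Pw_antimono[OF idl, of "Suc (int_valuation P a)" e] by blast
  then show ?thesis by simp
qed

text \<open>Local equations for \<open>a\<close> and \<open>b\<close> multiply to one for a b, and
  the product of the two cofactors stays outside \<open>P\<close> because \<open>P\<close> is
  prime.\<close>

lemma int_valuation_mult:
  assumes P: "P \<in> (finite_places :: 'k set set)" and a: "algebraic_int a" "a \<noteq> 0" and b: "algebraic_int b" "b \<noteq> 0"
  shows "int_valuation P (a * b) = int_valuation P a + int_valuation P b"
proof -
  note idl = places_ideal(1)[OF P]
  let ?e = "int_valuation P a" and ?f = "int_valuation P b"
  obtain \<pi> w where pw: "\<pi> \<in> P" "\<pi> \<noteq> 0" "algebraic_int w" "w \<notin> P" "\<And>p. p \<in> P \<Longrightarrow> \<exists>z. algebraic_int z \<and> w * p = \<pi> * z"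
    using uniformizer[OF P] by metis
  have we: "algebraic_int (w ^ k)" "w ^ k \<notin> P" for k using pw(3,4) places_power[OF P pw(3)] algebraic_int_power by blast+
  obtain y where y: "algebraic_int y" "w ^ ?e * a = \<pi> ^ ?e * y"
    using Pw_local[OF idl pw(3,5) int_valuation_props(1)[OF P a]] by blast
  obtain z where z: "algebraic_int z" "w ^ ?f * b = \<pi> ^ ?f * z"
    using Pw_local[OF idl pw(3,5) int_valuation_props(1)[OF P b]] by blast
  have "y \<notin> P" using Pw_Suc_iff(2)[OF P pw(1-4) pw(5) a(1) we y] int_valuation_props(2)[OF P a] by simp
  moreover have "z \<notin> P" using Pw_Suc_iff(2)[OF P pw(1-4) pw(5) b(1) we z] int_valuation_props(2)[OF P b] by simp
  ultimately have yz: "y * z \<notin> P" using places_ideal(4)[OF P y(1) z(1)] by blast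
  have "w ^ (?e + ?f) * (a * b) = (w ^ ?e * a) * (w ^ ?f * b)" by (simp add: power_add ac_simps)
  also have "\<dots> = \<pi> ^ (?e + ?f) * (y * z)" unfolding y(2) z(2) by (simp add: power_add ac_simps)
  finally have e: "w ^ (?e + ?f) * (a * b) = \<pi> ^ (?e + ?f) * (y * z)" .
  show ?thesis
  proof (rule int_valuation_eqI[OF P])
    show "a * b \<noteq> 0" using a b by simp
    show "a * b \<in> Pw P (?e + ?f)" by (intro Pw_mult[OF idl] int_valuation_props(1) P a b)
    show "a * b \<notin> Pw P (Suc (?e + ?f))"
      using Pw_Suc_iff(2)[OF P pw(1-4) pw(5) algebraic_int_times[OF a(1) b(1)] we algebraic_int_times[OF y(1) z(1)] e] yz by simp
  qed
qed

lemma int_valuation_pos: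
  assumes P: "P \<in> (finite_places :: 'k set set)" and a: "algebraic_int a" "a \<noteq> 0"
  shows "int_valuation P a > 0 \<longleftrightarrow> a \<in> P"
proof
  note idl = places_ideal(1)[OF P]
  assume "int_valuation P a > 0"
  then have "Pw P (int_valuation P a) \<subseteq> Pw P 1" by (intro Pw_antimono[OF idl]) simp
  then show "a \<in> P" using int_valuation_props(1)[OF P a] Pw_1[OF idl] by blast
next
  note idl = places_ideal(1)[OF P]
  assume "a \<in> P"
  then show "int_valuation P a > 0" using int_valuation_ge[OF P a(2), of 1] Pw_1[OF idl] by simp
qed

lemma fraction:
  obtains a b where "algebraic_int a" "algebraic_int b" "b \<noteq> 0" "(x::'k) = a / b"
proof -
  obtain d where "d > 0" "algebraic_int (of_nat d * x)" using algebraic_int_multiple[OF nf] by blast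
  then show ?thesis using that[of "of_nat d * x" "of_nat d"] algebraic_int_of_int[of "int d"] by simp
qed

lemma valuation_fraction:
  assumes P: "P \<in> (finite_places :: 'k set set)" and a: "algebraic_int a" "a \<noteq> 0" and b: "algebraic_int b" "b \<noteq> 0"
  shows "valuation P (a / b) = int (int_valuation P a) - int (int_valuation P b)"
  unfolding valuation_def
proof (rule the_equality)
  show "\<exists>a' b'. algebraic_int a' \<and> algebraic_int b' \<and> a' \<noteq> 0 \<and> b' \<noteq> 0 \<and> a / b = a' / b' \<and>
        int (int_valuation P a) - int (int_valuation P b) = int (int_valuation P a') - int (int_valuation P b')"
    using a b by blast
  fix e assume "\<exists>a' b'. algebraic_int a' \<and> algebraic_int b' \<and> a' \<noteq> 0 \<and> b' \<noteq> 0 \<and> a / b = a' / b' \<and>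
        e = int (int_valuation P a') - int (int_valuation P b')"
  then obtain a' b' where *: "algebraic_int a'" "algebraic_int b'" "a' \<noteq> 0" "b' \<noteq> 0" "a / b = a' / b'"
        "e = int (int_valuation P a') - int (int_valuation P b')" by blast
  then have "a * b' = a' * b" using b by (simp add: field_simps)
  then have "int_valuation P a + int_valuation P b' = int_valuation P a' + int_valuation P b"
    using int_valuation_mult[OF P] a b * by metis
  then show "e = int (int_valuation P a) - int (int_valuation P b)" using *(6) by simp
qed

lemma idx_place_pos: "P \<in> (finite_places :: 'k set set) \<Longrightarrow> real (idx P) > 1"
  using idx_place_ge_2[of P] by simp

lemma finite_abs_fraction:
  assumes P: "P \<in> (finite_places :: 'k set set)" and a: "algebraic_int a" "a \<noteq> 0" and b: "algebraic_int b" "b \<noteq> 0"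
  shows "finite_abs P (a / b) = real (idx P) ^ int_valuation P b / real (idx P) ^ int_valuation P a"
proof -
  have "finite_abs P (a / b) = real (idx P) powi (int (int_valuation P b) - int (int_valuation P a))"
    using a b by (simp add: finite_abs_def valuation_fraction[OF P a b] ideal_norm_idx[OF P])
  also have "\<dots> = real (idx P) ^ int_valuation P b / real (idx P) ^ int_valuation P a"
    using idx_place_pos[OF P] by (simp add: power_int_diff)
  finally show ?thesis .
qed

lemma finite_abs_int:
  assumes P: "P \<in> (finite_places :: 'k set set)" and a: "algebraic_int a" "a \<noteq> 0"
  shows "finite_abs P a = 1 / real (idx P) ^ int_valuation P a"
proof -
  have "int_valuation P 1 = 0" using int_valuation_mult[OF P, of 1 1] by simp
  then show ?thesis using finite_abs_fraction[OF P a, of 1] by simp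
qed

lemma finite_abs_int_le_1:
  assumes P: "P \<in> (finite_places :: 'k set set)" and a: "algebraic_int a"
  shows "finite_abs P a \<le> 1"
proof (cases "a = 0")
  case False
  have "1 \<le> real (idx P) ^ int_valuation P a" using idx_place_pos[OF P] by (intro one_le_power) simp
  then show ?thesis unfolding finite_abs_int[OF P a False] by (simp only: divide_le_eq_1 simp_thms) auto
qed (simp add: finite_abs_def)

lemma finite_abs_pos: "P \<in> (finite_places :: 'k set set) \<Longrightarrow> x \<noteq> 0 \<Longrightarrow> finite_abs P x > 0"
  using idx_place_pos[of P] by (simp add: finite_abs_def ideal_norm_idx)

lemma finite_abs_nonneg: "P \<in> (finite_places :: 'k set set) \<Longrightarrow> finite_abs P x \<ge> 0"
  using finite_abs_pos[of P x] by (cases "x = 0") (auto simp: finite_abs_def)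

lemma finite_abs_mult:
  assumes P: "P \<in> (finite_places :: 'k set set)"
  shows "finite_abs P (x * y) = finite_abs P x * finite_abs P y"
proof (cases "x = 0 \<or> y = 0")
  case False
  obtain a b where x: "algebraic_int a" "algebraic_int b" "b \<noteq> 0" "x = a / b" using fraction[of x] by metis
  obtain c d where y: "algebraic_int c" "algebraic_int d" "d \<noteq> 0" "y = c / d" using fraction[of y] by metis
  have nz: "a \<noteq> 0" "c \<noteq> 0" using False x y by auto
  have "finite_abs P (x * y) = finite_abs P ((a * c) / (b * d))" by (simp add: x y)
  also have "\<dots> = real (idx P) ^ (int_valuation P b + int_valuation P d) / real (idx P) ^ (int_valuation P a + int_valuation P c)"
    using finite_abs_fraction[OF P, of "a * c" "b * d"] int_valuation_mult[OF P] x y nz by (simp add: algebraic_int_times)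
  also have "\<dots> = finite_abs P x * finite_abs P y"
    using finite_abs_fraction[OF P x(1) nz(1) x(2,3)] finite_abs_fraction[OF P y(1) nz(2) y(2,3)] by (simp add: x(4) y(4) power_add)
  finally show ?thesis .
qed (auto simp: finite_abs_def)

text \<open>Over a common denominator this says that P^k is closed under addition, with k the
  smaller of the two exponents.\<close>

lemma finite_abs_add:
  assumes P: "P \<in> (finite_places :: 'k set set)"
  shows "finite_abs P (x + y) \<le> max (finite_abs P x) (finite_abs P y)"
proof (cases "x = 0 \<or> y = 0 \<or> x + y = 0")
  case True
  then show ?thesis using finite_abs_nonneg[OF P] by (auto simp: finite_abs_def max_def)
next
  case False
  obtain a b where x: "algebraic_int a" "algebraic_int b" "b \<noteq> 0" "x = a / b" using fraction[of x] by metis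
  obtain c d where y: "algebraic_int c" "algebraic_int d" "d \<noteq> 0" "y = c / d" using fraction[of y] by metis
  define p where "p = a * d" define q where "q = c * b" define e where "e = b * d"
  have i: "algebraic_int p" "algebraic_int q" "algebraic_int e" "algebraic_int (p + q)" "e \<noteq> 0"
    using x y by (auto simp: p_def q_def e_def intro: algebraic_int_times algebraic_int_plus)
  have xe: "x = p / e" "y = q / e" "x + y = (p + q) / e" using x y by (auto simp: p_def q_def e_def field_simps)
  have nz: "p \<noteq> 0" "q \<noteq> 0" "p + q \<noteq> 0" using False xe by auto
  have fe: "finite_abs P (u / e) = finite_abs P u * real (idx P) ^ int_valuation P e" if "algebraic_int u" "u \<noteq> 0" for u
    using finite_abs_fraction[OF P that i(3,5)] finite_abs_int[OF P that] by simp
  have "finite_abs P (p + q) \<le> max (finite_abs P p) (finite_abs P q)"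
  proof -
    let ?k = "min (int_valuation P p) (int_valuation P q)"
    note idl = places_ideal(1)[OF P]
    have "p \<in> Pw P ?k" "q \<in> Pw P ?k"
      using int_valuation_props(1)[OF P i(1) nz(1)] int_valuation_props(1)[OF P i(2) nz(2)]
        Pw_antimono[OF idl, of ?k "int_valuation P p"] Pw_antimono[OF idl, of ?k "int_valuation P q"] by auto
    then have "p + q \<in> Pw P ?k" by (rule isidealD(3)[OF Pw_ideal[OF idl]])
    then have "?k \<le> int_valuation P (p + q)" by (rule int_valuation_ge[OF P nz(3)])
    then have "real (idx P) ^ ?k \<le> real (idx P) ^ int_valuation P (p + q)"
      using idx_place_pos[OF P] by (intro power_increasing) auto
    then have "finite_abs P (p + q) \<le> 1 / real (idx P) ^ ?k"
      unfolding finite_abs_int[OF P i(4) nz(3)] using idx_place_pos[OF P] by (intro divide_left_mono) auto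
    also have "\<dots> \<le> max (finite_abs P p) (finite_abs P q)"
      unfolding finite_abs_int[OF P i(1) nz(1)] finite_abs_int[OF P i(2) nz(2)] by (simp add: min_def max_def)
    finally show ?thesis .
  qed
  then have "finite_abs P (p + q) * real (idx P) ^ int_valuation P e
      \<le> max (finite_abs P p) (finite_abs P q) * real (idx P) ^ int_valuation P e" by (intro mult_right_mono) auto
  also have "\<dots> = max (finite_abs P p * real (idx P) ^ int_valuation P e) (finite_abs P q * real (idx P) ^ int_valuation P e)"
    using idx_place_pos[OF P] by (simp add: max_mult_distrib_right)
  finally show ?thesis unfolding xe(3) unfolding xe(1,2) using fe i nz by simp
qed

text \<open>A prime containing \<open>x\<close> is a union of classes modulo (x), hence determined
  by the representatives that it contains.\<close>

lemma places_containing_finite: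
  assumes x: "algebraic_int (x :: 'k)" "x \<noteq> 0"
  shows "finite {P \<in> finite_places. x \<in> P}"
proof -
  have xin: "x \<in> pideal x" unfolding pideal_def by (intro CollectI exI[of _ 1]) auto
  note pid = pideal_ideal[OF x(1)]
  obtain T where T: "finite T" "\<And>t. t \<in> T \<Longrightarrow> algebraic_int t" "\<And>y. algebraic_int y \<Longrightarrow> \<exists>t\<in>T. y - t \<in> pideal x"
    using finite_index[OF pid xin x(2)] by metis
  have key: "P \<subseteq> Q" if P: "P \<in> finite_places" "x \<in> P" and Q: "Q \<in> finite_places" "x \<in> Q" and eq: "T \<inter> P = T \<inter> Q" for P Q
  proof
    have sub: "pideal x \<subseteq> I" if "isideal I" "x \<in> I" for I unfolding pideal_def using isidealD(6)[OF that] by blast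
    note iP = places_ideal(1)[OF P(1)] and iQ = places_ideal(1)[OF Q(1)]
    fix y assume y: "y \<in> P"
    obtain t where t: "t \<in> T" "y - t \<in> pideal x" using T(3) isidealD(2)[OF iP y] by blast
    have "y - (y - t) \<in> P" using isidealD(4)[OF iP y] t sub[OF iP P(2)] by blast
    then have "t \<in> Q" using t(1) eq by auto
    then have "t + (y - t) \<in> Q" using isidealD(3)[OF iQ] t sub[OF iQ Q(2)] by blast
    then show "y \<in> Q" by simp
  qed
  have "inj_on (\<lambda>P. T \<inter> P) {P \<in> finite_places. x \<in> P}"
    by (rule inj_onI) (use key in blast)
  moreover have "finite ((\<lambda>P. T \<inter> P) ` {P \<in> finite_places. x \<in> P})"
    by (rule finite_subset[of _ "Pow T"]) (use T(1) in auto)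
  ultimately show ?thesis using finite_imageD by blast
qed

end

section \<open>Factorisation of principal ideals, the product formula and heights\<close>

context nfield
begin

text \<open>Distinct nonzero primes are comaximal: an element of \<open>Q\<close> outside
  \<open>P\<close> is invertible modulo \<open>P\<close>. A proper inclusion of \<open>Q\<close> in
  \<open>P\<close> is ruled out, since an inverse modulo \<open>Q\<close> of an element of
  \<open>P\<close> would put 1 into \<open>P\<close>.\<close>

lemma places_coprime_element:
  assumes P: "P \<in> (finite_places :: 'k set set)" and Q: "Q \<in> finite_places" and ne: "P \<noteq> Q"
  obtains a where "a \<in> Q" "1 - a \<in> P"
proof -
  note iP = places_ideal(1)[OF P] and iQ = places_ideal(1)[OF Q]
  show ?thesis
  proof (cases "Q \<subseteq> P")
    case False
    then obtain q where q: "q \<in> Q" "q \<notin> P" by blast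
    obtain u where "algebraic_int u" "1 - u * q \<in> P" using places_inverse[OF P isidealD(2)[OF iQ q(1)] q(2)] by metis
    then show ?thesis using that[of "u * q"] isidealD(5)[OF iQ q(1)] by blast
  next
    case True
    then obtain p where p: "p \<in> P" "p \<notin> Q" using ne by blast
    obtain u where u: "algebraic_int u" "1 - u * p \<in> Q" using places_inverse[OF Q isidealD(2)[OF iP p(1)] p(2)] by metis
    then have "(1 - u * p) + u * p \<in> P" using True isidealD(3,5)[OF iP] p(1) by blast
    then show ?thesis using places_ideal(2)[OF P] by simp
  qed
qed

lemma Pw_coprime_element:
  assumes P: "P \<in> (finite_places :: 'k set set)" and Q: "Q \<in> finite_places" and ne: "P \<noteq> Q"
  obtains c where "c \<in> Pw Q f" "1 - c \<in> Pw P e"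
proof -
  note iP = places_ideal(1)[OF P] and iQ = places_ideal(1)[OF Q]
  obtain a where a: "a \<in> Q" "1 - a \<in> P" using places_coprime_element[OF assms] by metis
  have ai: "algebraic_int a" using isidealD(2)[OF iQ a(1)] .
  have one_minus_power: "\<exists>y. algebraic_int y \<and> 1 - (1 - z) ^ k = z * y" if z: "algebraic_int z" for z :: 'k and k
  proof (induction k)
    case 0 then show ?case by (intro exI[of _ 0]) auto
  next
    case (Suc k)
    then obtain y where y: "algebraic_int y" "1 - (1 - z) ^ k = z * y" by blast
    then have e: "(1 - z) ^ k = 1 - z * y" by (simp add: algebra_simps)
    have "1 - (1 - z) ^ Suc k = z * (y + 1 - z * y)" by (simp only: power_Suc2 e) (simp add: algebra_simps)
    moreover have "algebraic_int (y + 1 - z * y)" using y(1) z by (intro algebraic_int_diff algebraic_int_plus algebraic_int_times) auto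
    ultimately show ?case by blast
  qed
  \<comment> \<open>First a^f lies in Q^f and is still 1 modulo \<open>P\<close>; then 1 - (1 - b)^e
    is a multiple of b and is 1 modulo P^e.\<close>
  define b where "b = a ^ f"
  have bi: "algebraic_int b" "b \<in> Pw Q f" unfolding b_def using algebraic_int_power[OF ai] Pw_power[OF iQ a(1)] by auto
  have "1 - b \<in> P"
  proof -
    obtain y where y: "algebraic_int y" "1 - (1 - (1 - a)) ^ f = (1 - a) * y"
      using one_minus_power[OF algebraic_int_diff[OF algebraic_int_1 ai]] by blast
    then have "1 - b = (1 - a) * y" by (simp add: b_def)
    then show ?thesis using isidealD(6)[OF iP a(2) y(1)] by simp
  qed
  then have "(1 - b) ^ e \<in> Pw P e" by (rule Pw_power[OF iP])
  moreover obtain y where y: "algebraic_int y" "1 - (1 - b) ^ e = b * y" using one_minus_power[OF bi(1)] by blast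
  moreover have "b * y \<in> Pw Q f" using isidealD(6)[OF Pw_ideal[OF iQ] bi(2) y(1)] .
  moreover from y(2) have "1 - b * y = (1 - b) ^ e" by (simp add: algebra_simps)
  ultimately show ?thesis using that[of "b * y"] by simp
qed

text \<open>An intersection rather than a product of prime powers, since this is the form in which
  the Chinese remainder theorem counts classes. For empty \<open>S\<close> it is \<O>.\<close>

definition PwS :: "'k set set \<Rightarrow> ('k set \<Rightarrow> nat) \<Rightarrow> 'k set" where
  "PwS S f = {x. algebraic_int x \<and> (\<forall>P\<in>S. x \<in> Pw P (f P))}"

lemma idx_PwS:
  assumes "finite S" "S \<subseteq> (finite_places :: 'k set set)"
  shows "isideal (PwS S f)" "idx (PwS S f) = (\<Prod>P\<in>S. idx P ^ f P)"
proof -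
  have "isideal (PwS S f) \<and> idx (PwS S f) = (\<Prod>P\<in>S. idx P ^ f P)"
    using assms
  proof (induction S)
    case empty
    \<comment> \<open>\<open>Pw {0} 0\<close> is a name for the whole ring to which
      \<open>Pw_ideal\<close> applies.\<close>
    have "PwS {} f = Pw {0} 0" by (simp add: PwS_def)
    moreover have "isideal ({0} :: 'k set)" by (auto simp: isideal_def)
    moreover have "idx (Pw {0} 0) = 1"
    proof -
      have "coset (Pw {0} 0) x = {x. algebraic_int x}" if "algebraic_int x" for x
        using that by (auto simp: coset_def intro: algebraic_int_diff)
      then have "coset (Pw {0} 0) ` {x. algebraic_int x} = {{x. algebraic_int x}}" using algebraic_int_0 by (auto simp: image_def)
      then show ?thesis by (simp add: idx_card)
    qed
    ultimately show ?case using Pw_ideal[of "{0}" 0] by simp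
  next
    case (insert P S)
    have S: "isideal (PwS S f)" "idx (PwS S f) = (\<Prod>P\<in>S. idx P ^ f P)" using insert by auto
    have P: "P \<in> finite_places" using insert.prems by blast
    note iP = Pw_ideal[OF places_ideal(1)[OF P], of "f P"]
    have eq: "PwS (insert P S) f = PwS S f \<inter> Pw P (f P)" by (auto simp: PwS_def)
    have "\<exists>c. algebraic_int c \<and> c \<in> Pw P (f P) \<and> 1 - c \<in> PwS S f"
    proof -
      have "\<forall>Q\<in>S. \<exists>c. c \<in> Pw P (f P) \<and> 1 - c \<in> Pw Q (f Q)"
      proof
        fix Q assume "Q \<in> S"
        then have "Q \<in> finite_places" "Q \<noteq> P" using insert by auto
        then show "\<exists>c. c \<in> Pw P (f P) \<and> 1 - c \<in> Pw Q (f Q)" using Pw_coprime_element[OF _ P] by metis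
      qed
      then obtain c where c: "\<And>Q. Q \<in> S \<Longrightarrow> c Q \<in> Pw P (f P)" "\<And>Q. Q \<in> S \<Longrightarrow> 1 - c Q \<in> Pw Q (f Q)" by metis
      have ci: "algebraic_int (1 - c Q)" if "Q \<in> S" for Q
        using isidealD(2)[OF iP c(1)[OF that]] algebraic_int_diff[OF algebraic_int_1] by blast
      \<comment> \<open>The product of the 1 - c Q lies in every \<open>Pw Q (f Q)\<close> and is 1
        modulo \<open>Pw P (f P)\<close>; so 1 - d is the element required by
        \<open>idx_inter\<close>.\<close>
      define d where "d = (\<Prod>Q\<in>S. 1 - c Q)"
      have di: "algebraic_int d" unfolding d_def using ci by (rule algebraic_int_prod)
      have "d \<in> Pw Q (f Q)" if Q: "Q \<in> S" for Q
      proof -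
        have "d = (1 - c Q) * (\<Prod>R\<in>S - {Q}. 1 - c R)" unfolding d_def using insert.hyps(1) Q by (rule prod.remove)
        moreover have "algebraic_int (\<Prod>R\<in>S - {Q}. 1 - c R)" using ci by (intro algebraic_int_prod) auto
        moreover have "isideal (Pw Q (f Q))" using Q insert.prems by (intro Pw_ideal places_ideal(1)) auto
        ultimately show ?thesis using isidealD(6) c(2)[OF Q] by metis
      qed
      then have "d \<in> PwS S f" using di by (simp add: PwS_def)
      moreover have "1 - (\<Prod>Q\<in>S'. 1 - c Q) \<in> Pw P (f P)" if "finite S'" "S' \<subseteq> S" for S'
        using that
      proof (induction S')
        case empty then show ?case using isidealD(1)[OF iP] by simp
      next
        case (insert Q S')
        let ?d = "\<Prod>Q\<in>S'. 1 - c Q"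
        have eq: "1 - (\<Prod>Q\<in>insert Q S'. 1 - c Q) = (1 - ?d) + c Q * ?d" using insert.hyps by (simp add: algebra_simps)
        have "algebraic_int ?d" using ci insert.prems by (intro algebraic_int_prod) auto
        then have "c Q * ?d \<in> Pw P (f P)" using isidealD(6)[OF iP c(1)] insert.prems by auto
        then have "(1 - ?d) + c Q * ?d \<in> Pw P (f P)" using insert by (intro isidealD(3)[OF iP]) auto
        then show ?case by (simp only: eq)
      qed
      then have "1 - d \<in> Pw P (f P)" unfolding d_def using insert.hyps(1) by blast
      ultimately show ?thesis
        by (intro exI[of _ "1 - d"]) (use di in \<open>auto intro: algebraic_int_diff\<close>)
    qed
    then have "idx (PwS S f \<inter> Pw P (f P)) = idx (PwS S f) * idx (Pw P (f P))" using idx_inter[OF S(1) iP] by blast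
    moreover have "isideal (PwS S f \<inter> Pw P (f P))" using S(1) iP unfolding isideal_def by blast
    ultimately show ?case using S(2) idx_Pw[OF P] insert.hyps by (simp add: eq mult.commute)
  qed
  then show "isideal (PwS S f)" "idx (PwS S f) = (\<Prod>P\<in>S. idx P ^ f P)" by auto
qed

text \<open>A proper ideal of least index containing \<open>J\<close> is prime.\<close>

lemma exists_place_containing:
  assumes J: "isideal J" "x \<in> J" "x \<noteq> 0" "1 \<notin> J"
  obtains P where "P \<in> (finite_places :: 'k set set)" "J \<subseteq> P"
proof -
  define good where "good I \<longleftrightarrow> isideal I \<and> J \<subseteq> I \<and> 1 \<notin> I" for I
  have "good J" using J by (simp add: good_def)
  then obtain M where M: "good M" "\<And>I. good I \<Longrightarrow> idx M \<le> idx I"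
    using exists_least_iff[of "\<lambda>n. \<exists>I. good I \<and> idx I = n"] by (metis linorder_not_less)
  have iM: "isideal M" "J \<subseteq> M" "1 \<notin> M" using M(1) by (auto simp: good_def)
  have "M \<in> finite_places"
  proof (rule places_intro[OF iM(1,3) _ J(3)])
    show "x \<in> M" using J(2) iM(2) by blast
    fix a b :: 'k assume ab: "algebraic_int a" "algebraic_int b" "a * b \<in> M"
    show "a \<in> M \<or> b \<in> M"
    proof (rule ccontr)
      assume n: "\<not> (a \<in> M \<or> b \<in> M)"
      \<comment> \<open>The ideal M + (a) is larger, so by minimality of the index it contains 1;
        multiplying 1 = u + v a by b puts b into \<open>M\<close>.\<close>
      define I where "I = {u + v * a | u v. u \<in> M \<and> algebraic_int v}"
      have iI: "isideal I" unfolding isideal_def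
      proof (intro conjI ballI allI impI)
        show "0 \<in> I" unfolding I_def using isidealD(1)[OF iM(1)] by (intro CollectI exI[of _ 0]) auto
        fix y assume "y \<in> I"
        then obtain u v where y: "y = u + v * a" "u \<in> M" "algebraic_int v" unfolding I_def by blast
        show "algebraic_int y" using y isidealD(2)[OF iM(1)] ab(1) by (simp add: algebraic_int_plus algebraic_int_times)
        show "c * y \<in> I" if c: "algebraic_int c" for c
        proof -
          have "c * y = c * u + (c * v) * a" by (simp add: y algebra_simps)
          then show ?thesis unfolding I_def using isidealD(5)[OF iM(1) y(2) c] algebraic_int_times[OF c y(3)] by blast
        qed
        fix z assume "z \<in> I"
        then obtain u' v' where z: "z = u' + v' * a" "u' \<in> M" "algebraic_int v'" unfolding I_def by blast
        have "y + z = (u + u') + (v + v') * a" by (simp add: y z algebra_simps)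
        then show "y + z \<in> I" unfolding I_def using isidealD(3)[OF iM(1) y(2) z(2)] algebraic_int_plus[OF y(3) z(3)] by blast
      qed
      have MI: "M \<subseteq> I" unfolding I_def by (intro subsetI CollectI) (metis add.right_neutral algebraic_int_0 mult_zero_left)
      have "a \<in> I" unfolding I_def using isidealD(1)[OF iM(1)] by (intro CollectI exI[of _ 0] exI[of _ 1]) auto
      then have "M \<noteq> I" using n by blast
      then have "idx I < idx M" using idx_mono(2)[OF iM(1) iI MI _ J(3)] J(2) iM(2) by blast
      then have "\<not> good I" using M(2) by fastforce
      then have "1 \<in> I" using iI MI iM(2) by (auto simp: good_def)
      then obtain u v where uv: "1 = u + v * a" "u \<in> M" "algebraic_int v" unfolding I_def by blast
      have "b = (u + v * a) * b" using uv(1) by simp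
      also have "\<dots> = u * b + v * (a * b)" by (simp add: algebra_simps)
      also have "\<dots> \<in> M" 
        by (rule isidealD(3)[OF iM(1) isidealD(6)[OF iM(1) uv(2) ab(2)] isidealD(5)[OF iM(1) ab(3) uv(3)]])
      finally show False using n by blast
    qed
  qed
  then show ?thesis using that iM(2) by blast
qed

text \<open>For the inclusion from right to left, the multipliers that carry y into (x) form an
  ideal \<open>J\<close>. If \<open>J\<close> were proper, it would lie in a prime \<open>P\<close>;
  but local equations of x and y at \<open>P\<close> with the same exponent yield a multiplier u
  outside \<open>P\<close>.\<close>

lemma pideal_factorization:
  assumes x: "algebraic_int x" "x \<noteq> 0"
  shows "pideal x = PwS {P \<in> finite_places. x \<in> P} (\<lambda>P. int_valuation P x)"
proof
  let ?S = "{P \<in> finite_places. x \<in> P}"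
  have xin: "x \<in> pideal x" unfolding pideal_def by (intro CollectI exI[of _ 1]) auto
  note pid = pideal_ideal[OF x(1)]
  show "pideal x \<subseteq> PwS ?S (\<lambda>P. int_valuation P x)"
  proof
    fix y assume "y \<in> pideal x"
    then obtain z where z: "y = x * z" "algebraic_int z" unfolding pideal_def by blast
    have "y \<in> Pw P (int_valuation P x)" if "P \<in> ?S" for P
      using isidealD(6)[OF Pw_ideal[OF places_ideal(1)] int_valuation_props(1)[OF _ x] z(2)] that z(1) by auto
    then show "y \<in> PwS ?S (\<lambda>P. int_valuation P x)" using z x by (auto simp: PwS_def intro: algebraic_int_times)
  qed
  show "PwS ?S (\<lambda>P. int_valuation P x) \<subseteq> pideal x"
  proof
    fix y assume y: "y \<in> PwS ?S (\<lambda>P. int_valuation P x)"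
    have yi: "algebraic_int y" using y by (simp add: PwS_def)
    define J where "J = {s. algebraic_int s \<and> s * y \<in> pideal x}"
    have iJ: "isideal J" unfolding isideal_def J_def
      using isidealD[OF pid] by (auto simp: distrib_right mult.assoc intro: algebraic_int_plus algebraic_int_times)
    have xJ: "x \<in> J" unfolding J_def using x isidealD(6)[OF pid xin yi] by simp
    have "1 \<in> J"
    proof (rule ccontr)
      assume "1 \<notin> J"
      then obtain P where P: "P \<in> finite_places" "J \<subseteq> P" using exists_place_containing[OF iJ xJ x(2)] by metis
      note idl = places_ideal(1)[OF P(1)]
      let ?e = "int_valuation P x"
      have PS: "P \<in> ?S" using P xJ by blast
      obtain \<pi> w where pw: "\<pi> \<in> P" "\<pi> \<noteq> 0" "algebraic_int w" "w \<notin> P" "\<And>p. p \<in> P \<Longrightarrow> \<exists>z. algebraic_int z \<and> w * p = \<pi> * z"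
        using uniformizer[OF P(1)] by metis
      have we: "algebraic_int (w ^ k)" "w ^ k \<notin> P" for k using pw(3,4) places_power[OF P(1) pw(3)] algebraic_int_power by blast+
      have w0: "w \<noteq> 0" using pw(4) isidealD(1)[OF idl] by blast
      have "y \<in> Pw P ?e" using y PS by (auto simp: PwS_def)
      then obtain z where z: "algebraic_int z" "w ^ ?e * y = \<pi> ^ ?e * z" using Pw_local[OF idl pw(3,5)] by blast
      obtain u where u: "algebraic_int u" "w ^ ?e * x = \<pi> ^ ?e * u"
        using Pw_local[OF idl pw(3,5) int_valuation_props(1)[OF P(1) x]] by blast
      have uP: "u \<notin> P" using Pw_Suc_iff(2)[OF P(1) pw(1-4) pw(5) x(1) we u] int_valuation_props(2)[OF P(1) x] by simp
      have "w ^ ?e * (u * y) = u * (w ^ ?e * y)" by (rule mult.left_commute)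
      also have "\<dots> = (\<pi> ^ ?e * u) * z" unfolding z(2) by (simp only: ac_simps)
      also have "\<dots> = w ^ ?e * (x * z)" unfolding u(2)[symmetric] by (rule mult.assoc)
      finally have "u * y = x * z" using w0 by simp
      then have "u \<in> J" unfolding J_def pideal_def using u(1) z(1) by blast
      then show False using P(2) uP by blast
    qed
    then show "y \<in> pideal x" by (simp add: J_def)
  qed
qed

text \<open>\<open>S\<close> may exceed the set of prime divisors, so that several elements can
  share one index set.\<close>

lemma idx_pideal_prod:
  assumes x: "algebraic_int x" "x \<noteq> 0" and S: "finite S" "S \<subseteq> finite_places" "{P \<in> finite_places. x \<in> P} \<subseteq> S"
  shows "idx (pideal x) = (\<Prod>P\<in>S. idx P ^ int_valuation P x)"
proof -
  have "idx (pideal x) = (\<Prod>P\<in>{P \<in> finite_places. x \<in> P}. idx P ^ int_valuation P x)"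
    unfolding pideal_factorization[OF x] by (rule idx_PwS(2)[OF places_containing_finite[OF x]]) auto
  also have "\<dots> = (\<Prod>P\<in>S. idx P ^ int_valuation P x)"
  proof (rule prod.mono_neutral_left[OF S(1,3)], rule ballI)
    fix P assume "P \<in> S - {P \<in> finite_places. x \<in> P}"
    then show "idx P ^ int_valuation P x = 1" using int_valuation_pos[OF _ x, of P] S(2) by auto
  qed
  finally show ?thesis .
qed

lemma idx_pideal_mult:
  assumes x: "algebraic_int x" "x \<noteq> 0" and y: "algebraic_int y" "y \<noteq> 0"
  shows "idx (pideal (x * y)) = idx (pideal x) * idx (pideal y)"
proof -
  let ?S = "{P \<in> finite_places. x * y \<in> P}"
  have xy: "algebraic_int (x * y)" "x * y \<noteq> 0" using x y by (auto intro: algebraic_int_times)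
  have sub: "{P \<in> finite_places. x \<in> P} \<subseteq> ?S" "{P \<in> finite_places. y \<in> P} \<subseteq> ?S"
    using isidealD(5,6)[OF places_ideal(1)] x y by auto
  have fin: "finite ?S" by (rule places_containing_finite[OF xy])
  show ?thesis
    using idx_pideal_prod[OF x fin _ sub(1)] idx_pideal_prod[OF y fin _ sub(2)] idx_pideal_prod[OF xy fin]
    by (simp add: int_valuation_mult x y power_add prod.distrib)
qed

lemma idx_pideal_pos: "algebraic_int x \<Longrightarrow> x \<noteq> 0 \<Longrightarrow> idx (pideal x) > 0"
proof -
  assume x: "algebraic_int x" "x \<noteq> 0"
  have "idx P > 0" if "P \<in> finite_places" for P :: "'k set" using idx_place_ge_2[OF that] by simp
  then show ?thesis using idx_pideal_prod[OF x places_containing_finite[OF x]] by (auto intro: prod_pos)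
qed

lemma idx_pideal_power:
  assumes x: "algebraic_int x" "x \<noteq> 0" shows "idx (pideal (x ^ k)) = idx (pideal x) ^ k"
proof (induction k)
  case 0
  have "idx (pideal 1) = idx (pideal 1) * idx (pideal 1)" using idx_pideal_mult[of 1 1] by simp
  then show ?case using idx_pideal_pos[of 1] by simp
next
  case (Suc k)
  then show ?case using idx_pideal_mult[OF x, of "x ^ k"] x by (simp add: algebraic_int_power)
qed

text \<open>A constant factor disappears on passing to k-th powers and letting k grow.\<close>

lemma power_trick:
  fixes a b c :: real
  assumes "c > 0" "a > 0" "b > 0" "\<And>k. c * a ^ k \<le> b ^ k"
  shows "a \<le> b"
proof (rule ccontr)
  assume "\<not> a \<le> b"
  then have "1 < a / b" using assms by simp
  then obtain k where "1 / c < (a / b) ^ k" using real_arch_pow by blast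
  then have "b ^ k < c * a ^ k" using assms by (simp add: power_divide field_simps)
  then show False using assms(4)[of k] by simp
qed

text \<open>Index and norm are multiplicative, so \<open>power_trick\<close> sharpens comparisons up
  to constants. The lower bound is Minkowski's; the upper bound is available for integers n, from
  the lattice \<int>[\<theta>]. A cofactor y with x y = n then forces equality at x.\<close>

theorem idx_pideal_eq_norm:
  assumes x: "algebraic_int x" "x \<noteq> 0"
  shows "real (idx (pideal x)) = Nm x"
proof -
  have Npow: "Nm (y ^ k) = Nm y ^ k" for y k
    by (induction k) (simp_all add: Nm_mult, simp add: Nm_def)
  have lower: "Nm y \<le> real (idx (pideal y))" if y: "algebraic_int y" "y \<noteq> 0" for y
  proof -
    obtain c where c: "c > 0" "\<And>x. algebraic_int x \<Longrightarrow> x \<noteq> 0 \<Longrightarrow> c * Nm x \<le> real (idx (pideal x))"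
      using idx_pideal_lower by blast
    show ?thesis
    proof (rule power_trick[OF c(1) Nm_pos[OF y(2)]])
      show "real (idx (pideal y)) > 0" using idx_pideal_pos[OF y] by simp
      fix k show "c * Nm y ^ k \<le> real (idx (pideal y)) ^ k"
        using c(2)[of "y ^ k"] y idx_pideal_power[OF y, of k] Npow[of y k] by (simp add: algebraic_int_power)
    qed
  qed
  have Nn: "Nm (of_nat n) = real n ^ m" for n unfolding Nm_def using E_card by simp
  have upper: "real (idx (pideal (of_nat n))) \<le> real n ^ m" if n: "n > 0" for n :: nat
  proof -
    obtain q where q: "q > 0" "\<forall>n>0. idx (pideal (of_nat n)) \<le> q * n ^ m" using idx_nat_bound by blast
    have ni: "algebraic_int (of_nat n :: 'k)" using algebraic_int_of_int[of "int n"] by simp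
    show ?thesis
    proof (rule power_trick[of "1 / real q"])
      show "0 < real (idx (pideal (of_nat n)))" using idx_pideal_pos[OF ni] n by simp
      fix k
      have "real (idx (pideal (of_nat (n ^ k)))) \<le> real (q * (n ^ k) ^ m)" using q(2)[rule_format, of "n ^ k"] n by (simp only: of_nat_le_iff zero_less_power)
      moreover have "idx (pideal (of_nat (n ^ k))) = idx (pideal (of_nat n)) ^ k" using idx_pideal_power[OF ni, of k] n by simp
      ultimately have "real (idx (pideal (of_nat n))) ^ k \<le> real q * (real n ^ m) ^ k"
        by (simp add: power_mult[symmetric] mult.commute)
      then show "1 / real q * real (idx (pideal (of_nat n))) ^ k \<le> (real n ^ m) ^ k" using q(1) by (simp add: field_simps)
    qed (use q n in auto)
  qed
  obtain y n where y: "algebraic_int y" "x * y = of_nat n" "n > 0" using norm_cofactor[OF x] by metis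
  have y0: "y \<noteq> 0" using y by auto
  have "real (idx (pideal x)) * real (idx (pideal y)) = real (idx (pideal (of_nat n)))"
    unfolding y(2)[symmetric] idx_pideal_mult[OF x y(1) y0] by simp
  also have "\<dots> \<le> Nm (of_nat n)" unfolding Nn by (rule upper[OF y(3)])
  also have "\<dots> = Nm x * Nm y" unfolding y(2)[symmetric] by (rule Nm_mult)
  finally have "real (idx (pideal x)) * real (idx (pideal y)) \<le> Nm x * Nm y" .
  also have "\<dots> \<le> Nm x * real (idx (pideal y))" using lower[OF y(1) y0] Nm_pos[OF x(2)] by (intro mult_left_mono) auto
  finally have "real (idx (pideal x)) \<le> Nm x" using idx_pideal_pos[OF y(1) y0] by simp
  then show ?thesis using lower[OF x] by simp
qed

lemma finite_abs_support: "x \<noteq> 0 \<Longrightarrow> finite {P \<in> (finite_places :: 'k set set). finite_abs P x \<noteq> 1}"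
proof -
  assume x0: "x \<noteq> 0"
  obtain a b where x: "algebraic_int a" "algebraic_int b" "b \<noteq> 0" "x = a / b" using fraction[of x] by metis
  have a0: "a \<noteq> 0" using x x0 by auto
  have "finite_abs P x = 1" if P: "P \<in> finite_places" "a \<notin> P" "b \<notin> P" for P
    using finite_abs_fraction[OF P(1) x(1) a0 x(2,3)] int_valuation_pos[OF P(1) x(1) a0] int_valuation_pos[OF P(1) x(2,3)] P x(4) by simp
  then have "{P \<in> finite_places. finite_abs P x \<noteq> 1} \<subseteq> {P \<in> finite_places. a \<in> P} \<union> {P \<in> finite_places. b \<in> P}" by blast
  then show ?thesis using places_containing_finite[OF x(1) a0] places_containing_finite[OF x(2,3)] finite_subset by blast
qed

text \<open>For algebraic integers both contributions are the logarithm of the norm, the finite one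
  through the index of the principal ideal. \<open>S\<close> is any finite set of places containing
  the support, so that several supports can be merged.\<close>

theorem product_formula:
  assumes x0: "x \<noteq> 0" and S: "finite S" "S \<subseteq> (finite_places :: 'k set set)" "{P \<in> finite_places. finite_abs P x \<noteq> 1} \<subseteq> S"
  shows "(\<Sum>\<sigma>\<in>E. ln (cmod (\<sigma> x))) + (\<Sum>P\<in>S. ln (finite_abs P x)) = 0"
proof -
  obtain a b where x: "algebraic_int a" "algebraic_int b" "b \<noteq> 0" "x = a / b" using fraction[of x] by metis
  have a0: "a \<noteq> 0" using x x0 by auto
  \<comment> \<open>Numerator and denominator may share primes at which \<open>x\<close> itself has
    absolute value 1.\<close>
  define S' where "S' = S \<union> {P \<in> finite_places. a \<in> P} \<union> {P \<in> finite_places. b \<in> P}"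
  have S': "finite S'" "S' \<subseteq> finite_places" "{P \<in> finite_places. a \<in> P} \<subseteq> S'" "{P \<in> finite_places. b \<in> P} \<subseteq> S'"
    unfolding S'_def using S places_containing_finite[OF x(1) a0] places_containing_finite[OF x(2,3)] by auto
  have int: "(\<Sum>\<sigma>\<in>E. ln (cmod (\<sigma> y))) = (\<Sum>P\<in>S'. real (int_valuation P y) * ln (real (idx P)))"
    if y: "algebraic_int y" "y \<noteq> 0" "{P \<in> finite_places. y \<in> P} \<subseteq> S'" for y
  proof -
    have "(\<Sum>\<sigma>\<in>E. ln (cmod (\<sigma> y))) = ln (Nm y)" unfolding Nm_def using y(2) E_card(1) by (subst ln_prod) auto
    also have "\<dots> = ln (\<Prod>P\<in>S'. real (idx P) ^ int_valuation P y)"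
      unfolding idx_pideal_eq_norm[OF y(1,2), symmetric] idx_pideal_prod[OF y(1,2) S'(1,2) y(3)] by simp
    also have "\<dots> = (\<Sum>P\<in>S'. ln (real (idx P) ^ int_valuation P y))"
    proof (rule ln_prod)
      fix P assume "P \<in> S'"
      then have "real (idx P) > 1" using idx_place_pos S'(2) by blast
      then show "real (idx P) ^ int_valuation P y \<noteq> 0" by simp
    qed (rule S'(1))
    also have "\<dots> = (\<Sum>P\<in>S'. real (int_valuation P y) * ln (real (idx P)))"
    proof (intro sum.cong refl)
      fix P assume "P \<in> S'"
      then have "real (idx P) > 1" using idx_place_pos S'(2) by blast
      then show "ln (real (idx P) ^ int_valuation P y) = real (int_valuation P y) * ln (real (idx P))" by (simp add: ln_realpow)
    qed
    finally show ?thesis .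
  qed
  have "(\<Sum>P\<in>S. ln (finite_abs P x)) = (\<Sum>P\<in>S'. ln (finite_abs P x))"
    by (rule sum.mono_neutral_left[OF S'(1)]) (use S S' in \<open>auto simp: S'_def\<close>)
  also have "\<dots> = (\<Sum>P\<in>S'. real (int_valuation P b) * ln (real (idx P)) - real (int_valuation P a) * ln (real (idx P)))"
  proof (rule sum.cong[OF refl])
    fix P assume "P \<in> S'"
    then have P: "P \<in> finite_places" using S' by blast
    show "ln (finite_abs P x) = real (int_valuation P b) * ln (real (idx P)) - real (int_valuation P a) * ln (real (idx P))"
      unfolding x(4) finite_abs_fraction[OF P x(1) a0 x(2,3)] using idx_place_pos[OF P] by (simp add: ln_div ln_realpow)
  qed
  also have "\<dots> = (\<Sum>\<sigma>\<in>E. ln (cmod (\<sigma> b))) - (\<Sum>\<sigma>\<in>E. ln (cmod (\<sigma> a)))"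
    using int[OF x(1) a0 S'(3)] int[OF x(2,3) S'(4)] by (simp add: sum_subtractf)
  also have "\<dots> = - (\<Sum>\<sigma>\<in>E. ln (cmod (\<sigma> x)))"
    unfolding x(4) using a0 x(3) by (simp add: norm_divide ln_div sum_subtractf)
  finally show ?thesis by simp
qed

lemma degree_pos: "degree_over_Q TYPE('k) > 0"
proof -
  obtain B :: "'k set" where B: "finite B" "rvs.span B = UNIV"
    using nf unfolding number_field_def by blast
  obtain C :: "'k set" where C: "C \<subseteq> UNIV" "rvs.independent C" "UNIV \<subseteq> rvs.span C" "card C = rvs.dim (UNIV :: 'k set)"
    by (rule rvs.basis_exists[of "UNIV :: 'k set"])
  have "finite C" using rvs.independent_span_bound[OF B(1) C(2)] B(2) by simp
  moreover have "C \<noteq> {}"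
  proof
    assume "C = {}"
    then have "(1::'k) \<in> {0}" using C(3) by (metis UNIV_I rvs.span_empty subsetD)
    then show False by simp
  qed
  ultimately show ?thesis unfolding degree_over_Q_def unfolding C(4)[symmetric] by (simp add: card_gt_0_iff)
qed

definition fmax :: "nat \<Rightarrow> (nat \<Rightarrow> 'k) \<Rightarrow> 'k set \<Rightarrow> real" where
  "fmax r a P = Max ((\<lambda>i. finite_abs P (a i)) ` {..r})"

definition amax :: "nat \<Rightarrow> (nat \<Rightarrow> 'k) \<Rightarrow> ('k \<Rightarrow> complex) \<Rightarrow> real" where
  "amax r a \<sigma> = Max ((\<lambda>i. cmod (\<sigma> (a i))) ` {..r})"

lemma fmax_ge: "i \<le> r \<Longrightarrow> finite_abs P (a i) \<le> fmax r a P"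
  unfolding fmax_def by (rule Max_ge) auto

lemma amax_ge: "i \<le> r \<Longrightarrow> cmod (\<sigma> (a i)) \<le> amax r a \<sigma>"
  unfolding amax_def by (rule Max_ge) auto

lemma fmax_pos: "P \<in> (finite_places :: 'k set set) \<Longrightarrow> i \<le> r \<Longrightarrow> a i \<noteq> 0 \<Longrightarrow> fmax r a P > 0"
  using fmax_ge[of i r P a] finite_abs_pos[of P "a i"] by linarith

lemma amax_pos: "\<sigma> \<in> E \<Longrightarrow> i \<le> r \<Longrightarrow> a i \<noteq> 0 \<Longrightarrow> amax r a \<sigma> > 0"
proof -
  assume "\<sigma> \<in> E" "i \<le> r" "a i \<noteq> 0"
  then have "0 < cmod (\<sigma> (a i))" "cmod (\<sigma> (a i)) \<le> amax r a \<sigma>" using amax_ge by auto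
  then show "amax r a \<sigma> > 0" by linarith
qed

text \<open>The finite part of the statement that \<open>x\<close> is the value at \<open>a\<close>
  of a form of degree \<open>D\<close> with integral coefficients. Being closed under sums and
  products with the expected degrees, it takes the place of polynomials over
  \<open>'k\<close>.\<close>

definition intform :: "nat \<Rightarrow> (nat \<Rightarrow> 'k) \<Rightarrow> nat \<Rightarrow> 'k \<Rightarrow> bool" where
  "intform r a D x \<longleftrightarrow> (\<forall>P\<in>finite_places. finite_abs P x \<le> fmax r a P ^ D)"

lemma fmax_nonneg: "P \<in> (finite_places :: 'k set set) \<Longrightarrow> fmax r a P \<ge> 0"
  using fmax_ge[of 0 r P a] finite_abs_nonneg[of P "a 0"] by linarith

lemma intform_int: "algebraic_int x \<Longrightarrow> intform r a 0 x"
  unfolding intform_def using finite_abs_int_le_1 by simp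

lemma intform_coord: "i \<le> r \<Longrightarrow> intform r a 1 (a i)"
  unfolding intform_def using fmax_ge by simp

lemma intform_mult: "intform r a D x \<Longrightarrow> intform r a D' y \<Longrightarrow> intform r a (D + D') (x * y)"
  unfolding intform_def
  by (auto simp: finite_abs_mult power_add intro!: mult_mono finite_abs_nonneg fmax_nonneg zero_le_power)

lemma intform_add: "intform r a D x \<Longrightarrow> intform r a D y \<Longrightarrow> intform r a D (x + y)"
  unfolding intform_def using finite_abs_add by (meson max.bounded_iff order_trans max.boundedI)

lemma intform_0: "intform r a D 0"
  unfolding intform_def using fmax_nonneg by (auto simp: finite_abs_def)

lemma intform_sum: "(\<And>i. i \<in> A \<Longrightarrow> intform r a D (f i)) \<Longrightarrow> intform r a D (sum f A)"
  by (induction A rule: infinite_finite_induct) (auto intro: intform_0 intform_add)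

lemma intform_power: "intform r a D x \<Longrightarrow> intform r a (D * k) (x ^ k)"
  by (induction k) (auto intro: intform_int dest: intform_mult)

lemma intform_prod: "finite A \<Longrightarrow> (\<And>i. i \<in> A \<Longrightarrow> intform r a (D i) (f i)) \<Longrightarrow> intform r a (sum D A) (prod f A)"
  by (induction A rule: finite_induct) (auto intro: intform_int intform_mult)

text \<open>Liouville's inequality, summed over all embeddings.\<close>

theorem height_inequality:
  assumes a: "i0 \<le> r" "a i0 \<noteq> 0" and x: "x \<noteq> 0" "intform r a D x"
  shows "(\<Sum>\<sigma>\<in>E. real D * ln (amax r a \<sigma>) - ln (cmod (\<sigma> x))) \<le> real D * (real (degree_over_Q TYPE('k)) * log_height r a)"
proof -
  \<comment> \<open>Outside \<open>S\<close> the element \<open>x\<close> and all nonzero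
    coordinates have absolute value 1, so the sum over all places reduces to a finite one.\<close>
  define S where "S = {P \<in> finite_places. finite_abs P x \<noteq> 1} \<union> (\<Union>i\<in>{i\<in>{..r}. a i \<noteq> 0}. {P \<in> finite_places. finite_abs P (a i) \<noteq> 1})"
  have S: "finite S" "S \<subseteq> finite_places" "{P \<in> finite_places. finite_abs P x \<noteq> 1} \<subseteq> S"
    unfolding S_def using finite_abs_support x(1) by auto
  have out: "fmax r a P = 1" if P: "P \<in> finite_places" "P \<notin> S" for P
  proof -
    have 1: "finite_abs P (a i) = 1" if "i \<le> r" "a i \<noteq> 0" for i using that P unfolding S_def by blast
    have "finite_abs P (a i) \<le> 1" if "i \<le> r" for i
      using 1[OF that] by (cases "a i = 0") (auto simp: finite_abs_def)
    then have "fmax r a P \<le> 1" unfolding fmax_def by (intro Max.boundedI) auto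
    moreover have "1 \<le> fmax r a P" using fmax_ge[OF a(1), of P a] 1[OF a] by simp
    ultimately show ?thesis by simp
  qed
  have "(\<Sum>\<^sub>\<infinity>P\<in>finite_places. ln (fmax r a P)) = (\<Sum>\<^sub>\<infinity>P\<in>S. ln (fmax r a P))"
    by (rule infsum_cong_neutral) (use S(2) out in auto)
  also have "\<dots> = (\<Sum>P\<in>S. ln (fmax r a P))" using S(1) by simp
  finally have fin: "(\<Sum>\<^sub>\<infinity>P\<in>finite_places. ln (fmax r a P)) = (\<Sum>P\<in>S. ln (fmax r a P))" .
  have H: "real (degree_over_Q TYPE('k)) * log_height r a = (\<Sum>\<sigma>\<in>E. ln (amax r a \<sigma>)) + (\<Sum>P\<in>S. ln (fmax r a P))"
    unfolding log_height_def fin[symmetric] using degree_pos by (simp add: fmax_def amax_def E_def)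
  have "(\<Sum>P\<in>S. ln (finite_abs P x)) \<le> (\<Sum>P\<in>S. real D * ln (fmax r a P))"
  proof (rule sum_mono)
    fix P assume "P \<in> S"
    then have P: "P \<in> finite_places" using S by blast
    have "ln (finite_abs P x) \<le> ln (fmax r a P ^ D)"
      using x(2) P finite_abs_pos[OF P x(1)] fmax_pos[of P i0 r a, OF P a] unfolding intform_def by (subst ln_le_cancel_iff) auto
    then show "ln (finite_abs P x) \<le> real D * ln (fmax r a P)" using fmax_pos[of P i0 r a, OF P a] by (simp add: ln_realpow)
  qed
  then have "- (\<Sum>\<sigma>\<in>E. ln (cmod (\<sigma> x))) \<le> real D * (\<Sum>P\<in>S. ln (fmax r a P))"
    using product_formula[OF x(1) S] by (simp add: sum_distrib_left)
  then show ?thesis unfolding H by (simp add: sum_subtractf sum_distrib_left distrib_left)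
qed

end

section \<open>Holomorphic functions with many zeros\<close>

lemma holomorphic_divide_zeros:
  fixes g :: "complex \<Rightarrow> complex"
  assumes "g holomorphic_on S" "open S" "finite Z" "Z \<subseteq> S" "\<And>z. z \<in> Z \<Longrightarrow> g z = 0"
  shows "\<exists>h. h holomorphic_on S \<and> (\<forall>z\<in>S. g z = (\<Prod>a\<in>Z. z - a) * h z)"
  using assms(3,1,4,5)
proof (induction Z arbitrary: g)
  case empty then show ?case by auto
next
  case (insert a Z)
  define f where "f z = (if z = a then deriv g a else g z / (z - a))" for z
  have "f holomorphic_on S"
    by (rule pole_theorem_open_0[OF insert.prems(1) assms(2), of a]) (use insert.prems in \<open>auto simp: f_def\<close>)
  moreover have gf: "g z = (z - a) * f z" for z using insert.prems(3)[of a] by (simp add: f_def)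
  moreover have "f z = 0" if "z \<in> Z" for z
    using that insert.hyps insert.prems(3)[of z] by (auto simp: f_def)
  ultimately obtain h where h: "h holomorphic_on S" "\<forall>z\<in>S. f z = (\<Prod>a\<in>Z. z - a) * h z"
    using insert.IH[of f] insert.prems(2) by auto
  then show ?case using gf insert.hyps by (intro exI[of _ h]) (auto simp: mult.assoc)
qed

text \<open>The maximum principle for the quotient by the product of the z - a. On the circle of
  radius 5/6 each factor is at least 2/3, and at points of modulus below 1/6 it is at most 1/3; so
  every zero gains a factor 1/2.\<close>

lemma disc_zeros_bound:
  fixes g :: "complex \<Rightarrow> complex"
  assumes g: "g holomorphic_on ball 0 1" "\<And>z. z \<in> ball 0 1 \<Longrightarrow> norm (g z) \<le> S"
    and Z: "finite Z" "Z \<subseteq> ball 0 (1/6)" "\<And>z. z \<in> Z \<Longrightarrow> g z = 0" and z: "z \<in> ball 0 (1/6)"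
  shows "norm (g z) \<le> S * (1/2) ^ card Z"
proof -
  have S0: "S \<ge> 0" using g(2)[of 0] norm_ge_zero[of "g 0"] by (simp del: norm_ge_zero)
  have "Z \<subseteq> ball 0 1" using Z(2) by force
  then obtain h where h: "h holomorphic_on ball 0 1" "\<forall>z\<in>ball 0 1. g z = (\<Prod>a\<in>Z. z - a) * h z"
    using holomorphic_divide_zeros[OF g(1) open_ball Z(1) _ Z(3)] by blast
  have "norm (h z) \<le> S * (3/2) ^ card Z"
  proof (rule maximum_modulus_frontier[where S = "cball 0 (5/6)" and f = h])
    show "h holomorphic_on interior (cball 0 (5/6))"
      by (rule holomorphic_on_subset[OF h(1)]) (auto simp: interior_cball)
    have "cball (0::complex) (5/6) \<subseteq> ball 0 1" by auto
    then show "continuous_on (closure (cball 0 (5/6))) h"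
      using holomorphic_on_imp_continuous_on[OF h(1)] continuous_on_subset by (metis closure_closed closed_cball)
    show "bounded (cball (0::complex) (5/6))" by simp
    show "z \<in> cball 0 (5/6)" using z by simp
    fix w :: complex assume "w \<in> frontier (cball 0 (5/6))"
    then have w: "norm w = 5/6" by (simp add: frontier_cball)
    have "(2/3) ^ card Z \<le> (\<Prod>a\<in>Z. norm (w - a))"
    proof -
      have "(\<Prod>a\<in>Z. (2/3::real)) \<le> (\<Prod>a\<in>Z. norm (w - a))"
      proof (rule prod_mono)
        fix a assume "a \<in> Z"
        then have "norm a < 1/6" using Z(2) by auto
        then show "0 \<le> (2/3::real) \<and> 2/3 \<le> norm (w - a)" using norm_triangle_ineq2[of w a] w by simp
      qed
      then show ?thesis by simp
    qed
    moreover have "norm (g w) = (\<Prod>a\<in>Z. norm (w - a)) * norm (h w)" using h(2) w by (simp add: norm_mult prod_norm)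
    moreover have "norm (g w) \<le> S" using g(2) w by simp
    moreover from calculation(1) have "(2/3) ^ card Z * norm (h w) \<le> (\<Prod>a\<in>Z. norm (w - a)) * norm (h w)"
      by (intro mult_right_mono) auto
    ultimately have "(2/3) ^ card Z * norm (h w) \<le> S" by linarith
    moreover have "(3/2::real) ^ card Z * (2/3) ^ card Z = 1" by (simp flip: power_mult_distrib)
    ultimately have "(3/2) ^ card Z * ((2/3) ^ card Z * norm (h w)) \<le> (3/2) ^ card Z * S"
      by (intro mult_left_mono) auto
    moreover have "(3/2) ^ card Z * ((2/3) ^ card Z * norm (h w)) = norm (h w)"
      by (simp only: mult.assoc[symmetric] \<open>(3/2::real) ^ card Z * (2/3) ^ card Z = 1\<close> mult_1)
    ultimately show "norm (h w) \<le> S * (3/2) ^ card Z" by (simp only: mult.commute)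
  qed
  moreover have "(\<Prod>a\<in>Z. norm (z - a)) \<le> (1/3) ^ card Z"
  proof -
    have "(\<Prod>a\<in>Z. norm (z - a)) \<le> (\<Prod>a\<in>Z. (1/3::real))"
    proof (rule prod_mono)
      fix a assume "a \<in> Z"
      then have "norm a < 1/6" using Z(2) by auto
      then show "0 \<le> norm (z - a) \<and> norm (z - a) \<le> 1/3" using norm_triangle_ineq4[of z a] z by simp
    qed
    then show ?thesis by simp
  qed
  ultimately have "(\<Prod>a\<in>Z. norm (z - a)) * norm (h z) \<le> (1/3) ^ card Z * (S * (3/2) ^ card Z)"
    by (intro mult_mono) auto
  moreover have "norm (g z) = (\<Prod>a\<in>Z. norm (z - a)) * norm (h z)" using h(2) z by (simp add: norm_mult prod_norm)
  moreover have "(1/3::real) ^ card Z * (S * (3/2) ^ card Z) = S * (1/2) ^ card Z"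
    by (simp add: power_mult_distrib[symmetric] mult.left_commute)
  ultimately show ?thesis by simp
qed

text \<open>A two-constant theorem: the quotient of \<open>g\<close> by a power of \<open>z - a\<close> obeys the maximum
  principle on an annulus around \<open>a\<close>.\<close>

lemma disc_propagation:
  assumes a: "a \<in> ball 0 (1/6)" and \<eta>: "0 < \<eta>" "\<eta> \<le> (1/3::real)"
  shows "\<exists>\<delta>>0. \<forall>g S \<kappa>. g holomorphic_on ball 0 1 \<longrightarrow> (\<forall>z\<in>ball 0 1. norm (g z) \<le> S) \<longrightarrow> \<kappa> \<ge> 0 \<longrightarrow>
      (\<forall>z\<in>cball a \<eta>. norm (g z) \<le> S * exp (- \<kappa>)) \<longrightarrow>
      (\<forall>z\<in>ball 0 (1/6). norm (g z) \<le> 2 * S * exp (- (\<delta> * \<kappa>)))"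
proof -
  \<comment> \<open>The logarithm of the ratio of the radii of the annulus. Each power of z - a uses
    up \<Lambda> of the exponent \<kappa> on the inner circle and gains a factor 1/2 on the small
    disc, whence \<delta> = ln 2 / \<Lambda>.\<close>
  define \<Lambda> where "\<Lambda> = ln ((2/3) / \<eta>)"
  have L: "\<Lambda> > 0" unfolding \<Lambda>_def using \<eta> by (intro ln_gt_zero) (simp add: field_simps)
  define \<delta> where "\<delta> = ln 2 / \<Lambda>"
  have "\<delta> > 0" using L by (simp add: \<delta>_def)
  moreover have "norm (g z) \<le> 2 * S * exp (- (\<delta> * \<kappa>))"
    if g: "g holomorphic_on ball 0 1" and gS: "\<And>z. z \<in> ball 0 1 \<Longrightarrow> norm (g z) \<le> S" and k: "\<kappa> \<ge> 0"
      and small: "\<And>z. z \<in> cball a \<eta> \<Longrightarrow> norm (g z) \<le> S * exp (- \<kappa>)" and z: "z \<in> ball 0 (1/6)" for g S \<kappa> z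
  proof -
    have S0: "S \<ge> 0" using gS[of 0] norm_ge_zero[of "g 0"] by (simp del: norm_ge_zero)
    \<comment> \<open>The largest power for which the inner circle still gives the bound S (3/2)^q
      of the outer one. Rounding down costs the factor 2 in the conclusion.\<close>
    define q where "q = nat \<lfloor>\<kappa> / \<Lambda>\<rfloor>"
    have q1: "real q \<le> \<kappa> / \<Lambda>" and q2: "\<kappa> / \<Lambda> < real q + 1" using k L by (auto simp: q_def)
    have e1: "((2/3) / \<eta>) ^ q \<le> exp \<kappa>"
    proof -
      have "((2/3) / \<eta>) ^ q = exp (\<Lambda> * real q)" unfolding \<Lambda>_def using \<eta>
        by (simp add: exp_of_nat_mult mult.commute)
      also have "\<dots> \<le> exp \<kappa>" using q1 L by (simp add: field_simps)
      finally show ?thesis .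
    qed
    have half: "(1/2::real) ^ q \<le> 2 * exp (- (\<delta> * \<kappa>))"
    proof -
      have "\<delta> * \<kappa> = ln 2 * (\<kappa> / \<Lambda>)" by (simp add: \<delta>_def)
      also have "\<dots> \<le> ln 2 * (real q + 1)" using q2 by (intro mult_left_mono) auto
      finally have "exp (\<delta> * \<kappa>) \<le> exp (ln 2 * (real q + 1))" by simp
      also have "\<dots> = 2 * 2 ^ q" by (simp add: exp_add algebra_simps exp_of_nat_mult mult.commute[of "ln 2"])
      finally show ?thesis by (simp add: exp_minus field_simps power_one_over)
    qed
    have "norm (g z) \<le> S * (1/2) ^ q"
    proof (cases "z \<in> cball a \<eta>")
      case True
      have "(2::real) ^ q \<le> ((2/3) / \<eta>) ^ q" using \<eta> by (intro power_mono) (auto simp: field_simps)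
      then have "2 ^ q \<le> exp \<kappa>" using e1 by linarith
      then have "exp (- \<kappa>) \<le> (1/2) ^ q" by (simp add: exp_minus field_simps power_one_over)
      then show ?thesis using small[OF True] S0 by (meson mult_left_mono order_trans)
    next
      case False
      have na: "norm a < 1/6" using a by simp
      define An where "An = cball a (2/3) - ball a \<eta>"
      define f where "f w = g w / (w - a) ^ q" for w
      have sub: "cball a (2/3) \<subseteq> ball 0 1"
      proof
        fix w assume "w \<in> cball a (2/3)"
        then have "norm (w - a) \<le> 2/3" by (simp add: dist_norm norm_minus_commute)
        then show "w \<in> ball 0 1" using na norm_triangle_sub[of w a] by simp
      qed
      have clA: "closed An" unfolding An_def by (intro closed_Diff) auto
      have aA: "w \<noteq> a" if "w \<in> An" for w using that \<eta> by (auto simp: An_def)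
      have fh: "f holomorphic_on An" unfolding f_def
        by (intro holomorphic_intros holomorphic_on_subset[OF g]) (use sub aA in \<open>auto simp: An_def\<close>)
      have zA: "z \<in> An"
        using False z na norm_triangle_ineq4[of z a] by (auto simp: An_def dist_norm norm_minus_commute)
      have "norm (f z) \<le> S * (3/2) ^ q"
      proof (rule maximum_modulus_frontier[where S = An and f = f])
        show "f holomorphic_on interior An" by (rule holomorphic_on_subset[OF fh interior_subset])
        show "continuous_on (closure An) f" using fh clA by (simp add: holomorphic_on_imp_continuous_on)
        show "bounded An" unfolding An_def by (rule bounded_subset[of "cball a (2/3)"]) auto
        show "z \<in> An" by (rule zA)
        fix w assume wf: "w \<in> frontier An"
        then have wA: "w \<in> An" using clA frontier_subset_closed by blast
        have "ball a (2/3) - cball a \<eta> \<subseteq> interior An"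
          unfolding An_def by (intro interior_maximal open_Diff) auto
        then have "w \<notin> ball a (2/3) - cball a \<eta>" using wf unfolding frontier_def by blast
        then consider "norm (w - a) = 2/3" | "norm (w - a) = \<eta>"
          using wA by (auto simp: An_def dist_norm norm_minus_commute)
        then show "norm (f w) \<le> S * (3/2) ^ q"
        proof cases
          case 1
          have "norm (g w) \<le> S" using gS sub wA by (auto simp: An_def)
          then have "norm (g w) / (2/3) ^ q \<le> S / (2/3) ^ q" by (intro divide_right_mono) auto
          then show ?thesis by (simp add: f_def norm_divide norm_power 1 power_divide)
        next
          case 2
          then have "norm (g w) \<le> S * exp (- \<kappa>)" using small[of w] by (simp add: dist_norm norm_minus_commute)
          then have "norm (f w) \<le> S * exp (- \<kappa>) / \<eta> ^ q"
            unfolding f_def norm_divide norm_power 2 using \<eta> by (intro divide_right_mono) auto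
          also have "\<dots> = S * ((3/2) ^ q * (((2/3) / \<eta>) ^ q * exp (- \<kappa>)))"
            by (simp add: power_divide)
          also have "\<dots> \<le> S * ((3/2) ^ q * 1)"
          proof -
            have "((2/3) / \<eta>) ^ q * exp (- \<kappa>) \<le> exp \<kappa> * exp (- \<kappa>)" using e1 by (intro mult_right_mono) auto
            then have "((2/3) / \<eta>) ^ q * exp (- \<kappa>) \<le> 1" by (simp flip: exp_add)
            then show ?thesis using S0 by (intro mult_left_mono) auto
          qed
          finally show ?thesis by simp
        qed
      qed
      moreover have "norm (z - a) ^ q \<le> (1/3) ^ q"
        using z na norm_triangle_ineq4[of z a] by (intro power_mono) auto
      ultimately have "norm (z - a) ^ q * norm (f z) \<le> (1/3) ^ q * (S * (3/2) ^ q)"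
        by (intro mult_mono) auto
      moreover have "norm (g z) = norm (z - a) ^ q * norm (f z)"
        unfolding f_def norm_divide norm_power using aA[OF zA] by simp
      moreover have "(1/3::real) ^ q * (S * (3/2) ^ q) = S * (1/2) ^ q"
        by (simp add: power_mult_distrib[symmetric] mult.left_commute)
      ultimately show ?thesis by simp
    qed
    also have "\<dots> \<le> S * (2 * exp (- (\<delta> * \<kappa>)))" using half S0 by (intro mult_left_mono)
    finally show ?thesis by simp
  qed
  ultimately show ?thesis by blast
qed

text \<open>Abstracts the normalised forms on the curve: an element of \<open>\<S>\<close> consists
  of a degree \<open>D\<close>, a global bound \<open>S\<close> and a modulus \<open>u\<close>. On a
  disc, \<open>u\<close> agrees with the modulus of a holomorphic function only up to exp (\<C> p
  D).\<close>

locale disc_atlas =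
  fixes \<tau> :: "'m::topological_space \<Rightarrow> complex \<Rightarrow> 'm"
    and \<C> :: "'m \<Rightarrow> real"
    and \<S> :: "(nat \<times> real \<times> ('m \<Rightarrow> real)) set"
  assumes conn: "connected (UNIV :: 'm set)"
    and center: "\<tau> p 0 = p"
    and cont: "continuous_on (ball 0 1) (\<tau> p)"
    and inj: "inj_on (\<tau> p) (ball 0 1)"
    and opn: "open A \<Longrightarrow> A \<subseteq> ball 0 1 \<Longrightarrow> open (\<tau> p ` A)"
    and C0: "\<C> p \<ge> 0"
    and sec: "(D, S, u) \<in> \<S> \<Longrightarrow> D \<ge> 1 \<and> S > 0 \<and> (\<forall>z. 0 \<le> u z \<and> u z \<le> S)"
    and rep: "(D, S, u) \<in> \<S> \<Longrightarrow> \<exists>g. g holomorphic_on ball 0 1 \<and>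
        (\<forall>\<zeta>\<in>ball 0 1. u (\<tau> p \<zeta>) \<le> exp (\<C> p * real D) * norm (g \<zeta>) \<and> norm (g \<zeta>) \<le> exp (\<C> p * real D) * u (\<tau> p \<zeta>))"
begin

definition V :: "'m \<Rightarrow> 'm set" where "V p = \<tau> p ` ball 0 (1/6)"

text \<open>The constants hold for the whole family at once; a member enters only through its
  degree, linearly in the exponent. This is what survives composition along a chain of
  discs.\<close>

definition propagates :: "real \<Rightarrow> real \<Rightarrow> 'm set \<Rightarrow> 'm set \<Rightarrow> bool" where
  "propagates \<delta> C A B \<longleftrightarrow> (\<forall>(D, S, u)\<in>\<S>. \<forall>\<kappa>\<ge>0. (\<forall>z\<in>A. u z \<le> S * exp (- \<kappa>)) \<longrightarrow>
      (\<forall>z\<in>B. u z \<le> S * exp (C * real D - \<delta> * \<kappa>)))"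

definition carries :: "'m set \<Rightarrow> 'm set \<Rightarrow> bool" where
  "carries A B \<longleftrightarrow> (\<exists>\<delta>>0. \<exists>C\<ge>0. propagates \<delta> C A B)"

lemma open_V: "open (V p)" unfolding V_def by (rule opn) auto

lemma p_in_V: "p \<in> V p" unfolding V_def using center[of p] by (intro image_eqI[of _ _ 0]) auto

lemma carries_subset: "B \<subseteq> A \<Longrightarrow> carries A B"
  unfolding carries_def propagates_def by (rule exI[of _ 1], simp, rule exI[of _ 0]) auto

lemma propagates_mono:
  assumes "propagates \<delta> C A B" "\<delta>' \<le> \<delta>" "C \<le> C'"
  shows "propagates \<delta>' C' A B"
  unfolding propagates_def
proof (clarify)
  fix D S u \<kappa> z assume *: "(D, S, u) \<in> \<S>" "0 \<le> \<kappa>" "\<forall>z\<in>A. u z \<le> S * exp (- \<kappa>)" "z \<in> B"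
  then have "u z \<le> S * exp (C * real D - \<delta> * \<kappa>)" using assms(1) unfolding propagates_def by blast
  also have "\<dots> \<le> S * exp (C' * real D - \<delta>' * \<kappa>)"
  proof -
    have "C * real D \<le> C' * real D" using assms(3) by (intro mult_right_mono) auto
    moreover have "\<delta>' * \<kappa> \<le> \<delta> * \<kappa>" using assms(2) *(2) by (intro mult_right_mono) auto
    ultimately have "C * real D - \<delta> * \<kappa> \<le> C' * real D - \<delta>' * \<kappa>" by linarith
    then show ?thesis using sec[OF *(1)] by (intro mult_left_mono) auto
  qed
  finally show "u z \<le> S * exp (C' * real D - \<delta>' * \<kappa>)" .
qed

lemma carries_trans:
  assumes "carries A B" "carries B E" shows "carries A E"
proof -
  obtain d1 c1 where 1: "d1 > 0" "c1 \<ge> 0" "propagates d1 c1 A B" using assms(1) unfolding carries_def by blast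
  obtain d2 c2 where 2: "d2 > 0" "c2 \<ge> 0" "propagates d2 c2 B E" using assms(2) unfolding carries_def by blast
  have "propagates (d1 * d2) (c2 + d2 * c1) A E"
    unfolding propagates_def
  proof (clarify)
    fix D S u \<kappa> z assume *: "(D, S, u) \<in> \<S>" "0 \<le> \<kappa>" "\<forall>z\<in>A. u z \<le> S * exp (- \<kappa>)" "z \<in> E"
    \<comment> \<open>If the first passage has used up the whole exponent, it is cut off at 0 and
      the trivial bound by \<open>S\<close> takes over.\<close>
    define k where "k = max 0 (d1 * \<kappa> - c1 * real D)"
    have "u w \<le> S * exp (- k)" if "w \<in> B" for w
    proof (cases "d1 * \<kappa> - c1 * real D \<ge> 0")
      case True
      have "u w \<le> S * exp (c1 * real D - d1 * \<kappa>)" using 1(3) * that unfolding propagates_def by blast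
      then show ?thesis using True by (simp add: k_def max_def)
    next
      case False then show ?thesis using sec[OF *(1)] by (simp add: k_def max_def)
    qed
    moreover have "k \<ge> 0" by (simp add: k_def)
    ultimately have "u z \<le> S * exp (c2 * real D - d2 * k)" using 2(3) *(1,4) unfolding propagates_def by blast
    also have "d2 * (d1 * \<kappa> - c1 * real D) \<le> d2 * k" unfolding k_def using 2(1) by (intro mult_left_mono) auto
    then have "S * exp (c2 * real D - d2 * k) \<le> S * exp ((c2 + d2 * c1) * real D - d1 * d2 * \<kappa>)"
      using sec[OF *(1)] by (intro mult_left_mono) (auto simp: algebra_simps)
    finally show "u z \<le> S * exp ((c2 + d2 * c1) * real D - d1 * d2 * \<kappa>)" .
  qed
  then show ?thesis unfolding carries_def using 1 2 by (intro exI[of _ "d1 * d2"] conjI exI[of _ "c2 + d2 * c1"]) auto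
qed

text \<open>The set contains the image of a closed disc about some a, from which
  \<open>disc_propagation\<close> spreads smallness over the disc of radius 1/6.\<close>

lemma carries_local:
  assumes "open A" "A \<noteq> {}" "A \<subseteq> V p"
  shows "carries A (V p)"
proof -
  obtain z0 where z0: "z0 \<in> A" using assms(2) by blast
  then obtain a where a: "a \<in> ball 0 (1/6)" "\<tau> p a = z0" using assms(3) unfolding V_def by blast
  have "open (ball 0 (1/6) \<inter> \<tau> p -` A)"
    by (rule continuous_open_preimage[OF continuous_on_subset[OF cont[of p]] open_ball assms(1)]) auto
  moreover have "a \<in> ball 0 (1/6) \<inter> \<tau> p -` A" using a z0 by auto
  ultimately obtain e where e: "e > 0" "cball a e \<subseteq> ball 0 (1/6) \<inter> \<tau> p -` A"
    using open_contains_cball by blast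
  define \<eta> where "\<eta> = min e (1/3)"
  have eta: "0 < \<eta>" "\<eta> \<le> 1/3" "cball a \<eta> \<subseteq> \<tau> p -` A" using e by (auto simp: \<eta>_def)
  obtain \<delta> where d: "\<delta> > 0" "\<And>g S \<kappa>. g holomorphic_on ball 0 1 \<Longrightarrow> (\<forall>z\<in>ball 0 1. norm (g z) \<le> S) \<Longrightarrow> \<kappa> \<ge> 0 \<Longrightarrow>
      (\<forall>z\<in>cball a \<eta>. norm (g z) \<le> S * exp (- \<kappa>)) \<Longrightarrow>
      (\<forall>z\<in>ball 0 (1/6). norm (g z) \<le> 2 * S * exp (- (\<delta> * \<kappa>)))"
    using disc_propagation[OF a(1) eta(1,2)] by blast
  have sub: "cball a \<eta> \<subseteq> ball 0 1"
  proof
    fix w assume "w \<in> cball a \<eta>"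
    then have "norm (w - a) \<le> 1/3" using eta(2) by (simp add: dist_norm norm_minus_commute)
    then show "w \<in> ball 0 1" using a(1) norm_triangle_sub[of w a] by simp
  qed
  have "propagates \<delta> (2 * \<C> p + 1) A (V p)"
    unfolding propagates_def
  proof (clarify)
    fix D S u \<kappa> z assume *: "(D, S, u) \<in> \<S>" "0 \<le> \<kappa>" "\<forall>z\<in>A. u z \<le> S * exp (- \<kappa>)" "z \<in> V p"
    obtain \<zeta> where \<zeta>: "\<zeta> \<in> ball 0 (1/6)" "z = \<tau> p \<zeta>" using *(4) unfolding V_def by blast
    define Q where "Q = exp (\<C> p * real D)"
    have Q: "Q > 0" by (simp add: Q_def)
    obtain g where g: "g holomorphic_on ball 0 1"
      "\<And>\<zeta>. \<zeta> \<in> ball 0 1 \<Longrightarrow> u (\<tau> p \<zeta>) \<le> Q * norm (g \<zeta>) \<and> norm (g \<zeta>) \<le> Q * u (\<tau> p \<zeta>)"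
      using rep[OF *(1), of p] unfolding Q_def by blast
    have "\<forall>z\<in>ball 0 (1/6). norm (g z) \<le> 2 * (Q * S) * exp (- (\<delta> * \<kappa>))"
    proof (rule d(2)[OF g(1) _ *(2)])
      show "\<forall>z\<in>ball 0 1. norm (g z) \<le> Q * S"
        using g(2) sec[OF *(1)] Q by (meson mult_left_mono less_imp_le order_trans)
      show "\<forall>z\<in>cball a \<eta>. norm (g z) \<le> Q * S * exp (- \<kappa>)"
      proof
        fix w assume w: "w \<in> cball a \<eta>"
        have "u (\<tau> p w) \<le> S * exp (- \<kappa>)" using *(3) eta(3) w by blast
        then have "Q * u (\<tau> p w) \<le> Q * (S * exp (- \<kappa>))" using Q by (intro mult_left_mono) auto
        moreover have "norm (g w) \<le> Q * u (\<tau> p w)" using g(2) w sub by blast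
        ultimately show "norm (g w) \<le> Q * S * exp (- \<kappa>)" by (simp add: mult.assoc)
      qed
    qed
    then have "norm (g \<zeta>) \<le> 2 * (Q * S) * exp (- (\<delta> * \<kappa>))" using \<zeta>(1) by blast
    then have "Q * norm (g \<zeta>) \<le> Q * (2 * (Q * S) * exp (- (\<delta> * \<kappa>)))" using Q by (intro mult_left_mono) auto
    moreover have "u z \<le> Q * norm (g \<zeta>)" using g(2)[of \<zeta>] \<zeta> by auto
    ultimately have "u z \<le> 2 * (Q * Q * S * exp (- (\<delta> * \<kappa>)))" by (simp add: ac_simps)
    \<comment> \<open>The factor 2 of the disc estimate is paid by the degree, since 2 \<le> 1 + D
      \<le> exp D.\<close>
    also have "\<dots> \<le> exp (real D) * (Q * Q * S * exp (- (\<delta> * \<kappa>)))"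
    proof (rule mult_right_mono)
      have "1 + real D \<le> exp (real D)" by (rule exp_ge_add_one_self)
      moreover have "real D \<ge> 1" using sec[OF *(1)] by simp
      ultimately show "2 \<le> exp (real D)" by linarith
    qed (use sec[OF *(1)] Q in auto)
    also have "\<dots> = S * exp ((2 * \<C> p + 1) * real D - \<delta> * \<kappa>)"
    proof -
      have "exp (real D) * Q * Q * exp (- (\<delta> * \<kappa>)) = exp ((2 * \<C> p + 1) * real D - \<delta> * \<kappa>)"
        unfolding Q_def mult_exp_exp by (simp add: algebra_simps)
      then have "S * (exp (real D) * Q * Q * exp (- (\<delta> * \<kappa>))) = S * exp ((2 * \<C> p + 1) * real D - \<delta> * \<kappa>)"
        by simp
      then show ?thesis by (simp only: ac_simps)
    qed
    finally show "u z \<le> S * exp ((2 * \<C> p + 1) * real D - \<delta> * \<kappa>)" .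
  qed
  then show ?thesis unfolding carries_def using d(1) C0[of p] by (intro exI[of _ \<delta>] conjI exI[of _ "2 * \<C> p + 1"]) auto
qed

text \<open>Overlapping discs carry smallness to each other through their intersection. Carrying in
  both directions is an equivalence relation with open classes, and connectedness leaves a single
  class.\<close>

lemma carries_V: "carries (V p) (V q)"
proof -
  have loc: "carries (V p) (V q)" if "V p \<inter> V q \<noteq> {}" for p q
    using carries_trans[OF carries_subset[of "V p \<inter> V q" "V p"] carries_local[of "V p \<inter> V q" q]] that
    by (simp add: open_V open_Int)
  have "carries (V p) (V q) \<and> carries (V q) (V p)"
  proof (rule connected_equivalence_relation[OF conn, of p q])
    fix x :: 'm
    show "\<exists>T. openin (top_of_set UNIV) T \<and> x \<in> T \<and> (\<forall>y\<in>T. carries (V x) (V y) \<and> carries (V y) (V x))"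
    proof (intro exI[of _ "V x"] conjI ballI)
      fix y assume "y \<in> V x"
      then have "V x \<inter> V y \<noteq> {}" "V y \<inter> V x \<noteq> {}" using p_in_V by blast+
      then show "carries (V x) (V y)" "carries (V y) (V x)" using loc by blast+
    qed (use open_V p_in_V in auto)
  qed (use carries_trans in blast)+
  then show ?thesis by simp
qed

lemma zeros_local:
  assumes "(D, S, u) \<in> \<S>" "finite Z" "Z \<subseteq> V p" "\<And>z. z \<in> Z \<Longrightarrow> u z = 0" "z \<in> V p"
  shows "u z \<le> S * exp (2 * \<C> p * real D - ln 2 * real (card Z))"
proof -
  define Q where "Q = exp (\<C> p * real D)"
  have Q: "Q > 0" by (simp add: Q_def)
  obtain g where g: "g holomorphic_on ball 0 1"
    "\<And>\<zeta>. \<zeta> \<in> ball 0 1 \<Longrightarrow> u (\<tau> p \<zeta>) \<le> Q * norm (g \<zeta>) \<and> norm (g \<zeta>) \<le> Q * u (\<tau> p \<zeta>)"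
    using rep[OF assms(1), of p] unfolding Q_def by blast
  define Y where "Y = ball 0 (1/6) \<inter> \<tau> p -` Z"
  have injb: "inj_on (\<tau> p) (ball 0 (1/6))" by (rule inj_on_subset[OF inj]) auto
  have YZ: "\<tau> p ` Y = Z" using assms(3) unfolding Y_def V_def by auto
  have injY: "inj_on (\<tau> p) Y" using injb unfolding Y_def by (rule inj_on_subset) auto
  have finY: "finite Y" using YZ assms(2) injY finite_image_iff by metis
  have cY: "card Y = card Z" using card_image[OF injY] YZ by simp
  obtain \<zeta> where \<zeta>: "\<zeta> \<in> ball 0 (1/6)" "z = \<tau> p \<zeta>" using assms(5) unfolding V_def by blast
  have "norm (g \<zeta>) \<le> (Q * S) * (1/2) ^ card Y"
  proof (rule disc_zeros_bound[OF g(1) _ finY _ _ \<zeta>(1)])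
    show "norm (g z) \<le> Q * S" if "z \<in> ball 0 1" for z
      using g(2)[OF that] sec[OF assms(1)] Q by (meson mult_left_mono less_imp_le order_trans)
    show "Y \<subseteq> ball 0 (1/6)" by (auto simp: Y_def)
    show "g y = 0" if "y \<in> Y" for y
      using g(2)[of y] assms(4)[of "\<tau> p y"] that by (auto simp: Y_def)
  qed
  then have "Q * norm (g \<zeta>) \<le> Q * (Q * S * (1/2) ^ card Z)" using Q cY by (intro mult_left_mono) auto
  moreover have "u z \<le> Q * norm (g \<zeta>)" using g(2)[of \<zeta>] \<zeta> by auto
  moreover have "Q * (Q * S * (1/2) ^ card Z) = S * exp (2 * \<C> p * real D - ln 2 * real (card Z))"
  proof -
    have "exp (ln 2 * real (card Z)) = 2 ^ card Z" by (simp add: exp_of_nat_mult mult.commute)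
    moreover have "Q * Q = exp (2 * \<C> p * real D)" unfolding Q_def by (simp flip: exp_add)
    ultimately show ?thesis by (simp add: exp_diff power_one_over field_simps)
  qed
  ultimately show ?thesis by simp
qed

lemma finite_uniform:
  fixes P :: "'i \<Rightarrow> real \<Rightarrow> real \<Rightarrow> bool"
  assumes "finite I" "\<And>i. i \<in> I \<Longrightarrow> \<exists>\<delta>>0. \<exists>C\<ge>0. P i \<delta> C"
    and mono: "\<And>i \<delta> C \<delta>' C'. P i \<delta> C \<Longrightarrow> \<delta>' \<le> \<delta> \<Longrightarrow> C \<le> C' \<Longrightarrow> P i \<delta>' C'"
  shows "\<exists>\<delta>>0. \<exists>C\<ge>0. \<forall>i\<in>I. P i \<delta> C"
  using assms(1,2)
proof (induction I)
  case empty then show ?case by (intro exI[of _ 1]) auto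
next
  case (insert i I)
  obtain d c where 1: "d > 0" "c \<ge> 0" "\<forall>i\<in>I. P i d c" using insert by auto
  obtain d' c' where 2: "d' > 0" "c' \<ge> 0" "P i d' c'" using insert.prems[OF insertI1] by blast
  have "\<forall>i\<in>insert i I. P i (min d d') (max c c')" using 1 2 mono by auto
  then show ?case using 1 2 by (intro exI[of _ "min d d'"] conjI exI[of _ "max c c'"]) auto
qed

text \<open>Finitely many discs cover \<open>K\<close>; one of them contains a fixed proportion of
  the zeros, the function is small there, and smallness spreads to the other discs.\<close>

theorem zeros_bound:
  assumes K: "compact K"
  shows "\<exists>c>0. \<exists>C\<ge>0. \<forall>(D, S, u)\<in>\<S>. \<forall>Z. finite Z \<longrightarrow> Z \<subseteq> K \<longrightarrow> (\<forall>z\<in>Z. u z = 0) \<longrightarrow>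
     (\<forall>z\<in>K. u z \<le> S * exp (C * real D - c * real (card Z)))"
proof -
  obtain F where F: "finite F" "K \<subseteq> (\<Union>p\<in>F. V p)"
    by (rule compactE_image[OF K, of UNIV V]) (auto intro: open_V p_in_V)
  have "\<exists>\<delta>>0. \<exists>C\<ge>0. \<forall>i\<in>F \<times> F. propagates \<delta> C (V (fst i)) (V (snd i))"
  proof (rule finite_uniform)
    show "\<exists>\<delta>>0. \<exists>C\<ge>0. propagates \<delta> C (V (fst i)) (V (snd i))" for i
      using carries_V[of "fst i" "snd i"] unfolding carries_def .
  qed (use F(1) propagates_mono in auto)
  then obtain \<delta> C1 where 1: "\<delta> > 0" "C1 \<ge> 0" "\<forall>i\<in>F \<times> F. propagates \<delta> C1 (V (fst i)) (V (snd i))"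
    by blast
  define C2 where "C2 = (\<Sum>p\<in>F. 2 * \<C> p)"
  have C2: "C2 \<ge> 0" "\<And>p. p \<in> F \<Longrightarrow> 2 * \<C> p \<le> C2" unfolding C2_def using C0 F(1)
    by (auto intro!: sum_nonneg member_le_sum)
  \<comment> \<open>The summand 1 keeps \<open>n\<close> positive when the cover is empty.\<close>
  define n where "n = real (card F) + 1"
  have n: "n > 0" by (simp add: n_def)
  have "u z \<le> S * exp ((C1 + \<delta> * C2) * real D - \<delta> * (ln 2 / n) * real (card Z))"
    if *: "(D, S, u) \<in> \<S>" "finite Z" "Z \<subseteq> K" "\<forall>z\<in>Z. u z = 0" "z \<in> K" for D S u Z z
  proof -
    obtain q where q: "q \<in> F" "z \<in> V q" using F(2) *(5) by blast
    have "\<exists>p\<in>F. real (card Z) \<le> n * real (card (Z \<inter> V p))"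
    proof (rule ccontr)
      assume a: "\<not> ?thesis"
      have ne: "F \<noteq> {}" using q by blast
      have "card Z \<le> (\<Sum>p\<in>F. card (Z \<inter> V p))"
        using card_UN_le[OF F(1), of "\<lambda>p. Z \<inter> V p"] F(2) *(3) by (metis Int_UN_distrib Int_absorb2 order_trans)
      then have "n * real (card Z) \<le> (\<Sum>p\<in>F. n * real (card (Z \<inter> V p)))"
        using n by (simp flip: sum_distrib_left of_nat_sum)
      also have "\<dots> < (\<Sum>p\<in>F. real (card Z))" using a F(1) ne by (intro sum_strict_mono) auto
      also have "\<dots> \<le> n * real (card Z)" by (simp add: n_def algebra_simps)
      finally show False by simp
    qed
    then obtain p where p: "p \<in> F" "real (card Z) \<le> n * real (card (Z \<inter> V p))" by blast
    define \<kappa> where "\<kappa> = max 0 (ln 2 / n * real (card Z) - C2 * real D)"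
    have "u w \<le> S * exp (- \<kappa>)" if w: "w \<in> V p" for w
    proof (cases "ln 2 / n * real (card Z) - C2 * real D \<ge> 0")
      case True
      have "u w \<le> S * exp (2 * \<C> p * real D - ln 2 * real (card (Z \<inter> V p)))"
        by (rule zeros_local[OF *(1)]) (use * w in auto)
      also have "\<dots> \<le> S * exp (- \<kappa>)"
      proof -
        have "2 * \<C> p * real D \<le> C2 * real D" using C2(2)[OF p(1)] by (intro mult_right_mono) auto
        moreover have "real (card Z) / n \<le> real (card (Z \<inter> V p))" using p(2) n by (simp add: field_simps)
        then have "ln 2 * (real (card Z) / n) \<le> ln 2 * real (card (Z \<inter> V p))" by (intro mult_left_mono) auto
        moreover have "- \<kappa> = C2 * real D - ln 2 * (real (card Z) / n)" using True by (simp add: \<kappa>_def max_def)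
        ultimately have "2 * \<C> p * real D - ln 2 * real (card (Z \<inter> V p)) \<le> - \<kappa>" by linarith
        then show ?thesis using sec[OF *(1)] by (intro mult_left_mono) auto
      qed
      finally show ?thesis .
    next
      case False then show ?thesis using sec[OF *(1)] by (simp add: \<kappa>_def max_def)
    qed
    moreover have "\<kappa> \<ge> 0" by (simp add: \<kappa>_def)
    moreover have "propagates \<delta> C1 (V p) (V q)" using 1(3) p(1) q(1) by auto
    ultimately have "u z \<le> S * exp (C1 * real D - \<delta> * \<kappa>)" using *(1) q(2) unfolding propagates_def by blast
    also have "\<dots> \<le> S * exp ((C1 + \<delta> * C2) * real D - \<delta> * (ln 2 / n) * real (card Z))"
    proof -
      have "\<delta> * (ln 2 / n * real (card Z) - C2 * real D) \<le> \<delta> * \<kappa>" unfolding \<kappa>_def using 1(1) by (intro mult_left_mono) auto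
      then show ?thesis using sec[OF *(1)] by (intro mult_left_mono) (auto simp: algebra_simps)
    qed
    finally show ?thesis .
  qed
  moreover have "\<delta> * (ln 2 / n) > 0" "C1 + \<delta> * C2 \<ge> 0" using 1 C2 n by auto
  ultimately show ?thesis
    by (intro exI[of _ "\<delta> * (ln 2 / n)"] conjI exI[of _ "C1 + \<delta> * C2"]) (auto simp del: times_divide_eq_right)
qed

end

section \<open>Forms on projective varieties\<close>

definition mon :: "(nat \<Rightarrow>\<^sub>0 nat) \<Rightarrow> (nat \<Rightarrow> complex) \<Rightarrow> complex" where
  "mon m v = (\<Prod>i\<in>Poly_Mapping.keys m. v i ^ Poly_Mapping.lookup m i)"

lemma mon_superset:
  assumes "finite A" "Poly_Mapping.keys m \<subseteq> A"
  shows "mon m v = (\<Prod>i\<in>A. v i ^ Poly_Mapping.lookup m i)"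
  unfolding mon_def using assms by (intro prod.mono_neutral_left) (auto simp: in_keys_iff)

lemma mon_add: "mon (m + n) v = mon m v * mon n v"
proof -
  let ?A = "Poly_Mapping.keys m \<union> Poly_Mapping.keys n"
  have "mon (m + n) v = (\<Prod>i\<in>?A. v i ^ Poly_Mapping.lookup (m + n) i)"
    by (rule mon_superset) (use keys_add[of m n] in auto)
  also have "\<dots> = mon m v * mon n v"
    using mon_superset[of ?A m v] mon_superset[of ?A n v] by (simp add: lookup_add power_add prod.distrib)
  finally show ?thesis .
qed

lemma poly_eval_mon: "poly_eval p v = (\<Sum>m\<in>Poly_Mapping.keys p. Poly_Mapping.lookup p m * mon m v)"
  by (simp add: poly_eval_def mon_def)

lemma poly_eval_superset:
  assumes "finite A" "Poly_Mapping.keys p \<subseteq> A"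
  shows "poly_eval p v = (\<Sum>m\<in>A. Poly_Mapping.lookup p m * mon m v)"
  unfolding poly_eval_mon using assms by (intro sum.mono_neutral_left) (auto simp: in_keys_iff)

lemma poly_eval_add: "poly_eval (p + q) v = poly_eval p v + poly_eval q v"
proof -
  let ?A = "Poly_Mapping.keys p \<union> Poly_Mapping.keys q"
  have "poly_eval (p + q) v = (\<Sum>m\<in>?A. Poly_Mapping.lookup (p + q) m * mon m v)"
    by (rule poly_eval_superset) (use keys_add[of p q] in auto)
  also have "\<dots> = poly_eval p v + poly_eval q v"
    using poly_eval_superset[of ?A p v] poly_eval_superset[of ?A q v] by (simp add: lookup_add distrib_right sum.distrib)
  finally show ?thesis .
qed

lemma poly_eval_0 [simp]: "poly_eval 0 v = 0" by (simp add: poly_eval_def)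

lemma poly_eval_sum: "poly_eval (sum f A) v = (\<Sum>i\<in>A. poly_eval (f i) v)"
  by (induction A rule: infinite_finite_induct) (auto simp: poly_eval_add)

lemma poly_eval_single: "poly_eval (Poly_Mapping.single m c) v = c * mon m v"
  by (cases "c = 0") (auto simp: poly_eval_mon)

lemma sum_singles: "p = (\<Sum>m\<in>Poly_Mapping.keys p. Poly_Mapping.single m (Poly_Mapping.lookup p m))"
proof (rule poly_mapping_eqI)
  fix k
  show "Poly_Mapping.lookup p k = Poly_Mapping.lookup (\<Sum>m\<in>Poly_Mapping.keys p. Poly_Mapping.single m (Poly_Mapping.lookup p m)) k"
    by (simp add: lookup_sum lookup_single when_def in_keys_iff sum.delta')
qed

lemma mult_singles:
  fixes p q :: cpoly
  shows "p * q = (\<Sum>m\<in>Poly_Mapping.keys p. \<Sum>n\<in>Poly_Mapping.keys q.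
    Poly_Mapping.single (m + n) (Poly_Mapping.lookup p m * Poly_Mapping.lookup q n))"
proof -
  have "p * q = (\<Sum>m\<in>Poly_Mapping.keys p. Poly_Mapping.single m (Poly_Mapping.lookup p m)) *
     (\<Sum>n\<in>Poly_Mapping.keys q. Poly_Mapping.single n (Poly_Mapping.lookup q n))"
    using sum_singles[of p] sum_singles[of q] by simp
  then show ?thesis by (simp add: sum_product mult_single)
qed

lemma poly_eval_mult: "poly_eval (p * q) v = poly_eval p v * poly_eval q v"
proof -
  have "poly_eval (p * q) v = (\<Sum>m\<in>Poly_Mapping.keys p. \<Sum>n\<in>Poly_Mapping.keys q.
      Poly_Mapping.lookup p m * Poly_Mapping.lookup q n * mon (m + n) v)"
    by (subst mult_singles) (simp only: poly_eval_sum poly_eval_single)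
  also have "\<dots> = poly_eval p v * poly_eval q v"
    unfolding poly_eval_mon[of p] poly_eval_mon[of q] sum_product by (simp add: mon_add ac_simps)
  finally show ?thesis .
qed

definition subring :: "complex set \<Rightarrow> bool" where
  "subring F \<longleftrightarrow> 0 \<in> F \<and> 1 \<in> F \<and> (\<forall>x\<in>F. \<forall>y\<in>F. x + y \<in> F \<and> x * y \<in> F)"

lemma subring_sum: "subring F \<Longrightarrow> (\<And>i. i \<in> A \<Longrightarrow> f i \<in> F) \<Longrightarrow> sum f A \<in> F"
  by (induction A rule: infinite_finite_induct) (auto simp: subring_def)

lemma subring_prod: "subring F \<Longrightarrow> (\<And>i. i \<in> A \<Longrightarrow> f i \<in> F) \<Longrightarrow> prod f A \<in> F"
  by (induction A rule: infinite_finite_induct) (auto simp: subring_def)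

lemma subring_power: "subring F \<Longrightarrow> x \<in> F \<Longrightarrow> x ^ k \<in> F"
  by (induction k) (auto simp: subring_def)

text \<open>Forms as functions of the coordinate vector: products, compositions and zero sets are
  then those of functions, and only the existence of a representing polynomial over \<open>F\<close>
  is recorded.\<close>

definition hform :: "complex set \<Rightarrow> nat \<Rightarrow> nat \<Rightarrow> ((nat \<Rightarrow> complex) \<Rightarrow> complex) \<Rightarrow> bool" where
  "hform F N d f \<longleftrightarrow> (\<exists>p. homogeneous F N d p \<and> f = poly_eval p)"

lemma hform_mono: "F \<subseteq> F' \<Longrightarrow> hform F N d f \<Longrightarrow> hform F' N d f"
  unfolding hform_def homogeneous_def by blast

lemma hform_0: "hform F N d (\<lambda>v. 0)"
  unfolding hform_def by (intro exI[of _ 0]) (auto simp: homogeneous_def)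

lemma hform_add:
  assumes "subring F" "hform F N d f" "hform F N d g" shows "hform F N d (\<lambda>v. f v + g v)"
proof -
  obtain p q where p: "homogeneous F N d p" "f = poly_eval p" and q: "homogeneous F N d q" "g = poly_eval q"
    using assms(2,3) unfolding hform_def by blast
  have cf: "Poly_Mapping.lookup s m \<in> F" if "homogeneous F N d s" for s m
    using that assms(1) unfolding homogeneous_def subring_def by (cases "m \<in> Poly_Mapping.keys s") (auto simp: in_keys_iff)
  have "homogeneous F N d (p + q)"
    unfolding homogeneous_def
  proof
    fix m assume "m \<in> Poly_Mapping.keys (p + q)"
    then have "m \<in> Poly_Mapping.keys p \<or> m \<in> Poly_Mapping.keys q" using keys_add[of p q] by auto
    moreover have "Poly_Mapping.lookup (p + q) m \<in> F"
      using cf[OF p(1)] cf[OF q(1)] assms(1) by (simp add: lookup_add subring_def)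
    ultimately show "Poly_Mapping.lookup (p + q) m \<in> F \<and> Poly_Mapping.keys m \<subseteq> {..N} \<and> sum (Poly_Mapping.lookup m) (Poly_Mapping.keys m) = d"
      using p(1) q(1) unfolding homogeneous_def by auto
  qed
  then show ?thesis unfolding hform_def using p(2) q(2) by (intro exI[of _ "p + q"]) (auto simp: poly_eval_add)
qed

lemma keys_add_degree:
  "(\<Sum>i\<in>Poly_Mapping.keys (m + n). Poly_Mapping.lookup (m + n) i)
    = (\<Sum>i\<in>Poly_Mapping.keys m. Poly_Mapping.lookup m i) + (\<Sum>i\<in>Poly_Mapping.keys n. Poly_Mapping.lookup n (i::nat) :: nat)"
proof -
  let ?A = "Poly_Mapping.keys m \<union> Poly_Mapping.keys n"
  have s: "(\<Sum>i\<in>Poly_Mapping.keys k. Poly_Mapping.lookup k i) = (\<Sum>i\<in>?A. Poly_Mapping.lookup k i)"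
    if "Poly_Mapping.keys k \<subseteq> ?A" for k
    using that by (intro sum.mono_neutral_left) (auto simp: in_keys_iff)
  show ?thesis using s[of m] s[of n] s[of "m + n"] keys_add[of m n] by (simp add: lookup_add sum.distrib)
qed

lemma hform_mult:
  assumes "subring F" "hform F N d f" "hform F N d' g" shows "hform F N (d + d') (\<lambda>v. f v * g v)"
proof -
  obtain p q where p: "homogeneous F N d p" "f = poly_eval p" and q: "homogeneous F N d' q" "g = poly_eval q"
    using assms(2,3) unfolding hform_def by blast
  have "homogeneous F N (d + d') (p * q)"
    unfolding homogeneous_def
  proof
    fix k assume "k \<in> Poly_Mapping.keys (p * q)"
    then obtain m n where mn: "k = m + n" "m \<in> Poly_Mapping.keys p" "n \<in> Poly_Mapping.keys q"
      using keys_mult[of p q] by blast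
    have "Poly_Mapping.lookup (p * q) k \<in> F"
      unfolding mult_singles lookup_sum
    proof (intro subring_sum[OF assms(1)])
      fix m n assume "m \<in> Poly_Mapping.keys p" "n \<in> Poly_Mapping.keys q"
      then have "Poly_Mapping.lookup p m * Poly_Mapping.lookup q n \<in> F"
        using p(1) q(1) assms(1) unfolding homogeneous_def subring_def by blast
      then show "Poly_Mapping.lookup (Poly_Mapping.single (m + n) (Poly_Mapping.lookup p m * Poly_Mapping.lookup q n)) k \<in> F"
        using assms(1) by (auto simp: lookup_single when_def subring_def)
    qed
    moreover have "Poly_Mapping.keys k \<subseteq> {..N}"
      using keys_add[of m n] mn p(1) q(1) unfolding homogeneous_def by fastforce
    moreover have "sum (Poly_Mapping.lookup k) (Poly_Mapping.keys k) = d + d'"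
      using keys_add_degree[of m n] mn p(1) q(1) unfolding homogeneous_def by simp
    ultimately show "Poly_Mapping.lookup (p * q) k \<in> F \<and> Poly_Mapping.keys k \<subseteq> {..N} \<and> sum (Poly_Mapping.lookup k) (Poly_Mapping.keys k) = d + d'"
      by blast
  qed
  then show ?thesis unfolding hform_def using p(2) q(2) by (intro exI[of _ "p * q"]) (auto simp: poly_eval_mult)
qed

lemma hform_const: "c \<in> F \<Longrightarrow> hform F N 0 (\<lambda>v. c)"
  unfolding hform_def
  by (intro exI[of _ "Poly_Mapping.single 0 c"]) (auto simp: homogeneous_def poly_eval_single mon_def)

lemma hform_coord: "subring F \<Longrightarrow> i \<le> N \<Longrightarrow> hform F N 1 (\<lambda>v. v i)"
  unfolding hform_def
  by (intro exI[of _ "Poly_Mapping.single (Poly_Mapping.single i 1) 1"])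
     (auto simp: homogeneous_def poly_eval_single mon_def subring_def)

lemma hform_power: "subring F \<Longrightarrow> hform F N d f \<Longrightarrow> hform F N (d * k) (\<lambda>v. f v ^ k)"
proof (induction k)
  case 0 then show ?case using hform_const[of 1 F N] by (simp add: subring_def)
next
  case (Suc k) then show ?case using hform_mult[of F N d f "d * k" "\<lambda>v. f v ^ k"] by simp
qed

lemma hform_sum: "subring F \<Longrightarrow> (\<And>i. i \<in> A \<Longrightarrow> hform F N d (f i)) \<Longrightarrow> hform F N d (\<lambda>v. \<Sum>i\<in>A. f i v)"
  by (induction A rule: infinite_finite_induct) (auto simp: hform_0 intro: hform_add)

lemma hform_prod:
  assumes "subring F" "finite A" "\<And>i. i \<in> A \<Longrightarrow> hform F N (d i) (f i)"
  shows "hform F N (sum d A) (\<lambda>v. \<Prod>i\<in>A. f i v)"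
  using assms(2,3)
proof (induction A)
  case empty then show ?case using hform_const[of 1 F N] assms(1) by (simp add: subring_def)
next
  case (insert i A) then show ?case using assms(1) hform_mult[of F N "d i" "f i" "sum d A" "\<lambda>v. \<Prod>i\<in>A. f i v"] by simp
qed

lemma hform_cmult: "subring F \<Longrightarrow> c \<in> F \<Longrightarrow> hform F N d f \<Longrightarrow> hform F N d (\<lambda>v. c * f v)"
  using hform_mult[OF _ hform_const, of F c N d f] by simp

lemma hform_scale:
  assumes "hform F N d f" shows "f (\<lambda>i. c * v i) = c ^ d * f v"
proof -
  obtain p where p: "homogeneous F N d p" "f = poly_eval p" using assms unfolding hform_def by blast
  have "mon m (\<lambda>i. c * v i) = c ^ d * mon m v" if "m \<in> Poly_Mapping.keys p" for m
  proof -
    have "(\<Prod>i\<in>Poly_Mapping.keys m. c ^ Poly_Mapping.lookup m i) = c ^ d"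
      using p(1) that unfolding homogeneous_def by (simp flip: power_sum)
    then show ?thesis by (simp add: mon_def power_mult_distrib prod.distrib)
  qed
  then show ?thesis unfolding p(2) poly_eval_mon sum_distrib_left by (intro sum.cong) (auto simp: ac_simps)
qed

lemma hform_degree_0:
  assumes "hform F N 0 f" shows "f v = f w"
  using hform_scale[OF assms, of 0 v] hform_scale[OF assms, of 0 w] by simp

lemma hform_expand:
  assumes "hform F N d f"
  shows "\<exists>K c. finite K \<and> (\<forall>m\<in>K. c m \<in> F) \<and> (\<forall>m\<in>K. Poly_Mapping.keys m \<subseteq> {..N}) \<and>
    (\<forall>m\<in>K. sum (Poly_Mapping.lookup m) (Poly_Mapping.keys m) = d) \<and>
    (\<forall>v. f v = (\<Sum>m\<in>K. c m * (\<Prod>i\<in>Poly_Mapping.keys m. v i ^ Poly_Mapping.lookup m i)))"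
proof -
  obtain p where p: "homogeneous F N d p" "f = poly_eval p" using assms unfolding hform_def by blast
  show ?thesis
    by (rule exI[of _ "Poly_Mapping.keys p"], rule exI[of _ "Poly_Mapping.lookup p"]) (use p in \<open>auto simp: homogeneous_def poly_eval_def\<close>)
qed

lemma hform_compose:
  assumes F: "subring F" and g: "hform F r d' g" and P: "\<And>j. j \<le> r \<Longrightarrow> hform F N d (P j)"
  shows "hform F N (d * d') (\<lambda>v. g (\<lambda>j. if j \<le> r then P j v else 0))"
proof -
  obtain K c where K': "finite K" "\<forall>m\<in>K. c m \<in> F" "\<forall>m\<in>K. Poly_Mapping.keys m \<subseteq> {..r}"
    "\<forall>m\<in>K. sum (Poly_Mapping.lookup m) (Poly_Mapping.keys m) = d'"
    "\<forall>v. g v = (\<Sum>m\<in>K. c m * (\<Prod>i\<in>Poly_Mapping.keys m. v i ^ Poly_Mapping.lookup m i))"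
    using hform_expand[OF g] by (elim exE conjE)
  note K = K'(1) K'(2-5)[rule_format]
  have "hform F N (d * d') (\<lambda>v. \<Sum>m\<in>K. c m * (\<Prod>i\<in>Poly_Mapping.keys m. P i v ^ Poly_Mapping.lookup m i))"
  proof (intro hform_sum[OF F] hform_cmult[OF F K(2)])
    fix m assume m: "m \<in> K"
    have "hform F N (\<Sum>i\<in>Poly_Mapping.keys m. d * Poly_Mapping.lookup m i) (\<lambda>v. \<Prod>i\<in>Poly_Mapping.keys m. P i v ^ Poly_Mapping.lookup m i)"
      by (rule hform_prod[OF F]) (use K(3)[OF m] P hform_power[OF F] in auto)
    then show "hform F N (d * d') (\<lambda>v. \<Prod>i\<in>Poly_Mapping.keys m. P i v ^ Poly_Mapping.lookup m i)"
      using K(4)[OF m] by (simp flip: sum_distrib_left)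
  qed
  moreover have "g (\<lambda>j. if j \<le> r then P j v else 0) = (\<Sum>m\<in>K. c m * (\<Prod>i\<in>Poly_Mapping.keys m. P i v ^ Poly_Mapping.lookup m i))" for v
    unfolding K(5) using K(3) by (intro sum.cong refl arg_cong2[where f = times] prod.cong) auto
  ultimately show ?thesis by simp
qed

section \<open>Projective points, Zariski closed sets and morphisms\<close>

lemma proj_class_self: "v \<in> proj_class v"
  unfolding proj_class_def by (intro CollectI exI[of _ 1]) auto

lemma proj_class_mem: "w \<in> proj_class v \<longleftrightarrow> (\<exists>c. c \<noteq> 0 \<and> w = (\<lambda>i. c * v i))"
  unfolding proj_class_def by blast

lemma proj_class_eq: assumes "w \<in> proj_class v" shows "proj_class w = proj_class v"
proof -
  obtain c where c: "c \<noteq> 0" "w = (\<lambda>i. c * v i)" using assms proj_class_mem by blast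
  show ?thesis
  proof (intro Set.set_eqI iffI)
    fix u assume "u \<in> proj_class w"
    then obtain b where "b \<noteq> 0" "u = (\<lambda>i. b * w i)" using proj_class_mem by blast
    then show "u \<in> proj_class v" unfolding proj_class_mem using c by (intro exI[of _ "b * c"]) auto
  next
    fix u assume "u \<in> proj_class v"
    then obtain b where "b \<noteq> 0" "u = (\<lambda>i. b * v i)" using proj_class_mem by blast
    then show "u \<in> proj_class w" unfolding proj_class_mem using c by (intro exI[of _ "b / c"]) auto
  qed
qed

lemma proj_space_mem:
  assumes "x \<in> proj_space N" "v \<in> x"
  shows "x = proj_class v" "\<exists>i\<le>N. v i \<noteq> 0" "i > N \<Longrightarrow> v i = 0"
proof -
  obtain w where w: "x = proj_class w" "\<exists>i. w i \<noteq> 0" "\<forall>i>N. w i = 0" using assms(1) unfolding proj_space_def by blast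
  obtain c where c: "c \<noteq> 0" "v = (\<lambda>i. c * w i)" using assms(2) w(1) proj_class_mem by blast
  show "x = proj_class v" using proj_class_eq[of v w] assms(2) w(1) by simp
  show "i > N \<Longrightarrow> v i = 0" using c w(3) by simp
  show "\<exists>i\<le>N. v i \<noteq> 0" using c w(2,3) by (metis mult_eq_0_iff not_le)
qed

lemma proj_space_nonempty: "x \<in> proj_space N \<Longrightarrow> \<exists>v. v \<in> x"
  unfolding proj_space_def using proj_class_self by blast

lemma proj_class_in_space: "\<exists>i\<le>N. v i \<noteq> 0 \<Longrightarrow> (\<And>i. i > N \<Longrightarrow> v i = 0) \<Longrightarrow> proj_class v \<in> proj_space N"
  unfolding proj_space_def by blast

lemma hform_zero_class:
  assumes "hform F N d f" "x \<in> proj_space N'" "v \<in> x" "w \<in> x" shows "f v = 0 \<longleftrightarrow> f w = 0"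
proof -
  obtain c where c: "c \<noteq> 0" "w = (\<lambda>i. c * v i)" using assms(4) proj_space_mem(1)[OF assms(2,3)] proj_class_mem by blast
  then show ?thesis using hform_scale[OF assms(1), of c v] by simp
qed

definition zeros :: "nat \<Rightarrow> ((nat \<Rightarrow> complex) \<Rightarrow> complex) set \<Rightarrow> ppoint set" where
  "zeros N S = {x \<in> proj_space N. \<forall>f\<in>S. \<forall>v\<in>x. f v = 0}"

lemma zerosD: "x \<in> zeros N S \<Longrightarrow> f \<in> S \<Longrightarrow> v \<in> x \<Longrightarrow> f v = 0"
  by (simp add: zeros_def)

lemma zariski_closed_iff: "zariski_closed F N Z \<longleftrightarrow> (\<exists>S. (\<forall>f\<in>S. \<exists>d. hform F N d f) \<and> Z = zeros N S)"
proof
  assume "zariski_closed F N Z"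
  then obtain S where "\<forall>p\<in>S. \<exists>d. homogeneous F N d p" "Z = {x \<in> proj_space N. \<forall>p\<in>S. \<forall>v\<in>x. poly_eval p v = 0}"
    unfolding zariski_closed_def by blast
  then show "\<exists>S. (\<forall>f\<in>S. \<exists>d. hform F N d f) \<and> Z = zeros N S"
    by (intro exI[of _ "poly_eval ` S"] conjI) (unfold hform_def, blast, simp add: zeros_def)
next
  assume "\<exists>S. (\<forall>f\<in>S. \<exists>d. hform F N d f) \<and> Z = zeros N S"
  then obtain S where S: "\<forall>f\<in>S. \<exists>d. hform F N d f" "Z = zeros N S" by blast
  define S' where "S' = {p. (\<exists>d. homogeneous F N d p) \<and> poly_eval p \<in> S}"
  have "zeros N S = {x \<in> proj_space N. \<forall>p\<in>S'. \<forall>v\<in>x. poly_eval p v = 0}"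
  proof (intro Set.set_eqI iffI)
    fix x assume x: "x \<in> {x \<in> proj_space N. \<forall>p\<in>S'. \<forall>v\<in>x. poly_eval p v = 0}"
    have "f v = 0" if fv: "f \<in> S" "v \<in> x" for f v
    proof -
      obtain d p where "homogeneous F N d p" "f = poly_eval p" using S(1) fv(1) unfolding hform_def by blast
      then show ?thesis using x fv unfolding S'_def by blast
    qed
    then show "x \<in> zeros N S" using x by (simp add: zeros_def)
  qed (auto simp: zeros_def S'_def)
  then show "zariski_closed F N Z" unfolding zariski_closed_def using S(2) by (intro exI[of _ S']) (auto simp: S'_def)
qed

lemma zariski_closed_form: "hform F N d f \<Longrightarrow> zariski_closed F N (zeros N {f})"
  unfolding zariski_closed_iff by (intro exI[of _ "{f}"]) auto

lemma zariski_closed_mono: "F \<subseteq> F' \<Longrightarrow> zariski_closed F N Z \<Longrightarrow> zariski_closed F' N Z"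
  unfolding zariski_closed_iff
proof (elim exE conjE)
  fix S assume "F \<subseteq> F'" "\<forall>f\<in>S. \<exists>d. hform F N d f" "Z = zeros N S"
  then show "\<exists>S. (\<forall>f\<in>S. \<exists>d. hform F' N d f) \<and> Z = zeros N S"
    by (intro exI[of _ S] conjI ballI) (use hform_mono[of F F' N] in fast)+
qed

lemma zariski_closed_subset: "zariski_closed F N Z \<Longrightarrow> Z \<subseteq> proj_space N"
  unfolding zariski_closed_def by blast

lemma zariski_closed_Inter:
  assumes "\<And>Z. Z \<in> \<Z> \<Longrightarrow> zariski_closed F N Z"
  shows "zariski_closed F N (proj_space N \<inter> \<Inter>\<Z>)"
proof -
  have "\<forall>Z\<in>\<Z>. \<exists>S. (\<forall>f\<in>S. \<exists>d. hform F N d f) \<and> Z = zeros N S" using assms unfolding zariski_closed_iff by blast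
  then obtain S where S: "\<And>Z. Z \<in> \<Z> \<Longrightarrow> (\<forall>f\<in>S Z. \<exists>d. hform F N d f)" "\<And>Z. Z \<in> \<Z> \<Longrightarrow> Z = zeros N (S Z)" by metis
  have "proj_space N \<inter> \<Inter>\<Z> = zeros N (\<Union>Z\<in>\<Z>. S Z)"
  proof (intro Set.set_eqI iffI)
    fix x assume "x \<in> proj_space N \<inter> \<Inter>\<Z>"
    then have x: "x \<in> proj_space N" "\<And>Z. Z \<in> \<Z> \<Longrightarrow> x \<in> zeros N (S Z)" using S(2) by blast+
    then show "x \<in> zeros N (\<Union>Z\<in>\<Z>. S Z)" unfolding zeros_def by blast
  next
    fix x assume x: "x \<in> zeros N (\<Union>Z\<in>\<Z>. S Z)"
    then have "x \<in> zeros N (S Z)" if "Z \<in> \<Z>" for Z using that unfolding zeros_def by blast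
    then show "x \<in> proj_space N \<inter> \<Inter>\<Z>" using S(2) x unfolding zeros_def by blast
  qed
  then show ?thesis unfolding zariski_closed_iff using S(1) by (intro exI[of _ "\<Union>Z\<in>\<Z>. S Z"]) auto
qed

lemma zariski_closed_Un:
  assumes F: "subring F" and "zariski_closed F N Z1" "zariski_closed F N Z2"
  shows "zariski_closed F N (Z1 \<union> Z2)"
proof -
  obtain S1 where S1: "\<forall>f\<in>S1. \<exists>d. hform F N d f" "Z1 = zeros N S1" using assms(2) unfolding zariski_closed_iff by blast
  obtain S2 where S2: "\<forall>f\<in>S2. \<exists>d. hform F N d f" "Z2 = zeros N S2" using assms(3) unfolding zariski_closed_iff by blast
  define S where "S = {\<lambda>v. f v * g v | f g. f \<in> S1 \<and> g \<in> S2}"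
  have "\<forall>f\<in>S. \<exists>d. hform F N d f" unfolding S_def using S1(1) S2(1) hform_mult[OF F] by blast
  moreover have "Z1 \<union> Z2 = zeros N S"
  proof (intro Set.set_eqI iffI)
    fix x assume "x \<in> Z1 \<union> Z2" then show "x \<in> zeros N S" unfolding S1 S2 S_def zeros_def by auto
  next
    fix x assume x: "x \<in> zeros N S"
    then have xp: "x \<in> proj_space N" by (simp add: zeros_def)
    show "x \<in> Z1 \<union> Z2"
    proof (rule ccontr)
      assume "x \<notin> Z1 \<union> Z2"
      then obtain f v g w where fg: "f \<in> S1" "v \<in> x" "f v \<noteq> 0" "g \<in> S2" "w \<in> x" "g w \<noteq> 0"
        unfolding S1 S2 zeros_def using xp by blast
      obtain d where "hform F N d g" using S2(1) fg(4) by blast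
      then have "g v \<noteq> 0" using hform_zero_class[OF _ xp fg(2,5)] fg(6) by blast
      then have "f v * g v \<noteq> 0" using fg(3) by simp
      moreover have "(\<lambda>v. f v * g v) \<in> S" unfolding S_def using fg(1,4) by blast
      moreover have "k v = 0" if "k \<in> S" for k using x that fg(2) unfolding zeros_def by blast
      ultimately show False by blast
    qed
  qed
  ultimately show ?thesis unfolding zariski_closed_iff by blast
qed

definition pv :: "nat \<Rightarrow> (nat \<Rightarrow> cpoly) \<Rightarrow> (nat \<Rightarrow> complex) \<Rightarrow> nat \<Rightarrow> complex" where
  "pv r P v = (\<lambda>j. if j \<le> r then poly_eval (P j) v else 0)"

lemma proj_morphism_local:
  assumes "proj_morphism F N X r f" "x \<in> X"
  shows "\<exists>Z P d. zariski_closed F N Z \<and> x \<notin> Z \<and> (\<forall>j\<le>r. hform F N d (poly_eval (P j))) \<and>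
    (\<forall>y v. y \<in> X \<longrightarrow> y \<notin> Z \<longrightarrow> v \<in> y \<longrightarrow> (\<exists>j\<le>r. pv r P v j \<noteq> 0) \<and> f y = proj_class (pv r P v))"
proof -
  obtain W P d where W: "zariski_open_in F N X W" "x \<in> W" "\<forall>j\<le>r. homogeneous F N d (P j)"
    "\<forall>y\<in>W. \<forall>v\<in>y. (\<exists>j\<le>r. poly_eval (P j) v \<noteq> 0) \<and> f y = proj_class (\<lambda>j. if j \<le> r then poly_eval (P j) v else 0)"
    using bspec[OF assms(1)[unfolded proj_morphism_def] assms(2)] by (elim exE conjE)
  obtain Z where Z: "zariski_closed F N Z" "W = X - Z" using W(1) unfolding zariski_open_in_def by blast
  show ?thesis
  proof (rule exI[of _ Z], rule exI[of _ P], rule exI[of _ d], intro conjI allI impI Z(1))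
    show "x \<notin> Z" using W(2) Z(2) by blast
    show "hform F N d (poly_eval (P j))" if "j \<le> r" for j using W(3) that unfolding hform_def by blast
    fix y v assume a: "y \<in> X" "y \<notin> Z" "v \<in> y"
    have yW: "y \<in> W" using a Z(2) by blast
    have *: "(\<exists>j\<le>r. poly_eval (P j) v \<noteq> 0) \<and> f y = proj_class (pv r P v)"
      using bspec[OF bspec[OF W(4) yW] a(3)] unfolding pv_def .
    then show "\<exists>j\<le>r. pv r P v j \<noteq> 0" by (auto simp: pv_def)
    show "f y = proj_class (pv r P v)" using * by simp
  qed
qed

lemma proj_morphism_in_space:
  assumes "proj_morphism F N X r f" "x \<in> X" "X \<subseteq> proj_space N"
  shows "f x \<in> proj_space r"
proof -
  obtain Z P d where Z: "zariski_closed F N Z" "x \<notin> Z" "\<forall>j\<le>r. hform F N d (poly_eval (P j))"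
    "\<forall>y v. y \<in> X \<longrightarrow> y \<notin> Z \<longrightarrow> v \<in> y \<longrightarrow> (\<exists>j\<le>r. pv r P v j \<noteq> 0) \<and> f y = proj_class (pv r P v)"
    using proj_morphism_local[OF assms(1,2)] by (elim exE conjE)
  note * = Z(2) Z(4)[rule_format]
  obtain v where "v \<in> x" using proj_space_nonempty assms(2,3) by blast
  then have "\<exists>j\<le>r. pv r P v j \<noteq> 0" "f x = proj_class (pv r P v)" using *(2)[OF assms(2) *(1)] by auto
  then show ?thesis using proj_class_in_space[of r "pv r P v"] by (auto simp: pv_def)
qed

text \<open>Closedness is local on \<open>X\<close>: on each chart of the morphism the preimage is cut out by the
  composed forms, and off the chart nothing is required.\<close>

lemma zariski_closed_preimage:
  assumes F: "subring F" and f: "proj_morphism F N X r f" and X: "zariski_closed F N X" and Z: "zariski_closed F r Z"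
  shows "zariski_closed F N {x \<in> X. f x \<in> Z}"
proof -
  obtain S where S: "\<forall>g\<in>S. \<exists>d. hform F r d g" "Z = zeros r S" using Z unfolding zariski_closed_iff by blast
  \<comment> \<open>The preimage is the intersection of all closed sets containing it, provided that
    each point of \<open>X\<close> outside is missed by one of them.\<close>
  define good where "good B \<longleftrightarrow> zariski_closed F N B \<and> {x \<in> X. f x \<in> Z} \<subseteq> B" for B
  have ex: "\<exists>B. good B \<and> (x \<in> B \<longrightarrow> f x \<in> Z)" if x: "x \<in> X" for x
  proof -
    obtain Z' P d where Z': "zariski_closed F N Z'" "x \<notin> Z'" "\<forall>j\<le>r. hform F N d (poly_eval (P j))"
      "\<forall>y v. y \<in> X \<longrightarrow> y \<notin> Z' \<longrightarrow> v \<in> y \<longrightarrow> (\<exists>j\<le>r. pv r P v j \<noteq> 0) \<and> f y = proj_class (pv r P v)"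
      using proj_morphism_local[OF f x] by (elim exE conjE)
    note * = Z'(1,2) Z'(3)[rule_format] Z'(4)[rule_format]
    define A where "A = zeros N {\<lambda>v. g (pv r P v) | g. g \<in> S}"
    have "zariski_closed F N A" unfolding A_def zariski_closed_iff
    proof (intro exI[of _ "{\<lambda>v. g (pv r P v) | g. g \<in> S}"] conjI refl ballI)
      fix k assume "k \<in> {\<lambda>v. g (pv r P v) | g. g \<in> S}"
      then obtain g d' where "k = (\<lambda>v. g (pv r P v))" "hform F r d' g" using S(1) by blast
      then show "\<exists>d. hform F N d k" using hform_compose[OF F, of r d' g N d "\<lambda>j. poly_eval (P j)"] *(3) unfolding pv_def by blast
    qed
    then have cl: "zariski_closed F N (A \<union> Z')" using zariski_closed_Un[OF F] *(1) by blast
    have mem: "f y \<in> Z \<longleftrightarrow> y \<in> A" if y: "y \<in> X" "y \<notin> Z'" for y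
    proof
      assume "f y \<in> Z"
      have "g (pv r P v) = 0" if "g \<in> S" "v \<in> y" for g v
        using \<open>f y \<in> Z\<close> *(4)[OF y that(2)] that(1) proj_class_self unfolding S(2) zeros_def by blast
      then show "y \<in> A" unfolding A_def zeros_def using y(1) zariski_closed_subset[OF X] by auto
    next
      assume "y \<in> A"
      obtain v where v: "v \<in> y" using proj_space_nonempty y(1) zariski_closed_subset[OF X] by blast
      have "g u = 0" if g: "g \<in> S" "u \<in> f y" for g u
      proof -
        obtain c where c: "u = (\<lambda>i. c * pv r P v i)" using *(4)[OF y v] g(2) proj_class_mem by blast
        obtain d' where "hform F r d' g" using S(1) g(1) by blast
        then have "g u = c ^ d' * g (pv r P v)" unfolding c by (rule hform_scale)
        also have "g (pv r P v) = 0"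
        proof -
          have "k v = 0" if "k \<in> {\<lambda>v. g (pv r P v) | g. g \<in> S}" for k
            using zerosD[OF \<open>y \<in> A\<close>[unfolded A_def] that v] .
          moreover have "(\<lambda>v. g (pv r P v)) \<in> {\<lambda>v. g (pv r P v) | g. g \<in> S}"
            using g(1) by (intro CollectI exI[of _ g] conjI refl)
          ultimately show ?thesis .
        qed
        finally show ?thesis by simp
      qed
      then show "f y \<in> Z" unfolding S(2) zeros_def
        using proj_morphism_in_space[OF f y(1) zariski_closed_subset[OF X]] by blast
    qed
    have "{y \<in> X. f y \<in> Z} \<subseteq> A \<union> Z'" using mem by blast
    moreover have "x \<in> A \<union> Z' \<longrightarrow> f x \<in> Z" using mem[OF x *(2)] *(2) by blast
    ultimately show ?thesis unfolding good_def using cl by (intro exI[of _ "A \<union> Z'"]) simp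
  qed
  have "{x \<in> X. f x \<in> Z} = proj_space N \<inter> \<Inter>(insert X {B. good B})"
  proof (intro equalityI subsetI)
    fix x assume "x \<in> {x \<in> X. f x \<in> Z}"
    then show "x \<in> proj_space N \<inter> \<Inter>(insert X {B. good B})"
      using zariski_closed_subset[OF X] by (auto simp: good_def)
  next
    fix x assume x: "x \<in> proj_space N \<inter> \<Inter>(insert X {B. good B})"
    then have xX: "x \<in> X" by simp
    obtain B where "good B" "x \<in> B \<longrightarrow> f x \<in> Z" using ex[OF xX] by (elim exE conjE)
    then show "x \<in> {x \<in> X. f x \<in> Z}" using x xX by simp
  qed
  then show ?thesis using zariski_closed_Inter[of "insert X {B. good B}" F N] X unfolding good_def by auto
qed

text \<open>The forms live on the target of \<open>\<psi>\<close> while irreducibility is known in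
  the source, so their zero sets are pulled back.\<close>

lemma variety_irreducible_forms:
  assumes F: "subring F" and f: "proj_morphism F N X r \<psi>" and X: "zariski_closed F N X"
    and Z: "projective_variety F N Z" "Z \<subseteq> X" and g: "hform F r d g" and h: "hform F r d' h"
    and van: "\<And>x v. x \<in> Z \<Longrightarrow> v \<in> \<psi> x \<Longrightarrow> g v * h v = 0"
  shows "(\<forall>x\<in>Z. \<forall>v\<in>\<psi> x. g v = 0) \<or> (\<forall>x\<in>Z. \<forall>v\<in>\<psi> x. h v = 0)"
proof -
  have sp: "\<psi> x \<in> proj_space r" if "x \<in> Z" for x
    using proj_morphism_in_space[OF f _ zariski_closed_subset[OF X]] that Z(2) by blast
  have cg: "zariski_closed F N {x \<in> X. \<psi> x \<in> zeros r {g}}" and ch: "zariski_closed F N {x \<in> X. \<psi> x \<in> zeros r {h}}"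
    using zariski_closed_preimage[OF F f X zariski_closed_form] g h by blast+
  have "Z \<subseteq> {x \<in> X. \<psi> x \<in> zeros r {g}} \<union> {x \<in> X. \<psi> x \<in> zeros r {h}}"
  proof
    fix x assume x: "x \<in> Z"
    obtain v where v: "v \<in> \<psi> x" using proj_space_nonempty[OF sp[OF x]] by blast
    have "g v = 0 \<or> h v = 0" using van[OF x v] by simp
    then have "(\<forall>w\<in>\<psi> x. g w = 0) \<or> (\<forall>w\<in>\<psi> x. h w = 0)"
      using hform_zero_class[OF g sp[OF x] v] hform_zero_class[OF h sp[OF x] v] by blast
    then show "x \<in> {x \<in> X. \<psi> x \<in> zeros r {g}} \<union> {x \<in> X. \<psi> x \<in> zeros r {h}}"
      using x Z(2) sp[OF x] unfolding zeros_def by auto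
  qed
  then have "Z \<subseteq> {x \<in> X. \<psi> x \<in> zeros r {g}} \<or> Z \<subseteq> {x \<in> X. \<psi> x \<in> zeros r {h}}"
    using Z(1) cg ch unfolding projective_variety_def by blast
  then show ?thesis unfolding zeros_def by blast
qed

section \<open>Independent forms from a chain of subvarieties\<close>

lemma variety_chain:
  assumes "variety_dim F N X = enat n" "n > 0"
  shows "\<exists>Z. (\<forall>i\<le>n. projective_variety F N (Z i) \<and> Z i \<subseteq> X) \<and> (\<forall>i<n. Z i \<subset> Z (Suc i))"
proof -
  define A where "A = {enat d | d. \<exists>Z. (\<forall>i\<le>d. projective_variety F N (Z i) \<and> Z i \<subseteq> X) \<and> (\<forall>i<d. Z i \<subset> Z (Suc i))}"
  have S: "Sup A = enat n" using assms(1) by (simp add: variety_dim_def A_def)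
  \<comment> \<open>A bounded set of extended naturals is finite, so its supremum is attained;
    \<open>n > 0\<close> excludes the empty set, whose supremum is 0.\<close>
  have "A \<subseteq> enat ` {..n}"
  proof
    fix a assume a: "a \<in> A"
    then have "a \<le> Sup A" by (rule Sup_upper)
    then show "a \<in> enat ` {..n}" using a S by (auto simp: A_def)
  qed
  then have fin: "finite A" by (rule finite_subset) simp
  have ne: "A \<noteq> {}"
  proof
    assume "A = {}"
    then have "enat n = 0" using S by (simp add: bot_enat_def)
    then show False using assms(2) by (simp add: zero_enat_def)
  qed
  have "Max A \<in> A" using fin ne by (rule Max_in)
  moreover have "Sup A = Max A" using fin ne by (simp add: Sup_enat_def)
  ultimately have "enat n \<in> A" using S by simp
  then show ?thesis unfolding A_def by auto
qed

text \<open>A chain \<open>Z 0 \<subset> \<dots> \<subset> Z n\<close> produces forms \<open>f i\<close> that vanish on \<open>Z (i - 1)\<close> but not on \<open>Z i\<close>.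
  They are algebraically independent on \<open>Z n\<close>: a relation is divided by the largest power of
  \<open>f n\<close> and then restricted to \<open>Z (n - 1)\<close>.\<close>

locale form_chain =
  fixes F :: "complex set" and N r :: nat and X :: "ppoint set" and \<psi> :: "ppoint \<Rightarrow> ppoint"
    and Z :: "nat \<Rightarrow> ppoint set" and n e :: nat and f :: "nat \<Rightarrow> (nat \<Rightarrow> complex) \<Rightarrow> complex"
  assumes F: "subring F" and mor: "proj_morphism F N X r \<psi>" and X: "zariski_closed F N X"
    and Z: "\<And>i. i \<le> n \<Longrightarrow> projective_variety F N (Z i)" "\<And>i. i \<le> n \<Longrightarrow> Z i \<subseteq> X" "\<And>i. i < n \<Longrightarrow> Z i \<subseteq> Z (Suc i)"
    and f: "\<And>i. i \<le> n \<Longrightarrow> hform F r e (f i)"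
    and nv: "\<And>i. i \<le> n \<Longrightarrow> \<exists>x\<in>Z i. \<exists>v\<in>\<psi> x. f i v \<noteq> 0"
    and van: "\<And>i x v. i < n \<Longrightarrow> x \<in> Z i \<Longrightarrow> v \<in> \<psi> x \<Longrightarrow> f (Suc i) v = 0"
begin

text \<open>\<open>f 0\<close> homogenises a monomial in the other forms to degree \<open>D\<close>.
  The subtraction is truncated, so the exponents have to sum to at most \<open>D\<close>.\<close>

definition mono :: "nat \<Rightarrow> nat \<Rightarrow> (nat \<Rightarrow> nat) \<Rightarrow> (nat \<Rightarrow> complex) \<Rightarrow> complex" where
  "mono j D k v = f 0 v ^ (D - sum k {1..j}) * (\<Prod>i\<in>{1..j}. f i v ^ k i)"

lemma mono_hform:
  assumes "j \<le> n" "sum k {1..j} \<le> D"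
  shows "hform F r (e * D) (mono j D k)"
proof -
  have "hform F r (\<Sum>i\<in>{1..j}. e * k i) (\<lambda>v. \<Prod>i\<in>{1..j}. f i v ^ k i)"
    by (rule hform_prod[OF F]) (use assms(1) f hform_power[OF F] in auto)
  then have "hform F r (e * (D - sum k {1..j}) + e * sum k {1..j}) (mono j D k)"
    unfolding mono_def sum_distrib_left[symmetric] by (intro hform_mult[OF F] hform_power[OF F] f) auto
  moreover have "e * (D - sum k {1..j}) + e * sum k {1..j} = e * D"
    using assms(2) by (simp flip: distrib_left)
  ultimately show ?thesis by simp
qed

lemma forms_independent:
  assumes "j \<le> n" "finite L" "\<And>k. k \<in> L \<Longrightarrow> sum k {1..j} \<le> D" "\<And>k. k \<in> L \<Longrightarrow> c k \<in> F"
    "\<And>k i. k \<in> L \<Longrightarrow> i \<notin> {1..j} \<Longrightarrow> k i = 0" "\<exists>k\<in>L. c k \<noteq> 0"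
  shows "\<exists>x\<in>Z j. \<exists>v\<in>\<psi> x. (\<Sum>k\<in>L. c k * mono j D k v) \<noteq> 0"
  using assms
proof (induction j arbitrary: L D c)
  case 0
  have "k = (\<lambda>_. 0)" if "k \<in> L" for k using 0(5)[OF that] by auto
  then have L: "L = {\<lambda>_. 0}" using 0(6) by blast
  then have "c (\<lambda>_. 0) \<noteq> 0" using 0(6) by auto
  then show ?case using nv[of 0] by (auto simp: L mono_def)
next
  case (Suc j)
  define L' where "L' = {k \<in> L. c k \<noteq> 0}"
  have L': "finite L'" "L' \<noteq> {}" using Suc.prems by (auto simp: L'_def)
  \<comment> \<open>The largest power of the last form that divides all terms of the relation;
    \<open>red\<close> removes it.\<close>
  define t where "t = Min ((\<lambda>k. k (Suc j)) ` L')"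
  have t: "t \<le> k (Suc j)" if "k \<in> L'" for k unfolding t_def using that L' by (intro Min_le) auto
  have "t \<in> (\<lambda>k. k (Suc j)) ` L'" unfolding t_def using L' by (intro Min_in) auto
  then obtain k0 where k0: "k0 \<in> L'" "k0 (Suc j) = t" by blast
  have le: "sum k {1..Suc j} \<le> D" if "k \<in> L'" for k using Suc.prems(3) that by (simp add: L'_def)
  have tD: "t \<le> D" using le[OF k0(1)] k0(2) by (simp add: sum.atLeast_Suc_atMost)
  define red where "red k = k(Suc j := k (Suc j) - t)" for k :: "nat \<Rightarrow> nat"
  have sr: "sum (red k) {1..Suc j} = sum k {1..Suc j} - t" "sum (red k) {1..Suc j} \<le> D - t" if k: "k \<in> L'" for k
  proof -
    have "sum (red k) {1..j} = sum k {1..j}" by (intro sum.cong) (auto simp: red_def)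
    then have 1: "sum (red k) {1..Suc j} = sum k {1..j} + (k (Suc j) - t)" by (simp add: red_def)
    then show "sum (red k) {1..Suc j} = sum k {1..Suc j} - t" using t[OF k] by simp
    then show "sum (red k) {1..Suc j} \<le> D - t" using le[OF k] by simp
  qed
  define H where "H v = (\<Sum>k\<in>L'. c k * mono (Suc j) (D - t) (red k) v)" for v
  have Hf: "hform F r (e * (D - t)) H" unfolding H_def
  proof (intro hform_sum[OF F] hform_cmult[OF F] mono_hform)
    fix k assume k: "k \<in> L'"
    show "c k \<in> F" using k Suc.prems(4) by (simp add: L'_def)
    show "sum (red k) {1..Suc j} \<le> D - t" by (rule sr(2)[OF k])
  qed (use Suc.prems(1) in simp)
  have factor: "mono (Suc j) D k v = f (Suc j) v ^ t * mono (Suc j) (D - t) (red k) v" if k: "k \<in> L'" for k v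
  proof -
    have "D - t - sum (red k) {1..Suc j} = D - sum k {1..Suc j}" using sr(1)[OF k] t[OF k] by simp
    moreover have "(\<Prod>i\<in>{1..j}. f i v ^ red k i) = (\<Prod>i\<in>{1..j}. f i v ^ k i)" by (intro prod.cong) (auto simp: red_def)
    moreover have "f (Suc j) v ^ t * f (Suc j) v ^ red k (Suc j) = f (Suc j) v ^ k (Suc j)"
      using t[OF k] by (simp add: red_def flip: power_add)
    ultimately show ?thesis unfolding mono_def by (simp add: mult.left_commute[of "f (Suc j) v ^ t"])
  qed
  have G: "(\<Sum>k\<in>L. c k * mono (Suc j) D k v) = f (Suc j) v ^ t * H v" for v
  proof -
    have "(\<Sum>k\<in>L. c k * mono (Suc j) D k v) = (\<Sum>k\<in>L'. c k * mono (Suc j) D k v)"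
      using Suc.prems(2) by (intro sum.mono_neutral_right) (auto simp: L'_def)
    also have "\<dots> = (\<Sum>k\<in>L'. f (Suc j) v ^ t * (c k * mono (Suc j) (D - t) (red k) v))"
      by (intro sum.cong refl) (simp add: factor)
    finally show ?thesis by (simp add: H_def sum_distrib_left)
  qed
  show ?case
  proof (rule ccontr)
    assume "\<not> ?case"
    then have zero: "f (Suc j) v ^ t * H v = 0" if "x \<in> Z (Suc j)" "v \<in> \<psi> x" for x v using that G by metis
    \<comment> \<open>Irreducibility cancels the power of \<open>f (Suc j)\<close>, which does not
      vanish identically on this member of the chain.\<close>
    have "(\<forall>x\<in>Z (Suc j). \<forall>v\<in>\<psi> x. f (Suc j) v ^ t = 0) \<or> (\<forall>x\<in>Z (Suc j). \<forall>v\<in>\<psi> x. H v = 0)"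
      by (rule variety_irreducible_forms[OF F mor X Z(1,2)[OF Suc.prems(1)] hform_power[OF F f[OF Suc.prems(1)]] Hf zero])
    moreover have "\<not> (\<forall>x\<in>Z (Suc j). \<forall>v\<in>\<psi> x. f (Suc j) v ^ t = 0)" using nv[OF Suc.prems(1)] by auto
    ultimately have Hz: "H v = 0" if "x \<in> Z (Suc j)" "v \<in> \<psi> x" for x v using that by blast
    \<comment> \<open>On \<open>Z j\<close> the last form vanishes, so only the terms from which the
      t-th power removes it completely survive; \<open>cut\<close> and \<open>rest\<close> translate
      their exponents to and from those of a relation among fewer forms.\<close>
    define L0 where "L0 = {k \<in> L'. k (Suc j) = t}"
    define cut where "cut k = k(Suc j := 0)" for k :: "nat \<Rightarrow> nat"
    define rest where "rest k = k(Suc j := t)" for k :: "nat \<Rightarrow> nat"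
    have rc: "rest (cut k) = k" if "k \<in> L0" for k using that by (auto simp: rest_def cut_def L0_def)
    then have inj: "inj_on cut L0" by (auto intro: inj_on_inverseI)
    have "\<exists>x\<in>Z j. \<exists>v\<in>\<psi> x. (\<Sum>k\<in>cut ` L0. c (rest k) * mono j (D - t) k v) \<noteq> 0"
    proof (rule Suc.IH)
      show "j \<le> n" using Suc.prems(1) by simp
      show "finite (cut ` L0)" using L'(1) by (simp add: L0_def)
      show "\<exists>k\<in>cut ` L0. c (rest k) \<noteq> 0" using k0 rc by (auto simp: L0_def L'_def)
      fix k assume "k \<in> cut ` L0"
      then obtain k' where k': "k' \<in> L0" "k = cut k'" by blast
      have k'L: "k' \<in> L'" "k' \<in> L" using k'(1) by (auto simp: L0_def L'_def)
      show "c (rest k) \<in> F" using rc[OF k'(1)] k' k'L Suc.prems(4) by simp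
      have "sum k {1..j} = sum k' {1..j}" unfolding k'(2) by (intro sum.cong) (auto simp: cut_def)
      then show "sum k {1..j} \<le> D - t" using le[OF k'L(1)] k'(1) by (simp add: L0_def)
      show "k i = 0" if "i \<notin> {1..j}" for i
        using Suc.prems(5)[OF k'L(2), of i] that by (cases "i = Suc j") (auto simp: k'(2) cut_def)
    qed
    then obtain x v where xv: "x \<in> Z j" "v \<in> \<psi> x" "(\<Sum>k\<in>cut ` L0. c (rest k) * mono j (D - t) k v) \<noteq> 0" by blast
    have fz: "f (Suc j) v = 0" using van[of j x v] Suc.prems(1) xv by simp
    have "H v = (\<Sum>k\<in>L0. c k * mono (Suc j) (D - t) (red k) v)"
      unfolding H_def
    proof (rule sum.mono_neutral_right[OF L'(1)])
      show "\<forall>k\<in>L' - L0. c k * mono (Suc j) (D - t) (red k) v = 0"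
      proof
        fix k assume k: "k \<in> L' - L0"
        then have "red k (Suc j) > 0" using t[of k] by (auto simp: L0_def red_def)
        then show "c k * mono (Suc j) (D - t) (red k) v = 0" by (simp add: mono_def fz)
      qed
    qed (auto simp: L0_def)
    also have "\<dots> = (\<Sum>k\<in>L0. c (rest (cut k)) * mono j (D - t) (cut k) v)"
    proof (intro sum.cong refl)
      fix k assume k: "k \<in> L0"
      have "red k = cut k" using k by (auto simp: red_def cut_def L0_def)
      moreover have "mono (Suc j) (D - t) (cut k) v = mono j (D - t) (cut k) v" by (simp add: mono_def cut_def)
      ultimately show "c k * mono (Suc j) (D - t) (red k) v = c (rest (cut k)) * mono j (D - t) (cut k) v"
        using rc[OF k] by simp
    qed
    also have "\<dots> = (\<Sum>k\<in>cut ` L0. c (rest k) * mono j (D - t) k v)"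
      by (simp add: sum.reindex[OF inj])
    finally have "H v \<noteq> 0" using xv(3) by simp
    moreover have "x \<in> Z (Suc j)" using Z(3)[of j] Suc.prems(1) xv(1) by auto
    ultimately show False using Hz xv(2) by blast
  qed
qed

end

text \<open>The image of each member of the chain is closed in the target, being a preimage under
  the inverse morphism, so one of its equations fails somewhere on the next member. Powers bring
  these equations to the common degree \<open>e\<close>, the product of their degrees.\<close>

lemma form_chain_exists:
  assumes F: "subring F" and X: "zariski_closed F N X" and dim: "variety_dim F N X = enat n" "n > 0"
    and ci: "closed_immersion F N X r \<psi>"
  obtains Z e f where "e > 0" "form_chain F N r X \<psi> Z n e f"
proof -
  have mor: "proj_morphism F N X r \<psi>" and inj: "inj_on \<psi> X" and Y: "zariski_closed F r (\<psi> ` X)"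
    and inv: "proj_morphism F r (\<psi> ` X) N (inv_into X \<psi>)" using ci unfolding closed_immersion_def by auto
  obtain Z where Z': "\<forall>i\<le>n. projective_variety F N (Z i) \<and> Z i \<subseteq> X" "\<forall>i<n. Z i \<subset> Z (Suc i)"
    using variety_chain[OF dim] by (elim exE conjE)
  have Z: "\<And>i. i \<le> n \<Longrightarrow> projective_variety F N (Z i)" "\<And>i. i \<le> n \<Longrightarrow> Z i \<subseteq> X" "\<And>i. i < n \<Longrightarrow> Z i \<subset> Z (Suc i)"
    using Z' by auto
  have sp: "\<psi> x \<in> proj_space r" if "x \<in> X" for x
    using proj_morphism_in_space[OF mor that zariski_closed_subset[OF X]] .
  define good where "good i d g \<longleftrightarrow> d > 0 \<and> hform F r d g \<and> (\<exists>x\<in>Z i. \<exists>v\<in>\<psi> x. g v \<noteq> 0) \<and>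
    (i > 0 \<longrightarrow> (\<forall>x\<in>Z (i - 1). \<forall>v\<in>\<psi> x. g v = 0))" for i d g
  have "\<exists>d g. good i d g" if i: "i \<le> n" for i
  proof (cases i)
    case 0
    obtain x where x: "x \<in> Z 0" using Z(1)[of 0] unfolding projective_variety_def by blast
    then have px: "\<psi> x \<in> proj_space r" using sp Z(2)[of 0] by blast
    obtain v where v: "v \<in> \<psi> x" using proj_space_nonempty[OF px] by blast
    obtain j where "j \<le> r" "v j \<noteq> 0" using proj_space_mem(2)[OF px v] by blast
    then show ?thesis unfolding good_def using hform_coord[OF F, of j r] x v 0
      by (intro exI[of _ 1] exI[of _ "\<lambda>v. v j"]) auto
  next
    case (Suc k)
    have k: "k < n" "k \<le> n" using i Suc by auto
    have "zariski_closed F N (Z k)" using Z(1)[OF k(2)] unfolding projective_variety_def by blast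
    then have "zariski_closed F r {y \<in> \<psi> ` X. inv_into X \<psi> y \<in> Z k}"
      by (rule zariski_closed_preimage[OF F inv Y])
    then obtain S where S: "\<forall>g\<in>S. \<exists>d. hform F r d g" "{y \<in> \<psi> ` X. inv_into X \<psi> y \<in> Z k} = zeros r S"
      unfolding zariski_closed_iff by blast
    obtain x where x: "x \<in> Z i" "x \<notin> Z k" using Z(3)[OF k(1)] Suc by blast
    have xX: "x \<in> X" using Z(2)[OF i] x by blast
    have "\<psi> x \<notin> zeros r S" unfolding S(2)[symmetric] using inv_into_f_f[OF inj xX] x(2) by simp
    then obtain g v where g: "g \<in> S" "v \<in> \<psi> x" "g v \<noteq> 0" unfolding zeros_def using sp[OF xX] by blast
    have zk: "g w = 0" if "y \<in> Z k" "w \<in> \<psi> y" for y w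
    proof -
      have yX: "y \<in> X" using Z(2)[OF k(2)] that(1) by blast
      then have "\<psi> y \<in> zeros r S" unfolding S(2)[symmetric] using inv_into_f_f[OF inj yX] that(1) by simp
      then show ?thesis using g(1) that(2) unfolding zeros_def by blast
    qed
    obtain d where d: "hform F r d g" using S(1) g(1) by blast
    \<comment> \<open>A form of degree 0 is constant, and this one vanishes somewhere but not
      everywhere.\<close>
    have "d \<noteq> 0"
    proof
      assume "d = 0"
      obtain y where y: "y \<in> Z k" using Z(1)[OF k(2)] unfolding projective_variety_def by blast
      then obtain w where "w \<in> \<psi> y" using proj_space_nonempty[OF sp] Z(2)[OF k(2)] by blast
      then have "g w = 0" using zk y by blast
      then show False using hform_degree_0[of F r g v w] d \<open>d = 0\<close> g(3) by simp
    qed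
    then show ?thesis unfolding good_def using d x(1) g zk Suc by (intro exI[of _ d] exI[of _ g]) auto
  qed
  then obtain d g where dg: "\<And>i. i \<le> n \<Longrightarrow> good i (d i) (g i)" by metis
  define e where "e = (\<Prod>i\<le>n. d i)"
  have epos: "e > 0" unfolding e_def using dg by (intro prod_pos) (auto simp: good_def)
  define f where "f i v = g i v ^ (e div d i)" for i v
  have ed: "d i * (e div d i) = e" if "i \<le> n" for i
    unfolding e_def using that by (intro dvd_mult_div_cancel dvd_prodI) auto
  have edpos: "e div d i > 0" if "i \<le> n" for i using ed[OF that] epos by (metis mult_0_right not_gr_zero)
  have "form_chain F N r X \<psi> Z n e f"
  proof
    fix i assume i: "i \<le> n"
    note gi = dg[OF i, unfolded good_def]
    show "hform F r e (f i)" unfolding f_def using hform_power[OF F, of r "d i" "g i" "e div d i"] gi ed[OF i] by simp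
    obtain x v where "x \<in> Z i" "v \<in> \<psi> x" "g i v \<noteq> 0" using gi by blast
    then show "\<exists>x\<in>Z i. \<exists>v\<in>\<psi> x. f i v \<noteq> 0" by (intro bexI[of _ x] bexI[of _ v]) (auto simp: f_def)
  next
    fix i x v assume "i < n" "x \<in> Z i" "v \<in> \<psi> x"
    then show "f (Suc i) v = 0" using dg[of "Suc i"] edpos[of "Suc i"] by (auto simp: good_def f_def)
  next
    fix i assume "i < n"
    then show "Z i \<subseteq> Z (Suc i)" using Z(3)[of i] by blast
  qed (use F mor X Z(1,2) in auto)
  then show ?thesis using that epos by blast
qed

section \<open>Forms on a holomorphic curve\<close>

definition vmax :: "nat \<Rightarrow> (nat \<Rightarrow> complex) \<Rightarrow> real" where
  "vmax r v = Max ((\<lambda>j. cmod (v j)) ` {..r})"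

lemma vmax_ge: "j \<le> r \<Longrightarrow> cmod (v j) \<le> vmax r v"
  unfolding vmax_def by (rule Max_ge) auto

lemma vmax_le: "(\<And>j. j \<le> r \<Longrightarrow> cmod (v j) \<le> B) \<Longrightarrow> vmax r v \<le> B"
  unfolding vmax_def by (rule Max.boundedI) auto

lemma vmax_nonneg: "vmax r v \<ge> 0"
  using vmax_ge[of 0 r v] norm_ge_zero[of "v 0"] by linarith

lemma vmax_scale: "vmax r (\<lambda>i. c * v i) = cmod c * vmax r v"
proof -
  have "(\<lambda>j. cmod (c * v j)) ` {..r} = (\<lambda>t. cmod c * t) ` ((\<lambda>j. cmod (v j)) ` {..r})"
    by (auto simp: norm_mult image_image)
  moreover have "Max ((\<lambda>t. cmod c * t) ` ((\<lambda>j. cmod (v j)) ` {..r})) = cmod c * Max ((\<lambda>j. cmod (v j)) ` {..r})"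
    by (rule mono_Max_commute[symmetric]) (auto simp: mono_def mult_left_mono)
  ultimately show ?thesis by (simp add: vmax_def)
qed

lemma vmax_pos: "\<exists>i\<le>r. v i \<noteq> 0 \<Longrightarrow> vmax r v > 0"
  using vmax_ge by (metis less_le_trans zero_less_norm_iff)

lemma poly_eval_holomorphic:
  assumes "\<And>i. (\<lambda>\<zeta>. h i \<zeta>) holomorphic_on S"
  shows "(\<lambda>\<zeta>. poly_eval p (\<lambda>i. h i \<zeta>)) holomorphic_on S"
  unfolding poly_eval_def by (intro holomorphic_intros assms)

lemma hform_holomorphic:
  assumes "hform F N d g" "\<And>i. (\<lambda>\<zeta>. h i \<zeta>) holomorphic_on S"
  shows "(\<lambda>\<zeta>. g (\<lambda>i. h i \<zeta>)) holomorphic_on S"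
  using assms(1) poly_eval_holomorphic[OF assms(2)] unfolding hform_def by auto

definition affine_vec :: "nat \<Rightarrow> nat \<Rightarrow> ppoint \<Rightarrow> nat \<Rightarrow> complex" where
  "affine_vec N i x = (\<lambda>j. if j \<le> N then affine_coord i j x else 0)"

lemma affine_vec_mem:
  assumes "x \<in> standard_chart N i"
  shows "affine_vec N i x \<in> x"
proof -
  have x: "x \<in> proj_space N" "\<And>v. v \<in> x \<Longrightarrow> v i \<noteq> 0" using assms by (auto simp: standard_chart_def)
  define v where "v = (SOME v. v \<in> x)"
  have v: "v \<in> x" unfolding v_def using proj_space_nonempty[OF x(1)] by (rule someI_ex)
  have "affine_vec N i x = (\<lambda>j. (1 / v i) * v j)"
    unfolding affine_vec_def affine_coord_def v_def[symmetric] Let_def using proj_space_mem(3)[OF x(1) v] by auto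
  then have "affine_vec N i x \<in> proj_class v"
    unfolding proj_class_mem using x(2)[OF v] by (intro exI[of _ "1 / v i"]) simp
  then show ?thesis unfolding proj_space_mem(1)[OF x(1) v, symmetric] .
qed

lemma standard_chart_cover:
  assumes "x \<in> proj_space N" obtains i where "i \<le> N" "x \<in> standard_chart N i"
proof -
  obtain v where v: "v \<in> x" using proj_space_nonempty[OF assms] by blast
  obtain i where i: "i \<le> N" "v i \<noteq> 0" using proj_space_mem(2)[OF assms v] by blast
  have "w i \<noteq> 0" if wx: "w \<in> x" for w
  proof -
    obtain c where "c \<noteq> 0" "w = (\<lambda>j. c * v j)" using wx unfolding proj_space_mem(1)[OF assms v] proj_class_mem by blast
    then show ?thesis using i(2) by simp
  qed
  then show ?thesis using that i(1) assms by (auto simp: standard_chart_def)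
qed

locale curve_map =
  fixes \<A> :: "('m::t2_space set \<times> ('m \<Rightarrow> complex)) set" and N r :: nat and F :: "complex set" and X :: "ppoint set"
    and \<phi> :: "'m \<Rightarrow> ppoint" and \<psi> :: "ppoint \<Rightarrow> ppoint"
  assumes rs: "riemann_surface \<A>" and hol: "holomorphic_to_proj \<A> N \<phi>" and ran: "range \<phi> \<subseteq> X"
    and mor: "proj_morphism F N X r \<psi>" and Xp: "X \<subseteq> proj_space N"
begin

lemma target_space: "\<psi> (\<phi> z) \<in> proj_space r"
  by (rule proj_morphism_in_space[OF mor _ Xp]) (use ran in blast)

text \<open>A disc about \<open>p\<close> with a holomorphic vector \<open>w\<close> of homogeneous
  coordinates for the image point. The bounds on both sides of its maximum norm make the scale
  invariant modulus of a form of degree d comparable to that of a holomorphic function up to exp (C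
  d).\<close>

definition disc_lift :: "'m \<Rightarrow> (complex \<Rightarrow> 'm) \<Rightarrow> (nat \<Rightarrow> complex \<Rightarrow> complex) \<Rightarrow> real \<Rightarrow> bool" where
  "disc_lift p t w C \<longleftrightarrow> t 0 = p \<and> continuous_on (ball 0 1) t \<and> inj_on t (ball 0 1) \<and>
     (\<forall>A. open A \<longrightarrow> A \<subseteq> ball 0 1 \<longrightarrow> open (t ` A)) \<and> C \<ge> 0 \<and> (\<forall>j. w j holomorphic_on ball 0 1) \<and>
     (\<forall>\<zeta>\<in>ball 0 1. (\<lambda>j. w j \<zeta>) \<in> \<psi> (\<phi> (t \<zeta>)) \<and> exp (- C) \<le> vmax r (\<lambda>j. w j \<zeta>) \<and> vmax r (\<lambda>j. w j \<zeta>) \<le> exp C)"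

text \<open>Affine coordinates of \<open>\<phi>\<close> are fed into polynomials that represent
  \<open>\<psi>\<close> near the image of \<open>p\<close>. The disc is shrunk until these remain
  valid and one component stays above half its value at the centre; compactness bounds the
  components from above.\<close>

lemma disc_lift_exists: "\<exists>t w C. disc_lift p t w C"
proof -
  have "(\<Union>(W, \<kappa>)\<in>\<A>. W) = UNIV" by (rule rs[unfolded riemann_surface_def, THEN conjunct2, THEN conjunct1])
  then have "p \<in> (\<Union>(W, \<kappa>)\<in>\<A>. W)" by simp
  then obtain W \<kappa> where Wk: "(W, \<kappa>) \<in> \<A>" "p \<in> W" by blast
  have W: "open W" "open (\<kappa> ` W)" "homeomorphism W (\<kappa> ` W) \<kappa> (inv_into W \<kappa>)"
    using bspec[OF rs[unfolded riemann_surface_def, THEN conjunct2, THEN conjunct2, THEN conjunct1] Wk(1)] by simp_all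
  let ?k = "inv_into W \<kappa>"
  have kk: "?k (\<kappa> z) = z" if "z \<in> W" for z using W(3) that by (rule homeomorphism_apply1)
  obtain i where i: "i \<le> N" "\<phi> p \<in> standard_chart N i"
    by (rule standard_chart_cover[of "\<phi> p" N]) (use ran Xp in auto)
  define S where "S = \<phi> -` standard_chart N i"
  have S: "open S" "p \<in> S" unfolding S_def using hol i unfolding holomorphic_to_proj_def by auto
  define v where "v z = affine_vec N i (\<phi> z)" for z
  have v: "v z \<in> \<phi> z" if "z \<in> S" for z unfolding v_def by (rule affine_vec_mem) (use that in \<open>simp add: S_def\<close>)
  define O1 where "O1 = \<kappa> ` (W \<inter> S)"
  have O1: "open O1"
  proof -
    have "openin (top_of_set W) (W \<inter> S)" using S(1) by (simp add: openin_open_Int)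
    then have "openin (top_of_set (\<kappa> ` W)) O1" unfolding O1_def by (rule homeomorphism_imp_open_map[OF W(3)])
    then show ?thesis using W(2) by (simp add: openin_open_eq)
  qed
  have O1W: "?k \<zeta> \<in> W \<inter> S" "\<kappa> (?k \<zeta>) = \<zeta>" "\<zeta> \<in> \<kappa> ` W" if "\<zeta> \<in> O1" for \<zeta>
    using that kk unfolding O1_def by auto
  define q where "q = \<kappa> p"
  have q: "q \<in> O1" "?k q = p" using Wk(2) S(2) kk by (auto simp: q_def O1_def)
  define u where "u j \<zeta> = v (?k \<zeta>) j" for j \<zeta>
  have uh: "u j holomorphic_on O1" for j
  proof (cases "j \<le> N")
    case True
    then have "surface_holomorphic_on \<A> S (affine_coord i j \<circ> \<phi>)" using hol i(1) unfolding holomorphic_to_proj_def S_def by blast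
    then have "((affine_coord i j \<circ> \<phi>) \<circ> ?k) holomorphic_on O1" using Wk(1) unfolding surface_holomorphic_on_def O1_def by blast
    moreover have "u j = (affine_coord i j \<circ> \<phi>) \<circ> ?k" using True by (auto simp: u_def v_def affine_vec_def)
    ultimately show ?thesis by simp
  next
    case False
    then have "u j = (\<lambda>_. 0)" by (auto simp: u_def v_def affine_vec_def)
    then show ?thesis by simp
  qed
  have um: "(\<lambda>j. u j \<zeta>) \<in> \<phi> (?k \<zeta>)" if "\<zeta> \<in> O1" for \<zeta> using v[of "?k \<zeta>"] O1W(1)[OF that] by (simp add: u_def)
  have phX: "\<phi> z \<in> X" for z using ran by blast
  obtain Z P d where Z: "zariski_closed F N Z" "\<phi> p \<notin> Z" "\<forall>j\<le>r. hform F N d (poly_eval (P j))"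
    "\<forall>y v. y \<in> X \<longrightarrow> y \<notin> Z \<longrightarrow> v \<in> y \<longrightarrow> (\<exists>j\<le>r. pv r P v j \<noteq> 0) \<and> \<psi> y = proj_class (pv r P v)"
    using proj_morphism_local[OF mor phX[of p]] by (elim exE conjE)
  obtain T where T: "\<forall>f\<in>T. \<exists>d. hform F N d f" "Z = zeros N T" using Z(1) unfolding zariski_closed_iff by blast
  \<comment> \<open>An equation of the excluded closed set that fails at \<open>\<phi> p\<close>.
    Along the curve it is holomorphic, so the polynomials \<open>P\<close> remain valid on a
    neighbourhood in the classical topology.\<close>
  obtain g x0 where g: "g \<in> T" "x0 \<in> \<phi> p" "g x0 \<noteq> 0" using Z(2) T(2) phX[of p] Xp unfolding zeros_def by blast
  obtain d' where d': "hform F N d' g" using T(1) g(1) by blast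
  have php: "\<phi> p \<in> proj_space N" using phX Xp by blast
  define gu where "gu \<zeta> = g (\<lambda>j. u j \<zeta>)" for \<zeta>
  have guq: "gu q \<noteq> 0" using hform_zero_class[OF d' php g(2), of "\<lambda>j. u j q"] um[OF q(1)] g(3) by (simp add: q(2) gu_def)
  have guh: "gu holomorphic_on O1" unfolding gu_def by (rule hform_holomorphic[OF d' uh])
  define b where "b j \<zeta> = pv r P (\<lambda>j. u j \<zeta>) j" for j \<zeta>
  have bh: "b j holomorphic_on O1" for j
  proof (cases "j \<le> r")
    case True
    then have "b j = (\<lambda>\<zeta>. poly_eval (P j) (\<lambda>i. u i \<zeta>))" by (auto simp: b_def pv_def)
    then show ?thesis using poly_eval_holomorphic[OF uh] by simp
  next
    case False
    then have "b j = (\<lambda>_. 0)" by (auto simp: b_def pv_def)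
    then show ?thesis by simp
  qed
  have key: "(\<exists>j\<le>r. b j \<zeta> \<noteq> 0) \<and> \<psi> (\<phi> (?k \<zeta>)) = proj_class (\<lambda>j. b j \<zeta>)" if z: "\<zeta> \<in> O1" "gu \<zeta> \<noteq> 0" for \<zeta>
  proof -
    have "\<phi> (?k \<zeta>) \<notin> Z" using um[OF z(1)] z(2) g(1) unfolding T(2) zeros_def gu_def by blast
    then show ?thesis using Z(4)[rule_format, OF phX _ um[OF z(1)]] by (simp add: b_def)
  qed
  obtain j0 where j0: "j0 \<le> r" "b j0 q \<noteq> 0" using key[OF q(1) guq] by blast
  define O2 where "O2 = {\<zeta> \<in> O1. gu \<zeta> \<noteq> 0} \<inter> {\<zeta> \<in> O1. cmod (b j0 \<zeta>) > cmod (b j0 q) / 2}"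
  have cgu: "continuous_on O1 gu" using guh by (rule holomorphic_on_imp_continuous_on)
  have cb: "continuous_on O1 (b j)" for j using bh by (rule holomorphic_on_imp_continuous_on)
  have "open {\<zeta> \<in> O1. gu \<zeta> \<noteq> 0}"
    using continuous_open_preimage[OF cgu O1 open_Compl[OF closed_singleton[of 0]]] by (simp add: vimage_def Int_def)
  moreover have "open {\<zeta> \<in> O1. cmod (b j0 \<zeta>) > cmod (b j0 q) / 2}"
    using continuous_open_preimage[OF continuous_on_norm[OF cb] O1 open_greaterThan[of "cmod (b j0 q) / 2"]] by (simp add: vimage_def Int_def)
  ultimately have "open O2" unfolding O2_def by (rule open_Int)
  moreover have "q \<in> O2" using q guq j0 by (simp add: O2_def)
  ultimately obtain \<rho> where \<rho>: "\<rho> > 0" "cball q \<rho> \<subseteq> O2" using open_contains_cball by blast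
  have O21: "O2 \<subseteq> O1" by (auto simp: O2_def)
  have "\<exists>B. \<forall>\<zeta>\<in>cball q \<rho>. cmod (b j \<zeta>) \<le> B" for j
  proof -
    have "compact (b j ` cball q \<rho>)"
      by (rule compact_continuous_image[OF continuous_on_subset[OF cb]]) (use \<rho>(2) O21 in auto)
    then have "bounded (b j ` cball q \<rho>)" by (rule compact_imp_bounded)
    then obtain B where "\<forall>y\<in>b j ` cball q \<rho>. cmod y \<le> B" unfolding bounded_iff ..
    then show ?thesis by (intro exI[of _ B]) simp
  qed
  then obtain B where B: "\<And>j \<zeta>. \<zeta> \<in> cball q \<rho> \<Longrightarrow> cmod (b j \<zeta>) \<le> B j" by metis
  \<comment> \<open>One constant for both sides: the logarithm secures the lower bound
    \<open>cmod (b j0 q) / 2\<close>, the sum dominates all upper bounds \<open>B j\<close>.\<close>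
  define C where "C = max 0 (max (ln (2 / cmod (b j0 q))) (\<Sum>j\<le>r. \<bar>B j\<bar>))"
  define h where "h \<zeta> = q + of_real \<rho> * \<zeta>" for \<zeta> :: complex
  have hb: "h \<zeta> \<in> cball q \<rho>" if "\<zeta> \<in> ball 0 1" for \<zeta>
    using that \<rho>(1) by (simp add: h_def dist_norm norm_mult)
  have hO1: "h \<zeta> \<in> O1" "h \<zeta> \<in> O2" if "\<zeta> \<in> ball 0 1" for \<zeta> using hb[OF that] \<rho>(2) O21 by auto
  have hinj: "h x = h y \<longleftrightarrow> x = y" for x y using \<rho>(1) by (simp add: h_def)
  have "disc_lift p (\<lambda>\<zeta>. ?k (h \<zeta>)) (\<lambda>j \<zeta>. b j (h \<zeta>)) C"
    unfolding disc_lift_def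
  proof (intro conjI allI ballI impI)
    show "?k (h 0) = p" using q by (simp add: h_def)
    have ck: "continuous_on (\<kappa> ` W) ?k" using W(3) unfolding homeomorphism_def by blast
    show "continuous_on (ball 0 1) (\<lambda>\<zeta>. ?k (h \<zeta>))"
    proof (rule continuous_on_compose2[OF ck])
      show "continuous_on (ball 0 1) h" unfolding h_def by (intro continuous_intros)
      show "h ` ball 0 1 \<subseteq> \<kappa> ` W" by (rule image_subsetI) (rule O1W(3)[OF hO1(1)])
    qed
    show "inj_on (\<lambda>\<zeta>. ?k (h \<zeta>)) (ball 0 1)"
    proof (rule inj_onI)
      fix x y :: complex assume a: "x \<in> ball 0 1" "y \<in> ball 0 1" "?k (h x) = ?k (h y)"
      have "\<kappa> (?k (h x)) = \<kappa> (?k (h y))" using a(3) by (rule arg_cong)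
      then have "h x = h y" unfolding O1W(2)[OF hO1(1)[OF a(1)]] O1W(2)[OF hO1(1)[OF a(2)]] .
      then show "x = y" using hinj by simp
    qed
    show "C \<ge> 0" by (simp add: C_def)
    have hh: "h holomorphic_on ball 0 1" unfolding h_def by (intro holomorphic_intros)
    show "(\<lambda>\<zeta>. b j (h \<zeta>)) holomorphic_on ball 0 1" for j
    proof -
      have "h ` ball 0 1 \<subseteq> O1" by (rule image_subsetI) (rule hO1(1))
      from holomorphic_on_compose_gen[OF hh bh this] show ?thesis by (simp add: o_def)
    qed
  next
    fix A :: "complex set" assume A: "open A" "A \<subseteq> ball 0 1"
    have "h ` A = (\<lambda>x. x + q) ` ((\<lambda>x. of_real \<rho> * x) ` A)" by (auto simp: h_def image_image add.commute)
    moreover have "open ((\<lambda>x. complex_of_real \<rho> * x) ` A)"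
      using open_scaling[of \<rho> A] A(1) \<rho>(1) by (simp add: scaleR_conv_of_real)
    ultimately have "open (h ` A)" using open_translation[of "(\<lambda>x. complex_of_real \<rho> * x) ` A" q] by (simp add: add.commute)
    moreover have hA: "h ` A \<subseteq> \<kappa> ` W" using A(2) hO1 O1W(3) by blast
    ultimately have "openin (top_of_set (\<kappa> ` W)) (h ` A)" using W(2) by (simp add: openin_open_eq)
    then have "openin (top_of_set W) (?k ` h ` A)"
      by (rule homeomorphism_imp_open_map[OF homeomorphism_symD[OF W(3)]])
    then show "open ((\<lambda>\<zeta>. ?k (h \<zeta>)) ` A)" using W(1) by (simp add: openin_open_eq image_image)
  next
    fix \<zeta> :: complex assume z: "\<zeta> \<in> ball 0 1"
    have "gu (h \<zeta>) \<noteq> 0" using hO1(2)[OF z] by (simp add: O2_def)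
    then have "\<psi> (\<phi> (?k (h \<zeta>))) = proj_class (\<lambda>j. b j (h \<zeta>))" using key[OF hO1(1)[OF z]] by blast
    then show "(\<lambda>j. b j (h \<zeta>)) \<in> \<psi> (\<phi> (?k (h \<zeta>)))" using proj_class_self by simp
    have b0: "cmod (b j0 q) > 0" using j0 by simp
    have "exp (- C) \<le> exp (- ln (2 / cmod (b j0 q)))" by (simp add: C_def)
    also have "\<dots> = cmod (b j0 q) / 2" using b0 by (simp add: exp_minus)
    also have "\<dots> \<le> cmod (b j0 (h \<zeta>))" using hO1(2)[OF z] by (simp add: O2_def)
    also have "\<dots> \<le> vmax r (\<lambda>j. b j (h \<zeta>))" by (rule vmax_ge[OF j0(1)])
    finally show "exp (- C) \<le> vmax r (\<lambda>j. b j (h \<zeta>))" .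
    show "vmax r (\<lambda>j. b j (h \<zeta>)) \<le> exp C"
    proof (rule vmax_le)
      fix j assume j: "j \<le> r"
      have "cmod (b j (h \<zeta>)) \<le> \<bar>B j\<bar>" using B[OF hb[OF z], of j] by linarith
      also have "\<dots> \<le> (\<Sum>j\<le>r. \<bar>B j\<bar>)" using j by (intro member_le_sum) auto
      also have "\<dots> \<le> C" by (simp add: C_def)
      also have "\<dots> \<le> exp C" using exp_ge_add_one_self[of C] by linarith
      finally show "cmod (b j (h \<zeta>)) \<le> exp C" .
    qed
  qed
  then show ?thesis by blast
qed

text \<open>By homogeneity the quotient does not depend on the chosen vector, as
  \<open>nrm_eq\<close> records; so a form becomes a function on the curve.\<close>

definition nrm :: "nat \<Rightarrow> ((nat \<Rightarrow> complex) \<Rightarrow> complex) \<Rightarrow> 'm \<Rightarrow> real" where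
  "nrm d G z = (let v = (SOME v. v \<in> \<psi> (\<phi> z)) in cmod (G v) / vmax r v ^ d)"

lemma target_vmax_pos: "v \<in> \<psi> (\<phi> z) \<Longrightarrow> vmax r v > 0"
  using proj_space_mem(2)[OF target_space[of z]] vmax_pos by blast

lemma nrm_eq:
  assumes "hform F' r d G" "v \<in> \<psi> (\<phi> z)"
  shows "nrm d G z = cmod (G v) / vmax r v ^ d"
proof -
  define w where "w = (SOME v. v \<in> \<psi> (\<phi> z))"
  have "w \<in> \<psi> (\<phi> z)" unfolding w_def by (rule someI[of "\<lambda>v. v \<in> \<psi> (\<phi> z)", OF assms(2)])
  then obtain c where c: "c \<noteq> 0" "w = (\<lambda>i. c * v i)" using proj_space_mem(1)[OF target_space[of z] assms(2)] proj_class_mem by blast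
  have "nrm d G z = cmod (G w) / vmax r w ^ d" by (simp add: nrm_def w_def Let_def)
  also have "\<dots> = cmod (G v) / vmax r v ^ d"
    unfolding c(2) hform_scale[OF assms(1)] vmax_scale using c(1) by (simp add: norm_mult norm_power power_mult_distrib)
  finally show ?thesis .
qed

text \<open>All normalised forms of all degrees together make up the family of one
  \<open>disc_atlas\<close>, so the same two constants serve them all. This uniformity is essential,
  since the degree of the auxiliary form grows with the initial height.\<close>

theorem form_zeros_bound:
  assumes K: "compact K"
  shows "\<exists>c>0. \<exists>C\<ge>0. \<forall>d G S Zs. d \<ge> 1 \<longrightarrow> S > 0 \<longrightarrow> hform UNIV r d G \<longrightarrow> (\<forall>v. cmod (G v) \<le> S * vmax r v ^ d) \<longrightarrow>
     finite Zs \<longrightarrow> Zs \<subseteq> K \<longrightarrow> (\<forall>z\<in>Zs. \<forall>v\<in>\<psi> (\<phi> z). G v = 0) \<longrightarrow>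
     (\<forall>z\<in>K. \<forall>v\<in>\<psi> (\<phi> z). cmod (G v) \<le> S * exp (C * real d - c * real (card Zs)) * vmax r v ^ d)"
proof -
  have "\<forall>p. \<exists>t. \<exists>w. \<exists>C. disc_lift p t w C" using disc_lift_exists by blast
  then obtain \<tau> w \<C> where dl: "\<And>p. disc_lift p (\<tau> p) (w p) (\<C> p)" by metis
  define \<S> where "\<S> = {(d, S, nrm d G) | d S G. d \<ge> 1 \<and> S > 0 \<and> hform UNIV r d G \<and> (\<forall>v. cmod (G v) \<le> S * vmax r v ^ d)}"
  interpret disc_atlas \<tau> \<C> \<S>
  proof
    show "connected (UNIV :: 'm set)" using rs unfolding riemann_surface_def by blast
    fix p
    note d = dl[of p, unfolded disc_lift_def]
    show "\<tau> p 0 = p" "continuous_on (ball 0 1) (\<tau> p)" "inj_on (\<tau> p) (ball 0 1)" "\<C> p \<ge> 0" using d by blast+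
    show "open (\<tau> p ` A)" if "open A" "A \<subseteq> ball 0 1" for A using d that by blast
    fix D S u assume "(D, S, u) \<in> \<S>"
    then obtain G where G: "D \<ge> 1" "S > 0" "hform UNIV r D G" "\<And>v. cmod (G v) \<le> S * vmax r v ^ D" "u = nrm D G"
      unfolding \<S>_def by blast
    have "0 \<le> u z \<and> u z \<le> S" for z
    proof -
      obtain v where v: "v \<in> \<psi> (\<phi> z)" using proj_space_nonempty[OF target_space] by blast
      have "u z = cmod (G v) / vmax r v ^ D" unfolding G(5) by (rule nrm_eq[OF G(3) v])
      then show ?thesis using G(4)[of v] target_vmax_pos[OF v] by (simp add: divide_le_eq)
    qed
    then show "1 \<le> D \<and> 0 < S \<and> (\<forall>z. 0 \<le> u z \<and> u z \<le> S)" using G by blast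
    define g where "g \<zeta> = G (\<lambda>j. w p j \<zeta>)" for \<zeta>
    have "g holomorphic_on ball 0 1" unfolding g_def by (rule hform_holomorphic[OF G(3)]) (use d in blast)
    moreover have "u (\<tau> p \<zeta>) \<le> exp (\<C> p * real D) * cmod (g \<zeta>) \<and> cmod (g \<zeta>) \<le> exp (\<C> p * real D) * u (\<tau> p \<zeta>)"
      if z: "\<zeta> \<in> ball 0 1" for \<zeta>
    proof -
      let ?v = "\<lambda>j. w p j \<zeta>"
      have v: "?v \<in> \<psi> (\<phi> (\<tau> p \<zeta>))" "exp (- \<C> p) \<le> vmax r ?v" "vmax r ?v \<le> exp (\<C> p)" using d z by blast+
      have u: "u (\<tau> p \<zeta>) = cmod (g \<zeta>) / vmax r ?v ^ D" unfolding G(5) g_def by (rule nrm_eq[OF G(3) v(1)])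
      have vp: "vmax r ?v > 0" by (rule target_vmax_pos[OF v(1)])
      have e: "exp (\<C> p * real D) = exp (\<C> p) ^ D" by (simp add: exp_of_nat_mult mult.commute)
      have "vmax r ?v ^ D \<le> exp (\<C> p) ^ D" using v(3) vp by (intro power_mono) auto
      then have "u (\<tau> p \<zeta>) * vmax r ?v ^ D \<le> u (\<tau> p \<zeta>) * exp (\<C> p) ^ D"
        by (intro mult_left_mono) (auto simp: u vp less_imp_le)
      moreover have "cmod (g \<zeta>) = u (\<tau> p \<zeta>) * vmax r ?v ^ D" using vp by (simp add: u)
      ultimately have "cmod (g \<zeta>) \<le> exp (\<C> p) ^ D * u (\<tau> p \<zeta>)" by (simp only: mult.commute)
      then have 1: "cmod (g \<zeta>) \<le> exp (\<C> p * real D) * u (\<tau> p \<zeta>)" unfolding e .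
      have "1 \<le> (exp (\<C> p) * vmax r ?v) ^ D"
      proof (rule one_le_power)
        have "exp (\<C> p) * exp (- \<C> p) \<le> exp (\<C> p) * vmax r ?v" using v(2) by (intro mult_left_mono) auto
        then show "1 \<le> exp (\<C> p) * vmax r ?v" by (simp flip: exp_add)
      qed
      then have "1 / vmax r ?v ^ D \<le> exp (\<C> p) ^ D" using vp by (simp add: power_mult_distrib divide_le_eq)
      then have "cmod (g \<zeta>) * (1 / vmax r ?v ^ D) \<le> cmod (g \<zeta>) * exp (\<C> p) ^ D" by (intro mult_left_mono) auto
      moreover have "u (\<tau> p \<zeta>) = cmod (g \<zeta>) * (1 / vmax r ?v ^ D)" by (simp add: u)
      ultimately have "u (\<tau> p \<zeta>) \<le> exp (\<C> p) ^ D * cmod (g \<zeta>)" by (simp only: mult.commute)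
      then show ?thesis using 1 unfolding e by blast
    qed
    ultimately show "\<exists>g. g holomorphic_on ball 0 1 \<and> (\<forall>\<zeta>\<in>ball 0 1. u (\<tau> p \<zeta>) \<le> exp (\<C> p * real D) * cmod (g \<zeta>) \<and> cmod (g \<zeta>) \<le> exp (\<C> p * real D) * u (\<tau> p \<zeta>))"
      by blast
  qed
  obtain c C where cC: "c > 0" "C \<ge> 0" "\<forall>(D, S, u)\<in>\<S>. \<forall>Z. finite Z \<longrightarrow> Z \<subseteq> K \<longrightarrow> (\<forall>z\<in>Z. u z = 0) \<longrightarrow>
     (\<forall>z\<in>K. u z \<le> S * exp (C * real D - c * real (card Z)))" using zeros_bound[OF K] by blast
  have res: "cmod (G v) \<le> S * exp (C * real d - c * real (card Zs)) * vmax r v ^ d"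
    if *: "d \<ge> 1" "S > 0" "hform UNIV r d G" "\<forall>v. cmod (G v) \<le> S * vmax r v ^ d" "finite Zs" "Zs \<subseteq> K"
      "\<forall>z\<in>Zs. \<forall>v\<in>\<psi> (\<phi> z). G v = 0" "z \<in> K" "v \<in> \<psi> (\<phi> z)" for d G S Zs z v
  proof -
    have mem: "(d, S, nrm d G) \<in> \<S>" unfolding \<S>_def using * by blast
    have "nrm d G z = 0" if z: "z \<in> Zs" for z
    proof -
      obtain v where v: "v \<in> \<psi> (\<phi> z)" using proj_space_nonempty[OF target_space] by blast
      then have "G v = 0" using *(7) z by blast
      then show ?thesis using nrm_eq[OF *(3) v] by simp
    qed
    then have zz: "\<forall>z\<in>Zs. nrm d G z = 0" by blast
    have "nrm d G z \<le> S * exp (C * real d - c * real (card Zs))"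
      using bspec[OF cC(3) mem] by (simp add: *(5,6,8) zz)
    then show ?thesis using nrm_eq[OF *(3,9)] target_vmax_pos[OF *(9)] by (simp add: divide_le_eq)
  qed
  show ?thesis
    by (rule exI[of _ c], rule conjI[OF cC(1)], rule exI[of _ C], rule conjI[OF cC(2)], intro allI impI ballI, rule res)
qed

end

section \<open>The auxiliary form\<close>

lemma monomial_bound:
  assumes "\<And>i. i \<in> Poly_Mapping.keys k \<Longrightarrow> cmod (v i) \<le> B" "sum (Poly_Mapping.lookup k) (Poly_Mapping.keys k) = e"
  shows "cmod (\<Prod>i\<in>Poly_Mapping.keys k. v i ^ Poly_Mapping.lookup k i) \<le> B ^ e"
proof -
  have "cmod (\<Prod>i\<in>Poly_Mapping.keys k. v i ^ Poly_Mapping.lookup k i) = (\<Prod>i\<in>Poly_Mapping.keys k. cmod (v i) ^ Poly_Mapping.lookup k i)"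
    by (simp add: prod_norm[symmetric] norm_power)
  also have "\<dots> \<le> (\<Prod>i\<in>Poly_Mapping.keys k. B ^ Poly_Mapping.lookup k i)"
    by (intro prod_mono conjI zero_le_power power_mono assms(1)) auto
  also have "\<dots> = B ^ e" using assms(2) by (simp flip: power_sum)
  finally show ?thesis .
qed

lemma powr_dominates:
  fixes \<alpha> \<gamma> \<epsilon> K :: real
  assumes "\<gamma> > \<alpha>" "\<epsilon> > 0"
  shows "\<exists>T1\<ge>1. \<forall>T\<ge>T1. K * T powr \<alpha> \<le> \<epsilon> * T powr \<gamma>"
proof -
  define b where "b = \<bar>K\<bar> / \<epsilon> + 1"
  define T1 where "T1 = max 1 (b powr (1 / (\<gamma> - \<alpha>)))"
  have b: "b \<ge> 1" using assms by (simp add: b_def)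
  have "K * T powr \<alpha> \<le> \<epsilon> * T powr \<gamma>" if T: "T \<ge> T1" for T
  proof -
    have T': "T \<ge> 1" "T \<ge> b powr (1 / (\<gamma> - \<alpha>))" using T by (auto simp: T1_def)
    have "(b powr (1 / (\<gamma> - \<alpha>))) powr (\<gamma> - \<alpha>) \<le> T powr (\<gamma> - \<alpha>)" using T' assms by (intro powr_mono2) auto
    then have "b \<le> T powr (\<gamma> - \<alpha>)" using b assms by (simp add: powr_powr)
    then have "\<epsilon> * b \<le> \<epsilon> * T powr (\<gamma> - \<alpha>)" using assms by (intro mult_left_mono) auto
    moreover have "\<epsilon> * b = \<bar>K\<bar> + \<epsilon>" using assms by (simp add: b_def field_simps)
    ultimately have "K \<le> \<epsilon> * T powr (\<gamma> - \<alpha>)" using assms abs_ge_self[of K] by linarith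
    then have "K * T powr \<alpha> \<le> \<epsilon> * T powr (\<gamma> - \<alpha>) * T powr \<alpha>" by (intro mult_right_mono) auto
    then show ?thesis by (simp add: mult.assoc flip: powr_add)
  qed
  moreover have "T1 \<ge> 1" by (simp add: T1_def)
  ultimately show ?thesis by blast
qed

text \<open>\<open>pts T\<close> stands for the points counted up to height T. The constant
  \<open>H1\<close> absorbs the degree of the field, the power of the line bundle and the bounded
  error of the height. The forms come with integral coefficients \<open>\<kappa>\<close>, so that
  Liouville's inequality applies to their values.\<close>

locale dense_curve = nfield \<iota> + curve_map \<A> N r "range \<iota>" X \<phi> \<psi> + form_chain "range \<iota>" N r X \<psi> Z n e f
  for \<iota> :: "'k::field_char_0 \<Rightarrow> complex" and \<A> :: "('m::t2_space set \<times> ('m \<Rightarrow> complex)) set"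
    and N r :: nat and X \<phi> \<psi> Z n e f +
  fixes MS :: "nat \<Rightarrow> (nat \<Rightarrow>\<^sub>0 nat) set" and \<kappa> :: "nat \<Rightarrow> (nat \<Rightarrow>\<^sub>0 nat) \<Rightarrow> 'k"
    and pts :: "real \<Rightarrow> 'm set" and U :: "'m set" and H1 :: real
  assumes n2: "n \<ge> 2" and e0: "e > 0"
    and MS: "\<And>i. i \<le> n \<Longrightarrow> finite (MS i)" "\<And>i k. i \<le> n \<Longrightarrow> k \<in> MS i \<Longrightarrow> algebraic_int (\<kappa> i k)"
      "\<And>i k. i \<le> n \<Longrightarrow> k \<in> MS i \<Longrightarrow> Poly_Mapping.keys k \<subseteq> {..r}"
      "\<And>i k. i \<le> n \<Longrightarrow> k \<in> MS i \<Longrightarrow> sum (Poly_Mapping.lookup k) (Poly_Mapping.keys k) = e"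
      "\<And>i v. i \<le> n \<Longrightarrow> f i v = (\<Sum>k\<in>MS i. \<iota> (\<kappa> i k) * (\<Prod>j\<in>Poly_Mapping.keys k. v j ^ Poly_Mapping.lookup k j))"
    and pts: "\<And>T z. T \<ge> 1 \<Longrightarrow> z \<in> pts T \<Longrightarrow> \<exists>a. (\<lambda>i. \<iota> (a i)) \<in> \<psi> (\<phi> z) \<and> (\<exists>i\<le>r. a i \<noteq> 0) \<and>
        real (degree_over_Q TYPE('k)) * log_height r a \<le> H1 * T"
    and H1: "H1 \<ge> 0"
    and ptsU: "\<And>T. pts T \<subseteq> U" and cU: "compact (closure U)"
    and dense: "zariski_dense_in N X (range \<phi>)"
begin

text \<open>The forms on coordinates in \<open>'k\<close> instead of \<complex>, so that every
  embedding can be applied to their values.\<close>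

definition fk :: "nat \<Rightarrow> (nat \<Rightarrow> 'k) \<Rightarrow> 'k" where
  "fk i a = (\<Sum>k\<in>MS i. \<kappa> i k * (\<Prod>j\<in>Poly_Mapping.keys k. a j ^ Poly_Mapping.lookup k j))"

lemma emb_prod: "\<sigma> \<in> E \<Longrightarrow> \<sigma> (prod g A) = (\<Prod>i\<in>A. \<sigma> (g i))"
  by (induction A rule: infinite_finite_induct) auto

lemma fk_embedding: "\<sigma> \<in> E \<Longrightarrow> \<sigma> (fk i a) = (\<Sum>k\<in>MS i. \<sigma> (\<kappa> i k) * (\<Prod>j\<in>Poly_Mapping.keys k. \<sigma> (a j) ^ Poly_Mapping.lookup k j))"
  unfolding fk_def by (simp add: emb_prod)

lemma f_iota: "i \<le> n \<Longrightarrow> f i (\<lambda>j. \<iota> (a j)) = \<iota> (fk i a)"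
  using fk_embedding[OF E_card(3)] MS(5) by simp

lemma fk_intform: "i \<le> n \<Longrightarrow> intform r a e (fk i a)"
  unfolding fk_def
proof (rule intform_sum)
  fix k assume i: "i \<le> n" and k: "k \<in> MS i"
  have "intform r a (\<Sum>j\<in>Poly_Mapping.keys k. 1 * Poly_Mapping.lookup k j) (\<Prod>j\<in>Poly_Mapping.keys k. a j ^ Poly_Mapping.lookup k j)"
    by (intro intform_prod intform_power intform_coord) (use MS(3)[OF i k] in auto)
  then have "intform r a e (\<Prod>j\<in>Poly_Mapping.keys k. a j ^ Poly_Mapping.lookup k j)" using MS(4)[OF i k] by simp
  then show "intform r a e (\<kappa> i k * (\<Prod>j\<in>Poly_Mapping.keys k. a j ^ Poly_Mapping.lookup k j))"
    using intform_mult[OF intform_int[OF MS(2)[OF i k]]] by fastforce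
qed

definition Cf :: real where "Cf = 1 + (\<Sum>\<sigma>\<in>E. \<Sum>i\<le>n. \<Sum>k\<in>MS i. cmod (\<sigma> (\<kappa> i k)))"

lemma Cf_ge_1: "Cf \<ge> 1" unfolding Cf_def by (simp add: sum_nonneg)

lemma form_bound:
  assumes "\<sigma> \<in> E" "i \<le> n" "\<And>j. j \<le> r \<Longrightarrow> cmod (v j) \<le> B"
  shows "cmod (\<Sum>k\<in>MS i. \<sigma> (\<kappa> i k) * (\<Prod>j\<in>Poly_Mapping.keys k. v j ^ Poly_Mapping.lookup k j)) \<le> Cf * B ^ e"
proof -
  have B: "B \<ge> 0" using assms(3)[of 0] norm_ge_zero[of "v 0"] by (meson le0 order_trans)
  have "cmod (\<Sum>k\<in>MS i. \<sigma> (\<kappa> i k) * (\<Prod>j\<in>Poly_Mapping.keys k. v j ^ Poly_Mapping.lookup k j))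
      \<le> (\<Sum>k\<in>MS i. cmod (\<sigma> (\<kappa> i k)) * B ^ e)"
  proof (rule sum_norm_le)
    fix k assume k: "k \<in> MS i"
    have "cmod (\<Prod>j\<in>Poly_Mapping.keys k. v j ^ Poly_Mapping.lookup k j) \<le> B ^ e"
      by (rule monomial_bound) (use MS(3,4)[OF assms(2) k] assms(3) in auto)
    then show "cmod (\<sigma> (\<kappa> i k) * (\<Prod>j\<in>Poly_Mapping.keys k. v j ^ Poly_Mapping.lookup k j)) \<le> cmod (\<sigma> (\<kappa> i k)) * B ^ e"
      by (simp add: norm_mult mult_left_mono)
  qed
  also have "\<dots> = (\<Sum>k\<in>MS i. cmod (\<sigma> (\<kappa> i k))) * B ^ e" by (simp add: sum_distrib_right)
  also have "\<dots> \<le> Cf * B ^ e"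
  proof (rule mult_right_mono)
    have "(\<Sum>k\<in>MS i. cmod (\<sigma> (\<kappa> i k))) \<le> (\<Sum>i\<le>n. \<Sum>k\<in>MS i. cmod (\<sigma> (\<kappa> i k)))"
      using assms(2) by (intro member_le_sum[of i _ "\<lambda>i. \<Sum>k\<in>MS i. cmod (\<sigma> (\<kappa> i k))"]) (auto intro: sum_nonneg)
    also have "\<dots> \<le> (\<Sum>\<sigma>\<in>E. \<Sum>i\<le>n. \<Sum>k\<in>MS i. cmod (\<sigma> (\<kappa> i k)))"
      using assms(1) E_card(1) by (intro member_le_sum[of \<sigma> _ "\<lambda>\<sigma>. \<Sum>i\<le>n. \<Sum>k\<in>MS i. cmod (\<sigma> (\<kappa> i k))"]) (auto intro!: sum_nonneg)
    finally show "(\<Sum>k\<in>MS i. cmod (\<sigma> (\<kappa> i k))) \<le> Cf" by (simp add: Cf_def)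
  qed (use B in simp)
  finally show ?thesis .
qed

text \<open>A cube of exponents instead of a simplex makes the number of coefficients exactly
  (q+1)^n, with total degrees at most n q. The zeros outside 1..n make an exponent vector a unique
  function.\<close>

definition IX :: "nat \<Rightarrow> (nat \<Rightarrow> nat) set" where
  "IX q = {k. (\<forall>i. i \<notin> {1..n} \<longrightarrow> k i = 0) \<and> (\<forall>i\<in>{1..n}. k i \<le> q)}"

lemma IX_card: "finite (IX q)" "card (IX q) = (q + 1) ^ n"
proof -
  have "bij_betw (\<lambda>k. restrict k {1..n}) (IX q) (\<Pi>\<^sub>E i\<in>{1..n}. {..q})"
  proof (rule bij_betwI[where g = "\<lambda>k i. if i \<in> {1..n} then k i else 0"])
    show "(\<lambda>k. restrict k {1..n}) \<in> IX q \<rightarrow> (\<Pi>\<^sub>E i\<in>{1..n}. {..q})" by (auto simp: IX_def)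
    show "(\<lambda>k i. if i \<in> {1..n} then k i else 0) \<in> (\<Pi>\<^sub>E i\<in>{1..n}. {..q}) \<rightarrow> IX q" by (auto simp: IX_def)
    show "(\<lambda>i. if i \<in> {1..n} then restrict k {1..n} i else 0) = k" if "k \<in> IX q" for k
      using that by (auto simp: IX_def)
    show "restrict (\<lambda>i. if i \<in> {1..n} then k i else 0) {1..n} = k" if "k \<in> (\<Pi>\<^sub>E i\<in>{1..n}. {..q})" for k
      using that by (auto simp: PiE_def extensional_def restrict_def)
  qed
  moreover have "finite (\<Pi>\<^sub>E i\<in>{1..n}. {..q})" by (intro finite_PiE) auto
  moreover have "card (\<Pi>\<^sub>E i\<in>{1..n}. {..q}) = (q + 1) ^ n" by (simp add: card_PiE)
  ultimately show "finite (IX q)" "card (IX q) = (q + 1) ^ n"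
    using bij_betw_finite bij_betw_same_card by metis+
qed

lemma IX_sum: "k \<in> IX q \<Longrightarrow> sum k {1..n} \<le> n * q"
  using sum_bounded_above[of "{1..n}" k q] by (simp add: IX_def)

text \<open>Rational integers as coefficients have the same absolute value at every embedding, so
  one box of coefficients controls all conjugates.\<close>

definition G :: "nat \<Rightarrow> ((nat \<Rightarrow> nat) \<Rightarrow> int) \<Rightarrow> (nat \<Rightarrow> complex) \<Rightarrow> complex" where
  "G q c v = (\<Sum>k\<in>IX q. of_int (c k) * mono n (n * q) k v)"

definition Gk :: "nat \<Rightarrow> ((nat \<Rightarrow> nat) \<Rightarrow> int) \<Rightarrow> (nat \<Rightarrow> 'k) \<Rightarrow> 'k" where
  "Gk q c a = (\<Sum>k\<in>IX q. of_int (c k) * (fk 0 a ^ (n * q - sum k {1..n}) * (\<Prod>i\<in>{1..n}. fk i a ^ k i)))"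

lemma G_iota: "G q c (\<lambda>j. \<iota> (a j)) = \<iota> (Gk q c a)"
  unfolding G_def Gk_def mono_def using E_card(3) by (simp add: emb_prod f_iota)

lemma Gk_diff: "Gk q c a - Gk q c' a = Gk q (\<lambda>k. c k - c' k) a"
  unfolding Gk_def by (simp add: left_diff_distrib sum_subtractf)

lemma Gk_intform: "intform r a (e * (n * q)) (Gk q c a)"
  unfolding Gk_def
proof (rule intform_sum)
  fix k assume k: "k \<in> IX q"
  have "intform r a (\<Sum>i\<in>{1..n}. e * k i) (\<Prod>i\<in>{1..n}. fk i a ^ k i)"
    by (intro intform_prod intform_power fk_intform) auto
  then have "intform r a (e * (n * q - sum k {1..n}) + e * sum k {1..n}) (fk 0 a ^ (n * q - sum k {1..n}) * (\<Prod>i\<in>{1..n}. fk i a ^ k i))"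
    unfolding sum_distrib_left[symmetric] by (intro intform_mult intform_power fk_intform) auto
  moreover have "e * (n * q - sum k {1..n}) + e * sum k {1..n} = e * (n * q)"
    using IX_sum[OF k] by (simp flip: distrib_left)
  ultimately show "intform r a (e * (n * q)) (of_int (c k) * (fk 0 a ^ (n * q - sum k {1..n}) * (\<Prod>i\<in>{1..n}. fk i a ^ k i)))"
    using intform_mult[OF intform_int[OF algebraic_int_of_int], of r a "e * (n * q)" _ "c k"] by simp
qed

lemma product_bound:
  fixes x :: "nat \<Rightarrow> complex"
  assumes "k \<in> IX q" "\<And>i. i \<le> n \<Longrightarrow> cmod (x i) \<le> B"
  shows "cmod (x 0 ^ (n * q - sum k {1..n}) * (\<Prod>i\<in>{1..n}. x i ^ k i)) \<le> B ^ (n * q)"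
proof -
  have B: "B \<ge> 0" using assms(2)[of 0] norm_ge_zero[of "x 0"] by (meson le0 order_trans)
  have "cmod (\<Prod>i\<in>{1..n}. x i ^ k i) \<le> (\<Prod>i\<in>{1..n}. B ^ k i)"
    unfolding prod_norm[symmetric] norm_power by (intro prod_mono conjI zero_le_power power_mono assms(2)) auto
  then have "cmod (\<Prod>i\<in>{1..n}. x i ^ k i) \<le> B ^ sum k {1..n}" by (simp flip: power_sum)
  then have "cmod (x 0 ^ (n * q - sum k {1..n}) * (\<Prod>i\<in>{1..n}. x i ^ k i)) \<le> B ^ (n * q - sum k {1..n}) * B ^ sum k {1..n}"
    unfolding norm_mult norm_power using B assms(2) by (intro mult_mono power_mono) auto
  also have "\<dots> = B ^ (n * q)" using IX_sum[OF assms(1)] by (simp flip: power_add)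
  finally show ?thesis .
qed

text \<open>Bounds a form with coefficients up to \<open>B\<close>, at every embedding, relative to
  the power of the largest coordinate.\<close>

definition Sz :: "nat \<Rightarrow> real \<Rightarrow> real" where "Sz q B = B * real ((q + 1) ^ n) * Cf ^ (n * q)"

lemma sum_bound:
  assumes "\<And>k. k \<in> IX q \<Longrightarrow> \<bar>real_of_int (c k)\<bar> \<le> B" "\<And>k. k \<in> IX q \<Longrightarrow> cmod (y k) \<le> (Cf * A ^ e) ^ (n * q)" "A \<ge> 0" "B \<ge> 0"
  shows "cmod (\<Sum>k\<in>IX q. of_int (c k) * y k) \<le> Sz q B * A ^ (e * (n * q))"
proof -
  have "cmod (\<Sum>k\<in>IX q. of_int (c k) * y k) \<le> (\<Sum>k\<in>IX q. B * (Cf * A ^ e) ^ (n * q))"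
  proof (rule sum_norm_le)
    fix k assume k: "k \<in> IX q"
    have "cmod (of_int (c k)) \<le> B" using assms(1)[OF k] by simp
    then show "cmod (of_int (c k) * y k) \<le> B * (Cf * A ^ e) ^ (n * q)"
      unfolding norm_mult using assms(2)[OF k] assms(4) by (intro mult_mono) auto
  qed
  also have "\<dots> = Sz q B * A ^ (e * (n * q))"
    by (simp add: IX_card Sz_def power_mult_distrib power_mult)
  finally show ?thesis .
qed

lemma G_bound:
  assumes "\<And>k. k \<in> IX q \<Longrightarrow> \<bar>real_of_int (c k)\<bar> \<le> B" "B \<ge> 0"
  shows "cmod (G q c v) \<le> Sz q B * vmax r v ^ (e * (n * q))"
  unfolding G_def
proof (rule sum_bound[OF assms(1)])
  fix k assume k: "k \<in> IX q"
  have fb: "cmod (f i v) \<le> Cf * vmax r v ^ e" if "i \<le> n" for i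
    unfolding MS(5)[OF that] by (rule form_bound[OF E_card(3) that vmax_ge])
  show "cmod (mono n (n * q) k v) \<le> (Cf * vmax r v ^ e) ^ (n * q)"
    unfolding mono_def using product_bound[OF k, of "\<lambda>i. f i v"] fb by blast
qed (use vmax_nonneg assms(2) in auto)

lemma Gk_bound:
  assumes "\<And>k. k \<in> IX q \<Longrightarrow> \<bar>real_of_int (c k)\<bar> \<le> B" "B \<ge> 0" "\<sigma> \<in> E"
  shows "cmod (\<sigma> (Gk q c a)) \<le> Sz q B * amax r a \<sigma> ^ (e * (n * q))"
proof -
  have "\<sigma> (Gk q c a) = (\<Sum>k\<in>IX q. of_int (c k) * (\<sigma> (fk 0 a) ^ (n * q - sum k {1..n}) * (\<Prod>i\<in>{1..n}. \<sigma> (fk i a) ^ k i)))"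
    unfolding Gk_def using assms(3) by (simp add: emb_prod)
  also have "cmod \<dots> \<le> Sz q B * amax r a \<sigma> ^ (e * (n * q))"
  proof (rule sum_bound[OF assms(1)])
    fix k assume k: "k \<in> IX q"
    have fb: "cmod (\<sigma> (fk i a)) \<le> Cf * amax r a \<sigma> ^ e" if "i \<le> n" for i
      unfolding fk_embedding[OF assms(3)] by (rule form_bound[OF assms(3) that amax_ge])
    show "cmod (\<sigma> (fk 0 a) ^ (n * q - sum k {1..n}) * (\<Prod>i\<in>{1..n}. \<sigma> (fk i a) ^ k i)) \<le> (Cf * amax r a \<sigma> ^ e) ^ (n * q)"
      using product_bound[OF k, of "\<lambda>i. \<sigma> (fk i a)"] fb by blast
  qed (use assms(2) amax_ge[of 0 r \<sigma> a] norm_ge_zero[of "\<sigma> (a 0)"] in \<open>linarith+\<close>)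
  finally show ?thesis .
qed

lemma G_hform: "hform (range \<iota>) r (e * (n * q)) (G q c)"
proof -
  have "of_int z \<in> range \<iota>" for z using emb_simps(7)[OF E_card(3), of z] by (metis rangeI)
  then show ?thesis unfolding G_def using IX_sum by (intro hform_sum[OF F] hform_cmult[OF F] mono_hform) auto
qed

lemma vmax_amax: "vmax r (\<lambda>i. \<iota> (a i)) = amax r a \<iota>" by (simp add: vmax_def amax_def)

lemma Sz_ge_1: "B \<ge> 1 \<Longrightarrow> Sz q B \<ge> 1"
proof -
  assume B: "B \<ge> 1"
  have "1 \<le> real ((q + 1) ^ n)" using one_le_power[of "real (q + 1)" n] by simp
  moreover have "1 \<le> Cf ^ (n * q)" using Cf_ge_1 by (rule one_le_power)
  ultimately have "1 * 1 * 1 \<le> B * real ((q + 1) ^ n) * Cf ^ (n * q)" using B by (intro mult_mono) auto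
  then show ?thesis by (simp add: Sz_def)
qed

text \<open>A form with many zeros is too small at a point of bounded height to be nonzero there.\<close>

lemma vanishing_step:
  assumes bound: "\<And>v. v \<in> \<psi> (\<phi> z) \<Longrightarrow> cmod (G q c v) \<le> Sz q B * exp (C * real (e * (n * q)) - c0 * real k) * vmax r v ^ (e * (n * q))"
    and cB: "\<And>k. k \<in> IX q \<Longrightarrow> \<bar>real_of_int (c k)\<bar> \<le> B" "B \<ge> 1" and z: "T \<ge> 1" "z \<in> pts T"
    and large: "c0 * real k > (real m + 1) * ln (Sz q B) + real (e * (n * q)) * (C + H1 * T)"
  shows "\<forall>v\<in>\<psi> (\<phi> z). G q c v = 0"
proof -
  define D where "D = e * (n * q)"
  obtain a i0 where a: "(\<lambda>i. \<iota> (a i)) \<in> \<psi> (\<phi> z)" "i0 \<le> r" "a i0 \<noteq> 0"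
    "real (degree_over_Q TYPE('k)) * log_height r a \<le> H1 * T" using pts[OF z] by blast
  have S1: "Sz q B \<ge> 1" by (rule Sz_ge_1[OF cB(2)])
  have "Gk q c a = 0"
  proof (rule ccontr)
    assume nz: "Gk q c a \<noteq> 0"
    have "(\<Sum>\<sigma>\<in>E. real D * ln (amax r a \<sigma>) - ln (cmod (\<sigma> (Gk q c a)))) \<le> real D * (real (degree_over_Q TYPE('k)) * log_height r a)"
      unfolding D_def by (rule height_inequality[OF a(2,3) nz Gk_intform])
    also have "\<dots> \<le> real D * (H1 * T)" using a(4) by (intro mult_left_mono) auto
    finally have up: "(\<Sum>\<sigma>\<in>E. real D * ln (amax r a \<sigma>) - ln (cmod (\<sigma> (Gk q c a)))) \<le> real D * (H1 * T)" .
    \<comment> \<open>The trivial estimate, to be used at all embeddings other than \<iota>.\<close>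
    have low: "- ln (Sz q B) \<le> real D * ln (amax r a \<sigma>) - ln (cmod (\<sigma> (Gk q c a)))" if s: "\<sigma> \<in> E" for \<sigma>
    proof -
      have ap: "amax r a \<sigma> > 0" by (rule amax_pos[of \<sigma> i0 r a, OF s a(2,3)])
      have "cmod (\<sigma> (Gk q c a)) > 0" using nz s by simp
      moreover have "cmod (\<sigma> (Gk q c a)) \<le> Sz q B * amax r a \<sigma> ^ D"
        unfolding D_def by (rule Gk_bound[OF cB(1) _ s]) (use cB(2) in auto)
      ultimately have "ln (cmod (\<sigma> (Gk q c a))) \<le> ln (Sz q B * amax r a \<sigma> ^ D)" using S1 ap by (subst ln_le_cancel_iff) auto
      also have "\<dots> = ln (Sz q B) + real D * ln (amax r a \<sigma>)" using S1 ap by (simp add: ln_mult ln_realpow)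
      finally show ?thesis by linarith
    qed
    have ap: "amax r a \<iota> > 0" by (rule amax_pos[of \<iota> i0 r a, OF E_card(3) a(2,3)])
    \<comment> \<open>Liouville's sum is split at \<iota>, the one embedding at which the smallness
      on the curve is known.\<close>
    have "(\<Sum>\<sigma>\<in>E. real D * ln (amax r a \<sigma>) - ln (cmod (\<sigma> (Gk q c a))))
        = (real D * ln (amax r a \<iota>) - ln (cmod (\<iota> (Gk q c a)))) + (\<Sum>\<sigma>\<in>E - {\<iota>}. real D * ln (amax r a \<sigma>) - ln (cmod (\<sigma> (Gk q c a))))"
      using E_card by (intro sum.remove) auto
    moreover have "(\<Sum>\<sigma>\<in>E - {\<iota>}. - ln (Sz q B)) \<le> (\<Sum>\<sigma>\<in>E - {\<iota>}. real D * ln (amax r a \<sigma>) - ln (cmod (\<sigma> (Gk q c a))))"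
      using low by (intro sum_mono) auto
    moreover have "(\<Sum>\<sigma>\<in>E - {\<iota>}. - ln (Sz q B)) \<ge> - real m * ln (Sz q B)"
    proof -
      have "real (card (E - {\<iota>})) \<le> real m" using E_card by (simp add: card_Diff_singleton)
      then have "real (card (E - {\<iota>})) * ln (Sz q B) \<le> real m * ln (Sz q B)" using S1 by (intro mult_right_mono) auto
      then show ?thesis by simp
    qed
    ultimately have 1: "real D * ln (amax r a \<iota>) - ln (cmod (\<iota> (Gk q c a))) \<le> real D * (H1 * T) + real m * ln (Sz q B)"
      using up by linarith
    have gp: "cmod (\<iota> (Gk q c a)) > 0" using nz E_card(3) by simp
    have "cmod (\<iota> (Gk q c a)) \<le> Sz q B * exp (C * real D - c0 * real k) * amax r a \<iota> ^ D"
      using bound[OF a(1)] by (simp add: G_iota vmax_amax D_def)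
    then have "ln (cmod (\<iota> (Gk q c a))) \<le> ln (Sz q B * exp (C * real D - c0 * real k) * amax r a \<iota> ^ D)"
      using gp S1 ap by (subst ln_le_cancel_iff) auto
    also have "\<dots> = ln (Sz q B) + (C * real D - c0 * real k) + real D * ln (amax r a \<iota>)"
      using S1 ap by (simp add: ln_mult ln_realpow)
    finally show False using 1 large unfolding D_def[symmetric] by (simp add: algebra_simps)
  qed
  then have "G q c (\<lambda>i. \<iota> (a i)) = 0" using G_iota emb_simps(1)[OF E_card(3)] by simp
  then show ?thesis using hform_zero_class[OF G_hform target_space[of z] a(1)] by blast
qed

text \<open>Siegel's lemma by the pigeonhole principle: the values at a point, divided by the maxima of the
  conjugates of its coordinates, cannot be close at all embeddings without being equal.\<close>

lemma auxiliary_form: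
  assumes T: "T \<ge> 1" and Zs: "finite Zs" "Zs \<subseteq> pts T" "4 * m * card Zs \<le> (q + 1) ^ n" "Zs \<noteq> {}"
    and B: "real B \<ge> 6 * real ((q + 1) ^ n) * Cf ^ (n * q) * exp (real (e * (n * q)) * (H1 * T))"
  shows "\<exists>c. (\<forall>k\<in>IX q. \<bar>c k\<bar> \<le> int B) \<and> (\<exists>k\<in>IX q. c k \<noteq> 0) \<and> (\<forall>z\<in>Zs. \<forall>v\<in>\<psi> (\<phi> z). G q c v = 0)"
proof -
  define D where "D = e * (n * q)"
  define M where "M = (q + 1) ^ n"
  have "\<forall>z\<in>Zs. \<exists>a. (\<lambda>i. \<iota> (a i)) \<in> \<psi> (\<phi> z) \<and> (\<exists>i\<le>r. a i \<noteq> 0) \<and>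
        real (degree_over_Q TYPE('k)) * log_height r a \<le> H1 * T" using pts[OF T] Zs(2) by blast
  then obtain a where a: "\<And>z. z \<in> Zs \<Longrightarrow> (\<lambda>i. \<iota> (a z i)) \<in> \<psi> (\<phi> z)" "\<And>z. z \<in> Zs \<Longrightarrow> \<exists>i\<le>r. a z i \<noteq> 0"
    "\<And>z. z \<in> Zs \<Longrightarrow> real (degree_over_Q TYPE('k)) * log_height r (a z) \<le> H1 * T" by metis
  \<comment> \<open>Small enough that a nonzero difference within \<open>s\<close> at all embeddings
    would violate Liouville's inequality at height T.\<close>
  define s where "s = exp (- (real D * (H1 * T)))"
  define R where "R = Sz q (real B)"
  define P where "P = (\<Pi>\<^sub>E k\<in>IX q. {0..int B})"
  define Fv where "Fv c zs = (snd zs) (Gk q c (a (fst zs))) / of_real (amax r (a (fst zs)) (snd zs) ^ D)" for c and zs :: "'m \<times> ('k \<Rightarrow> complex)"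
  have M1: "real M \<ge> 1" unfolding M_def using one_le_power[of "real (q + 1)" n] by simp
  have Q1: "Cf ^ (n * q) \<ge> 1" using Cf_ge_1 by (rule one_le_power)
  have E1: "exp (real D * (H1 * T)) \<ge> 1" using H1 T by simp
  have MQ: "real M * Cf ^ (n * q) * exp (real D * (H1 * T)) \<ge> 1"
    using mult_mono[OF mult_mono[OF M1 Q1] E1] M1 Q1 by simp
  have B6: "real B \<ge> 6 * (real M * Cf ^ (n * q) * exp (real D * (H1 * T)))" using B by (simp add: M_def D_def)
  have B1: "real B \<ge> 1" using B6 MQ by linarith
  have R1: "R \<ge> 1" unfolding R_def by (rule Sz_ge_1[OF B1])
  have s: "s > 0" "s \<le> 1" unfolding s_def using H1 T by simp_all
  have ap: "amax r (a z) \<sigma> > 0" if "z \<in> Zs" "\<sigma> \<in> E" for z \<sigma>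
    using a(2)[OF that(1)] amax_pos[OF that(2)] by blast
  have cP: "finite P" "card P = (B + 1) ^ M" 
    unfolding P_def M_def using IX_card by (simp_all add: card_PiE finite_PiE nat_add_distrib)
  have Pb: "\<bar>real_of_int (c k)\<bar> \<le> real B" "0 \<le> c k \<and> c k \<le> int B" if "c \<in> P" "k \<in> IX q" for c k
  proof -
    have "c k \<in> {0..int B}" using that unfolding P_def by (rule PiE_mem)
    then show "0 \<le> c k \<and> c k \<le> int B" by simp
    then show "\<bar>real_of_int (c k)\<bar> \<le> real B" by (metis abs_of_nonneg of_int_0_le_iff of_int_le_iff of_int_of_nat_eq)
  qed
  have "\<exists>c\<in>P. \<exists>c'\<in>P. c \<noteq> c' \<and> (\<lambda>_. ()) c = (\<lambda>_. ()) c' \<and> (\<forall>zs\<in>Zs \<times> E. cmod (Fv c zs - Fv c' zs) < s)"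
  proof (rule box_pigeonhole[where R = "\<lambda>_. R" and L = "{()}"])
    show "finite (Zs \<times> E)" using Zs(1) E_card(1) by simp
    show "cmod (Fv c zs) \<le> R" if cp: "c \<in> P" and zse: "zs \<in> Zs \<times> E" for c zs
    proof -
      obtain z \<sigma> where zs: "zs = (z, \<sigma>)" "z \<in> Zs" "\<sigma> \<in> E" using zse by auto
      have "cmod (\<sigma> (Gk q c (a z))) \<le> R * amax r (a z) \<sigma> ^ D"
        unfolding R_def D_def by (rule Gk_bound[OF Pb(1)[OF cp] _ zs(3)]) auto
      then show ?thesis using ap[OF zs(2,3)] by (simp add: Fv_def zs(1) norm_divide norm_power divide_le_eq)
    qed
    \<comment> \<open>The hypothesis on \<open>B\<close> gives 6R/s \<le> B^2, so each complex
      coordinate needs fewer than (B+1)^4 squares. The exponent 4 is the factor in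
      \<open>4 * m * card Zs\<close>, which keeps the number of boxes below that of coefficient
      vectors.\<close>
    have "4 * R / s + 2 \<le> 6 * R / s"
    proof -
      have "1 * 1 \<le> R * (1 / s)" using R1 s by (intro mult_mono) auto
      then show ?thesis by simp
    qed
    moreover have "6 * R / s < (real B + 1)\<^sup>2"
    proof -
      have "6 * R / s = real B * (6 * (real M * Cf ^ (n * q) * exp (real D * (H1 * T))))"
        by (simp add: R_def Sz_def s_def M_def exp_minus field_simps)
      also have "\<dots> \<le> real B * real B" using B6 by (intro mult_left_mono) auto
      also have "\<dots> < (real B + 1)\<^sup>2" by (simp add: power2_eq_square algebra_simps)
      finally show ?thesis .
    qed
    ultimately have lt: "4 * R / s + 2 < (real B + 1)\<^sup>2" by linarith
    define N0 where "N0 = card (Zs \<times> E)"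
    have N0: "N0 = card Zs * m" "N0 > 0" unfolding N0_def using E_card Zs(1,4) m_pos by (auto simp: card_cartesian_product card_gt_0_iff)
    have "(\<Prod>zs\<in>Zs \<times> E. (4 * R / s + 2)\<^sup>2) = (4 * R / s + 2) ^ (2 * N0)" by (simp add: N0_def power_mult)
    also have "\<dots> < ((real B + 1)\<^sup>2) ^ (2 * N0)" using lt R1 s N0 by (intro power_strict_mono) auto
    also have "\<dots> = (real B + 1) ^ (4 * N0)" by (simp flip: power_mult)
    also have "\<dots> \<le> (real B + 1) ^ M" using Zs(3) N0(1) by (intro power_increasing) (auto simp: M_def ac_simps)
    also have "\<dots> = real (card P)" using cP by (simp add: add.commute)
    finally show "real (card {()}) * (\<Prod>zs\<in>Zs \<times> E. (4 * R / s + 2)\<^sup>2) < real (card P)" by simp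
  qed (use s R1 cP in auto)
  then obtain c c' where cc: "c \<in> P" "c' \<in> P" "c \<noteq> c'" "\<And>zs. zs \<in> Zs \<times> E \<Longrightarrow> cmod (Fv c zs - Fv c' zs) < s" by blast
  define d where "d k = c k - c' k" for k
  have "Gk q d (a z) = 0" if z: "z \<in> Zs" for z
  proof (rule ccontr)
    assume nz: "Gk q d (a z) \<noteq> 0"
    obtain i0 where i0: "i0 \<le> r" "a z i0 \<noteq> 0" using a(2)[OF z] by blast
    have "(\<Sum>\<sigma>\<in>E. real D * ln (amax r (a z) \<sigma>) - ln (cmod (\<sigma> (Gk q d (a z))))) \<le> real D * (real (degree_over_Q TYPE('k)) * log_height r (a z))"
      unfolding D_def by (rule height_inequality[OF i0 nz Gk_intform])
    also have "\<dots> \<le> real D * (H1 * T)" using a(3)[OF z] by (intro mult_left_mono) auto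
    finally have up: "(\<Sum>\<sigma>\<in>E. real D * ln (amax r (a z) \<sigma>) - ln (cmod (\<sigma> (Gk q d (a z))))) \<le> real D * (H1 * T)" .
    have low: "real D * (H1 * T) < real D * ln (amax r (a z) \<sigma>) - ln (cmod (\<sigma> (Gk q d (a z))))" if sg: "\<sigma> \<in> E" for \<sigma>
    proof -
      note app = ap[OF z sg]
      have "Fv c (z, \<sigma>) - Fv c' (z, \<sigma>) = \<sigma> (Gk q d (a z)) / of_real (amax r (a z) \<sigma> ^ D)"
        unfolding d_def Gk_diff[symmetric] using sg by (simp add: Fv_def diff_divide_distrib)
      then have "cmod (\<sigma> (Gk q d (a z))) / amax r (a z) \<sigma> ^ D < s" using cc(4)[of "(z, \<sigma>)"] z sg app by (simp add: norm_divide norm_power)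
      then have "cmod (\<sigma> (Gk q d (a z))) < s * amax r (a z) \<sigma> ^ D" using app by (simp add: divide_less_eq)
      then have "ln (cmod (\<sigma> (Gk q d (a z)))) < ln (s * amax r (a z) \<sigma> ^ D)" using nz sg s app by (subst ln_less_cancel_iff) auto
      also have "\<dots> = - (real D * (H1 * T)) + real D * ln (amax r (a z) \<sigma>)" using s app by (simp add: ln_mult ln_realpow s_def)
      finally show ?thesis by linarith
    qed
    \<comment> \<open>There is at least one embedding, and each single term of the sum already
      exceeds the bound for the whole sum.\<close>
    have "real D * (H1 * T) \<le> real m * (real D * (H1 * T))"
    proof -
      have "1 * (real D * (H1 * T)) \<le> real m * (real D * (H1 * T))" using m_pos H1 T by (intro mult_right_mono) auto
      then show ?thesis by simp
    qed
    also have "\<dots> = (\<Sum>\<sigma>\<in>E. real D * (H1 * T))" using E_card by simp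
    also have "\<dots> < (\<Sum>\<sigma>\<in>E. real D * ln (amax r (a z) \<sigma>) - ln (cmod (\<sigma> (Gk q d (a z)))))"
      using low E_card by (intro sum_strict_mono) auto
    finally show False using up by linarith
  qed
  then have "\<forall>z\<in>Zs. \<forall>v\<in>\<psi> (\<phi> z). G q d v = 0"
    using hform_zero_class[OF G_hform target_space a(1)] G_iota emb_simps(1)[OF E_card(3)] by metis
  moreover have "\<forall>k\<in>IX q. \<bar>d k\<bar> \<le> int B"
  proof
    fix k assume "k \<in> IX q"
    then show "\<bar>d k\<bar> \<le> int B" using Pb(2)[OF cc(1)] Pb(2)[OF cc(2)] unfolding d_def by fastforce
  qed
  moreover have "\<exists>k\<in>IX q. d k \<noteq> 0"
  proof (rule ccontr)
    assume "\<not> ?thesis"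
    then have "c k = c' k" if "k \<in> IX q" for k using that by (auto simp: d_def)
    then have "c = c'" using PiE_ext[OF cc(1,2)[unfolded P_def]] by blast
    then show False using cc(3) by blast
  qed
  ultimately show ?thesis by blast
qed

text \<open>The zero set of the form, pulled back to \<open>X\<close>, is closed over the number
  field, hence over \<complex>, and contains the image of the curve. By density it is all of
  \<open>X\<close>, which contradicts independence on \<open>Z n\<close>.\<close>

lemma vanishing_everywhere_impossible:
  assumes "\<exists>k\<in>IX q. c k \<noteq> 0" "\<And>z v. v \<in> \<psi> (\<phi> z) \<Longrightarrow> G q c v = 0"
  shows False
proof -
  have ofint: "of_int z \<in> range \<iota>" for z using emb_simps(7)[OF E_card(3), of z] by (metis rangeI)
  have "\<exists>x\<in>Z n. \<exists>v\<in>\<psi> x. (\<Sum>k\<in>IX q. of_int (c k) * mono n (n * q) k v) \<noteq> 0"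
    by (rule forms_independent) (use assms(1) IX_card IX_sum ofint in \<open>auto simp: IX_def\<close>)
  then obtain x v where xv: "x \<in> Z n" "v \<in> \<psi> x" "G q c v \<noteq> 0" unfolding G_def by blast
  define Y where "Y = {x \<in> X. \<psi> x \<in> zeros r {G q c}}"
  have "zariski_closed (range \<iota>) N Y" unfolding Y_def
    by (rule zariski_closed_preimage[OF F mor X zariski_closed_form[OF G_hform]])
  then have "zariski_closed UNIV N Y" by (rule zariski_closed_mono[rotated]) simp
  moreover have "range \<phi> \<subseteq> Y"
    using ran assms(2) target_space unfolding Y_def zeros_def by auto
  ultimately have "X \<subseteq> Y" using dense unfolding zariski_dense_in_def by blast
  then have "x \<in> Y" using xv(1) Z(2)[of n] by blast
  then show False using xv unfolding Y_def zeros_def by auto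
qed

section \<open>Choice of parameters and the growth argument\<close>

definition lam_rate :: real where "lam_rate = 8 + 2 * ln Cf + real e * H1"

lemma ln_Sz:
  assumes q: "q \<ge> 1" and T: "T \<ge> 1"
    and B: "B = nat \<lceil>6 * real ((q + 1) ^ n) * Cf ^ (n * q) * exp (real (e * (n * q)) * (H1 * T))\<rceil>"
  shows "real B \<ge> 1" "ln (Sz q (real B)) \<le> lam_rate * real (n * q) * T"
    "real B \<ge> 6 * real ((q + 1) ^ n) * Cf ^ (n * q) * exp (real (e * (n * q)) * (H1 * T))"
proof -
  define D where "D = n * q"
  define M where "M = (q + 1) ^ n"
  define y where "y = real M * Cf ^ D * exp (real (e * D) * (H1 * T))"
  have "1 * 1 \<le> D" unfolding D_def using n2 q by (intro mult_le_mono) auto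
  then have D1: "real D \<ge> 1" by simp
  have M1: "real M \<ge> 1" unfolding M_def using one_le_power[of "real (q + 1)" n] by simp
  have Q1: "Cf ^ D \<ge> 1" using Cf_ge_1 by (rule one_le_power)
  have E1: "exp (real (e * D) * (H1 * T)) \<ge> 1" using H1 T by simp
  have y1: "y \<ge> 1" unfolding y_def using mult_mono[OF mult_mono[OF M1 Q1] E1] M1 Q1 by simp
  have B': "B = nat \<lceil>6 * y\<rceil>" unfolding B y_def M_def D_def by (simp add: mult.assoc)
  have B6: "real B \<ge> 6 * y" unfolding B' by (rule real_nat_ceiling_ge)
  then show "real B \<ge> 6 * real ((q + 1) ^ n) * Cf ^ (n * q) * exp (real (e * (n * q)) * (H1 * T))"
    by (simp add: y_def M_def D_def mult.assoc)
  show B1: "real B \<ge> 1" using B6 y1 by linarith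
  have "real B < 6 * y + 1" unfolding B' using y1 by linarith
  then have B7: "real B \<le> 7 * y" using y1 by linarith
  have "ln (Sz q (real B)) = ln (real B) + ln (real M) + real D * ln Cf"
    unfolding Sz_def M_def[symmetric] D_def[symmetric] using B1 M1 Cf_ge_1 by (simp add: ln_mult ln_realpow)
  also have "ln (real B) \<le> ln (7 * y)" using B1 B7 by simp
  also have "ln (7 * y) = ln 7 + ln (real M) + real D * ln Cf + real (e * D) * (H1 * T)"
    unfolding y_def using M1 Cf_ge_1 by (simp add: ln_mult ln_realpow)
  also have "ln (7::real) \<le> 6" using ln_le_minus_one[of "7::real"] by simp
  also have lM: "ln (real M) \<le> real D"
  proof -
    have "ln (real M) = real n * ln (1 + real q)" by (simp add: M_def ln_realpow add.commute)
    also have "\<dots> \<le> real n * real q" by (intro mult_left_mono ln_add_one_self_le_self) auto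
    finally show ?thesis by (simp add: D_def)
  qed
  finally have 1: "ln (Sz q (real B)) \<le> 6 + 2 * real D + 2 * (real D * ln Cf) + real (e * D) * (H1 * T)" using lM by linarith
  have 2: "6 + 2 * real D + 2 * (real D * ln Cf) \<le> (8 + 2 * ln Cf) * real D" using D1 by (simp add: algebra_simps)
  have "(8 + 2 * ln Cf) * real D * 1 \<le> (8 + 2 * ln Cf) * real D * T" using T Cf_ge_1 by (intro mult_left_mono) auto
  then have "ln (Sz q (real B)) \<le> (8 + 2 * ln Cf) * real D * T + real (e * D) * (H1 * T)" using 1 2 by linarith
  also have "\<dots> = lam_rate * real (n * q) * T" by (simp add: lam_rate_def D_def algebra_simps)
  finally show "ln (Sz q (real B)) \<le> lam_rate * real (n * q) * T" .
qed

text \<open>The threshold for the number of zeros in \<open>vanishing_step\<close>, per unit of n q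
  T.\<close>

definition step_rate :: "real \<Rightarrow> real" where "step_rate C = (real m + 1) * lam_rate + real e * (C + H1)"

lemma rates: "C \<ge> 0 \<Longrightarrow> step_rate C > 0" "lam_rate > 0"
proof -
  have l: "ln Cf \<ge> 0" "real e * H1 \<ge> 0" using Cf_ge_1 H1 by auto
  then show *: "lam_rate > 0" unfolding lam_rate_def by linarith
  assume "C \<ge> 0"
  moreover have "(real m + 1) * lam_rate > 0" using * by simp
  ultimately show "step_rate C > 0" unfolding step_rate_def using H1 by (intro add_pos_nonneg) auto
qed

lemma step_rate_bound:
  assumes S: "ln S \<le> lam_rate * D * T0" and T: "1 \<le> T0" "T0 \<le> T" and D: "D \<ge> 0" and C: "C \<ge> 0"
  shows "(real m + 1) * ln S + real e * D * (C + H1 * T) \<le> step_rate C * D * T"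
proof -
  have "lam_rate * D * T0 \<le> lam_rate * D * T" using T D rates(2) by (intro mult_left_mono) auto
  then have 1: "(real m + 1) * ln S \<le> (real m + 1) * (lam_rate * D * T)" using S by (intro mult_left_mono) auto
  have "C * 1 \<le> C * T" using T C by (intro mult_left_mono) auto
  then have "real e * D * (C + H1 * T) \<le> real e * D * (C * T + H1 * T)" using D by (intro mult_left_mono) auto
  then show ?thesis using 1 by (simp add: step_rate_def algebra_simps)
qed

lemma growth_contradiction:
  assumes A: "A > 1" and \<gamma>: "\<gamma> > real n / (real n - 1)" and \<epsilon>: "\<epsilon> > 0"
    and bad: "\<And>t. t > t0 \<Longrightarrow> \<exists>T\<in>{t..A * t}. \<exists>Zs. finite Zs \<and> Zs \<subseteq> pts T \<and> real (card Zs) > \<epsilon> * T powr \<gamma>"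
  shows False
proof -
  define \<beta> where "\<beta> = 1 / (real n - 1)"
  define \<alpha> where "\<alpha> = real n / (real n - 1)"
  have \<beta>: "\<beta> > 0" "\<alpha> = \<beta> + 1" "\<alpha> > 1" using n2 by (auto simp: \<beta>_def \<alpha>_def field_simps)
  have \<gamma>1: "\<gamma> > \<alpha>" "\<gamma> > 1" using \<gamma> \<beta>(3) by (auto simp: \<alpha>_def)
  have "\<exists>c>0. \<exists>C\<ge>0. \<forall>d G S Zs. d \<ge> 1 \<longrightarrow> S > 0 \<longrightarrow> hform UNIV r d G \<longrightarrow> (\<forall>v. cmod (G v) \<le> S * vmax r v ^ d) \<longrightarrow>
     finite Zs \<longrightarrow> Zs \<subseteq> closure U \<longrightarrow> (\<forall>z\<in>Zs. \<forall>v\<in>\<psi> (\<phi> z). G v = 0) \<longrightarrow>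
     (\<forall>z\<in>closure U. \<forall>v\<in>\<psi> (\<phi> z). cmod (G v) \<le> S * exp (C * real d - c * real (card Zs)) * vmax r v ^ d)"
    by (rule form_zeros_bound[OF cU])
  then obtain c C where c: "c > 0" and C: "C \<ge> 0" and zb: "\<And>d G S Zs z v. d \<ge> 1 \<Longrightarrow> S > 0 \<Longrightarrow> hform UNIV r d G \<Longrightarrow>
     (\<And>v. cmod (G v) \<le> S * vmax r v ^ d) \<Longrightarrow> finite Zs \<Longrightarrow> Zs \<subseteq> closure U \<Longrightarrow> (\<And>z v. z \<in> Zs \<Longrightarrow> v \<in> \<psi> (\<phi> z) \<Longrightarrow> G v = 0) \<Longrightarrow>
     z \<in> closure U \<Longrightarrow> v \<in> \<psi> (\<phi> z) \<Longrightarrow> cmod (G v) \<le> S * exp (C * real d - c * real (card Zs)) * vmax r v ^ d"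
    by (elim exE conjE) (metis (no_types, lifting))
  define C4 where "C4 = step_rate C"
  have C4: "C4 > 0" unfolding C4_def by (rule rates(1)[OF C])
  \<comment> \<open>Siegel's lemma will give N0 \<ge> q \<Lambda> T0 / (8m) zeros; with this
    \<Lambda> they exceed the threshold C4 n q T0 / c by at least q T0.\<close>
  define \<Lambda> where "\<Lambda> = 8 * real m * (1 + real n * C4 / c)"
  have "8 * real m * 1 \<le> \<Lambda>" unfolding \<Lambda>_def using c C4 by (intro mult_left_mono) auto
  then have \<Lambda>8: "\<Lambda> \<ge> 8 * real m" by simp
  have \<Lambda>1: "\<Lambda> \<ge> 1" using \<Lambda>8 m_pos by linarith
  \<comment> \<open>Beyond \<open>T1\<close> there are enough points at the first height to
    prescribe N0 zeros among them; beyond \<open>T2\<close> the points at a height T suffice for the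
    passage to any height up to 2A T.\<close>
  obtain T1 where T1: "T1 \<ge> 1" "\<And>T. T \<ge> T1 \<Longrightarrow> 3 ^ n * \<Lambda> powr \<alpha> * T powr \<alpha> \<le> \<epsilon> * T powr \<gamma>"
    using powr_dominates[OF \<gamma>1(1) \<epsilon>, of "3 ^ n * \<Lambda> powr \<alpha>"] by blast
  have ce: "c * \<epsilon> > 0" using c \<epsilon> by simp
  obtain T2 where T2: "T2 \<ge> 1" "\<And>T. T \<ge> T2 \<Longrightarrow> (4 * real n * A * C4 * \<Lambda> powr \<beta>) * T powr \<alpha> \<le> c * \<epsilon> * T powr \<gamma>"
    using powr_dominates[OF \<gamma>1(1) ce, of "4 * real n * A * C4 * \<Lambda> powr \<beta>"] by blast
  define t where "t = max (max T1 T2) t0 + 1"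
  have t: "t > t0" "t > T1" "t > T2" "t > 0" unfolding t_def using T1(1) by auto
  obtain T0 Z0 where T0: "T0 \<in> {t..A * t}" "finite Z0" "Z0 \<subseteq> pts T0" "real (card Z0) > \<epsilon> * T0 powr \<gamma>" using bad[OF t(1)] by blast
  have T01: "T0 \<ge> 1" "T0 > T1" "T0 > T2" "T0 > t0" using T0(1) t T1(1) by auto
  \<comment> \<open>As \<beta> = 1/(n-1), this makes x^(n-1) = \<Lambda> T0, so that M is at least q
    \<Lambda> T0.\<close>
  define x where "x = (\<Lambda> * T0) powr \<beta>"
  define q where "q = nat \<lceil>x\<rceil>"
  define D where "D = n * q"
  define M where "M = (q + 1) ^ n"
  define N0 where "N0 = M div (4 * m)"
  define B where "B = nat \<lceil>6 * real ((q + 1) ^ n) * Cf ^ (n * q) * exp (real (e * (n * q)) * (H1 * T0))\<rceil>"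
  have LT: "\<Lambda> * T0 \<ge> 1" using mult_mono[OF \<Lambda>1 T01(1)] \<Lambda>1 by simp
  have x1: "x \<ge> 1" unfolding x_def using LT \<beta> by (simp add: ge_one_powr_ge_zero)
  have q: "real q \<ge> x" "real q < x + 1" unfolding q_def using x1 by linarith+
  have q1: "q \<ge> 1" using q x1 by linarith
  have D1: "D \<ge> 1" using q1 n2 by (simp add: D_def Suc_le_eq)
  have xn1: "x ^ (n - 1) = \<Lambda> * T0"
  proof -
    have "x ^ (n - 1) = x powr real (n - 1)" using x1 by (subst powr_realpow) auto
    also have "\<dots> = (\<Lambda> * T0) powr (\<beta> * real (n - 1))" by (simp add: x_def powr_powr)
    also have "\<beta> * real (n - 1) = 1" using n2 by (simp add: \<beta>_def of_nat_diff)
    finally show ?thesis using LT by simp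
  qed
  have xn: "x ^ n = (\<Lambda> * T0) powr \<alpha>"
  proof -
    have "x ^ n = x powr real n" using x1 by (subst powr_realpow) auto
    also have "\<dots> = (\<Lambda> * T0) powr (\<beta> * real n)" by (simp add: x_def powr_powr)
    also have "\<beta> * real n = \<alpha>" by (simp add: \<beta>_def \<alpha>_def)
    finally show ?thesis .
  qed
  have Mlow: "real M \<ge> real q * (\<Lambda> * T0)"
  proof -
    have "x ^ (n - 1) \<le> real (q + 1) ^ (n - 1)" using q x1 by (intro power_mono) auto
    then have "real q * (\<Lambda> * T0) \<le> real (q + 1) * real (q + 1) ^ (n - 1)" unfolding xn1[symmetric] using x1 by (intro mult_mono) auto
    also have "\<dots> = real M" unfolding M_def of_nat_power power_Suc[symmetric] using n2 by simp
    finally show ?thesis .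
  qed
  have Mup: "real M \<le> 3 ^ n * \<Lambda> powr \<alpha> * T0 powr \<alpha>"
  proof -
    have "real M \<le> (3 * x) ^ n" unfolding M_def of_nat_power using q x1 by (intro power_mono) auto
    also have "\<dots> = 3 ^ n * (\<Lambda> * T0) powr \<alpha>" by (simp add: power_mult_distrib xn)
    finally show ?thesis using \<Lambda>1 T01 by (simp add: powr_mult)
  qed
  \<comment> \<open>Ensures that the integer division defining \<open>N0\<close> loses at most half
    of the quotient.\<close>
  have M8: "real M \<ge> 8 * real m"
  proof -
    have "1 * (8 * real m * 1) \<le> real q * (\<Lambda> * T0)" using q1 \<Lambda>8 T01 \<Lambda>1 by (intro mult_mono) auto
    then show ?thesis using Mlow by simp
  qed
  have N0: "4 * m * N0 \<le> M" unfolding N0_def by (rule times_div_less_eq_dividend)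
  have N0low: "8 * real m * real N0 \<ge> real M"
  proof -
    have "M = N0 * (4 * m) + M mod (4 * m)" unfolding N0_def by (rule div_mult_mod_eq[symmetric])
    moreover have "M mod (4 * m) < 4 * m" using m_pos by simp
    ultimately have "M < N0 * (4 * m) + 4 * m" by linarith
    then have "real M < real (N0 * (4 * m) + 4 * m)" by (rule of_nat_less_iff[THEN iffD2])
    then have "real M < 4 * (real m * real N0) + 4 * real m" by (simp add: ac_simps)
    then have "real M \<le> 8 * (real m * real N0)" using M8 by linarith
    then show ?thesis by (simp add: mult.assoc)
  qed
  have "N0 > 0"
  proof (rule ccontr)
    assume "\<not> N0 > 0"
    then have "real M \<le> 0" using N0low by simp
    then show False using M8 m_pos by simp
  qed
  have "real N0 \<le> real M" unfolding N0_def by simp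
  also have "\<dots> \<le> \<epsilon> * T0 powr \<gamma>" using Mup T1(2)[of T0] T01 by linarith
  also have "\<dots> < real (card Z0)" by (rule T0(4))
  finally have "N0 \<le> card Z0" by simp
  then obtain Zs where Zs: "Zs \<subseteq> Z0" "card Zs = N0" "finite Zs" by (rule obtain_subset_with_card_n)
  have B: "real B \<ge> 1" "ln (Sz q (real B)) \<le> lam_rate * real (n * q) * T0"
    "real B \<ge> 6 * real ((q + 1) ^ n) * Cf ^ (n * q) * exp (real (e * (n * q)) * (H1 * T0))"
    by (rule ln_Sz[OF q1 T01(1) B_def])+
  have "\<exists>g. (\<forall>k\<in>IX q. \<bar>g k\<bar> \<le> int B) \<and> (\<exists>k\<in>IX q. g k \<noteq> 0) \<and> (\<forall>z\<in>Zs. \<forall>v\<in>\<psi> (\<phi> z). G q g v = 0)"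
    by (rule auxiliary_form[OF T01(1) Zs(3) _ _ _ B(3)]) (use Zs T0(3) N0 \<open>N0 > 0\<close> in \<open>auto simp: M_def\<close>)
  then obtain g where g: "\<And>k. k \<in> IX q \<Longrightarrow> \<bar>g k\<bar> \<le> int B" "\<exists>k\<in>IX q. g k \<noteq> 0" "\<And>z v. z \<in> Zs \<Longrightarrow> v \<in> \<psi> (\<phi> z) \<Longrightarrow> G q g v = 0" by blast
  have gB: "\<bar>real_of_int (g k)\<bar> \<le> real B" if "k \<in> IX q" for k
    using g(1)[OF that] by (metis of_int_abs of_int_le_iff of_int_of_nat_eq)
  have hG: "hform UNIV r (e * (n * q)) (G q g)" by (rule hform_mono[OF _ G_hform]) simp
  have d1: "e * (n * q) \<ge> 1" using e0 D1 unfolding D_def by (simp add: Suc_le_eq)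
  have S1: "Sz q (real B) \<ge> 1" by (rule Sz_ge_1[OF B(1)])
  have GB: "cmod (G q g v) \<le> Sz q (real B) * vmax r v ^ (e * (n * q))" for v
    by (rule G_bound[OF gB]) auto
  have ptsK: "pts T \<subseteq> closure U" for T using ptsU[of T] closure_subset[of U] by blast
  \<comment> \<open>The one form given by \<open>g\<close> serves all heights; its degree is fixed,
    so the threshold grows only linearly in T.\<close>
  have spread: "\<forall>z\<in>pts T. \<forall>v\<in>\<psi> (\<phi> z). G q g v = 0"
    if T: "T \<ge> T0" and Y: "finite Y" "Y \<subseteq> closure U" "\<And>z v. z \<in> Y \<Longrightarrow> v \<in> \<psi> (\<phi> z) \<Longrightarrow> G q g v = 0"
      and big: "c * real (card Y) > C4 * real (n * q) * T" for T Y
  proof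
    fix z assume z: "z \<in> pts T"
    have T1': "T \<ge> 1" using T T01 by linarith
    have "(real m + 1) * ln (Sz q (real B)) + real e * real (n * q) * (C + H1 * T) \<le> C4 * real (n * q) * T"
      unfolding C4_def by (rule step_rate_bound[OF B(2) T01(1) T _ C]) simp
    then have large: "c * real (card Y) > (real m + 1) * ln (Sz q (real B)) + real (e * (n * q)) * (C + H1 * T)"
      using big unfolding of_nat_mult[of e] by linarith
    have bound: "cmod (G q g v) \<le> Sz q (real B) * exp (C * real (e * (n * q)) - c * real (card Y)) * vmax r v ^ (e * (n * q))"
      if "v \<in> \<psi> (\<phi> z)" for v
      by (rule zb[OF d1 _ hG GB Y(1,2,3) _ that]) (use S1 ptsK z in auto)
    show "\<forall>v\<in>\<psi> (\<phi> z). G q g v = 0" by (rule vanishing_step[OF bound gB B(1) T1' z large])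
  qed
  have first: "\<forall>z\<in>pts T0. \<forall>v\<in>\<psi> (\<phi> z). G q g v = 0"
  proof (rule spread[OF order_refl Zs(3)])
    show "Zs \<subseteq> closure U" using Zs(1) T0(3) ptsK by blast
    show "G q g v = 0" if "z \<in> Zs" "v \<in> \<psi> (\<phi> z)" for z v by (rule g(3)[OF that])
    have "c * \<Lambda> = 8 * real m * (c + real n * C4)" unfolding \<Lambda>_def using c by (simp add: distrib_left)
    then have "8 * real m * (c + real n * C4) * (real q * T0) = c * (real q * (\<Lambda> * T0))"
      by (metis mult.assoc mult.left_commute)
    also have "\<dots> \<le> c * (8 * real m * real N0)" using Mlow N0low c by (intro mult_left_mono) auto
    finally have "8 * real m * ((c + real n * C4) * (real q * T0)) \<le> 8 * real m * (c * real N0)" by (simp add: ac_simps)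
    then have "(c + real n * C4) * (real q * T0) \<le> c * real N0" using m_pos by simp
    moreover have "c * (real q * T0) > 0" using c q1 T01 by simp
    ultimately have "C4 * (real n * real q) * T0 < c * real N0" by (simp add: algebra_simps)
    then show "c * real (card Zs) > C4 * real (n * q) * T0" by (simp add: Zs(2))
  qed
  \<comment> \<open>Applying \<open>bad\<close> at 2T at least doubles the height, so that heights
    tend to infinity, and multiplies it by at most 2A, so that the zeros at height T are
    enough.\<close>
  have next_step: "\<exists>T'\<ge>2 * T. (\<exists>Y. finite Y \<and> Y \<subseteq> pts T' \<and> real (card Y) > \<epsilon> * T' powr \<gamma>) \<and> (\<forall>z\<in>pts T'. \<forall>v\<in>\<psi> (\<phi> z). G q g v = 0)"
    if T: "T \<ge> T0" and Y: "finite Y" "Y \<subseteq> pts T" "real (card Y) > \<epsilon> * T powr \<gamma>" and van: "\<forall>z\<in>pts T. \<forall>v\<in>\<psi> (\<phi> z). G q g v = 0" for T Y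
  proof -
    have Tp: "T \<ge> 1" "2 * T > t0" "T \<ge> T2" using T T01 by linarith+
    obtain T' Y' where T': "T' \<in> {2 * T..A * (2 * T)}" "finite Y'" "Y' \<subseteq> pts T'" "real (card Y') > \<epsilon> * T' powr \<gamma>"
      using bad[OF Tp(2)] by blast
    have "\<forall>z\<in>pts T'. \<forall>v\<in>\<psi> (\<phi> z). G q g v = 0"
    proof (rule spread[OF _ Y(1)])
      show "T0 \<le> T'" using T'(1) T Tp by simp
      show "Y \<subseteq> closure U" using Y(2) ptsK by blast
      show "G q g v = 0" if "z \<in> Y" "v \<in> \<psi> (\<phi> z)" for z v using van that Y(2) by blast
      have "x \<le> (\<Lambda> * T) powr \<beta>" unfolding x_def using \<beta> T \<Lambda>1 T01 by (intro powr_mono2 mult_left_mono) auto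
      then have xT: "x \<le> \<Lambda> powr \<beta> * T powr \<beta>" using \<Lambda>1 Tp by (simp add: powr_mult)
      have "real q \<le> 2 * (\<Lambda> powr \<beta> * T powr \<beta>)" using q(2) x1 xT by linarith
      then have "real q * T' \<le> 2 * (\<Lambda> powr \<beta> * T powr \<beta>) * (A * (2 * T))" using T'(1) Tp by (intro mult_mono) auto
      then have "C4 * real n * (real q * T') \<le> C4 * real n * (2 * (\<Lambda> powr \<beta> * T powr \<beta>) * (A * (2 * T)))" using C4 by (intro mult_left_mono) auto
      also have "\<dots> = (4 * real n * A * C4 * \<Lambda> powr \<beta>) * T powr \<alpha>" unfolding \<beta>(2) using Tp by (simp add: powr_add)
      also have "\<dots> \<le> c * \<epsilon> * T powr \<gamma>" by (rule T2(2)[OF Tp(3)])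
      also have "\<dots> < c * real (card Y)" using Y(3) c by (simp add: mult.assoc)
      finally show "c * real (card Y) > C4 * real (n * q) * T'" by (simp add: ac_simps)
    qed
    then show ?thesis using T' by auto
  qed
  have many: "\<exists>T\<ge>2 ^ i * T0. (\<exists>Y. finite Y \<and> Y \<subseteq> pts T \<and> real (card Y) > \<epsilon> * T powr \<gamma>) \<and> (\<forall>z\<in>pts T. \<forall>v\<in>\<psi> (\<phi> z). G q g v = 0)" for i
  proof (induction i)
    case 0
    then show ?case using first T0 by auto
  next
    case (Suc i)
    then obtain T Y where T: "T \<ge> 2 ^ i * T0" "finite Y" "Y \<subseteq> pts T" "real (card Y) > \<epsilon> * T powr \<gamma>"
      "\<forall>z\<in>pts T. \<forall>v\<in>\<psi> (\<phi> z). G q g v = 0" by blast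
    have "1 * T0 \<le> 2 ^ i * T0" using T01 by (intro mult_right_mono) auto
    then have "T0 \<le> T" using T(1) by linarith
    from next_step[OF this T(2-5)] obtain T' where "T' \<ge> 2 * T"
      "(\<exists>Y. finite Y \<and> Y \<subseteq> pts T' \<and> real (card Y) > \<epsilon> * T' powr \<gamma>) \<and> (\<forall>z\<in>pts T'. \<forall>v\<in>\<psi> (\<phi> z). G q g v = 0)" by blast
    moreover have "2 ^ Suc i * T0 \<le> 2 * T" using T(1) by simp
    ultimately show ?case by (intro exI[of _ T']) auto
  qed
  \<comment> \<open>An arbitrary point z0 is added to the compact set. The constants change with z0,
    but the form is fixed and the number of its known zeros is unbounded, so its value at z0 must
    vanish.\<close>
  have "G q g v = 0" if v: "v \<in> \<psi> (\<phi> z0)" for z0 v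
  proof (rule ccontr)
    assume nz: "G q g v \<noteq> 0"
    have K': "compact (closure U \<union> {z0})" using cU by (intro compact_Un) auto
    have "\<exists>c>0. \<exists>C\<ge>0. \<forall>d G S Zs. d \<ge> 1 \<longrightarrow> S > 0 \<longrightarrow> hform UNIV r d G \<longrightarrow> (\<forall>v. cmod (G v) \<le> S * vmax r v ^ d) \<longrightarrow>
     finite Zs \<longrightarrow> Zs \<subseteq> closure U \<union> {z0} \<longrightarrow> (\<forall>z\<in>Zs. \<forall>v\<in>\<psi> (\<phi> z). G v = 0) \<longrightarrow>
     (\<forall>z\<in>closure U \<union> {z0}. \<forall>v\<in>\<psi> (\<phi> z). cmod (G v) \<le> S * exp (C * real d - c * real (card Zs)) * vmax r v ^ d)"
      by (rule form_zeros_bound[OF K'])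
    then obtain c' C' where c': "c' > 0" and zb': "\<forall>d G S Zs. d \<ge> 1 \<longrightarrow> S > 0 \<longrightarrow> hform UNIV r d G \<longrightarrow> (\<forall>v. cmod (G v) \<le> S * vmax r v ^ d) \<longrightarrow>
     finite Zs \<longrightarrow> Zs \<subseteq> closure U \<union> {z0} \<longrightarrow> (\<forall>z\<in>Zs. \<forall>v\<in>\<psi> (\<phi> z). G v = 0) \<longrightarrow>
     (\<forall>z\<in>closure U \<union> {z0}. \<forall>v\<in>\<psi> (\<phi> z). cmod (G v) \<le> S * exp (C' * real d - c' * real (card Zs)) * vmax r v ^ d)"
      by (elim exE conjE)
    define d where "d = e * (n * q)"
    define w where "w = Sz q (real B) * vmax r v ^ d"
    have w: "w > 0" unfolding w_def using S1 target_vmax_pos[OF v] by (intro mult_pos_pos) auto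
    define y where "y = cmod (G q g v) / w"
    have y: "y > 0" unfolding y_def using nz w by simp
    \<comment> \<open>So large that \<epsilon> 2^i zeros push the upper bound below the fixed
      positive value y; they are available since T powr \<gamma> \<ge> T \<ge> 2^i.\<close>
    obtain i where i: "(C' * real d - ln y) / (c' * \<epsilon>) < 2 ^ i" using real_arch_pow[of 2] by fastforce
    obtain T Y where T: "T \<ge> 2 ^ i * T0" "finite Y" "Y \<subseteq> pts T" "real (card Y) > \<epsilon> * T powr \<gamma>"
      "\<forall>z\<in>pts T. \<forall>v\<in>\<psi> (\<phi> z). G q g v = 0" using many[of i] by blast
    have "2 ^ i * 1 \<le> 2 ^ i * T0" using T01 by (intro mult_left_mono) auto
    then have Ti: "T \<ge> 2 ^ i" using T(1) by linarith
    have "(1::real) \<le> 2 ^ i" by simp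
    then have "T \<ge> 1" using Ti by linarith
    then have "T powr 1 \<le> T powr \<gamma>" using \<gamma>1 by (intro powr_mono) auto
    then have "2 ^ i \<le> T powr \<gamma>" using Ti \<open>T \<ge> 1\<close> by simp
    then have "\<epsilon> * 2 ^ i \<le> \<epsilon> * T powr \<gamma>" using \<epsilon> by (intro mult_left_mono) auto
    then have "c' * (\<epsilon> * 2 ^ i) < c' * real (card Y)" using T(4) c' by simp
    moreover have "C' * real d - ln y < c' * (\<epsilon> * 2 ^ i)" using i c' \<epsilon> by (simp add: divide_less_eq ac_simps)
    ultimately have lt: "C' * real d - c' * real (card Y) < ln y" by linarith
    have "cmod (G q g v) \<le> Sz q (real B) * exp (C' * real d - c' * real (card Y)) * vmax r v ^ d"
      unfolding d_def
    proof (rule zb'[rule_format, of _ _ _ Y z0 v, OF d1 _ hG GB T(2) _ _ _ v])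
      show "Y \<subseteq> closure U \<union> {z0}" using T(3) ptsK[of T] by blast
      show "G q g v = 0" if "z \<in> Y" "v \<in> \<psi> (\<phi> z)" for z v using T(3,5) that by blast
    qed (use S1 in auto)
    also have "\<dots> = w * exp (C' * real d - c' * real (card Y))" by (simp add: w_def)
    also have "\<dots> < w * exp (ln y)" using w lt by simp
    also have "\<dots> = cmod (G q g v)" using y w by (simp add: y_def)
    finally show False by simp
  qed
  then show False using vanishing_everywhere_impossible[OF g(2)] by blast
qed

end

section \<open>Integral equations, heights on the curve and the theorem\<close>

lemma hform_value:
  assumes "subring F" "hform F N d f" "\<And>i. v i \<in> F" shows "f v \<in> F"
proof -
  obtain K c where K: "finite K" "\<forall>m\<in>K. c m \<in> F" "\<forall>m\<in>K. Poly_Mapping.keys m \<subseteq> {..N}"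
    "\<forall>m\<in>K. sum (Poly_Mapping.lookup m) (Poly_Mapping.keys m) = d"
    "\<forall>v. f v = (\<Sum>m\<in>K. c m * (\<Prod>i\<in>Poly_Mapping.keys m. v i ^ Poly_Mapping.lookup m i))"
    using hform_expand[OF assms(2)] by (elim exE conjE)
  have "c m * (\<Prod>i\<in>Poly_Mapping.keys m. v i ^ Poly_Mapping.lookup m i) \<in> F" if "m \<in> K" for m
  proof -
    have "(\<Prod>i\<in>Poly_Mapping.keys m. v i ^ Poly_Mapping.lookup m i) \<in> F"
      by (intro subring_prod subring_power assms)
    moreover have "c m \<in> F" using K(2) that by blast
    ultimately show ?thesis using assms(1) unfolding subring_def by blast
  qed
  then show ?thesis unfolding K(5)[rule_format] by (rule subring_sum[OF assms(1)])
qed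

context nfield
begin

lemma subring_range: "subring (range \<iota>)"
proof -
  have "x + y \<in> range \<iota> \<and> x * y \<in> range \<iota>" if xy: "x \<in> range \<iota>" "y \<in> range \<iota>" for x y
  proof -
    obtain a b where ab: "x = \<iota> a" "y = \<iota> b" using xy by blast
    have "x + y = \<iota> (a + b)" "x * y = \<iota> (a * b)" unfolding ab using E_card(3) by simp_all
    then show ?thesis by blast
  qed
  moreover have "0 = \<iota> 0" "1 = \<iota> 1" using E_card(3) by simp_all
  ultimately show ?thesis unfolding subring_def by blast
qed

lemma integral_multiple_form:
  assumes "hform (range \<iota>) r e f"
  shows "\<exists>\<delta> K \<kappa>. \<delta> > 0 \<and> finite K \<and> (\<forall>k\<in>K. algebraic_int (\<kappa> k)) \<and> (\<forall>k\<in>K. Poly_Mapping.keys k \<subseteq> {..r}) \<and>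
    (\<forall>k\<in>K. sum (Poly_Mapping.lookup k) (Poly_Mapping.keys k) = e) \<and>
    (\<forall>v. of_nat \<delta> * f v = (\<Sum>k\<in>K. \<iota> (\<kappa> k) * (\<Prod>j\<in>Poly_Mapping.keys k. v j ^ Poly_Mapping.lookup k j)))"
proof -
  obtain K c where K: "finite K" "\<forall>m\<in>K. c m \<in> range \<iota>" "\<forall>m\<in>K. Poly_Mapping.keys m \<subseteq> {..r}"
    "\<forall>m\<in>K. sum (Poly_Mapping.lookup m) (Poly_Mapping.keys m) = e"
    "\<forall>v. f v = (\<Sum>m\<in>K. c m * (\<Prod>i\<in>Poly_Mapping.keys m. v i ^ Poly_Mapping.lookup m i))"
    using hform_expand[OF assms] by (elim exE conjE)
  have "\<forall>k\<in>K. \<exists>a. c k = \<iota> a" using K(2) by blast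
  then obtain a where a: "\<And>k. k \<in> K \<Longrightarrow> c k = \<iota> (a k)" by metis
  have "\<forall>k. \<exists>d. d > 0 \<and> algebraic_int (of_nat d * a k)" using algebraic_int_multiple[OF nf] by blast
  then obtain d where d: "\<And>k. d k > 0" "\<And>k. algebraic_int (of_nat (d k) * a k)" by metis
  define \<delta> where "\<delta> = prod d K"
  have \<delta>: "\<delta> > 0" unfolding \<delta>_def using d(1) by (intro prod_pos) auto
  have ai: "algebraic_int (of_nat \<delta> * a k)" if k: "k \<in> K" for k
  proof -
    have "of_nat \<delta> * a k = of_int (int (prod d (K - {k}))) * (of_nat (d k) * a k)"
      unfolding \<delta>_def using prod.remove[OF K(1) k, of d] by (simp del: of_nat_prod add: ac_simps)
    then show ?thesis using algebraic_int_times[OF algebraic_int_of_int d(2)] by metis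
  qed
  have "of_nat \<delta> * f v = (\<Sum>k\<in>K. \<iota> (of_nat \<delta> * a k) * (\<Prod>j\<in>Poly_Mapping.keys k. v j ^ Poly_Mapping.lookup k j))" for v
  proof -
    have "\<iota> (of_nat \<delta> * a k) = of_nat \<delta> * c k" if "k \<in> K" for k
      using emb_simps[OF E_card(3)] a[OF that] by simp
    then show ?thesis unfolding K(5)[rule_format] by (simp add: sum_distrib_left mult.assoc)
  qed
  then show ?thesis using \<delta> K(1,3,4) ai by (intro exI[of _ \<delta>] exI[of _ K] exI[of _ "\<lambda>k. of_nat \<delta> * a k"]) simp
qed

text \<open>The morphism is defined over the number field, so the image of a rational point has
  coordinates there. The vector returned is the one chosen inside \<open>weil_height\<close>, hence
  the heights agree by definition.\<close>

lemma rational_point_height: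
  assumes mor: "proj_morphism (range \<iota>) N X r \<psi>" and x: "x \<in> rational_points (range \<iota>) X"
  shows "\<exists>a. (\<lambda>i. \<iota> (a i)) \<in> \<psi> x \<and> (\<exists>i\<le>r. a i \<noteq> 0) \<and> log_height r a = weil_height \<iota> r (\<psi> x)"
proof -
  obtain v where v: "x \<in> X" "v \<in> x" "\<forall>i. v i \<in> range \<iota>" using x unfolding rational_points_def by blast
  obtain Z P d where P: "zariski_closed (range \<iota>) N Z" "x \<notin> Z" "\<forall>j\<le>r. hform (range \<iota>) N d (poly_eval (P j))"
    "\<forall>y v. y \<in> X \<longrightarrow> y \<notin> Z \<longrightarrow> v \<in> y \<longrightarrow> (\<exists>j\<le>r. pv r P v j \<noteq> 0) \<and> \<psi> y = proj_class (pv r P v)"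
    using proj_morphism_local[OF mor v(1)] by (elim exE conjE)
  have Pv: "\<exists>j\<le>r. pv r P v j \<noteq> 0" "\<psi> x = proj_class (pv r P v)" using P(4) v(1,2) P(2) by blast+
  have z: "0 = \<iota> 0" using E_card(3) by simp
  have "pv r P v j \<in> range \<iota>" for j
    unfolding pv_def using hform_value[OF subring_range P(3)[rule_format], of j v] v(3) z by auto
  then have "\<forall>j. \<exists>y. pv r P v j = \<iota> y" by blast
  then obtain b where b: "\<And>j. pv r P v j = \<iota> (b j)" by metis
  have "pv r P v = (\<lambda>j. \<iota> (b j))" using b by blast
  moreover have "\<exists>i. b i \<noteq> 0" using Pv(1) b z by metis
  moreover have "b i = 0" if "i > r" for i
  proof -
    have "\<iota> (b i) = 0" using b[of i] that by (simp add: pv_def)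
    then show ?thesis using E_card(3) by simp
  qed
  ultimately have ex: "\<exists>a. \<psi> x = proj_class (\<lambda>i. \<iota> (a i)) \<and> (\<exists>i. a i \<noteq> 0) \<and> (\<forall>i>r. a i = 0)"
    using Pv(2) by (intro exI[of _ b]) simp
  define a where "a = (SOME a. \<psi> x = proj_class (\<lambda>i. \<iota> (a i)) \<and> (\<exists>i. a i \<noteq> 0) \<and> (\<forall>i>r. a i = 0))"
  have a: "\<psi> x = proj_class (\<lambda>i. \<iota> (a i)) \<and> (\<exists>i. a i \<noteq> 0) \<and> (\<forall>i>r. a i = 0)"
    unfolding a_def by (rule someI_ex[OF ex])
  have "(\<lambda>i. \<iota> (a i)) \<in> \<psi> x" using a proj_class_self[of "\<lambda>i. \<iota> (a i)"] by simp
  moreover have "\<exists>i\<le>r. a i \<noteq> 0" using a by (meson not_le)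
  moreover have "log_height r a = weil_height \<iota> r (\<psi> x)" by (simp add: weil_height_def a_def)
  ultimately show ?thesis by blast
qed

end

lemma form_chain_scale:
  assumes fc: "form_chain F N r X \<psi> Z n e f" and c: "\<And>i. i \<le> n \<Longrightarrow> c i \<in> F" "\<And>i. i \<le> n \<Longrightarrow> c i \<noteq> 0"
  shows "form_chain F N r X \<psi> Z n e (\<lambda>i v. c i * f i v)"
proof -
  interpret form_chain F N r X \<psi> Z n e f by (rule fc)
  show ?thesis
  proof
    show "hform F r e (\<lambda>v. c i * f i v)" if "i \<le> n" for i by (rule hform_cmult[OF F c(1)[OF that] f[OF that]])
    show "\<exists>x\<in>Z i. \<exists>v\<in>\<psi> x. c i * f i v \<noteq> 0" if "i \<le> n" for i using nv[OF that] c(2)[OF that] by simp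
    show "c (Suc i) * f (Suc i) v = 0" if "i < n" "x \<in> Z i" "v \<in> \<psi> x" for i x v using van[OF that] by simp
  qed (use F mor X Z in auto)
qed

text \<open>Infinite sets are included: they have measure \<infinity> and finite subsets of every
  size.\<close>

lemma count_space_gt:
  assumes "\<not> emeasure (count_space UNIV) S \<le> ennreal x" "x \<ge> 0"
  shows "\<exists>Y. finite Y \<and> Y \<subseteq> S \<and> real (card Y) > x"
proof (cases "finite S")
  case True
  then have "emeasure (count_space UNIV) S = ennreal (real (card S))"
    by (simp add: emeasure_count_space_finite ennreal_of_nat_eq_real_of_nat)
  then have "real (card S) > x" using assms by (simp add: ennreal_le_iff not_le)
  then show ?thesis using True by blast
next
  case False
  obtain k where k: "x < real k" using reals_Archimedean2 by blast
  obtain Y where "finite Y" "card Y = k" "Y \<subseteq> S" using infinite_arbitrarily_large[OF False] by blast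
  then show ?thesis using k by blast
qed

theorem theorem1p2:
  fixes \<iota> :: "'k::field_char_0 \<Rightarrow> complex"
    and N n :: nat
    and X :: "ppoint set"
    and L :: line_bundle_data
    and h :: "ppoint \<Rightarrow> real"
    and \<A> :: "('m::t2_space set \<times> ('m \<Rightarrow> complex)) set"
    and U :: "'m set"
    and \<phi> :: "'m \<Rightarrow> ppoint"
    and A \<gamma> \<epsilon> :: real
  assumes "number_field TYPE('k)" and "field_embedding \<iota>"
    and "projective_variety (range \<iota>) N X"
    and "variety_dim (range \<iota>) N X = enat n" and "n \<ge> 2"
    and "ample (range \<iota>) N X L"
    and "height_function \<iota> N X L h"
    and "riemann_surface \<A>" and "\<not> compact (UNIV :: 'm set)"
    and "open U" and "compact (closure U)"
    and "holomorphic_to_proj \<A> N \<phi>" and "range \<phi> \<subseteq> X"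
    and "zariski_dense_in N X (range \<phi>)"
    and "A > 1" and "\<gamma> > real n / (real n - 1)" and "\<epsilon> > 0"
  shows "infinite {{t..A * t} | t. t > 1 \<and>
           (\<forall>T\<in>{t..A * t}. point_count \<iota> X h \<phi> U T \<le> ennreal (\<epsilon> * T powr \<gamma>))}
     \<and> \<not> bdd_above {t. t > 1 \<and>
           (\<forall>T\<in>{t..A * t}. point_count \<iota> X h \<phi> U T \<le> ennreal (\<epsilon> * T powr \<gamma>))}
     \<and> \<not> bdd_above {T. T > 0 \<and> point_count \<iota> X h \<phi> U T \<le> ennreal (\<epsilon> * T powr \<gamma>)}"
proof -
  define good where "good = {t. t > 1 \<and> (\<forall>T\<in>{t..A * t}. point_count \<iota> X h \<phi> U T \<le> ennreal (\<epsilon> * T powr \<gamma>))}"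
  interpret nfield \<iota> using assms(1,2) by (rule nfield.intro)
  have "\<exists>l>0. \<exists>r s. embedding_sections (range \<iota>) N X (tensor_power L l) r s \<and>
        (\<exists>C. \<forall>x\<in>rational_points (range \<iota>) X.
           \<bar>h x - weil_height \<iota> r (section_map (tensor_power L l) r s x) / real l\<bar> \<le> C)"
    using assms(7) unfolding height_function_def .
  then obtain l r s C where l: "l > 0" and es: "embedding_sections (range \<iota>) N X (tensor_power L l) r s"
    and C: "\<forall>x\<in>rational_points (range \<iota>) X. \<bar>h x - weil_height \<iota> r (section_map (tensor_power L l) r s x) / real l\<bar> \<le> C"
    by (elim exE conjE)
  define \<psi> where "\<psi> = section_map (tensor_power L l) r s"
  have ci: "closed_immersion (range \<iota>) N X r \<psi>" using es unfolding embedding_sections_def \<psi>_def by blast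
  then have mor: "proj_morphism (range \<iota>) N X r \<psi>" unfolding closed_immersion_def by blast
  have Xc: "zariski_closed (range \<iota>) N X" using assms(3) unfolding projective_variety_def by blast
  have n0: "n > 0" using assms(5) by simp
  obtain Z e f where e: "e > 0" and fc: "form_chain (range \<iota>) N r X \<psi> Z n e f"
    by (rule form_chain_exists[OF subring_range Xc assms(4) n0 ci])
  define Q where "Q i \<delta> K \<kappa> \<longleftrightarrow> \<delta> > 0 \<and> finite K \<and> (\<forall>k\<in>K. algebraic_int (\<kappa> k)) \<and> (\<forall>k\<in>K. Poly_Mapping.keys k \<subseteq> {..r}) \<and>
    (\<forall>k\<in>K. sum (Poly_Mapping.lookup k) (Poly_Mapping.keys k) = e) \<and>
    (\<forall>v. of_nat \<delta> * f i v = (\<Sum>k\<in>K. \<iota> (\<kappa> k) * (\<Prod>j\<in>Poly_Mapping.keys k. v j ^ Poly_Mapping.lookup k j)))"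
    for i and \<delta> :: nat and K and \<kappa> :: "(nat \<Rightarrow>\<^sub>0 nat) \<Rightarrow> 'k"
  have "\<exists>\<delta> K \<kappa>. Q i \<delta> K \<kappa>" if "i \<le> n" for i
    unfolding Q_def by (rule integral_multiple_form[OF form_chain.f[OF fc that]])
  then obtain \<delta> K \<kappa> where \<delta>: "\<And>i. i \<le> n \<Longrightarrow> Q i (\<delta> i) (K i) (\<kappa> i)" by metis
  note \<delta> = \<delta>[unfolded Q_def]
  have ofnat: "of_nat k \<in> range \<iota>" for k using emb_simps(7)[OF E_card(3), of "int k"] by (metis of_int_of_nat_eq rangeI)
  have fc': "form_chain (range \<iota>) N r X \<psi> Z n e (\<lambda>i v. of_nat (\<delta> i) * f i v)"
    by (rule form_chain_scale[OF fc ofnat]) (use \<delta> in auto)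
  define pts where "pts T = {z \<in> U. \<phi> z \<in> rational_points (range \<iota>) X \<and> h (\<phi> z) \<le> T}" for T
  \<comment> \<open>From h \<le> T the height in the embedding by sections of the l-th power is at
    most l (T + |C|), and |C| \<le> |C| T because T \<ge> 1; the degree of the field clears the
    denominator of \<open>log_height\<close>.\<close>
  define H1 where "H1 = real (degree_over_Q TYPE('k)) * (real l * (1 + \<bar>C\<bar>))"
  have H1: "H1 \<ge> 0" unfolding H1_def by simp
  have heights: "\<exists>a. (\<lambda>i. \<iota> (a i)) \<in> \<psi> (\<phi> z) \<and> (\<exists>i\<le>r. a i \<noteq> 0) \<and>
        real (degree_over_Q TYPE('k)) * log_height r a \<le> H1 * T" if T: "T \<ge> 1" and z: "z \<in> pts T" for T z
  proof -
    have z': "\<phi> z \<in> rational_points (range \<iota>) X" "h (\<phi> z) \<le> T" using z by (auto simp: pts_def)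
    obtain a where a: "(\<lambda>i. \<iota> (a i)) \<in> \<psi> (\<phi> z)" "\<exists>i\<le>r. a i \<noteq> 0" "log_height r a = weil_height \<iota> r (\<psi> (\<phi> z))"
      using rational_point_height[OF mor z'(1)] by blast
    have "\<bar>h (\<phi> z) - log_height r a / real l\<bar> \<le> C" using C z'(1) a(3) unfolding \<psi>_def by simp
    then have "log_height r a / real l \<le> T + \<bar>C\<bar>" using z'(2) by linarith
    also have "\<dots> \<le> (1 + \<bar>C\<bar>) * T" using T mult_left_mono[OF T, of "\<bar>C\<bar>"] by (simp add: distrib_right)
    finally have "log_height r a \<le> real l * ((1 + \<bar>C\<bar>) * T)" using l by (simp add: divide_le_eq ac_simps)
    then have "real (degree_over_Q TYPE('k)) * log_height r a \<le> real (degree_over_Q TYPE('k)) * (real l * ((1 + \<bar>C\<bar>) * T))"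
      by (intro mult_left_mono) auto
    then show ?thesis using a(1,2) unfolding H1_def by (intro exI[of _ a]) (simp add: mult.assoc)
  qed
  have ptsU: "pts T \<subseteq> U" for T by (auto simp: pts_def)
  have dc: "dense_curve \<iota> \<A> N r X \<phi> \<psi> Z n e (\<lambda>i v. of_nat (\<delta> i) * f i v) K \<kappa> pts U H1"
  proof (intro dense_curve.intro dense_curve_axioms.intro)
    show "nfield \<iota>" by (rule nfield_axioms)
    show "curve_map \<A> N r (range \<iota>) X \<phi> \<psi>"
      by (intro curve_map.intro assms(8,12,13) mor zariski_closed_subset[OF Xc])
    show "form_chain (range \<iota>) N r X \<psi> Z n e (\<lambda>i v. of_nat (\<delta> i) * f i v)" by (rule fc')
    show "finite (K i)" if "i \<le> n" for i using \<delta> that by blast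
    show "algebraic_int (\<kappa> i k)" if "i \<le> n" "k \<in> K i" for i k using \<delta> that by blast
    show "Poly_Mapping.keys k \<subseteq> {..r}" if "i \<le> n" "k \<in> K i" for i k using \<delta> that by blast
    show "sum (Poly_Mapping.lookup k) (Poly_Mapping.keys k) = e" if "i \<le> n" "k \<in> K i" for i k using \<delta> that by blast
    show "of_nat (\<delta> i) * f i v = (\<Sum>k\<in>K i. \<iota> (\<kappa> i k) * (\<Prod>j\<in>Poly_Mapping.keys k. v j ^ Poly_Mapping.lookup k j))"
      if "i \<le> n" for i v using \<delta> that by blast
  qed (rule assms e heights H1 ptsU; assumption)+
  have unb: "\<not> bdd_above good"
  proof
    assume "bdd_above good"
    then obtain t1 where t1: "\<And>t. t \<in> good \<Longrightarrow> t \<le> t1" unfolding bdd_above_def by blast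
    show False
    proof (rule dense_curve.growth_contradiction[OF dc assms(15-17)])
      \<comment> \<open>Beyond the supposed bound no t is good, so every interval [t, At] contains a
        height with too many points: the abundance that leads to the contradiction.\<close>
      fix t assume t: "t > max t1 1"
      then have "t \<notin> good" using t1[of t] by auto
      then obtain T where T: "T \<in> {t..A * t}" "\<not> point_count \<iota> X h \<phi> U T \<le> ennreal (\<epsilon> * T powr \<gamma>)"
        using t unfolding good_def by auto
      have "\<exists>Y. finite Y \<and> Y \<subseteq> pts T \<and> real (card Y) > \<epsilon> * T powr \<gamma>"
        by (rule count_space_gt) (use T(2) assms(17) in \<open>auto simp: point_count_def pts_def\<close>)
      then show "\<exists>T\<in>{t..A * t}. \<exists>Y. finite Y \<and> Y \<subseteq> pts T \<and> real (card Y) > \<epsilon> * T powr \<gamma>" using T(1) by blast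
    qed
  qed
  have le: "t \<le> A * t" if "t \<in> good" for t using that assms(15) unfolding good_def by simp
  have "infinite {{t..A * t} | t. t \<in> good}"
  proof
    assume "finite {{t..A * t} | t. t \<in> good}"
    \<comment> \<open>An interval determines its left end, so finitely many intervals would come
      from finitely many t.\<close>
    moreover have "good \<subseteq> Inf ` {{t..A * t} | t. t \<in> good}"
    proof
      fix t assume t: "t \<in> good"
      then have "t = Inf {t..A * t}" using le by simp
      then show "t \<in> Inf ` {{t..A * t} | t. t \<in> good}" using t by blast
    qed
    ultimately have "finite good" by (meson finite_imageI finite_subset)
    then have "bdd_above good" by (rule bdd_above_finite)
    then show False by (rule unb[THEN notE])
  qed
  \<comment> \<open>The left end t itself belongs to [t, At].\<close>
  moreover have sub: "good \<subseteq> {T. T > 0 \<and> point_count \<iota> X h \<phi> U T \<le> ennreal (\<epsilon> * T powr \<gamma>)}"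
    using le unfolding good_def by auto
  then have "\<not> bdd_above {T. T > 0 \<and> point_count \<iota> X h \<phi> U T \<le> ennreal (\<epsilon> * T powr \<gamma>)}"
    by (rule contrapos_nn[OF unb bdd_above_mono, rotated])
  ultimately show ?thesis using unb unfolding good_def by simp
qed

end
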